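(* The function $\det^2\mathrm{D}\Theta_\Lambda$ is a lattice invariant. We have the equivalence: $\det^2\mathrm{D}\Theta_\Lambda=0$ if and only if the differential of the theta map is degenerate at $\Lambda$. If $\Lambda$ is an integral lattice of level $N$, then $\det^2\mathrm{D}\Theta_\Lambda$ is a modular form of weight $\frac{(n+2)^2n(n-1)}{2}$ for $\Gamma_0(N)$.
   Context: $\mathbb{E}^n$ is Euclidean $n$-space and $\Lambda\subset\mathbb{E}^n$ is a lattice (of rank $n$). Let $m=\frac{n^2+n-2}{2}$, the dimension of the space of real homogeneous harmonic polynomials of degree two on $\mathbb{E}^n$ (quadratic forms with symmetric matrix of trace $0$). Identify quadratic forms with symmetric matrices and equip them with the scalar product $\langle h,h'\rangle=2\,\mathrm{tr}(hh')$. For a harmonic quadratic form $h$ put $\Theta_{h;\Lambda}(z)=\sum_{\lambda\in\Lambda}h(\lambda)\exp(2\pi i\|\lambda\|^2z)$ for $z$ in the upper half plane. For an orthonormal basis $\mathcal{B}=\{h_1,\dots,h_m\}$ of the harmonic quadratic forms let $$\det{}_{\mathcal{B}}\mathrm{D}\Theta_\Lambda(z)=\det\left(\Bigl(\tfrac{1}{2\pi i}\tfrac{\partial}{\partial z}\Bigr)^{k}\Theta_{h_j;\Lambda}(z)\right)_{0\le k\le m-1,\ 1\le j\le m},\qquad \det{}^2\mathrm{D}\Theta_\Lambda:=\bigl(\det{}_{\mathcal{B}}\mathrm{D}\Theta_\Lambda\bigr)^2 .$$ Changing the orthonormal basis multiplies $\det_{\mathcal{B}}\mathrm{D}\Theta_\Lambda$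 by $\pm1$, so the square is independent of $\mathcal{B}$. A lattice invariant is a quantity attached to lattices in $\mathbb{E}^n$ which is unchanged when $\Lambda$ is replaced by $\gamma(\Lambda)$ with $\gamma\in\mathrm{O}(n)$. Theta map: for a positive definite symmetric real $n\times n$ matrix $A$, $\Theta_A(z)=\sum_{\lambda\in\mathbb{Z}^n}\exp(2\pi i({}^t\lambda A\lambda)z)$. Its (rescaled) derivative at $A$ in the direction of a symmetric matrix $B$ is $\partial_B\Theta_A(z)=\frac{1}{2\pi iz}\frac{\partial}{\partial t}\Theta_{A+tB}(z)|_{t=0}=\sum_{\lambda\in\mathbb{Z}^n}({}^t\lambda B\lambda)\exp(2\pi i({}^t\lambda A\lambda)z)$. Let $T_A^0=\{B \text{ symmetric}: \mathrm{tr}(BA^{-1})=0\}$ (deformations fixing the discriminant). If $\Lambda$ is generated by the columns of $Q$ and $A={}^tQQ$, the differential of the theta map is called degenerate at $\Lambda$ if $B\mapsto\partial_B\Theta_A$ is not injective on $T_A^0$; equivalently, if $\Theta_{h_1;\Lambda},\dots,\Theta_{h_m;\Lambda}$ are linearly dependent. Integral means $\|\lambda\|^2\in\mathbb{Z}$ for all $\lambda\in\Lambda$; the level $N$ is the usual level of the even integral matrix $2A$, i.e. the least positive integer $N$ such that $N(2A)^{-1}$ is integral with even diagonal.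
   Formalization: When the weight is odd (exactly when n ≡ 3 mod 4), "modular form for Γ_0(N)" is taken with the nontrivial character mod 4, since −I ∈ Γ_0(N) would otherwise force the form to vanish; in even weight the character is trivial as stated. *)

theory Defs
  imports "Jordan_Normal_Form.Determinant" "HOL-Analysis.Analysis"
begin

no_notation Matrix.vec_index (infixl \<open>$\<close> 100)

text \<open>
  Euclidean \<open>n\<close>-space is \<^typ>\<open>real ^ 'n\<close> with \<open>n = CARD('n)\<close>. The \<open>m \<times> m\<close>
  determinant, whose size \<open>m\<close> depends on \<open>n\<close> numerically, is \<open>Determinant.det\<close> from
  \<open>Jordan_Normal_Form\<close>.
\<close>

definition upper_half_plane :: "complex set" where
  "upper_half_plane = {z. Im z > 0}"

definition quad_form :: "real ^ 'n ^ 'n \<Rightarrow> real ^ 'n \<Rightarrow> real" where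
  "quad_form h x = inner x (h *v x)"

definition of_int_vec :: "int ^ 'n \<Rightarrow> real ^ 'n" where
  "of_int_vec x = (\<chi> i. real_of_int (x $ i))"


subsection \<open>Lattices\<close>

text \<open>The group generated by the columns of \<open>Q\<close>.\<close>

definition lattice_of :: "real ^ 'n ^ 'n \<Rightarrow> (real ^ 'n) set" where
  "lattice_of Q = range (\<lambda>x. Q *v of_int_vec x)"

definition is_lattice :: "(real ^ 'n) set \<Rightarrow> bool" where
  "is_lattice \<Lambda> \<longleftrightarrow> (\<exists>Q. invertible Q \<and> \<Lambda> = lattice_of Q)"

definition lattice_invariant :: "((real ^ 'n) set \<Rightarrow> 'b) \<Rightarrow> bool" where
  "lattice_invariant F \<longleftrightarrow>
     (\<forall>\<Lambda> \<gamma>. is_lattice \<Lambda> \<longrightarrow> orthogonal_matrix \<gamma> \<longrightarrow> F ((\<lambda>x. \<gamma> *v x) ` \<Lambda>) = F \<Lambda>)"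

definition integral_lattice :: "(real ^ 'n) set \<Rightarrow> bool" where
  "integral_lattice \<Lambda> \<longleftrightarrow> is_lattice \<Lambda> \<and> (\<forall>v\<in>\<Lambda>. (norm v)\<^sup>2 \<in> \<int>)"

definition even_integral_matrix :: "real ^ 'n ^ 'n \<Rightarrow> bool" where
  "even_integral_matrix M \<longleftrightarrow>
     (\<forall>i j. M $ i $ j \<in> \<int>) \<and> (\<forall>i. \<exists>k::int. M $ i $ i = 2 * of_int k)"

text \<open>Here \<open>A\<close> is the Gram matrix; the level is that of the even integral matrix \<open>2A\<close>.\<close>

definition level :: "real ^ 'n ^ 'n \<Rightarrow> nat" where
  "level A = (LEAST N. N > 0 \<and> even_integral_matrix (real N *\<^sub>R matrix_inv (2 *\<^sub>R A)))"


subsection \<open>Theta series with harmonic coefficients\<close>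

definition harmonic_forms :: "(real ^ 'n ^ 'n) set" where
  "harmonic_forms = {h. transpose h = h \<and> trace h = 0}"

definition harmonic_dim :: "'n::finite itself \<Rightarrow> nat" where
  "harmonic_dim _ = (CARD('n)\<^sup>2 + CARD('n) - 2) div 2"

text \<open>
  A basis \<open>h\<^sub>1, \<dots>, h\<^sub>m\<close> is represented by the values \<open>hs 0, \<dots>, hs (m - 1)\<close>;
  the other values of \<open>hs\<close> are irrelevant.
\<close>

definition orthonormal_basis :: "(nat \<Rightarrow> real ^ 'n ^ 'n) \<Rightarrow> bool" where
  "orthonormal_basis hs \<longleftrightarrow>
     (\<forall>i < harmonic_dim TYPE('n). \<forall>j < harmonic_dim TYPE('n).
        2 * trace (hs i ** hs j) = (if i = j then 1 else 0)) \<and>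
     span (hs ` {..<harmonic_dim TYPE('n)}) = harmonic_forms"

definition Theta :: "real ^ 'n ^ 'n \<Rightarrow> (real ^ 'n) set \<Rightarrow> complex \<Rightarrow> complex" where
  "Theta h \<Lambda> z =
     (\<Sum>\<^sub>\<infinity>v\<in>\<Lambda>. of_real (quad_form h v) * exp (2 * of_real pi * \<i> * of_real ((norm v)\<^sup>2) * z))"

definition D :: "(complex \<Rightarrow> complex) \<Rightarrow> complex \<Rightarrow> complex" where
  "D f = (\<lambda>z. deriv f z / (2 * of_real pi * \<i>))"

definition detDTheta ::
    "(nat \<Rightarrow> real ^ 'n ^ 'n) \<Rightarrow> (real ^ 'n) set \<Rightarrow> complex \<Rightarrow> complex" where
  "detDTheta hs \<Lambda> z =
     Determinant.det (Matrix.mat (harmonic_dim TYPE('n)) (harmonic_dim TYPE('n))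
       (\<lambda>(k, j). (D ^^ k) (Theta (hs j) \<Lambda>) z))"

text \<open>
  The choice of the orthonormal basis does not matter, as changing it multiplies
  \<^const>\<open>detDTheta\<close> by \<open>\<plusminus> 1\<close>.
\<close>

definition det2DTheta :: "(real ^ 'n) set \<Rightarrow> complex \<Rightarrow> complex" where
  "det2DTheta \<Lambda> z = (detDTheta (SOME hs. orthonormal_basis hs) \<Lambda> z)\<^sup>2"


subsection \<open>The theta map and its differential\<close>

definition theta_map :: "real ^ 'n ^ 'n \<Rightarrow> complex \<Rightarrow> complex" where
  "theta_map A z =
     (\<Sum>\<^sub>\<infinity>x\<in>UNIV. exp (2 * of_real pi * \<i> * of_real (quad_form A (of_int_vec x)) * z))"

definition theta_map_deriv ::
    "real ^ 'n ^ 'n \<Rightarrow> real ^ 'n ^ 'n \<Rightarrow> complex \<Rightarrow> complex" where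
  "theta_map_deriv A B z =
     vector_derivative (\<lambda>t::real. theta_map (A + t *\<^sub>R B) z) (at 0) / (2 * of_real pi * \<i> * z)"

definition disc_tangent :: "real ^ 'n ^ 'n \<Rightarrow> (real ^ 'n ^ 'n) set" where
  "disc_tangent A = {B. transpose B = B \<and> trace (B ** matrix_inv A) = 0}"

text \<open>Derivatives are compared as functions on the upper half plane only.\<close>

definition theta_differential_degenerate :: "real ^ 'n ^ 'n \<Rightarrow> bool" where
  "theta_differential_degenerate A \<longleftrightarrow>
     \<not> inj_on (\<lambda>B. restrict (theta_map_deriv A B) upper_half_plane) (disc_tangent A)"


subsection \<open>Modular forms\<close>

text \<open>An integral matrix with rows \<open>(a, b)\<close> and \<open>(c, d)\<close> is written \<open>(a, b, c, d)\<close>.\<close>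

definition SL2Z :: "(int \<times> int \<times> int \<times> int) set" where
  "SL2Z = {(a, b, c, d). a * d - b * c = 1}"

definition Gamma0 :: "nat \<Rightarrow> (int \<times> int \<times> int \<times> int) set" where
  "Gamma0 N = {(a, b, c, d). (a, b, c, d) \<in> SL2Z \<and> int N dvd c}"

definition slash ::
    "nat \<Rightarrow> (complex \<Rightarrow> complex) \<Rightarrow> int \<times> int \<times> int \<times> int \<Rightarrow> complex \<Rightarrow> complex" where
  "slash k f = (\<lambda>(a, b, c, d) z.
     f ((of_int a * z + of_int b) / (of_int c * z + of_int d)) / (of_int c * z + of_int d) ^ k)"

text \<open>
  The last clause is holomorphy at all cusps, \<open>\<psi>\<close> is the character (nebentypus).
\<close>

definition modular_form ::
    "nat \<Rightarrow> (int \<Rightarrow> complex) \<Rightarrow> nat \<Rightarrow> (complex \<Rightarrow> complex) \<Rightarrow> bool" where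
  "modular_form N \<psi> k f \<longleftrightarrow>
     f holomorphic_on upper_half_plane \<and>
     (\<forall>(a, b, c, d) \<in> Gamma0 N. \<forall>z \<in> upper_half_plane.
        slash k f (a, b, c, d) z = \<psi> d * f z) \<and>
     (\<forall>\<gamma> \<in> SL2Z. \<exists>C > 0. \<exists>K. \<forall>z. Im z \<ge> C \<longrightarrow> norm (slash k f \<gamma> z) \<le> K)"

text \<open>
  Trivial in even weight. Since \<open>-1\<close> belongs to \<^term>\<open>Gamma0 N\<close>, only the zero form has odd
  weight and trivial character; the convention in odd weight is the non-trivial character
  modulo 4, the character of \<open>\<theta>\<^sup>2\<close> where \<open>\<theta>\<close> is the Jacobi theta series. Odd
  weights occur here only for \<open>n \<equiv> 3\<close> modulo 4, and then the level is divisible by 4.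
\<close>

definition weight_character :: "nat \<Rightarrow> int \<Rightarrow> complex" where
  "weight_character k d =
     (if even k then 1 else if d mod 4 = 1 then 1 else if d mod 4 = 3 then -1 else 0)"

end

theory Submission
  imports Defs "HOL-Real_Asymp.Real_Asymp" "HOL-Complex_Analysis.Complex_Analysis" "HOL-Number_Theory.Number_Theory"
begin

text \<open>
  Reality of the theta series turns complex linear dependence of the \<open>\<Theta>\<^bsub>h\<^esub>\<close> into degeneracy of the
  differential, and for holomorphic functions dependence means that the Wronskian vanishes. For an integral
  lattice, let \<open>(a, b, c, d)\<close> be a unimodular matrix with \<open>c > 0\<close>. Splitting \<open>\<Lambda>\<close> into classes modulo
  \<open>c\<close> and applying Poisson summation, with harmonic forms as coefficients, gives
  \<open>\<Theta>\<^bsub>h\<^esub>((a z + b) / (c z + d)) = (c z + d)\<^sup>2 g(z) F\<^bsub>h\<^esub>(z)\<close> with \<open>F\<^bsub>h\<^esub>\<close> a dual theta series whose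
  coefficients are Gauss sums and \<open>g\<^sup>2\<close> proportional to \<open>(c z + d)\<^sup>n\<close>. Differentiating \<open>k\<close> times only
  adds derivatives of lower order, so row operations transfer the identity to the Wronskian; this yields
  the weight \<open>2 m (m - 1) + 4 m + n m\<close> and boundedness at all cusps. If \<open>N\<close> divides \<open>c\<close> then
  \<open>F\<^bsub>h\<^esub>\<close> is a Gauss sum times \<open>\<Theta>\<^bsub>h\<^esub>\<close>. Only the square of the multiplier is needed; comparison with the
  cusp \<open>b / d\<close> expresses it by the square of a Gauss sum to an odd modulus \<open>d\<close>, which can be evaluated
  without determining the sign of the Gauss sum.
\<close>

text \<open>The obstacle is the square root in the classical transformation law: a factor w^(-n/2)
  has no canonical branch in odd rank. \<open>poisson_factor\<close> is therefore just a name for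
  the zeroth Fourier coefficient of the periodised Gaussian, and the key fact about it is that its
  square times w^n is a nonzero constant \<open>\<kappa>\<close>. In the comparison of cusps this
  constant gets expressed by Gauss sums, so its value never enters. Poisson summation rests on
  uniqueness of Fourier coefficients, which comes from Stone-Weierstrass on the embedded torus.
  Harmonicity enters through a trace: differentiating Poisson summation twice in the shift r
  produces a main term and a term with the trace of h against the inverse Gram matrix, and only the
  former survives. For an odd prime p the square of a Gauss sum is p^n or -p^n, because conjugation
  changes the sum at most by a sign. If p is 3 modulo 4, that sign is decided by arithmetic: p - 1
  times a value independent of the multiplier b is a rational integer, and the square of such a
  value cannot be an odd power of p.\<close>

no_notation fps_nth (infixl \<open>$\<close> 75)
no_notation Matrix.scalar_prod (infix \<open>\<bullet>\<close> 70)

section \<open>The exponential with period 1\<close>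

definition e :: "complex \<Rightarrow> complex" where
  "e z = exp (2 * of_real pi * \<i> * z)"

lemma e_0 [simp]: "e 0 = 1"
  by (simp add: e_def)

lemma e_add: "e (x + y) = e x * e y"
  by (simp add: e_def ring_distribs exp_add)

lemma e_minus: "e (- x) = inverse (e x)"
  by (simp add: e_def exp_minus)

lemma e_diff: "e (x - y) = e x / e y"
  using e_add[of x "-y"] by (simp add: e_minus divide_inverse)

lemma e_nonzero [simp]: "e x \<noteq> 0"
  by (simp add: e_def)

lemma e_of_int [simp]: "e (of_int k) = 1"
  using exp_integer_2pi[of "of_int k"] by (simp add: e_def mult_ac)

lemma e_Ints: "x \<in> \<int> \<Longrightarrow> e x = 1"
  by (auto elim!: Ints_cases)

lemma e_add_Ints: "y \<in> \<int> \<Longrightarrow> e (x + y) = e x"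
  by (simp add: e_add e_Ints)

lemma norm_e: "norm (e z) = exp (- (2 * pi * Im z))"
  by (simp add: e_def norm_exp_eq_Re)

lemma norm_e_of_real [simp]: "norm (e (of_real x)) = 1"
  by (simp add: norm_e)

lemma cnj_e: "cnj (e z) = e (- cnj z)"
  by (simp add: e_def exp_cnj)

lemma cnj_e_of_real: "cnj (e (of_real x)) = e (- of_real x)"
  by (simp add: cnj_e)

lemma holomorphic_e [holomorphic_intros]:
  "f holomorphic_on S \<Longrightarrow> (\<lambda>z. e (f z)) holomorphic_on S"
  unfolding e_def by (intro holomorphic_intros)

lemma continuous_on_e [continuous_intros]:
  "continuous_on S f \<Longrightarrow> continuous_on S (\<lambda>z. e (f z))"
  unfolding e_def by (intro continuous_intros)

lemma DERIV_e [derivative_intros]: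
  "(f has_field_derivative f') (at z within S) \<Longrightarrow>
     ((\<lambda>z. e (f z)) has_field_derivative (2 * of_real pi * \<i> * f' * e (f z))) (at z within S)"
  unfolding e_def by (auto intro!: derivative_eq_intros)

lemma e_eq_1_iff_Ints: "e (of_real x) = 1 \<longleftrightarrow> x \<in> \<int>"
proof
  assume "e (of_real x) = 1"
  then have "cos (2 * pi * x) = 1"
    by (simp add: e_def complex_eq_iff Re_exp)
  then obtain k :: int where "2 * pi * x = of_int k * 2 * pi"
    by (auto simp: cos_one_2pi_int)
  then have "x = of_int k" by simp
  then show "x \<in> \<int>" by simp
next
  assume "x \<in> \<int>"
  then have "of_real x \<in> (\<int> :: complex set)"
    by (auto elim!: Ints_cases)
  then show "e (of_real x) = 1" by (rule e_Ints)
qed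

subsection \<open>Summation over integral vectors\<close>

lemma of_int_vec_0 [simp]: "of_int_vec 0 = 0"
  by (simp add: of_int_vec_def vec_eq_iff)

lemma of_int_vec_add: "of_int_vec (x + y) = of_int_vec x + of_int_vec y"
  by (simp add: of_int_vec_def vec_eq_iff)

lemma of_int_vec_minus: "of_int_vec (- x) = - of_int_vec x"
  by (simp add: of_int_vec_def vec_eq_iff)

lemma of_int_vec_nth [simp]: "of_int_vec x $ i = of_int (x $ i)"
  by (simp add: of_int_vec_def)

lemma inj_of_int_vec: "inj of_int_vec"
  by (auto simp: inj_def vec_eq_iff)

definition inorm :: "int ^ 'n \<Rightarrow> real" where
  "inorm x = norm (of_int_vec x)"

lemma inorm_nonneg [simp]: "inorm x \<ge> 0"
  by (simp add: inorm_def)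

lemma inorm_ge_component: "\<bar>of_int (x $ i)\<bar> \<le> inorm x"
  unfolding inorm_def using component_le_norm_cart[of "of_int_vec x" i] by simp

lemma inorm_ge_1: "x \<noteq> 0 \<Longrightarrow> inorm x \<ge> 1"
proof -
  assume "x \<noteq> 0"
  then obtain i where "x $ i \<noteq> 0" by (auto simp: vec_eq_iff)
  then have "1 \<le> \<bar>real_of_int (x $ i)\<bar>" by linarith
  with inorm_ge_component[of x i] show ?thesis by linarith
qed

lemma summable_exp_minus_abs_int: "(\<lambda>k::int. exp (- \<bar>real_of_int k\<bar>)) summable_on UNIV"
proof -
  have S: "summable (\<lambda>n. exp (- real n))"
  proof -
    have "summable (\<lambda>n. exp (- 1 :: real) ^ n)"
      by (rule summable_geometric) simp
    then show ?thesis by (simp add: exp_of_nat_mult[symmetric])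
  qed
  then have nat: "(\<lambda>n::nat. exp (- real n)) summable_on UNIV"
    by (subst summable_on_UNIV_nonneg_real_iff) auto
  have 1: "(\<lambda>k::int. exp (- \<bar>real_of_int k\<bar>)) summable_on (range int)"
    by (subst summable_on_reindex) (use nat in \<open>auto simp: o_def\<close>)
  have 2: "(\<lambda>k::int. exp (- \<bar>real_of_int k\<bar>)) summable_on (range (\<lambda>n. - int n))"
    by (subst summable_on_reindex) (use nat in \<open>auto simp: o_def inj_def\<close>)
  have "(UNIV :: int set) = range int \<union> range (\<lambda>n. - int n)"
    by (auto intro: int_cases2)
  then show ?thesis
    using summable_on_union[OF 1 2] by simp
qed

text \<open>A finite set of vectors lies in a box \<open>B\<close>^n, and over a box the sum factors
  into one-dimensional sums, each at most \<open>L\<close>. Hence \<open>L\<close>^n bounds all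
  finite partial sums.\<close>

lemma summable_exp_minus_abs_vec:
  "(\<lambda>x::int^'n. exp (- (\<Sum>i\<in>UNIV. \<bar>real_of_int (x $ i)\<bar>))) summable_on UNIV"
proof (rule nonneg_bdd_above_summable_on)
  define L where "L = infsum (\<lambda>k::int. exp (- \<bar>real_of_int k\<bar>)) UNIV"
  show "bdd_above (sum (\<lambda>x::int^'n. exp (- (\<Sum>i\<in>UNIV. \<bar>real_of_int (x $ i)\<bar>))) ` {F. F \<subseteq> UNIV \<and> finite F})"
  proof (rule bdd_aboveI2)
    fix F :: "(int ^ 'n) set" assume F: "F \<in> {F. F \<subseteq> UNIV \<and> finite F}"
    define B where "B = (\<Union>i. (\<lambda>x. x $ i) ` F)"
    have B: "finite B" using F by (auto simp: B_def)
    have "(\<Sum>x\<in>F. exp (- (\<Sum>i\<in>UNIV. \<bar>real_of_int (x $ i)\<bar>))) =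
          (\<Sum>x\<in>F. \<Prod>i\<in>UNIV. exp (- \<bar>real_of_int (x $ i)\<bar>))"
      by (simp add: exp_sum sum_negf[symmetric])
    also have "\<dots> = (\<Sum>g\<in>vec_nth ` F. \<Prod>i\<in>UNIV. exp (- \<bar>real_of_int (g i)\<bar>))"
      by (subst sum.reindex) (auto intro!: inj_onI simp: vec_eq_iff fun_eq_iff)
    also have "\<dots> \<le> (\<Sum>g\<in>PiE (UNIV :: 'n set) (\<lambda>_. B). \<Prod>i\<in>UNIV. exp (- \<bar>real_of_int (g i)\<bar>))"
    proof (rule sum_mono2)
      show "finite (PiE (UNIV :: 'n set) (\<lambda>_. B))" by (intro finite_PiE) (auto simp: B)
      show "vec_nth ` F \<subseteq> PiE (UNIV :: 'n set) (\<lambda>_. B)" by (auto simp: B_def)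
    qed (auto intro!: prod_nonneg)
    also have "\<dots> = (\<Prod>i\<in>(UNIV::'n set). \<Sum>k\<in>B. exp (- \<bar>real_of_int k\<bar>))"
      by (rule prod_sum_PiE[symmetric]) (auto simp: B)
    also have "\<dots> \<le> (\<Prod>i\<in>(UNIV::'n set). L)"
      unfolding L_def
      by (intro prod_mono conjI sum_nonneg finite_sum_le_infsum summable_exp_minus_abs_int) (auto simp: B)
    finally show "(\<Sum>x\<in>F. exp (- (\<Sum>i\<in>UNIV. \<bar>real_of_int (x $ i)\<bar>))) \<le> (\<Prod>i\<in>(UNIV::'n set). L)" .
  qed
qed auto

text \<open>The k-th term of the exponential series gives (1 + t)^k <= k! exp (1 + t), and
  completing the square absorbs (s + 1) t into the Gaussian. So a polynomial times a Gaussian decays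
  faster than an exponential of any prescribed slope s.\<close>

lemma gauss_bound:
  fixes t c s :: real
  assumes "t \<ge> 0" "c > 0"
  shows "(1 + t) ^ k * exp (- c * t\<^sup>2) \<le> fact k * exp 1 * exp ((s + 1)\<^sup>2 / (4 * c)) * exp (- s * t)"
proof -
  have "(\<Sum>n\<in>{k}. (1 + t) ^ n /\<^sub>R fact n) \<le> exp (1 + t)"
    unfolding exp_def
    by (rule sum_le_suminf) (use assms exp_converges[of "1 + t"] in \<open>auto simp: sums_iff\<close>)
  then have "(1 + t) ^ k \<le> fact k * exp (1 + t)"
    by (simp add: field_simps)
  then have "(1 + t) ^ k * exp (- c * t\<^sup>2) \<le> fact k * exp (1 + t) * exp (- c * t\<^sup>2)"
    by (intro mult_right_mono) auto
  also have "\<dots> = fact k * exp (1 + t - c * t\<^sup>2)"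
    by (simp add: exp_add exp_diff exp_minus field_simps)
  also have "\<dots> \<le> fact k * exp (1 + (s + 1)\<^sup>2 / (4 * c) - s * t)"
  proof -
    have "0 \<le> (2 * c * t - (s + 1))\<^sup>2 / (4 * c)" using assms by simp
    also have "\<dots> = c * t\<^sup>2 - (s + 1) * t + (s + 1)\<^sup>2 / (4 * c)"
      using assms by (simp add: field_simps power2_eq_square)
    finally show ?thesis by (simp add: algebra_simps)
  qed
  also have "\<dots> = fact k * exp 1 * exp ((s + 1)\<^sup>2 / (4 * c)) * exp (- s * t)"
    by (simp add: exp_add exp_diff exp_minus field_simps)
  finally show ?thesis .
qed

lemma gauss_summable:
  assumes "c > 0"
  shows "(\<lambda>x::int^'n. (1 + inorm x) ^ k * exp (- c * (inorm x)\<^sup>2)) summable_on UNIV"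
proof -
  \<comment> \<open>The sum of the |x_i| is at most n times the Euclidean norm, so decay of slope n
    in \<open>inorm x\<close> is dominated by the summable product.\<close>
  define s where "s = real CARD('n)"
  define K where "K = fact k * exp 1 * exp ((s + 1)\<^sup>2 / (4 * c))"
  have "(\<lambda>x::int^'n. K * exp (- (\<Sum>i\<in>UNIV. \<bar>real_of_int (x $ i)\<bar>))) summable_on UNIV"
    by (intro summable_on_cmult_right summable_exp_minus_abs_vec)
  then show ?thesis
  proof (rule summable_on_comparison_test)
    fix x :: "int ^ 'n"
    have "(\<Sum>i\<in>(UNIV::'n set). \<bar>real_of_int (x $ i)\<bar>) \<le> (\<Sum>i\<in>(UNIV::'n set). inorm x)"
      by (intro sum_mono inorm_ge_component)
    then have "(\<Sum>i\<in>(UNIV::'n set). \<bar>real_of_int (x $ i)\<bar>) \<le> s * inorm x" by (simp add: s_def)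
    then have "K * exp (- s * inorm x) \<le> K * exp (- (\<Sum>i\<in>UNIV. \<bar>real_of_int (x $ i)\<bar>))"
      by (intro mult_left_mono) (auto simp: K_def)
    with gauss_bound[of "inorm x" c k s] assms
    show "(1 + inorm x) ^ k * exp (- c * (inorm x)\<^sup>2) \<le> K * exp (- (\<Sum>i\<in>UNIV. \<bar>real_of_int (x $ i)\<bar>))"
      unfolding K_def by (meson order_trans inorm_nonneg)
  qed auto
qed

text \<open>Weierstrass' theorem for unconditional sums: the net of finite subsets takes the place
  of the sequence of partial sums, and the M-test on closed discs supplies uniform
  convergence.\<close>

lemma termwise_holomorphic:
  fixes f :: "'a \<Rightarrow> complex \<Rightarrow> complex"
  assumes S: "open S" and hol: "\<And>x. f x holomorphic_on S"
    and bound: "\<And>z. z \<in> S \<Longrightarrow> \<exists>r>0. \<exists>M. M summable_on UNIV \<and> cball z r \<subseteq> S \<and>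
                   (\<forall>x. \<forall>w\<in>cball z r. norm (f x w) \<le> M x)"
  shows "z \<in> S \<Longrightarrow> (\<lambda>x. deriv (f x) z) summable_on UNIV"
    and "z \<in> S \<Longrightarrow> ((\<lambda>w. infsum (\<lambda>x. f x w) UNIV) has_field_derivative infsum (\<lambda>x. deriv (f x) z) UNIV) (at z)"
    and "(\<lambda>w. infsum (\<lambda>x. f x w) UNIV) holomorphic_on S"
proof -
  have *: "(\<lambda>x. deriv (f x) z) summable_on UNIV \<and> ((\<lambda>w. infsum (\<lambda>x. f x w) UNIV) has_field_derivative
             infsum (\<lambda>x. deriv (f x) z) UNIV) (at z)" if z: "z \<in> S" for z
  proof -
    from bound[OF z] obtain r M where rM: "r > 0" "M summable_on UNIV" "cball z r \<subseteq> S"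
      "\<And>x w. w \<in> cball z r \<Longrightarrow> norm (f x w) \<le> M x" by blast
    have U: "uniform_limit (cball z r) (\<lambda>X y. \<Sum>x\<in>X. f x y) (\<lambda>y. \<Sum>\<^sub>\<infinity>x. f x y) (finite_subsets_at_top UNIV)"
      by (rule Weierstrass_m_test_general[OF rM(4) rM(2)])
    have C: "\<forall>\<^sub>F X in finite_subsets_at_top UNIV. continuous_on (cball z r) (\<lambda>y. \<Sum>x\<in>X. f x y) \<and>
        (\<forall>w\<in>ball z r. ((\<lambda>y. \<Sum>x\<in>X. f x y) has_field_derivative (\<Sum>x\<in>X. deriv (f x) w)) (at w))"
    proof (intro always_eventually allI conjI ballI)
      fix X :: "'a set"
      show "continuous_on (cball z r) (\<lambda>y. \<Sum>x\<in>X. f x y)"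
        by (intro continuous_on_sum holomorphic_on_imp_continuous_on holomorphic_on_subset[OF hol rM(3)])
      fix w assume "w \<in> ball z r"
      then have "w \<in> S" using rM(3) by auto
      then show "((\<lambda>y. \<Sum>x\<in>X. f x y) has_field_derivative (\<Sum>x\<in>X. deriv (f x) w)) (at w)"
        by (intro DERIV_sum holomorphic_derivI[OF hol S])
    qed
    obtain g' where g': "\<And>w. w \<in> ball z r \<Longrightarrow> ((\<lambda>y. \<Sum>\<^sub>\<infinity>x. f x y) has_field_derivative g' w) (at w) \<and>
        ((\<lambda>X. \<Sum>x\<in>X. deriv (f x) w) \<longlongrightarrow> g' w) (finite_subsets_at_top UNIV)"
      by (rule has_complex_derivative_uniform_limit[OF C U _ rM(1)]) auto
    have "((\<lambda>x. deriv (f x) z) has_sum g' z) UNIV"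
      using g'[of z] rM(1) by (simp add: has_sum_def)
    moreover from this have "infsum (\<lambda>x. deriv (f x) z) UNIV = g' z" by (rule infsumI)
    ultimately show ?thesis using g'[of z] rM(1)
      unfolding summable_on_def by auto
  qed
  show "z \<in> S \<Longrightarrow> (\<lambda>x. deriv (f x) z) summable_on UNIV"
    "z \<in> S \<Longrightarrow> ((\<lambda>w. infsum (\<lambda>x. f x w) UNIV) has_field_derivative infsum (\<lambda>x. deriv (f x) z) UNIV) (at z)"
    using * by auto
  show "(\<lambda>w. infsum (\<lambda>x. f x w) UNIV) holomorphic_on S"
    using * S by (auto simp: holomorphic_on_open)
qed

lemma open_upper_half_plane: "open upper_half_plane"
  unfolding upper_half_plane_def by (rule open_halfspace_Im_gt)

subsection \<open>Theta series\<close>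

text \<open>The additive constant \<open>C'\<close> admits shifted forms
  \<open>quad_form A (of_int_vec x + r)\<close>, which may be small at a nonzero x near -r.
  Nonnegativity is demanded separately because it makes |e(q z)| decrease as Im z grows.\<close>

definition quad_growth :: "(int ^ 'n \<Rightarrow> real) \<Rightarrow> bool" where
  "quad_growth q \<longleftrightarrow> (\<exists>c>0. \<exists>C C'. \<forall>x. 0 \<le> q x \<and> c * (inorm x)\<^sup>2 - C' \<le> q x \<and> q x \<le> C * (1 + inorm x)\<^sup>2)"

definition poly_growth :: "(int ^ 'n \<Rightarrow> complex) \<Rightarrow> bool" where
  "poly_growth \<phi> \<longleftrightarrow> (\<exists>C k. \<forall>x. norm (\<phi> x) \<le> C * (1 + inorm x) ^ k)"

definition theta_series :: "(int ^ 'n \<Rightarrow> complex) \<Rightarrow> (int ^ 'n \<Rightarrow> real) \<Rightarrow> complex \<Rightarrow> complex" where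
  "theta_series \<phi> q z = (\<Sum>\<^sub>\<infinity>x. \<phi> x * e (of_real (q x) * z))"

lemma poly_growthI: "(\<And>x. norm (\<phi> x) \<le> C * (1 + inorm x) ^ k) \<Longrightarrow> poly_growth \<phi>"
  by (auto simp: poly_growth_def)

lemma poly_growth_const: "poly_growth (\<lambda>x. c)"
  by (rule poly_growthI[of _ "norm c" 0]) auto

lemma poly_growth_mult:
  assumes "poly_growth f" "poly_growth g"
  shows "poly_growth (\<lambda>x. f x * g x)"
proof -
  from assms obtain C k C' k' where 1: "\<And>x. norm (f x) \<le> C * (1 + inorm x) ^ k"
    and 2: "\<And>x. norm (g x) \<le> C' * (1 + inorm x) ^ k'"
    unfolding poly_growth_def by blast
  show ?thesis
  proof (rule poly_growthI)
    fix x
    have "norm (f x * g x) \<le> (C * (1 + inorm x) ^ k) * (C' * (1 + inorm x) ^ k')"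
      unfolding norm_mult by (intro mult_mono 1 2) (auto intro: order_trans[OF norm_ge_zero 1])
    then show "norm (f x * g x) \<le> (C * C') * (1 + inorm x) ^ (k + k')"
      by (simp add: power_add mult_ac)
  qed
qed

lemma poly_growth_power: "poly_growth f \<Longrightarrow> poly_growth (\<lambda>x. f x ^ k)"
  by (induction k) (auto intro: poly_growth_const poly_growth_mult)

lemma quad_growth_nonneg: "quad_growth q \<Longrightarrow> q x \<ge> 0"
  unfolding quad_growth_def by blast

lemma poly_growth_quad: 
  assumes "quad_growth q" shows "poly_growth (\<lambda>x. of_real (q x))"
proof -
  from assms obtain C where C: "\<And>x. 0 \<le> q x" "\<And>x. q x \<le> C * (1 + inorm x)\<^sup>2"
    unfolding quad_growth_def by blast
  then show ?thesis by (intro poly_growthI[of _ C 2]) auto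
qed

text \<open>A term at height Im z >= y is at most its value at height y, since q >= 0. So one
  majorant serves the entire half-plane Im z >= y, and yields summability, local uniform convergence
  and boundedness towards the cusp.\<close>

lemma theta_majorant:
  assumes "poly_growth \<phi>" "quad_growth q" "y > 0"
  obtains M where "M summable_on UNIV" 
    "\<And>x z. Im z \<ge> y \<Longrightarrow> norm (\<phi> x * e (of_real (q x) * z)) \<le> M x"
proof -
  from assms(1) obtain C k where 1: "\<And>x. norm (\<phi> x) \<le> C * (1 + inorm x) ^ k"
    unfolding poly_growth_def by blast
  from assms(2) obtain c C' where c: "c > 0" "\<And>x. c * (inorm x)\<^sup>2 - C' \<le> q x"
    unfolding quad_growth_def by blast
  show ?thesis
  proof (rule that)
    show "(\<lambda>x. (C * exp (2 * pi * C' * y)) * ((1 + inorm x) ^ k * exp (- (2 * pi * c * y) * (inorm x)\<^sup>2))) summable_on UNIV"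
      by (intro summable_on_cmult_right gauss_summable) (use c assms in auto)
    fix x z assume z: "Im z \<ge> y"
    have "(c * (inorm x)\<^sup>2 - C') * y \<le> q x * y"
      using c assms by (intro mult_right_mono) auto
    also have "q x * y \<le> q x * Im z"
      using z assms by (intro mult_left_mono) (auto intro: quad_growth_nonneg)
    finally have "exp (- (2 * pi * (q x * Im z))) \<le> exp (2 * pi * C' * y) * exp (- (2 * pi * c * y) * (inorm x)\<^sup>2)"
      unfolding exp_add[symmetric] exp_le_cancel_iff
      using mult_left_mono[of "(c * (inorm x)\<^sup>2 - C') * y" "q x * Im z" "2 * pi"] by (simp add: algebra_simps)
    then have "norm (\<phi> x) * exp (- (2 * pi * (q x * Im z))) \<le>
        (C * (1 + inorm x) ^ k) * (exp (2 * pi * C' * y) * exp (- (2 * pi * c * y) * (inorm x)\<^sup>2))"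
      by (intro mult_mono 1) (auto intro: order_trans[OF norm_ge_zero 1])
    then show "norm (\<phi> x * e (of_real (q x) * z)) \<le> 
        (C * exp (2 * pi * C' * y)) * ((1 + inorm x) ^ k * exp (- (2 * pi * c * y) * (inorm x)\<^sup>2))"
      by (simp add: norm_mult norm_e mult_ac)
  qed
qed

lemma theta_abs_summable:
  assumes "poly_growth \<phi>" "quad_growth q" "z \<in> upper_half_plane"
  shows "(\<lambda>x. norm (\<phi> x * e (of_real (q x) * z))) summable_on UNIV"
proof -
  have "Im z > 0" using assms by (simp add: upper_half_plane_def)
  then obtain M where M: "M summable_on UNIV"
    "\<And>x w. Im w \<ge> Im z \<Longrightarrow> norm (\<phi> x * e (of_real (q x) * w)) \<le> M x"
    using theta_majorant[OF assms(1,2)] by metis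
  show ?thesis by (rule summable_on_comparison_test[OF M(1)]) (use M(2) in auto)
qed

lemma theta_summable:
  assumes "poly_growth \<phi>" "quad_growth q" "z \<in> upper_half_plane"
  shows "(\<lambda>x. \<phi> x * e (of_real (q x) * z)) summable_on UNIV"
  using theta_abs_summable[OF assms] by (rule abs_summable_summable)

lemma theta_bounded:
  assumes "poly_growth \<phi>" "quad_growth q" "y > 0"
  shows "\<exists>K. \<forall>z. Im z \<ge> y \<longrightarrow> norm (theta_series \<phi> q z) \<le> K"
proof -
  from theta_majorant[OF assms] obtain M where M:
    "M summable_on UNIV" "\<And>x z. Im z \<ge> y \<Longrightarrow> norm (\<phi> x * e (of_real (q x) * z)) \<le> M x" by metis
  have "norm (theta_series \<phi> q z) \<le> infsum M UNIV" if "Im z \<ge> y" for z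
    unfolding theta_series_def
    by (intro norm_infsum_le[OF has_sum_infsum has_sum_infsum])
      (use that M \<open>y > 0\<close> assms in \<open>auto intro!: theta_summable simp: upper_half_plane_def\<close>)
  then show ?thesis by blast
qed

lemma theta_deriv:
  assumes "poly_growth \<phi>" "quad_growth q"
  shows "theta_series \<phi> q holomorphic_on upper_half_plane"
    and "z \<in> upper_half_plane \<Longrightarrow> (theta_series \<phi> q has_field_derivative 
            (2 * of_real pi * \<i>) * theta_series (\<lambda>x. \<phi> x * of_real (q x)) q z) (at z)"
proof -
  let ?f = "\<lambda>x z. \<phi> x * e (of_real (q x) * z)"
  have hol: "?f x holomorphic_on upper_half_plane" for x
    by (intro holomorphic_intros)
  have bd: "\<exists>r>0. \<exists>M. M summable_on UNIV \<and> cball z r \<subseteq> upper_half_plane \<and>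
                   (\<forall>x. \<forall>w\<in>cball z r. norm (?f x w) \<le> M x)" if z: "z \<in> upper_half_plane" for z
  proof -
    have y: "Im z / 2 > 0" using z by (simp add: upper_half_plane_def)
    have I: "Im w \<ge> Im z / 2" if "w \<in> cball z (Im z / 2)" for w
      using that abs_Im_le_cmod[of "z - w"] by (auto simp: dist_norm)
    from theta_majorant[OF assms y] obtain M where 
      "M summable_on UNIV" "\<And>x w. Im w \<ge> Im z / 2 \<Longrightarrow> norm (\<phi> x * e (of_real (q x) * w)) \<le> M x" by metis
    with I y show ?thesis 
      by (intro exI[of _ "Im z / 2"] conjI exI[of _ M]) (force simp: upper_half_plane_def)+
  qed
  note T = termwise_holomorphic[of upper_half_plane ?f, OF open_upper_half_plane hol bd]
  have d: "deriv (?f x) z = (2 * of_real pi * \<i>) * ((\<phi> x * of_real (q x)) * e (of_real (q x) * z))" for x z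
    by (rule DERIV_imp_deriv) (auto intro!: derivative_eq_intros)
  show "theta_series \<phi> q holomorphic_on upper_half_plane"
    using T(3) by (simp add: theta_series_def[abs_def])
  show "(theta_series \<phi> q has_field_derivative 
            (2 * of_real pi * \<i>) * theta_series (\<lambda>x. \<phi> x * of_real (q x)) q z) (at z)"
    if "z \<in> upper_half_plane"
    using T(2)[OF _ that] by (simp add: theta_series_def[abs_def] d infsum_cmult_right' mult.assoc)
qed

lemma D_cong_open:
  assumes "open S" "\<And>z. z \<in> S \<Longrightarrow> f z = g z" "z \<in> S"
  shows "D f z = D g z"
proof -
  have "eventually (\<lambda>w. f w = g w) (nhds z)"
    using assms by (auto simp: eventually_nhds)
  then show ?thesis by (simp add: D_def deriv_cong_ev)
qed

lemma D_funpow_cong_open: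
  assumes "open S" "\<And>z. z \<in> S \<Longrightarrow> f z = g z" "z \<in> S"
  shows "(D ^^ k) f z = (D ^^ k) g z"
  using assms(3)
proof (induction k arbitrary: z)
  case (Suc k)
  then show ?case using D_cong_open[OF assms(1) Suc.IH] by simp
qed (use assms in auto)

lemma D_theta_series:
  assumes "poly_growth \<phi>" "quad_growth q" "z \<in> upper_half_plane"
  shows "(D ^^ k) (theta_series \<phi> q) z = theta_series (\<lambda>x. \<phi> x * of_real (q x) ^ k) q z"
  using assms(3)
proof (induction k arbitrary: z)
  case (Suc k)
  have "D ((D ^^ k) (theta_series \<phi> q)) z = D (theta_series (\<lambda>x. \<phi> x * of_real (q x) ^ k) q) z"
    by (rule D_cong_open[OF open_upper_half_plane Suc.IH Suc.prems])
  also have "poly_growth (\<lambda>x. \<phi> x * of_real (q x) ^ k)"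
    by (intro poly_growth_mult poly_growth_power assms poly_growth_quad)
  from theta_deriv(2)[OF this assms(2) Suc.prems]
  have "D (theta_series (\<lambda>x. \<phi> x * of_real (q x) ^ k) q) z 
      = theta_series (\<lambda>x. \<phi> x * of_real (q x) ^ Suc k) q z"
    by (simp add: D_def DERIV_imp_deriv mult_ac)
  finally show ?case by simp
qed auto

text \<open>Compared with its value at t = 1, every term with nonzero x has gained a factor exp (-2
  pi c (t - 1)), with the same c for all x. This limit later extracts Gauss sums as constant terms
  at a cusp.\<close>

lemma theta_tendsto:
  assumes "poly_growth \<phi>" "quad_growth q" and q0: "q 0 = 0"
    and c: "c > 0" "\<And>x. x \<noteq> 0 \<Longrightarrow> c \<le> q x"
  shows "((\<lambda>t. theta_series \<phi> q (of_real t * \<i>)) \<longlongrightarrow> \<phi> 0) at_top"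
proof -
  define M where "M = (\<lambda>x. norm (\<phi> x * e (of_real (q x) * \<i>)))"
  have M: "M summable_on UNIV"
    unfolding M_def by (intro theta_abs_summable assms) (auto simp: upper_half_plane_def)
  have *: "norm (theta_series \<phi> q (of_real t * \<i>) - \<phi> 0) \<le> exp (- (2 * pi * c) * (t - 1)) * infsum M UNIV"
    if t: "t \<ge> 1" for t
  proof -
    let ?f = "\<lambda>x. \<phi> x * e (of_real (q x) * (of_real t * \<i>))"
    have z: "of_real t * \<i> \<in> upper_half_plane" using t by (simp add: upper_half_plane_def)
    have S: "(?f has_sum theta_series \<phi> q (of_real t * \<i>)) UNIV"
      unfolding theta_series_def by (intro has_sum_infsum theta_summable assms z)
    have "(?f has_sum (theta_series \<phi> q (of_real t * \<i>) - sum ?f {0})) (UNIV - {0})"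
      by (intro has_sum_Diff S has_sum_finite) auto
    then have S': "(?f has_sum (theta_series \<phi> q (of_real t * \<i>) - \<phi> 0)) (UNIV - {0})"
      by (simp add: q0)
    have MS: "M summable_on (UNIV - {0})"
      using M by (rule summable_on_subset_banach) auto
    then have "((\<lambda>x. exp (- (2 * pi * c) * (t - 1)) * M x) has_sum (exp (- (2 * pi * c) * (t - 1)) * infsum M (UNIV - {0}))) (UNIV - {0})"
      by (intro has_sum_cmult_right has_sum_infsum)
    then have "norm (theta_series \<phi> q (of_real t * \<i>) - \<phi> 0) \<le> exp (- (2 * pi * c) * (t - 1)) * infsum M (UNIV - {0})"
    proof (rule norm_infsum_le[OF S'])
      fix x :: "int ^ 'a" assume x: "x \<in> UNIV - {0}"
      have "c * (t - 1) \<le> q x * (t - 1)" using c(2)[of x] x t by (intro mult_right_mono) auto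
      then have "exp (- (2 * pi * (q x * t))) \<le> exp (- (2 * pi * c) * (t - 1)) * exp (- (2 * pi * q x))"
      proof -
        have "- (2 * pi * (q x * t)) \<le> - (2 * pi * c) * (t - 1) + (- (2 * pi * q x))"
          using mult_left_mono[OF \<open>c * (t - 1) \<le> q x * (t - 1)\<close>, of "2 * pi"]
          by (simp add: algebra_simps)
        then show ?thesis by (simp only: exp_add[symmetric] exp_le_cancel_iff)
      qed
      then have "norm (\<phi> x) * exp (- (2 * pi * (q x * t))) \<le> norm (\<phi> x) * (exp (- (2 * pi * c) * (t - 1)) * exp (- (2 * pi * q x)))"
        by (intro mult_left_mono) auto
      then show "norm (?f x) \<le> exp (- (2 * pi * c) * (t - 1)) * M x"
        by (simp add: M_def norm_mult norm_e mult_ac)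
    qed
    also have "\<dots> \<le> exp (- (2 * pi * c) * (t - 1)) * infsum M UNIV"
      by (intro mult_left_mono infsum_mono2 M MS) (auto simp: M_def)
    finally show ?thesis .
  qed
  have "((\<lambda>t. exp (- (2 * pi * c) * (t - 1))) \<longlongrightarrow> 0) at_top"
    using c(1) by real_asymp
  then have "((\<lambda>t. exp (- (2 * pi * c) * (t - 1)) * infsum M UNIV) \<longlongrightarrow> 0) at_top"
    by (rule tendsto_mult_left_zero)
  then have "((\<lambda>t. theta_series \<phi> q (of_real t * \<i>) - \<phi> 0) \<longlongrightarrow> 0) at_top"
    by (rule Lim_null_comparison[rotated]) (use * in \<open>auto intro!: eventually_at_top_linorderI[of 1]\<close>)
  then show ?thesis by (rule LIM_zero_cancel)
qed

subsection \<open>Fourier coefficients of periodic functions\<close>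

definition ev :: "int ^ 'n \<Rightarrow> real ^ 'n \<Rightarrow> complex" where
  "ev y r = e (of_real (of_int_vec y \<bullet> r))"

definition periodic :: "(real ^ 'n \<Rightarrow> complex) \<Rightarrow> bool" where
  "periodic F \<longleftrightarrow> (\<forall>r x. F (r + of_int_vec x) = F r)"

definition torus_mean :: "(real ^ 'n \<Rightarrow> complex) \<Rightarrow> complex" where
  "torus_mean F = integral (cbox 0 (\<chi> i. 1)) F"

lemma continuous_on_ev [continuous_intros]:
  "continuous_on S f \<Longrightarrow> continuous_on S (\<lambda>r. ev y (f r))"
  unfolding ev_def by (intro continuous_intros)

lemma ev_add: "ev y (r + s) = ev y r * ev y s"
  by (simp add: ev_def inner_add_right e_add)

lemma ev_add_left: "ev (x + y) r = ev x r * ev y r"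
  by (simp add: ev_def inner_add_left e_add of_int_vec_add)

lemma ev_0 [simp]: "ev 0 r = 1"
  by (simp add: ev_def)

lemma norm_ev [simp]: "norm (ev y r) = 1"
  by (simp add: ev_def)

lemma inner_of_int_vec: "of_int_vec y \<bullet> of_int_vec x = of_int (\<Sum>i\<in>UNIV. y $ i * x $ i)"
  by (simp add: inner_vec_def)

lemma ev_of_int_vec [simp]: "ev y (of_int_vec x) = 1"
  by (simp add: ev_def inner_of_int_vec del: of_int_sum)

lemma periodic_ev: "periodic (ev y)"
  by (simp add: periodic_def ev_add)

lemma periodic_mult: "periodic F \<Longrightarrow> periodic G \<Longrightarrow> periodic (\<lambda>r. F r * G r)"
  by (simp add: periodic_def)

lemma torus_mean_integrable:
  fixes F :: "real ^ 'n \<Rightarrow> complex"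
  shows "continuous_on UNIV F \<Longrightarrow> F integrable_on cbox 0 (\<chi> i. (1::real))"
  by (auto intro: integrable_continuous continuous_on_subset)

lemma torus_mean_add:
  assumes "continuous_on UNIV F" "continuous_on UNIV G"
  shows "torus_mean (\<lambda>r. F r + G r) = torus_mean F + torus_mean G"
  unfolding torus_mean_def by (intro integral_add torus_mean_integrable assms)

lemma torus_mean_diff:
  assumes "continuous_on UNIV F" "continuous_on UNIV G"
  shows "torus_mean (\<lambda>r. F r - G r) = torus_mean F - torus_mean G"
  unfolding torus_mean_def by (intro integral_diff torus_mean_integrable assms)

lemma torus_mean_cmult: "torus_mean (\<lambda>r. c * F r) = c * torus_mean F"
  unfolding torus_mean_def by (rule integral_mult_right)

lemma content_unit_cube: "content (cbox 0 (\<chi> i. (1::real)) :: (real ^ 'n) set) = 1"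
proof -
  have "(0 :: real ^ 'n) \<in> cbox 0 (\<chi> i. 1)" by (simp add: mem_box_cart)
  then have "(cbox 0 (\<chi> i. (1::real)) :: (real ^ 'n) set) \<noteq> {}" by blast
  then show ?thesis by (subst content_cbox_cart) auto
qed

lemma torus_mean_norm_le:
  assumes "continuous_on UNIV F" "\<And>r. norm (F r) \<le> B"
  shows "norm (torus_mean F) \<le> B"
proof -
  have "(F has_integral torus_mean F) (cbox 0 (\<chi> i. 1))"
    unfolding torus_mean_def by (intro integrable_integral torus_mean_integrable assms)
  then have "norm (torus_mean F) \<le> B * content (cbox 0 (\<chi> i. 1) :: (real ^ 'a) set)"
    by (rule has_integral_bound[rotated]) (use assms(2)[THEN order_trans[OF norm_ge_zero]] assms(2) in auto)
  then show ?thesis by (simp add: content_unit_cube)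
qed

text \<open>The shifted interval [s, 1 + s] is cut at 1, and the part beyond 1 is moved back by one
  period to [0, s].\<close>

lemma torus_mean_axis_shift:
  fixes F :: "real ^ 'n \<Rightarrow> complex"
  assumes F: "continuous_on UNIV F" "periodic F" and s: "0 \<le> s" "s \<le> 1"
  shows "torus_mean (\<lambda>r. F (r + axis k s)) = torus_mean F"
proof -
  define lo hi where "lo = (\<lambda>a. (\<chi> i. if i = k then a else 0) :: real ^ 'n)"
    and "hi = (\<lambda>a. (\<chi> i. if i = k then a else 1) :: real ^ 'n)"
  define J where "J = (\<lambda>a b. integral (cbox (lo a) (hi b)) F)"
  have int: "F integrable_on cbox a b" for a b
    using F by (intro integrable_continuous) (auto intro: continuous_on_subset)
  have split: "J a b = J a c + J c b" if "a \<le> c" "c \<le> b" for a b c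
  proof -
    have "J a b = integral (cbox (lo a) (hi b) \<inter> {x. x \<bullet> axis k 1 \<le> c}) F +
                  integral (cbox (lo a) (hi b) \<inter> {x. c \<le> x \<bullet> axis k 1}) F"
      unfolding J_def by (rule integral_split[OF int]) auto
    also have "cbox (lo a) (hi b) \<inter> {x. x \<bullet> axis k 1 \<le> c} = cbox (lo a) (hi c)"
      using that by (force simp: mem_box_cart inner_axis lo_def hi_def split: if_splits)
    also have "cbox (lo a) (hi b) \<inter> {x. c \<le> x \<bullet> axis k 1} = cbox (lo c) (hi b)"
      using that by (force simp: mem_box_cart inner_axis lo_def hi_def split: if_splits)
    finally show ?thesis by (simp add: J_def)
  qed
  have shift: "integral (cbox (lo a) (hi b)) (\<lambda>r. F (r + axis k t)) = J (a + t) (b + t)" for a b t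
  proof -
    have "integral (cbox (lo a) (hi b)) (F \<circ> (+) (axis k t)) = integral (cbox (lo a + axis k t) (hi b + axis k t)) F"
      by (rule integral_shift_cbox_plus)
    also have "lo a + axis k t = lo (a + t)" by (simp add: vec_eq_iff lo_def axis_def)
    also have "hi b + axis k t = hi (b + t)" by (simp add: vec_eq_iff hi_def axis_def)
    finally show ?thesis by (simp add: o_def J_def add.commute)
  qed
  have ax: "axis k 1 = of_int_vec (axis k 1)" by (simp add: vec_eq_iff axis_def)
  have per: "J (a + 1) (b + 1) = J a b" for a b
    using shift[of a b 1] F(2) unfolding ax by (simp add: periodic_def J_def)
  have m: "torus_mean G = integral (cbox (lo 0) (hi 1)) G" for G
    unfolding torus_mean_def by (rule arg_cong2[of _ _ _ _ integral]) (auto simp: lo_def hi_def mem_box_cart)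
  have "torus_mean (\<lambda>r. F (r + axis k s)) = J s (1 + s)"
    using shift[of 0 1 s] by (simp add: m)
  also have "\<dots> = J s 1 + J (0 + 1) (s + 1)" using split[of s 1 "1 + s"] s by (simp add: add.commute)
  also have "J (0 + 1) (s + 1) = J 0 s" by (rule per)
  also have "J s 1 + J 0 s = J 0 1" using split[of 0 s 1] s by simp
  finally show ?thesis by (simp add: m J_def)
qed

text \<open>The coordinates are shifted one after the other by the fractional parts of v, where
  \<open>torus_mean_axis_shift\<close> applies; the integral parts are periods.\<close>

lemma torus_mean_shift:
  fixes F :: "real ^ 'n \<Rightarrow> complex"
  assumes F: "continuous_on UNIV F" "periodic F"
  shows "torus_mean (\<lambda>r. F (r + v)) = torus_mean F"
proof -
  define w where "w = (\<lambda>K. (\<chi> i. if i \<in> K then frac (v $ i) else 0) :: real ^ 'n)"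
  have "torus_mean (\<lambda>r. F (r + w K)) = torus_mean F" if "finite K" for K
    using that
  proof (induction K)
    case empty
    have "w {} = 0" by (simp add: w_def vec_eq_iff)
    then show ?case by simp
  next
    case (insert k K)
    have eq: "w (insert k K) = axis k (frac (v $ k)) + w K"
      using insert.hyps by (auto simp: vec_eq_iff w_def axis_def)
    have "torus_mean (\<lambda>r. F (r + axis k (frac (v $ k)) + w K)) = torus_mean (\<lambda>r. F (r + w K))"
    proof (rule torus_mean_axis_shift[of "\<lambda>r. F (r + w K)"])
      show "continuous_on UNIV (\<lambda>r. F (r + w K))"
        by (intro continuous_on_compose2[OF F(1)] continuous_intros) auto
      show "periodic (\<lambda>r. F (r + w K))"
        using F(2) unfolding periodic_def by (metis add.assoc add.commute)
    qed (auto simp: frac_lt_1 less_imp_le)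
    then show ?case using insert.IH by (simp add: eq add.assoc)
  qed
  from this[of UNIV] have "torus_mean (\<lambda>r. F (r + w UNIV)) = torus_mean F" by simp
  moreover have "F (r + v) = F (r + w UNIV)" for r
  proof -
    have "r + v = (r + w UNIV) + of_int_vec (\<chi> i. \<lfloor>v $ i\<rfloor>)"
      by (simp add: vec_eq_iff w_def frac_def)
    then show ?thesis using F(2) by (metis periodic_def)
  qed
  ultimately show ?thesis by simp
qed

lemma torus_mean_const: "torus_mean (\<lambda>r :: real ^ 'n. c) = c"
  by (simp add: torus_mean_def content_unit_cube)

lemma torus_mean_ev: "torus_mean (ev y) = (if y = 0 then 1 else 0)"
proof (cases "y = 0")
  case True
  then have "ev y = (\<lambda>r. 1)" by (auto simp: fun_eq_iff)
  then show ?thesis using True by (simp add: torus_mean_const)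
next
  case False
  then obtain i where i: "y $ i \<noteq> 0" by (auto simp: vec_eq_iff)
  \<comment> \<open>Half a period of the character: translation by \<open>v\<close> multiplies
    \<open>ev y\<close> by -1 but preserves its mean.\<close>
  define v where "v = (axis i (1 / (2 * of_int (y $ i))) :: real ^ 'a)"
  have "of_int_vec y \<bullet> v = 1 / 2" using i by (simp add: v_def inner_axis)
  then have v: "ev y v = -1"
    using exp_pi_i' by (simp only: ev_def e_def) (simp add: mult_ac)
  have "torus_mean (\<lambda>r. ev y (r + v)) = torus_mean (ev y)"
    by (rule torus_mean_shift) (auto intro!: continuous_intros periodic_ev)
  moreover have "torus_mean (\<lambda>r. ev y (r + v)) = - torus_mean (ev y)"
    using torus_mean_cmult[of "-1" "ev y"] by (simp add: ev_add v)
  ultimately show ?thesis using False by simp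
qed

section \<open>Uniqueness of Fourier coefficients\<close>

definition fourier_null :: "(real ^ 'n \<Rightarrow> complex) \<Rightarrow> bool" where
  "fourier_null G \<longleftrightarrow> continuous_on UNIV G \<and> periodic G \<and> (\<forall>y. torus_mean (\<lambda>r. G r * ev y r) = 0)"

text \<open>This class contains the characters and is closed under sums and products, so it contains
  every trigonometric polynomial. Speaking of multipliers lets the induction over polynomial
  functions run without writing out their coefficients.\<close>

definition null_multiplier :: "(real ^ 'n \<Rightarrow> complex) \<Rightarrow> bool" where
  "null_multiplier p \<longleftrightarrow> continuous_on UNIV p \<and> (\<forall>G. fourier_null G \<longrightarrow> fourier_null (\<lambda>r. G r * p r))"

lemma null_multiplier_const: "null_multiplier (\<lambda>r. c)"
proof -
  have "torus_mean (\<lambda>r. G r * c * ev y r) = c * torus_mean (\<lambda>r. G r * ev y r)" for G and y :: "int ^ 'a"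
    by (subst torus_mean_cmult[symmetric]) (simp add: mult_ac)
  then show ?thesis
    by (auto simp: null_multiplier_def fourier_null_def intro!: continuous_intros periodic_mult)
      (simp add: periodic_def)
qed

lemma null_multiplier_mult:
  "null_multiplier p \<Longrightarrow> null_multiplier q \<Longrightarrow> null_multiplier (\<lambda>r. p r * q r)"
  by (auto simp: null_multiplier_def mult.assoc[symmetric] intro!: continuous_intros)

lemma null_multiplier_add:
  assumes "null_multiplier p" "null_multiplier q" 
  shows "null_multiplier (\<lambda>r. p r + q r)"
  unfolding null_multiplier_def
proof (intro conjI allI impI)
  show "continuous_on UNIV (\<lambda>r. p r + q r)"
    using assms by (auto simp: null_multiplier_def intro!: continuous_intros)
  fix G :: "real ^ 'a \<Rightarrow> complex" assume "fourier_null G"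
  then have "fourier_null (\<lambda>r. G r * p r)" "fourier_null (\<lambda>r. G r * q r)"
    using assms by (auto simp: null_multiplier_def)
  then show "fourier_null (\<lambda>r. G r * (p r + q r))"
    by (auto simp: fourier_null_def periodic_def distrib_left distrib_right intro!: continuous_intros)
      (subst torus_mean_add; auto intro!: continuous_intros)
qed

lemma null_multiplier_sum:
  "finite S \<Longrightarrow> (\<And>x. x \<in> S \<Longrightarrow> null_multiplier (p x)) \<Longrightarrow> null_multiplier (\<lambda>r. \<Sum>x\<in>S. p x r)"
  by (induction S rule: finite_induct) (auto intro: null_multiplier_const null_multiplier_add)

lemma null_multiplier_ev: "null_multiplier (ev y)"
  by (auto simp: null_multiplier_def fourier_null_def mult.assoc ev_add_left[symmetric]
      intro!: continuous_intros periodic_mult periodic_ev)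

text \<open>Realises the torus as a compact subset of a Euclidean space, where Stone-Weierstrass for
  polynomial functions applies.\<close>

definition torus_embedding :: "real ^ 'n \<Rightarrow> complex ^ 'n" where
  "torus_embedding r = (\<chi> i. e (of_real (r $ i)))"

lemma ev_axis: "ev (axis i k) r = e (of_int k * of_real (r $ i))"
proof -
  have "of_int_vec (axis i k) = (axis i (of_int k) :: real ^ 'a)"
    by (simp add: vec_eq_iff axis_def)
  then show ?thesis by (simp add: ev_def inner_axis')
qed

text \<open>The real coordinates of the embedded point are the real and imaginary parts of e(r_i),
  hence combinations of the two characters belonging to plus and minus the i-th unit vector. A
  linear functional is expanded in these coordinates; polynomials follow by the closure
  properties.\<close>

lemma null_multiplier_real_polynomial:
  fixes g :: "complex ^ 'n \<Rightarrow> real"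
  assumes "real_polynomial_function g"
  shows "null_multiplier (\<lambda>r. of_real (g (torus_embedding r)))"
  using assms
proof (induction rule: real_polynomial_function.induct)
  case (linear f)
  then interpret bounded_linear f .
  have Re_Im: "of_real (Re (e (of_real t))) = (e (of_real t) + e (- of_real t)) / 2"
    "of_real (Im (e (of_real t))) = (e (of_real t) - e (- of_real t)) / (2 * \<i>)" for t
    using complex_add_cnj[of "e (of_real t)"] complex_diff_cnj[of "e (of_real t)"]
    by (simp_all add: cnj_e_of_real) (simp add: complex_eq_iff)
  have *: "null_multiplier (\<lambda>r :: real ^ 'n. of_real (torus_embedding r \<bullet> b))" if "b \<in> Basis" for b
  proof -
    from that obtain i u where b: "b = axis i u" "u = 1 \<or> u = \<i>" by (auto simp: Basis_vec_def Basis_complex_def)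
    \<comment> \<open>The coefficients of e(t) and e(-t) in the cosine (for \<open>u = 1\<close>)
      and in the sine (for \<open>u = \<i>\<close>).\<close>
    define z :: complex where "z = (if u = 1 then 1 / 2 else 1 / (2 * \<i>))"
    define z' :: complex where "z' = (if u = 1 then 1 / 2 else - 1 / (2 * \<i>))"
    have "null_multiplier (\<lambda>r :: real ^ 'n. z * ev (axis i 1) r + z' * ev (axis i (-1)) r)"
      by (intro null_multiplier_add null_multiplier_mult null_multiplier_const null_multiplier_ev)
    moreover have "of_real (torus_embedding r \<bullet> b) = z * ev (axis i 1) r + z' * ev (axis i (-1)) r" for r
      using b by (auto simp: inner_axis torus_embedding_def ev_axis z_def z'_def Re_Im field_simps)
    ultimately show ?thesis by simp
  qed
  have rep: "f x = (\<Sum>b\<in>Basis. f b * (x \<bullet> b))" for x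
    using arg_cong[OF euclidean_representation[of x], of f] by (simp add: sum scaleR mult.commute)
  have "(\<lambda>r :: real ^ 'n. complex_of_real (f (torus_embedding r))) = 
      (\<lambda>r. \<Sum>b\<in>Basis. of_real (f b) * of_real (torus_embedding r \<bullet> b))" by (rule ext) (subst rep, simp)
  then show ?case
    by (auto intro!: null_multiplier_sum null_multiplier_mult null_multiplier_const *)
qed (auto intro: null_multiplier_const null_multiplier_add null_multiplier_mult)

lemma null_multiplier_polynomial:
  fixes g :: "complex ^ 'n \<Rightarrow> complex"
  assumes "polynomial_function g"
  shows "null_multiplier (\<lambda>r. g (torus_embedding r))"
proof -
  have "real_polynomial_function (\<lambda>x. Re (g x))" "real_polynomial_function (\<lambda>x. Im (g x))"
    using assms bounded_linear_Re bounded_linear_Im unfolding polynomial_function_def o_def by blast+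
  then have "null_multiplier (\<lambda>r. of_real (Re (g (torus_embedding r))) + \<i> * of_real (Im (g (torus_embedding r))))"
    by (intro null_multiplier_add null_multiplier_mult null_multiplier_const null_multiplier_real_polynomial)
  then show ?thesis by (simp add: complex_eq[symmetric])
qed

lemma periodic_reduce:
  fixes r :: "real ^ 'n"
  obtains x s where "r = s + of_int_vec x" "s \<in> cbox 0 (\<chi> i. 1)"
proof -
  have "r = (\<chi> i. frac (r $ i)) + of_int_vec (\<chi> i. \<lfloor>r $ i\<rfloor>)"
    by (simp add: vec_eq_iff frac_def)
  moreover have "(\<chi> i. frac (r $ i)) \<in> cbox 0 (\<chi> i. (1::real))"
    by (auto simp: mem_box_cart frac_lt_1 less_imp_le)
  ultimately show ?thesis by (rule that)
qed

text \<open>Transports a periodic function to a continuous function on a compact set of complex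
  vectors, so that it can be approximated there by polynomials.\<close>

lemma periodic_factor:
  fixes G :: "real ^ 'n \<Rightarrow> complex"
  assumes G: "continuous_on UNIV G" "periodic G"
  obtains f S where "compact S" "range torus_embedding \<subseteq> S" "continuous_on S f"
    "\<And>r. f (torus_embedding r) = G r"
proof -
  let ?K = "cbox 0 (\<chi> i. 1) :: (real ^ 'n) set"
  define S where "S = torus_embedding ` ?K"
  define f where "f = (\<lambda>z :: complex ^ 'n. G (\<chi> i. Arg (z $ i) / (2 * pi)))"
  have cE: "continuous_on A torus_embedding" for A :: "(real ^ 'n) set"
    unfolding torus_embedding_def by (intro continuous_intros)
  have f: "f (torus_embedding r) = G r" for r
  proof -
    have "\<exists>k::int. Arg (e (of_real t)) / (2 * pi) = t + of_int k" for t
    proof -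
      have "e (of_real t) = of_real (norm (e (of_real t))) * exp (\<i> * of_real (Arg (e (of_real t))))"
        by (rule Arg_eq) simp
      then have "e (of_real t) = e (of_real (Arg (e (of_real t)) / (2 * pi)))"
        by (simp add: e_def mult_ac)
      then have "e (of_real (Arg (e (of_real t)) / (2 * pi) - t)) = 1"
        unfolding of_real_diff e_diff by (metis divide_self e_nonzero)
      then have "Arg (e (of_real t)) / (2 * pi) - t \<in> \<int>"
        by (simp only: e_eq_1_iff_Ints)
      then obtain k where "Arg (e (of_real t)) / (2 * pi) - t = of_int k" by (auto elim!: Ints_cases)
      then show ?thesis by (intro exI[of _ k]) simp
    qed
    then have "\<forall>i. \<exists>k::int. Arg (e (of_real (r $ i))) / (2 * pi) = r $ i + of_int k" by blast
    then obtain k where k: "\<forall>i. Arg (e (of_real (r $ i))) / (2 * pi) = r $ i + of_int (k i)"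
      unfolding choice_iff by blast
    have "f (torus_embedding r) = G (r + of_int_vec (\<chi> i. k i))"
      unfolding f_def by (rule arg_cong[of _ _ G]) (simp add: vec_eq_iff torus_embedding_def k)
    then show ?thesis using G(2) by (simp add: periodic_def)
  qed
  \<comment> \<open>\<open>Arg\<close> jumps, so continuity cannot be read off from the formula. The
    unit cube is compact, hence its map onto \<open>S\<close> is a quotient map, and openness may be
    tested after pulling back to the cube, where f becomes the continuous G.\<close>
  have "continuous_on S f"
    unfolding continuous_on_open_invariant
  proof (intro allI impI)
    fix V :: "complex set" assume V: "open V"
    have "openin (top_of_set ?K) (?K \<inter> torus_embedding -` (S \<inter> f -` V))"
    proof -
      have "?K \<inter> torus_embedding -` (S \<inter> f -` V) = ?K \<inter> G -` V"
        unfolding vimage_def S_def using f by auto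
      then show ?thesis
        using continuous_openin_preimage_gen[OF continuous_on_subset[OF G(1) subset_UNIV] V] by simp
    qed
    then have "openin (top_of_set S) (S \<inter> f -` V)"
      using Abstract_Topology_2.continuous_imp_quotient_map[OF cE _ compact_cbox, of 0 "\<chi> i. 1" S "S \<inter> f -` V"]
      by (simp add: S_def)
    then show "\<exists>A. open A \<and> A \<inter> S = f -` V \<inter> S"
      by (auto simp: openin_open)
  qed
  moreover have "range torus_embedding \<subseteq> S"
  proof safe
    fix r :: "real ^ 'n"
    obtain x s where "r = s + of_int_vec x" "s \<in> ?K" by (rule periodic_reduce)
    moreover from this have "torus_embedding r = torus_embedding s"
      by (simp add: torus_embedding_def vec_eq_iff e_add)
    ultimately show "torus_embedding r \<in> S" by (simp add: S_def)
  qed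
  moreover have "compact S" unfolding S_def by (intro compact_continuous_image cE compact_cbox)
  ultimately show ?thesis using f that by blast
qed

lemma periodic_bounded:
  fixes G :: "real ^ 'n \<Rightarrow> complex"
  assumes G: "continuous_on UNIV G" "periodic G"
  obtains B where "B > 0" "\<And>r. norm (G r) \<le> B"
proof -
  obtain B where B: "B > 0" "\<And>r. r \<in> G ` cbox 0 (\<chi> i. 1) \<Longrightarrow> norm r \<le> B"
    using compact_imp_bounded[OF compact_continuous_image[OF continuous_on_subset[OF G(1) subset_UNIV] compact_cbox]]
    unfolding bounded_pos by blast
  have "norm (G r) \<le> B" for r
  proof -
    obtain x s where "r = s + of_int_vec x" "s \<in> cbox 0 (\<chi> i. 1)" by (rule periodic_reduce)
    then show ?thesis using G(2) B(2)[of "G s"] by (auto simp: periodic_def)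
  qed
  then show ?thesis using that B(1) by blast
qed

text \<open>Approximate the conjugate of G uniformly by a polynomial p in the embedded point. The
  mean of G p is 0, so the mean of |G|^2 is at most a constant times the error of approximation.
  Hence it vanishes, and a continuous nonnegative function with integral 0 is 0.\<close>

lemma fourier_null_imp_0:
  fixes G :: "real ^ 'n \<Rightarrow> complex"
  assumes "fourier_null G"
  shows "G r = 0"
proof -
  have G: "continuous_on UNIV G" "periodic G" using assms by (auto simp: fourier_null_def)
  obtain B where B: "B > 0" "\<And>r. norm (G r) \<le> B" by (rule periodic_bounded[OF G]) blast
  have G': "continuous_on UNIV (\<lambda>r. cnj (G r))" "periodic (\<lambda>r. cnj (G r))"
    using G by (auto simp: periodic_def intro!: continuous_intros)
  define N where "N = torus_mean (\<lambda>r. G r * cnj (G r))"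
  have "norm N \<le> B * \<epsilon>" if \<epsilon>: "\<epsilon> > 0" for \<epsilon>
  proof -
    obtain S f where S: "compact S" "range torus_embedding \<subseteq> S" "continuous_on S f"
      "\<And>r. f (torus_embedding r) = cnj (G r)"
      by (rule periodic_factor[OF G']) blast
    obtain g where g: "polynomial_function g" "\<And>x. x \<in> S \<Longrightarrow> norm (f x - g x) < \<epsilon>"
      using Stone_Weierstrass_polynomial_function[OF S(1,3) \<epsilon>] by blast
    define p where "p = (\<lambda>r :: real ^ 'n. g (torus_embedding r))"
    have p: "null_multiplier p" unfolding p_def by (rule null_multiplier_polynomial[OF g(1)])
    then have "fourier_null (\<lambda>r. G r * p r)" using assms by (simp add: null_multiplier_def)
    \<comment> \<open>The coefficient at frequency 0 is the mean itself.\<close>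
    then have "torus_mean (\<lambda>r. G r * p r * ev 0 r) = 0" unfolding fourier_null_def by blast
    then have p0: "torus_mean (\<lambda>r. G r * p r) = 0" by simp
    have cp: "continuous_on UNIV p" using p by (simp add: null_multiplier_def)
    have "norm (cnj (G r) - p r) \<le> \<epsilon>" for r
      using g(2)[of "torus_embedding r"] S(2,4) by (auto simp: p_def less_imp_le image_subset_iff)
    then have *: "norm (G r * (cnj (G r) - p r)) \<le> B * \<epsilon>" for r
      unfolding norm_mult using B \<epsilon> by (intro mult_mono) auto
    have "N = torus_mean (\<lambda>r. G r * (cnj (G r) - p r))"
      using torus_mean_diff[of "\<lambda>r. G r * cnj (G r)" "\<lambda>r. G r * p r"] G cp
      by (simp add: N_def p0 right_diff_distrib continuous_intros)
    also have "norm \<dots> \<le> B * \<epsilon>"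
      by (intro torus_mean_norm_le * continuous_intros G cp)
    finally show ?thesis .
  qed
  from this[of "\<epsilon> / B" for \<epsilon>] have "norm N \<le> 0 + \<epsilon>" if "\<epsilon> > 0" for \<epsilon>
    using that B(1) by simp
  then have "norm N \<le> 0" by (rule field_le_epsilon)
  then have N0: "N = 0" by simp
  have int: "((\<lambda>r. G r * cnj (G r)) has_integral N) (cbox 0 (\<chi> i. 1))"
    unfolding N_def torus_mean_def by (intro integrable_integral torus_mean_integrable continuous_intros G)
  have "((\<lambda>r. Re (G r * cnj (G r))) has_integral Re N) (cbox 0 (\<chi> i. 1))"
    using has_integral_linear[OF int bounded_linear_Re] by (simp add: o_def)
  then have int': "((\<lambda>r. (norm (G r))\<^sup>2) has_integral 0) (cbox 0 (\<chi> i. 1))"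
    by (simp add: N0 complex_norm_square[symmetric] del: complex_mult_cnj)
  obtain x s where s: "r = s + of_int_vec x" "s \<in> cbox 0 (\<chi> i. 1)" by (rule periodic_reduce)
  have "(norm (G s))\<^sup>2 = 0"
  proof (rule has_integral_0_cbox_imp_0[OF _ _ int' _ s(2)])
    show "continuous_on (cbox 0 (\<chi> i. 1)) (\<lambda>r. (norm (G r))\<^sup>2)"
      using G(1) by (intro continuous_intros continuous_on_subset[OF G(1)]) auto
    have "(\<chi> i. 1 / 2) \<in> box 0 (\<chi> i. (1::real))" by (simp add: mem_box_cart)
    then show "box 0 (\<chi> i. (1::real)) \<noteq> {}" by blast
  qed auto
  then show ?thesis using s(1) G(2) by (simp add: periodic_def)
qed

subsection \<open>Positive definite quadratic forms\<close>

text \<open>Positivity is stated with a uniform constant c, the form in which all growth estimates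
  use it; from positivity off 0 it would follow by compactness of the sphere.\<close>

definition posdef :: "real ^ 'n ^ 'n \<Rightarrow> bool" where
  "posdef A \<longleftrightarrow> transpose A = A \<and> (\<exists>c>0. \<forall>x. c * (norm x)\<^sup>2 \<le> quad_form A x)"

lemma inner_matrix_sym: "transpose A = A \<Longrightarrow> inner (x :: real ^ 'n) (A *v y) = inner y (A *v x)"
  by (metis dot_lmul_matrix inner_commute transpose_matrix_vector)

lemma quad_form_add:
  "transpose A = A \<Longrightarrow> quad_form A (x + y) = quad_form A x + 2 * inner x (A *v y) + quad_form A y"
  using inner_matrix_sym[of A x y]
  by (simp add: quad_form_def matrix_vector_right_distrib inner_add_left inner_add_right)

lemma quad_form_scale: "quad_form A (c *\<^sub>R x) = c\<^sup>2 * quad_form A x"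
  by (simp add: quad_form_def matrix_vector_mult_scaleR power2_eq_square)

lemma quad_form_0 [simp]: "quad_form A 0 = 0"
  by (simp add: quad_form_def)

lemma quad_form_minus [simp]: "quad_form A (- x) = quad_form A x"
  using quad_form_scale[of A "-1" x] by simp

lemma posdef_sym: "posdef A \<Longrightarrow> transpose A = A"
  by (simp add: posdef_def)

lemma posdef_nonneg: "posdef A \<Longrightarrow> quad_form A x \<ge> 0"
  unfolding posdef_def by (meson mult_nonneg_nonneg less_imp_le order_trans zero_le_power2)

lemma matrix_bound: obtains K where "K > 0" "\<And>x. norm ((A :: real ^ 'n ^ 'm) *v x) \<le> K * norm x"
  using bounded_linear.pos_bounded[OF matrix_vector_mul_bounded_linear[of A]] by (metis mult.commute)

lemma quad_form_upper: obtains K where "K > 0" "\<And>x. \<bar>quad_form A x\<bar> \<le> K * (norm x)\<^sup>2"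
proof -
  obtain K where K: "K > 0" "\<And>x. norm (A *v x) \<le> K * norm x" by (rule matrix_bound) blast
  have "\<bar>quad_form A x\<bar> \<le> K * (norm x)\<^sup>2" for x
  proof -
    have "\<bar>quad_form A x\<bar> \<le> norm x * norm (A *v x)"
      unfolding quad_form_def by (rule Cauchy_Schwarz_ineq2)
    also have "\<dots> \<le> norm x * (K * norm x)" by (intro mult_left_mono K) auto
    finally show ?thesis by (simp add: power2_eq_square mult_ac)
  qed
  then show ?thesis using K that by blast
qed

lemma posdef_invertible:
  assumes "posdef A" shows "invertible A"
proof -
  obtain c where c: "c > 0" "\<And>x. c * (norm x)\<^sup>2 \<le> quad_form A x"
    using assms unfolding posdef_def by blast
  have "x = 0" if "A *v x = 0" for x
    using c(2)[of x] c(1) that by (simp add: quad_form_def mult_le_0_iff)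
  then show ?thesis
    by (metis invertible_left_inverse matrix_left_invertible_ker)
qed

lemma matrix_inv_mult:
  assumes "invertible (A :: real ^ 'n ^ 'n)"
  shows "A ** matrix_inv A = mat 1" "matrix_inv A ** A = mat 1"
    "A *v (matrix_inv A *v x) = x" "matrix_inv A *v (A *v x) = x"
  using someI_ex[OF assms[unfolded invertible_def], folded matrix_inv_def]
  by (simp_all add: matrix_vector_mul_assoc)

lemma matrix_inv_sym:
  assumes "invertible (A :: real ^ 'n ^ 'n)" "transpose A = A"
  shows "transpose (matrix_inv A) = matrix_inv A"
proof -
  have "transpose (matrix_inv A) ** A = mat 1"
    by (metis assms matrix_inv_mult(1) matrix_transpose_mul transpose_mat)
  then show ?thesis
    by (metis assms(1) matrix_inv_mult(1) matrix_mul_assoc matrix_mul_lid matrix_mul_rid)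
qed

lemma quad_form_inv:
  assumes "posdef A" shows "quad_form (matrix_inv A) (A *v x) = quad_form A x"
  using matrix_inv_mult(4)[OF posdef_invertible[OF assms], of x]
  by (simp add: quad_form_def inner_commute)

lemma posdef_inv:
  assumes "posdef A" shows "posdef (matrix_inv A)"
proof -
  note inv = posdef_invertible[OF assms]
  obtain c where c: "c > 0" "\<And>x. c * (norm x)\<^sup>2 \<le> quad_form A x"
    using assms unfolding posdef_def by blast
  obtain K where K: "K > 0" "\<And>x. norm (A *v x) \<le> K * norm x" by (rule matrix_bound) blast
  have "c / K\<^sup>2 * (norm y)\<^sup>2 \<le> quad_form (matrix_inv A) y" for y
  proof -
    define x where "x = matrix_inv A *v y"
    have y: "y = A *v x" by (simp add: x_def matrix_inv_mult[OF inv])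
    have "(norm y)\<^sup>2 \<le> (K * norm x)\<^sup>2" unfolding y by (intro power_mono K) auto
    then have "c / K\<^sup>2 * (norm y)\<^sup>2 \<le> c / K\<^sup>2 * (K * norm x)\<^sup>2" using c by (intro mult_left_mono) auto
    also have "\<dots> = c * (norm x)\<^sup>2" using K by (simp add: power_mult_distrib)
    also have "\<dots> \<le> quad_form A x" by (rule c)
    finally show ?thesis by (simp add: y quad_form_inv[OF assms])
  qed
  moreover have "c / K\<^sup>2 > 0" using c K by simp
  ultimately show ?thesis
    unfolding posdef_def using matrix_inv_sym[OF inv posdef_sym[OF assms]] by blast
qed

text \<open>Makes a shift by r cost half of a quadratic lower bound and an additive
  constant.\<close>

lemma half_square_le: "(norm (x :: 'a :: real_normed_vector))\<^sup>2 / 2 - (norm r)\<^sup>2 \<le> (norm (x + r))\<^sup>2"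
proof -
  have "norm x \<le> norm (x + r) + norm r"
    using norm_triangle_ineq4[of "x + r" r] by simp
  then have "(norm x)\<^sup>2 \<le> (norm (x + r) + norm r)\<^sup>2" by (rule power_mono) auto
  also have "\<dots> \<le> 2 * (norm (x + r))\<^sup>2 + 2 * (norm r)\<^sup>2"
    using zero_le_power2[of "norm (x + r) - norm r"] by (simp add: power2_eq_square algebra_simps)
  finally show ?thesis by simp
qed

lemma quad_growth_posdef:
  assumes "posdef A"
  shows "quad_growth (\<lambda>x. quad_form A (of_int_vec x + r))"
proof -
  obtain c where c: "c > 0" "\<And>x. c * (norm x)\<^sup>2 \<le> quad_form A x"
    using assms unfolding posdef_def by blast
  obtain K where K: "K > 0" "\<And>x. \<bar>quad_form A x\<bar> \<le> K * (norm x)\<^sup>2" by (rule quad_form_upper) blast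
  have "c / 2 * (inorm x)\<^sup>2 - c * (norm r)\<^sup>2 \<le> quad_form A (of_int_vec x + r)" for x
    using order_trans[OF mult_left_mono[OF half_square_le] c(2)] c(1) unfolding inorm_def
    by (simp add: right_diff_distrib less_imp_le)
  moreover have "quad_form A (of_int_vec x + r) \<le> K * (1 + norm r)\<^sup>2 * (1 + inorm x)\<^sup>2" for x
  proof -
    have "norm (of_int_vec x + r) \<le> inorm x + norm r"
      unfolding inorm_def by (rule norm_triangle_ineq)
    also have "\<dots> \<le> (1 + norm r) * (1 + inorm x)" by (simp add: algebra_simps)
    finally have "(norm (of_int_vec x + r))\<^sup>2 \<le> ((1 + norm r) * (1 + inorm x))\<^sup>2" by (rule power_mono) auto
    then have "K * (norm (of_int_vec x + r))\<^sup>2 \<le> K * ((1 + norm r) * (1 + inorm x))\<^sup>2"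
      using K by (intro mult_left_mono) auto
    then show ?thesis using K(2)[of "of_int_vec x + r"] by (simp add: power_mult_distrib)
  qed
  ultimately show ?thesis
    unfolding quad_growth_def using posdef_nonneg[OF assms] c(1) half_gt_zero[OF c(1)] by blast
qed

lemma quad_growth_posdef0:
  "posdef A \<Longrightarrow> quad_growth (\<lambda>x. quad_form A (of_int_vec x))"
  using quad_growth_posdef[of A 0] by simp

lemma poly_growth_quad_form: "poly_growth (\<lambda>x. of_real (quad_form B (of_int_vec x + r)))"
proof -
  obtain K where K: "K > 0" "\<And>x. \<bar>quad_form B x\<bar> \<le> K * (norm x)\<^sup>2" by (rule quad_form_upper) blast
  show ?thesis
  proof (rule poly_growthI)
    fix x :: "int ^ 'a"
    have "norm (of_int_vec x + r) \<le> inorm x + norm r"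
      unfolding inorm_def by (rule norm_triangle_ineq)
    also have "\<dots> \<le> (1 + norm r) * (1 + inorm x)" by (simp add: algebra_simps)
    finally have "(norm (of_int_vec x + r))\<^sup>2 \<le> ((1 + norm r) * (1 + inorm x))\<^sup>2" by (rule power_mono) auto
    then have "K * (norm (of_int_vec x + r))\<^sup>2 \<le> K * ((1 + norm r) * (1 + inorm x))\<^sup>2"
      using K by (intro mult_left_mono) auto
    then show "norm (of_real (quad_form B (of_int_vec x + r)) :: complex) \<le> (K * (1 + norm r)\<^sup>2) * (1 + inorm x) ^ 2"
      using K(2)[of "of_int_vec x + r"] by (simp add: power_mult_distrib)
  qed
qed

lemma poly_growth_quad_form0: "poly_growth (\<lambda>x. of_real (quad_form B (of_int_vec x)))"
  using poly_growth_quad_form[of B 0] by simp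

subsection \<open>Gaussian sums along complex lines\<close>

text \<open>The summand of \<open>gauss_sum_fn\<close> below along a line through \<open>r\<close>, with a complex parameter \<open>s\<close>,
  and its first two derivatives in \<open>s\<close>.\<close>

definition gterm :: "real ^ 'n ^ 'n \<Rightarrow> complex \<Rightarrow> (int ^ 'n \<Rightarrow> complex) \<Rightarrow> complex \<Rightarrow> complex \<Rightarrow> real ^ 'n \<Rightarrow>
    real ^ 'n \<Rightarrow> complex \<Rightarrow> int ^ 'n \<Rightarrow> complex" where
  "gterm A w \<kappa> \<beta> \<gamma> u r s x =
     \<kappa> x * e (of_real (quad_form A (of_int_vec x + r)) * w + s * \<beta> * of_real ((of_int_vec x + r) \<bullet> u) + s\<^sup>2 * \<gamma>)"

definition gterm' :: "real ^ 'n ^ 'n \<Rightarrow> complex \<Rightarrow> (int ^ 'n \<Rightarrow> complex) \<Rightarrow> complex \<Rightarrow> complex \<Rightarrow> real ^ 'n \<Rightarrow>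
    real ^ 'n \<Rightarrow> complex \<Rightarrow> int ^ 'n \<Rightarrow> complex" where
  "gterm' A w \<kappa> \<beta> \<gamma> u r s x =
     2 * of_real pi * \<i> * (\<beta> * of_real ((of_int_vec x + r) \<bullet> u) + 2 * s * \<gamma>) * gterm A w \<kappa> \<beta> \<gamma> u r s x"

definition gterm'' :: "real ^ 'n ^ 'n \<Rightarrow> complex \<Rightarrow> (int ^ 'n \<Rightarrow> complex) \<Rightarrow> complex \<Rightarrow> complex \<Rightarrow> real ^ 'n \<Rightarrow>
    real ^ 'n \<Rightarrow> complex \<Rightarrow> int ^ 'n \<Rightarrow> complex" where
  "gterm'' A w \<kappa> \<beta> \<gamma> u r s x =
     (4 * of_real pi * \<i> * \<gamma> + (2 * of_real pi * \<i> * (\<beta> * of_real ((of_int_vec x + r) \<bullet> u) + 2 * s * \<gamma>))\<^sup>2)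
       * gterm A w \<kappa> \<beta> \<gamma> u r s x"

lemma gterm_has_derivative:
  "((\<lambda>s. gterm A w \<kappa> \<beta> \<gamma> u r s x) has_field_derivative gterm' A w \<kappa> \<beta> \<gamma> u r s x) (at s within S)"
  unfolding gterm_def gterm'_def by (auto intro!: derivative_eq_intros simp: algebra_simps)

lemma gterm'_has_derivative:
  "((\<lambda>s. gterm' A w \<kappa> \<beta> \<gamma> u r s x) has_field_derivative gterm'' A w \<kappa> \<beta> \<gamma> u r s x) (at s within S)"
  unfolding gterm'_def gterm''_def
  by (rule derivative_eq_intros gterm_has_derivative refl)+
     (simp add: gterm'_def power2_eq_square algebra_simps)

text \<open>The parameter s contributes a factor growing exponentially in t = |x + r|. Half of the
  Gaussian decay in t absorbs it by completing the square, and passing from x + r to x halves the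
  rest. The bound is uniform for bounded r and s; the polynomial weight is there for the factor that
  a derivative in s brings down.\<close>

lemma gterm_majorant:
  assumes A: "posdef A" and w: "Im w > 0" and \<kappa>: "\<And>x. norm (\<kappa> x) \<le> 1"
  obtains M where "M summable_on UNIV"
    "\<And>x r s. norm r \<le> \<rho> \<Longrightarrow> norm s \<le> R \<Longrightarrow>
       (1 + norm (of_int_vec x + r)) ^ k * norm (gterm A w \<kappa> \<beta> \<gamma> u r s x) \<le> M x"
proof -
  obtain c where c: "c > 0" "\<And>x. c * (norm x)\<^sup>2 \<le> quad_form A x"
    using A unfolding posdef_def by blast
  \<comment> \<open>Half of the decay rate 2 pi c Im w in t^2; \<open>b\<close> and \<open>d\<close>
    bound the linear and the constant contribution of s to the exponent.\<close>
  define \<alpha> where "\<alpha> = pi * c * Im w"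
  define b where "b = 2 * pi * R * norm \<beta> * norm u"
  define d where "d = 2 * pi * R\<^sup>2 * norm \<gamma>"
  define K where "K = exp (b\<^sup>2 / (4 * \<alpha>) + d) * exp (\<alpha> * \<rho>\<^sup>2) * (1 + \<rho>) ^ k"
  have \<alpha>: "\<alpha> > 0" using c w by (simp add: \<alpha>_def)
  show ?thesis
  proof (rule that)
    show "(\<lambda>x. K * ((1 + inorm x) ^ k * exp (- (\<alpha> / 2) * (inorm x)\<^sup>2))) summable_on UNIV"
      by (intro summable_on_cmult_right gauss_summable) (use \<alpha> in auto)
    fix x :: "int ^ 'a" and r :: "real ^ 'a" and s :: complex
    assume r: "norm r \<le> \<rho>" and s: "norm s \<le> R"
    have R: "R \<ge> 0" "\<rho> \<ge> 0" using r s norm_ge_zero order_trans by blast+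
    define t where "t = norm (of_int_vec x + r)"
    have t: "t \<ge> 0" by (simp add: t_def)
    define p where "p = s * \<beta> * of_real ((of_int_vec x + r) \<bullet> u) + s\<^sup>2 * \<gamma>"
    have "norm p \<le> norm (s * \<beta> * of_real ((of_int_vec x + r) \<bullet> u)) + norm (s\<^sup>2 * \<gamma>)"
      unfolding p_def by (rule norm_triangle_ineq)
    also have "\<dots> \<le> R * norm \<beta> * (t * norm u) + R\<^sup>2 * norm \<gamma>"
      unfolding norm_mult norm_power t_def norm_of_real
      by (intro add_mono mult_mono power_mono s Cauchy_Schwarz_ineq2) (use R in auto)
    finally have p: "2 * pi * norm p \<le> b * t + d"
      using mult_left_mono[of "norm p" "R * norm \<beta> * (t * norm u) + R\<^sup>2 * norm \<gamma>" "2 * pi"]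
      by (simp add: b_def d_def algebra_simps)
    have "norm (gterm A w \<kappa> \<beta> \<gamma> u r s x) \<le> 1 * exp (- (2 * pi * (quad_form A (of_int_vec x + r) * Im w + Im p)))"
      unfolding gterm_def norm_mult add.assoc p_def[symmetric] norm_e
      by (intro mult_mono \<kappa>) auto
    also have "\<dots> \<le> exp (- 2 * \<alpha> * t\<^sup>2 + (b * t + d))"
    proof -
      have "c * t\<^sup>2 * Im w \<le> quad_form A (of_int_vec x + r) * Im w"
        using c(2)[of "of_int_vec x + r"] w unfolding t_def by (intro mult_right_mono) auto
      then have "2 * \<alpha> * t\<^sup>2 \<le> 2 * pi * (quad_form A (of_int_vec x + r) * Im w)"
        using mult_left_mono[of "c * t\<^sup>2 * Im w" "quad_form A (of_int_vec x + r) * Im w" "2 * pi"] by (simp add: \<alpha>_def mult_ac)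
      moreover have "- Im p \<le> norm p" using abs_Im_le_cmod[of p] by linarith
      then have "2 * pi * (- Im p) \<le> 2 * pi * norm p" by (intro mult_left_mono) auto
      ultimately show ?thesis using p by (simp add: algebra_simps)
    qed
    also have "\<dots> \<le> exp (b\<^sup>2 / (4 * \<alpha>) + d - \<alpha> * t\<^sup>2)"
    proof -
      have "0 \<le> (2 * \<alpha> * t - b)\<^sup>2 / (4 * \<alpha>)" using \<alpha> by simp
      also have "\<dots> = \<alpha> * t\<^sup>2 - b * t + b\<^sup>2 / (4 * \<alpha>)"
        using \<alpha> by (simp add: power2_eq_square field_simps)
      finally show ?thesis by simp
    qed
    also have "\<dots> \<le> exp (b\<^sup>2 / (4 * \<alpha>) + d + \<alpha> * \<rho>\<^sup>2 + - (\<alpha> / 2) * (inorm x)\<^sup>2)"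
    proof -
      have "(inorm x)\<^sup>2 / 2 - \<rho>\<^sup>2 \<le> t\<^sup>2"
        using half_square_le[of "of_int_vec x" r] power_mono[OF r norm_ge_zero, of 2]
        unfolding inorm_def t_def by linarith
      from mult_left_mono[OF this, of \<alpha>] \<alpha> show ?thesis by (simp add: algebra_simps)
    qed
    also have "\<dots> = exp (b\<^sup>2 / (4 * \<alpha>) + d) * exp (\<alpha> * \<rho>\<^sup>2) * exp (- (\<alpha> / 2) * (inorm x)\<^sup>2)"
      by (simp only: exp_add)
    finally have 1: "norm (gterm A w \<kappa> \<beta> \<gamma> u r s x) \<le> \<dots>" .
    have "1 + t \<le> 1 + (inorm x + norm r)"
      unfolding inorm_def t_def using norm_triangle_ineq[of "of_int_vec x" r] by simp
    also have "\<dots> \<le> (1 + \<rho>) * (1 + inorm x)" using r mult_nonneg_nonneg[OF R(2) inorm_nonneg[of x]] by (simp add: algebra_simps)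
    finally have "(1 + t) ^ k \<le> ((1 + \<rho>) * (1 + inorm x)) ^ k" using t by (intro power_mono) auto
    from mult_mono[OF this 1] show "(1 + norm (of_int_vec x + r)) ^ k * norm (gterm A w \<kappa> \<beta> \<gamma> u r s x) \<le> K * ((1 + inorm x) ^ k * exp (- (\<alpha> / 2) * (inorm x)\<^sup>2))"
      using R by (simp add: t_def K_def power_mult_distrib mult_ac)
  qed
qed

lemma gterm_bounds:
  assumes "posdef A" "Im w > 0" "\<And>x. norm (\<kappa> x) \<le> 1"
  obtains M M' where "M summable_on UNIV" "M' summable_on UNIV"
    "\<And>x r s. norm r \<le> \<rho> \<Longrightarrow> norm s \<le> R \<Longrightarrow> norm (gterm A w \<kappa> \<beta> \<gamma> u r s x) \<le> M x"
    "\<And>x r s. norm r \<le> \<rho> \<Longrightarrow> norm s \<le> R \<Longrightarrow> norm (gterm' A w \<kappa> \<beta> \<gamma> u r s x) \<le> M' x"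
proof -
  obtain M where M: "M summable_on UNIV"
    "\<And>x r s. norm r \<le> \<rho> \<Longrightarrow> norm s \<le> R \<Longrightarrow> (1 + norm (of_int_vec x + r)) ^ 0 * norm (gterm A w \<kappa> \<beta> \<gamma> u r s x) \<le> M x"
    by (rule gterm_majorant[where k = 0 and \<rho> = \<rho> and R = R and \<beta> = \<beta> and \<gamma> = \<gamma> and u = u and \<kappa> = \<kappa>, OF assms]) blast
  obtain M' where M': "M' summable_on UNIV"
    "\<And>x r s. norm r \<le> \<rho> \<Longrightarrow> norm s \<le> R \<Longrightarrow> (1 + norm (of_int_vec x + r)) ^ 1 * norm (gterm A w \<kappa> \<beta> \<gamma> u r s x) \<le> M' x"
    by (rule gterm_majorant[where k = 1 and \<rho> = \<rho> and R = R and \<beta> = \<beta> and \<gamma> = \<gamma> and u = u and \<kappa> = \<kappa>, OF assms]) blast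
  define K where "K = 2 * pi * (norm \<beta> * norm u + 2 * \<bar>R\<bar> * norm \<gamma>)"
  show ?thesis
  proof (rule that[OF M(1), of "\<lambda>x. K * M' x"])
    show "(\<lambda>x. K * M' x) summable_on UNIV" by (intro summable_on_cmult_right M')
    fix x :: "int ^ 'a" and r :: "real ^ 'a" and s :: complex
    assume r: "norm r \<le> \<rho>" and s: "norm s \<le> R"
    show "norm (gterm A w \<kappa> \<beta> \<gamma> u r s x) \<le> M x" using M(2)[OF r s, of x] by simp
    let ?t = "norm (of_int_vec x + r)"
    have "norm (\<beta> * of_real ((of_int_vec x + r) \<bullet> u) + 2 * s * \<gamma>) \<le> 
        norm (\<beta> * of_real ((of_int_vec x + r) \<bullet> u)) + norm (2 * s * \<gamma>)" by (rule norm_triangle_ineq)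
    also have "\<dots> \<le> norm \<beta> * (?t * norm u) + 2 * \<bar>R\<bar> * norm \<gamma>"
      unfolding norm_mult norm_of_real using s
      by (intro add_mono mult_mono Cauchy_Schwarz_ineq2) auto
    also have "\<dots> \<le> (norm \<beta> * norm u + 2 * \<bar>R\<bar> * norm \<gamma>) * (1 + ?t)"
      by (simp add: algebra_simps)
    finally have "2 * pi * norm (\<beta> * of_real ((of_int_vec x + r) \<bullet> u) + 2 * s * \<gamma>) * norm (gterm A w \<kappa> \<beta> \<gamma> u r s x)
      \<le> 2 * pi * ((norm \<beta> * norm u + 2 * \<bar>R\<bar> * norm \<gamma>) * (1 + ?t)) * norm (gterm A w \<kappa> \<beta> \<gamma> u r s x)"
      by (intro mult_right_mono mult_left_mono) auto
    also have "\<dots> = K * ((1 + ?t) * norm (gterm A w \<kappa> \<beta> \<gamma> u r s x))" by (simp add: K_def)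
    also have "\<dots> \<le> K * M' x"
      using M'(2)[OF r s, of x] by (intro mult_left_mono) (auto simp: K_def)
    finally show "norm (gterm' A w \<kappa> \<beta> \<gamma> u r s x) \<le> K * M' x"
      by (simp add: gterm'_def norm_mult)
  qed
qed

lemma gterm_sum_derivs:
  assumes "posdef A" "Im w > 0" "\<And>x. norm (\<kappa> x) \<le> 1"
  shows "gterm A w \<kappa> \<beta> \<gamma> u r s summable_on UNIV"
    and "gterm' A w \<kappa> \<beta> \<gamma> u r s summable_on UNIV"
    and "gterm'' A w \<kappa> \<beta> \<gamma> u r s summable_on UNIV"
    and "((\<lambda>s. infsum (gterm A w \<kappa> \<beta> \<gamma> u r s) UNIV) has_field_derivative infsum (gterm' A w \<kappa> \<beta> \<gamma> u r s) UNIV) (at s within S)"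
    and "((\<lambda>s. infsum (gterm' A w \<kappa> \<beta> \<gamma> u r s) UNIV) has_field_derivative infsum (gterm'' A w \<kappa> \<beta> \<gamma> u r s) UNIV) (at s within S)"
proof -
  let ?g = "\<lambda>x s. gterm A w \<kappa> \<beta> \<gamma> u r s x" and ?g' = "\<lambda>x s. gterm' A w \<kappa> \<beta> \<gamma> u r s x"
  have hol: "?g x holomorphic_on UNIV" "?g' x holomorphic_on UNIV" for x
    by (auto intro!: holomorphic_onI gterm_has_derivative gterm'_has_derivative simp: field_differentiable_def)
  have bd: "\<exists>\<rho>>0. \<exists>M. M summable_on UNIV \<and> cball z \<rho> \<subseteq> UNIV \<and> (\<forall>x. \<forall>w\<in>cball z \<rho>. norm (?g x w) \<le> M x)"
    and bd': "\<exists>\<rho>>0. \<exists>M. M summable_on UNIV \<and> cball z \<rho> \<subseteq> UNIV \<and> (\<forall>x. \<forall>w\<in>cball z \<rho>. norm (?g' x w) \<le> M x)" for z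
  proof -
    obtain M M' where M: "M summable_on UNIV" "M' summable_on UNIV"
      "\<And>x r' s. norm r' \<le> norm r \<Longrightarrow> norm s \<le> norm z + 1 \<Longrightarrow> norm (gterm A w \<kappa> \<beta> \<gamma> u r' s x) \<le> M x"
      "\<And>x r' s. norm r' \<le> norm r \<Longrightarrow> norm s \<le> norm z + 1 \<Longrightarrow> norm (gterm' A w \<kappa> \<beta> \<gamma> u r' s x) \<le> M' x"
      by (rule gterm_bounds[where \<rho> = "norm r" and R = "norm z + 1" and \<beta> = \<beta> and \<gamma> = \<gamma> and u = u and \<kappa> = \<kappa>, OF assms]) blast
    have "norm s \<le> norm z + 1" if "s \<in> cball z 1" for s
      using that norm_triangle_ineq2[of s z] by (simp add: dist_norm norm_minus_commute)
    then show "\<exists>\<rho>>0. \<exists>M. M summable_on UNIV \<and> cball z \<rho> \<subseteq> UNIV \<and> (\<forall>x. \<forall>w\<in>cball z \<rho>. norm (?g x w) \<le> M x)"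
      and "\<exists>\<rho>>0. \<exists>M. M summable_on UNIV \<and> cball z \<rho> \<subseteq> UNIV \<and> (\<forall>x. \<forall>w\<in>cball z \<rho>. norm (?g' x w) \<le> M x)"
      using M by (intro exI[of _ 1] conjI exI[of _ M] exI[of _ M']; auto)+
  qed
  have d: "deriv (?g x) s = ?g' x s" "deriv (?g' x) s = gterm'' A w \<kappa> \<beta> \<gamma> u r s x" for x s
    by (intro DERIV_imp_deriv gterm_has_derivative gterm'_has_derivative)+
  note T = termwise_holomorphic[of UNIV ?g, OF open_UNIV hol(1) bd]
  note T' = termwise_holomorphic[of UNIV ?g', OF open_UNIV hol(2) bd']
  show "gterm A w \<kappa> \<beta> \<gamma> u r s summable_on UNIV"
  proof -
    obtain \<rho> M where *: "\<rho> > 0" "M summable_on UNIV" "\<And>x w. w\<in>cball s \<rho> \<Longrightarrow> norm (?g x w) \<le> M x"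
      using bd[of s] by blast
    have "(\<lambda>x. norm (?g x s)) summable_on UNIV"
      by (rule summable_on_comparison_test[OF *(2)]) (use * in auto)
    then show ?thesis by (rule abs_summable_summable)
  qed
  show "gterm' A w \<kappa> \<beta> \<gamma> u r s summable_on UNIV"
    using T(1)[of s] by (simp add: d)
  show "gterm'' A w \<kappa> \<beta> \<gamma> u r s summable_on UNIV"
    using T'(1)[of s] by (simp add: d)
  show "((\<lambda>s. infsum (gterm A w \<kappa> \<beta> \<gamma> u r s) UNIV) has_field_derivative infsum (gterm' A w \<kappa> \<beta> \<gamma> u r s) UNIV) (at s within S)"
    using T(2)[of s] by (simp add: d has_field_derivative_at_within)
  show "((\<lambda>s. infsum (gterm' A w \<kappa> \<beta> \<gamma> u r s) UNIV) has_field_derivative infsum (gterm'' A w \<kappa> \<beta> \<gamma> u r s) UNIV) (at s within S)"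
    using T'(2)[of s] by (simp add: d has_field_derivative_at_within)
qed

text \<open>The sum itself must be continuous to be integrated over the torus, and its s-derivative
  jointly continuous to differentiate that integral under the integral sign.\<close>

lemma gterm_continuous:
  assumes "posdef A" "Im w > 0" "\<And>x. norm (\<kappa> x) \<le> 1"
  shows "continuous_on (cball 0 R \<times> cball 0 \<rho>) (\<lambda>(s, r). infsum (gterm A w \<kappa> \<beta> \<gamma> u r s) UNIV)"
    and "continuous_on (cball 0 R \<times> cball 0 \<rho>) (\<lambda>(s, r). infsum (gterm' A w \<kappa> \<beta> \<gamma> u r s) UNIV)"
proof -
  let ?U = "cball 0 R \<times> cball 0 \<rho> :: (complex \<times> (real ^ 'a)) set"
  obtain M M' where M: "M summable_on UNIV" "M' summable_on UNIV"
    "\<And>x r s. norm r \<le> \<rho> \<Longrightarrow> norm s \<le> R \<Longrightarrow> norm (gterm A w \<kappa> \<beta> \<gamma> u r s x) \<le> M x"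
    "\<And>x r s. norm r \<le> \<rho> \<Longrightarrow> norm s \<le> R \<Longrightarrow> norm (gterm' A w \<kappa> \<beta> \<gamma> u r s x) \<le> M' x"
    by (rule gterm_bounds[where \<rho> = \<rho> and R = R and \<beta> = \<beta> and \<gamma> = \<gamma> and u = u and \<kappa> = \<kappa>, OF assms]) blast
  have c: "continuous_on S (\<lambda>p. gterm A w \<kappa> \<beta> \<gamma> u (snd p) (fst p) x)" for x S
    unfolding gterm_def quad_form_def
    by (intro continuous_intros bounded_linear.continuous_on[OF matrix_vector_mul_bounded_linear])
  have c': "continuous_on S (\<lambda>p. gterm' A w \<kappa> \<beta> \<gamma> u (snd p) (fst p) x)" for x S
    unfolding gterm'_def by (intro continuous_intros c)
  have "uniform_limit ?U (\<lambda>X p. \<Sum>x\<in>X. gterm A w \<kappa> \<beta> \<gamma> u (snd p) (fst p) x)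
      (\<lambda>p. \<Sum>\<^sub>\<infinity>x. gterm A w \<kappa> \<beta> \<gamma> u (snd p) (fst p) x) (finite_subsets_at_top UNIV)"
    by (rule Weierstrass_m_test_general[OF _ M(1)]) (auto intro: M(3))
  then have "continuous_on ?U (\<lambda>p. \<Sum>\<^sub>\<infinity>x. gterm A w \<kappa> \<beta> \<gamma> u (snd p) (fst p) x)"
    by (rule uniform_limit_theorem[rotated]) (auto intro!: always_eventually continuous_on_sum c)
  then show "continuous_on ?U (\<lambda>(s, r). infsum (gterm A w \<kappa> \<beta> \<gamma> u r s) UNIV)"
    by (simp add: case_prod_unfold)
  have "uniform_limit ?U (\<lambda>X p. \<Sum>x\<in>X. gterm' A w \<kappa> \<beta> \<gamma> u (snd p) (fst p) x)
      (\<lambda>p. \<Sum>\<^sub>\<infinity>x. gterm' A w \<kappa> \<beta> \<gamma> u (snd p) (fst p) x) (finite_subsets_at_top UNIV)"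
    by (rule Weierstrass_m_test_general[OF _ M(2)]) (auto intro: M(4))
  then have "continuous_on ?U (\<lambda>p. \<Sum>\<^sub>\<infinity>x. gterm' A w \<kappa> \<beta> \<gamma> u (snd p) (fst p) x)"
    by (rule uniform_limit_theorem[rotated]) (auto intro!: always_eventually continuous_on_sum c')
  then show "continuous_on ?U (\<lambda>(s, r). infsum (gterm' A w \<kappa> \<beta> \<gamma> u r s) UNIV)"
    by (simp add: case_prod_unfold)
qed

text \<open>The real line has limit points, so the identity theorem applies. It carries identities
  in a real translation parameter over to complex translations.\<close>

lemma line_identity:
  fixes f g :: "complex \<Rightarrow> complex"
  assumes "f holomorphic_on UNIV" "g holomorphic_on UNIV" "\<And>t::real. f (of_real t) = g (of_real t)"
  shows "f = g"
proof
  fix z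
  have "f z - g z = 0"
  proof (rule analytic_continuation[of "\<lambda>z. f z - g z" UNIV "range of_real" 0])
    show "(0 :: complex) islimpt range of_real"
      unfolding islimpt_approachable
    proof safe
      fix \<epsilon> :: real assume "\<epsilon> > 0"
      then show "\<exists>x'\<in>range of_real. x' \<noteq> (0 :: complex) \<and> dist x' 0 < \<epsilon>"
        by (intro bexI[of _ "of_real (\<epsilon> / 2)"] rangeI) auto
    qed
  qed (use assms in \<open>auto intro!: holomorphic_intros\<close>)
  then show "f z = g z" by simp
qed

subsection \<open>Poisson summation\<close>

definition gauss_sum_fn :: "real ^ 'n ^ 'n \<Rightarrow> complex \<Rightarrow> real ^ 'n \<Rightarrow> complex" where
  "gauss_sum_fn A w r = (\<Sum>\<^sub>\<infinity>x. e (of_real (quad_form A (of_int_vec x + r)) * w))"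

text \<open>The integral of e(A[x] w) over the whole space, that is (det A)^(-1/2) (-2 i w)^(-n/2)
  for a suitable branch. Defining it as a mean leaves the branch implicit.\<close>

definition poisson_factor :: "real ^ 'n ^ 'n \<Rightarrow> complex \<Rightarrow> complex" where
  "poisson_factor A w = torus_mean (gauss_sum_fn A w)"

definition dual_sum_fn :: "real ^ 'n ^ 'n \<Rightarrow> complex \<Rightarrow> real ^ 'n \<Rightarrow> complex" where
  "dual_sum_fn A w r = (\<Sum>\<^sub>\<infinity>y. ev y r * e (of_real (quad_form (matrix_inv A) (of_int_vec y)) * (- 1 / (4 * w))))"

text \<open>On the right-hand side t may be replaced by a complex number, which is impossible for
  the real vector r + t v on the left.\<close>

lemma gauss_sum_fn_line:
  assumes "transpose A = A"
  shows "gauss_sum_fn A w (r + t *\<^sub>R v) =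
     infsum (gterm A w (\<lambda>_. 1) (2 * w) (w * of_real (quad_form A v)) (A *v v) r (of_real t)) UNIV"
proof -
  have "quad_form A (of_int_vec x + (r + t *\<^sub>R v)) = quad_form A (of_int_vec x + r)
      + 2 * (t * ((of_int_vec x + r) \<bullet> (A *v v))) + t\<^sup>2 * quad_form A v" for x
    using quad_form_add[OF assms, of "of_int_vec x + r" "t *\<^sub>R v"]
    by (simp add: quad_form_scale matrix_vector_mult_scaleR add.assoc)
  then show ?thesis
    unfolding gauss_sum_fn_def gterm_def
    by (intro infsum_cong) (simp add: algebra_simps)
qed

lemma gauss_sum_fn_gterm: "gauss_sum_fn A w r = infsum (gterm A w (\<lambda>_. 1) \<beta> \<gamma> u r 0) UNIV"
  unfolding gauss_sum_fn_def by (rule infsum_cong) (simp add: gterm_def)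

lemma continuous_gterm_sum:
  assumes "posdef A" "Im w > 0"
  shows "continuous_on UNIV (\<lambda>r. infsum (gterm A w (\<lambda>_. 1) \<beta> \<gamma> u r s) UNIV)"
proof (rule continuous_on_eq_continuous_within[THEN iffD2], safe)
  fix r :: "real ^ 'a"
  define \<rho> where "\<rho> = norm r + 1"
  have "continuous_on (cball 0 (norm s) \<times> cball 0 \<rho>) (\<lambda>(s, r). infsum (gterm A w (\<lambda>_. 1) \<beta> \<gamma> u r s) UNIV)"
    by (rule gterm_continuous[OF assms]) auto
  then have "continuous_on (cball 0 \<rho>) (\<lambda>r. (\<lambda>(s, r). infsum (gterm A w (\<lambda>_. 1) \<beta> \<gamma> u r s) UNIV) (s, r))"
    by (rule continuous_on_compose2) (auto intro!: continuous_intros)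
  then have "continuous_on (ball 0 \<rho>) (\<lambda>r. infsum (gterm A w (\<lambda>_. 1) \<beta> \<gamma> u r s) UNIV)"
    by (auto intro: continuous_on_subset)
  moreover have "r \<in> ball 0 \<rho>" by (simp add: \<rho>_def)
  ultimately show "isCont (\<lambda>r. infsum (gterm A w (\<lambda>_. 1) \<beta> \<gamma> u r s) UNIV) r"
    by (simp add: continuous_on_eq_continuous_at)
qed

lemma continuous_gauss_sum_fn:
  assumes "posdef A" "Im w > 0" shows "continuous_on UNIV (gauss_sum_fn A w)"
  using continuous_gterm_sum[OF assms, of 0 0 0 0] by (simp add: gauss_sum_fn_gterm[symmetric])

lemma periodic_gauss_sum_fn: "periodic (gauss_sum_fn A w)"
  unfolding periodic_def
proof safe
  fix r :: "real ^ 'a" and m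
  have "gauss_sum_fn A w (r + of_int_vec m) = 
    (\<Sum>\<^sub>\<infinity>x. (\<lambda>x. e (of_real (quad_form A (of_int_vec x + r)) * w)) (x + m))"
    by (simp add: gauss_sum_fn_def of_int_vec_add add_ac)
  also have "\<dots> = gauss_sum_fn A w r"
    unfolding gauss_sum_fn_def
    by (rule infsum_reindex_bij_betw) (rule bij_betwI[of _ _ _ "\<lambda>x. x - m"], auto)
  finally show "gauss_sum_fn A w (r + of_int_vec m) = gauss_sum_fn A w r" .
qed

text \<open>Shifting the contour: the mean over the torus does not change under a complex translation.\<close>

lemma torus_mean_complex_shift:
  assumes A: "posdef A" and w: "Im w > 0"
  shows "torus_mean (\<lambda>r. infsum (gterm A w (\<lambda>_. 1) (2 * w) (w * of_real (quad_form A v)) (A *v v) r s) UNIV)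
     = poisson_factor A w" (is "torus_mean (\<lambda>r. ?F s r) = _")
proof -
  define \<phi> where "\<phi> = (\<lambda>s. torus_mean (?F s))"
  have hol: "\<phi> holomorphic_on ball 0 R" for R
    unfolding \<phi>_def torus_mean_def
  proof (rule leibniz_rule_holomorphic)
    fix s r assume "s \<in> ball (0::complex) R"
    show "((\<lambda>s. ?F s r) has_field_derivative 
        infsum (gterm' A w (\<lambda>_. 1) (2 * w) (w * of_real (quad_form A v)) (A *v v) r s) UNIV) (at s within ball 0 R)"
      by (rule gterm_sum_derivs[OF A w]) auto
  next
    fix s
    show "?F s integrable_on cbox 0 (\<chi> i. 1)"
      by (intro torus_mean_integrable continuous_gterm_sum A w)
  next
    obtain \<rho> where \<rho>: "cbox 0 (\<chi> i. 1) \<subseteq> cball (0 :: real ^ 'a) \<rho>"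
      using bounded_cbox[of 0 "(\<chi> i. 1) :: real ^ 'a"] unfolding bounded_iff by (auto simp: subset_iff)
    show "continuous_on (ball 0 R \<times> cbox 0 (\<chi> i. 1)) (\<lambda>(s, r). infsum (gterm' A w (\<lambda>_. 1) (2 * w) (w * of_real (quad_form A v)) (A *v v) r s) UNIV)"
      by (rule continuous_on_subset[OF gterm_continuous(2)[OF A w, of _ R \<rho>]]) (use \<rho> in auto)
  qed auto
  have "\<phi> holomorphic_on UNIV"
  proof -
    have "\<phi> field_differentiable at s" for s
      using holomorphic_on_imp_differentiable_at[OF hol[of "norm s + 1"] open_ball] by simp
    then show ?thesis by (simp add: holomorphic_on_def)
  qed
  \<comment> \<open>For a real parameter the translation is an honest shift of the torus.\<close>
  moreover have "\<phi> (of_real t) = poisson_factor A w" for t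
    unfolding \<phi>_def poisson_factor_def gauss_sum_fn_line[OF posdef_sym[OF A], symmetric]
    by (intro torus_mean_shift continuous_gauss_sum_fn A w periodic_gauss_sum_fn)
  ultimately have "\<phi> = (\<lambda>_. poisson_factor A w)"
    by (intro line_identity) auto
  then show ?thesis by (simp add: \<phi>_def fun_eq_iff)
qed

text \<open>A complex translation by s = 1 / (2 w) along v = A^(-1) m multiplies each summand by
  \<open>ev m r\<close> and by a constant c. As the translation preserves the mean, the coefficient
  at m is the one at 0 divided by c.\<close>

lemma gauss_sum_fn_coefficient:
  assumes A: "posdef A" and w: "Im w > 0"
  shows "torus_mean (\<lambda>r. gauss_sum_fn A w r * ev m r) =
     poisson_factor A w * e (of_real (quad_form (matrix_inv A) (of_int_vec m)) * (- 1 / (4 * w)))"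
proof -
  define v where "v = matrix_inv A *v of_int_vec m"
  have Av: "A *v v = of_int_vec m" by (simp add: v_def matrix_inv_mult posdef_invertible A)
  have q: "quad_form A v = quad_form (matrix_inv A) (of_int_vec m)"
    by (simp add: quad_form_inv[OF A, of v, symmetric] Av)
  define c where "c = e (of_real (quad_form (matrix_inv A) (of_int_vec m)) * (1 / (4 * w)))"
  have w0: "w \<noteq> 0" using w by auto
  have "gterm A w (\<lambda>_. 1) (2 * w) (w * of_real (quad_form A v)) (A *v v) r (1 / (2 * w)) x =
      e (of_real (quad_form A (of_int_vec x + r)) * w) * (c * ev m r)" for r x
  proof -
    have "(1 / (2 * w))\<^sup>2 * (w * of_real (quad_form A v)) = of_real (quad_form (matrix_inv A) (of_int_vec m)) * (1 / (4 * w))"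
      using w0 by (simp add: q power2_eq_square field_simps)
    moreover have "e (1 / (2 * w) * (2 * w) * of_real ((of_int_vec x + r) \<bullet> (A *v v))) = ev m r"
    proof -
      have "e (of_real ((of_int_vec x + r) \<bullet> (A *v v))) = ev m (of_int_vec x + r)"
        by (simp add: Av ev_def inner_commute)
      then show ?thesis using w0 by (simp add: ev_add)
    qed
    ultimately show ?thesis by (simp add: gterm_def e_add c_def)
  qed
  then have "infsum (gterm A w (\<lambda>_. 1) (2 * w) (w * of_real (quad_form A v)) (A *v v) r (1 / (2 * w))) UNIV
     = (\<Sum>\<^sub>\<infinity>x. e (of_real (quad_form A (of_int_vec x + r)) * w) * (c * ev m r))" for r
    by (intro infsum_cong) simp
  then have "infsum (gterm A w (\<lambda>_. 1) (2 * w) (w * of_real (quad_form A v)) (A *v v) r (1 / (2 * w))) UNIV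
     = c * (gauss_sum_fn A w r * ev m r)" for r
    by (simp only: gauss_sum_fn_def infsum_cmult_left') (simp only: mult_ac)
  then have *: "poisson_factor A w = c * torus_mean (\<lambda>r. gauss_sum_fn A w r * ev m r)"
    using torus_mean_complex_shift[OF A w, of v "1 / (2 * w)"] by (simp add: torus_mean_cmult)
  have "e (of_real (quad_form (matrix_inv A) (of_int_vec m)) * (- 1 / (4 * w))) = inverse c"
    by (simp add: c_def e_minus[symmetric])
  moreover have "c \<noteq> 0" by (simp add: c_def)
  ultimately show ?thesis unfolding * by simp
qed

lemma Im_neg_inverse_pos: "Im w > 0 \<Longrightarrow> Im (- 1 / (4 * w)) > 0"
proof -
  assume "Im w > 0"
  then show ?thesis by (auto simp: Im_divide intro!: divide_pos_pos add_nonneg_pos)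
qed

text \<open>Uniform convergence allows taking means term by term. The sign in \<open>c (- m)\<close>
  arises because the factor \<open>ev m\<close> is not conjugated, so it pairs with the frequency
  -m.\<close>

lemma torus_mean_trig_series:
  fixes c :: "int ^ 'n \<Rightarrow> complex"
  assumes c: "(\<lambda>y. norm (c y)) summable_on UNIV"
  shows "continuous_on UNIV (\<lambda>r. \<Sum>\<^sub>\<infinity>y. ev y r * c y)"
    and "torus_mean (\<lambda>r. (\<Sum>\<^sub>\<infinity>y. ev y r * c y) * ev m r) = c (- m)"
proof -
  let ?F = "\<lambda>r. \<Sum>\<^sub>\<infinity>y. ev y r * c y" and ?S = "\<lambda>X r. \<Sum>y\<in>X. ev y r * c y"
  have U: "uniform_limit UNIV ?S ?F (finite_subsets_at_top UNIV)"
    by (rule Weierstrass_m_test_general[OF _ c]) (auto simp: norm_mult)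
  have cS: "continuous_on UNIV (?S X)" for X by (intro continuous_intros)
  show cF: "continuous_on UNIV ?F"
    by (rule uniform_limit_theorem[OF _ U]) (auto intro!: always_eventually cS)
  have S: "torus_mean (\<lambda>r. ?S X r * ev m r) = c (- m)" if X: "finite X" "{- m} \<subseteq> X" for X
  proof -
    have "torus_mean (\<lambda>r. ?S X r * ev m r) = torus_mean (\<lambda>r. \<Sum>y\<in>X. c y * ev (y + m) r)"
      unfolding sum_distrib_right ev_add_left by (simp only: mult_ac)
    also have "\<dots> = (\<Sum>y\<in>X. c y * torus_mean (ev (y + m)))"
      unfolding torus_mean_def integral_mult_right[symmetric] using X
      by (intro integral_sum torus_mean_integrable continuous_intros)
    also have "\<dots> = (\<Sum>y\<in>X. if y = - m then c y else 0)"
      by (intro sum.cong) (auto simp: torus_mean_ev add_eq_0_iff2)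
    also have "\<dots> = c (- m)" using X by simp
    finally show ?thesis .
  qed
  have "((\<lambda>X. torus_mean (\<lambda>r. ?S X r * ev m r)) \<longlongrightarrow> torus_mean (\<lambda>r. ?F r * ev m r)) (finite_subsets_at_top UNIV)"
  proof (rule tendstoI)
    fix \<epsilon> :: real assume \<epsilon>: "\<epsilon> > 0"
    have "eventually (\<lambda>X. \<forall>r\<in>UNIV. dist (?S X r) (?F r) < \<epsilon> / 2) (finite_subsets_at_top UNIV)"
      by (rule uniform_limitD[OF U]) (use \<epsilon> in auto)
    then show "eventually (\<lambda>X. dist (torus_mean (\<lambda>r. ?S X r * ev m r)) (torus_mean (\<lambda>r. ?F r * ev m r)) < \<epsilon>) (finite_subsets_at_top UNIV)"
    proof eventually_elim
      case (elim X)
      have "dist (torus_mean (\<lambda>r. ?S X r * ev m r)) (torus_mean (\<lambda>r. ?F r * ev m r)) =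
          norm (torus_mean (\<lambda>r. ?S X r * ev m r - ?F r * ev m r))"
        unfolding dist_norm by (subst torus_mean_diff) (auto intro!: continuous_intros cS cF)
      also have "\<dots> \<le> \<epsilon> / 2"
      proof (rule torus_mean_norm_le)
        fix r show "norm (?S X r * ev m r - ?F r * ev m r) \<le> \<epsilon> / 2"
          using elim by (simp add: left_diff_distrib[symmetric] norm_mult dist_norm less_imp_le)
      qed (intro continuous_intros cS cF)
      finally show ?case using \<epsilon> by simp
    qed
  qed
  moreover have "((\<lambda>X. torus_mean (\<lambda>r. ?S X r * ev m r)) \<longlongrightarrow> c (- m)) (finite_subsets_at_top UNIV)"
    by (rule tendsto_eventually) (use S in \<open>auto simp: eventually_finite_subsets_at_top intro!: exI[of _ "{- m}"]\<close>)
  ultimately show "torus_mean (\<lambda>r. ?F r * ev m r) = c (- m)"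
    by (intro tendsto_unique[OF finite_subsets_at_top_neq_bot])
qed

lemma of_int_vec_uminus_quad: "quad_form A (of_int_vec (- x)) = quad_form A (of_int_vec x)"
  by (simp add: of_int_vec_minus)

text \<open>Both sides are continuous and periodic in r with the same Fourier coefficients, so their
  difference is \<open>fourier_null\<close>. The sign of the frequency disappears because the
  inverse form is even.\<close>

theorem poisson_summation:
  assumes A: "posdef A" and w: "Im w > 0"
  shows "gauss_sum_fn A w r = poisson_factor A w * dual_sum_fn A w r"
proof -
  define c where "c = (\<lambda>y. e (of_real (quad_form (matrix_inv A) (of_int_vec y)) * (- 1 / (4 * w))))"
  have c: "(\<lambda>y. norm (c y)) summable_on UNIV"
    using theta_abs_summable[OF poly_growth_const[of 1] quad_growth_posdef0[OF posdef_inv[OF A]], of "- 1 / (4 * w)"]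
      Im_neg_inverse_pos[OF w] by (simp add: c_def upper_half_plane_def)
  have d: "dual_sum_fn A w r = (\<Sum>\<^sub>\<infinity>y. ev y r * c y)" for r
    by (simp add: dual_sum_fn_def c_def)
  note T = torus_mean_trig_series[OF c, folded d[abs_def], folded d]
  note cG = continuous_gauss_sum_fn[OF A w]
  let ?G = "\<lambda>r. gauss_sum_fn A w r - poisson_factor A w * dual_sum_fn A w r"
  have "fourier_null ?G"
    unfolding fourier_null_def
  proof (intro conjI allI)
    show "continuous_on UNIV ?G" by (intro continuous_intros T cG)
    have "periodic (dual_sum_fn A w)"
      by (simp add: periodic_def dual_sum_fn_def ev_add)
    then show "periodic ?G" using periodic_gauss_sum_fn[of A w] by (simp add: periodic_def)
    fix y
    have "torus_mean (\<lambda>r. ?G r * ev y r) = 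
        torus_mean (\<lambda>r. gauss_sum_fn A w r * ev y r) - torus_mean (\<lambda>r. poisson_factor A w * (dual_sum_fn A w r * ev y r))"
      by (subst torus_mean_diff[symmetric]) (auto intro!: continuous_intros T cG simp: left_diff_distrib mult.assoc)
    then show "torus_mean (\<lambda>r. ?G r * ev y r) = 0"
      by (simp only: torus_mean_cmult T(2)) (simp add: gauss_sum_fn_coefficient[OF A w] c_def of_int_vec_uminus_quad)
  qed
  from fourier_null_imp_0[OF this, of r] show ?thesis by simp
qed

lemma gauss_sum_fn_theta: "gauss_sum_fn A w r = theta_series (\<lambda>_. 1) (\<lambda>x. quad_form A (of_int_vec x + r)) w"
  by (simp add: gauss_sum_fn_def theta_series_def)

lemma dual_sum_fn_theta:
  "dual_sum_fn A w r = theta_series (\<lambda>y. ev y r) (\<lambda>y. quad_form (matrix_inv A) (of_int_vec y)) (- 1 / (4 * w))"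
  by (simp add: dual_sum_fn_def theta_series_def)

lemma poly_growth_ev: "poly_growth (\<lambda>y. ev y r)"
  by (rule poly_growthI[of _ 1 0]) simp

text \<open>Along the line r + s v both sides of Poisson summation are entire in s and agree for
  real s, hence everywhere. Their complex second derivatives at s = 0 are the two sides
  here.\<close>

lemma poisson_second_derivative:
  assumes A: "posdef A" and w: "Im w > 0"
  shows "(\<Sum>\<^sub>\<infinity>x. (4 * of_real pi * \<i> * w * of_real (quad_form A v)
            + (4 * of_real pi * \<i> * w)\<^sup>2 * of_real (((A *v (of_int_vec x + r)) \<bullet> v)\<^sup>2))
            * e (of_real (quad_form A (of_int_vec x + r)) * w)) =
         poisson_factor A w * (\<Sum>\<^sub>\<infinity>y. (2 * of_real pi * \<i>)\<^sup>2 * of_real ((of_int_vec y \<bullet> v)\<^sup>2) *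
            (ev y r * e (of_real (quad_form (matrix_inv A) (of_int_vec y)) * (- 1 / (4 * w)))))"
    (is "?L = poisson_factor A w * ?R")
proof -
  define w' where "w' = - 1 / (4 * w)"
  have w': "Im w' > 0" unfolding w'_def by (rule Im_neg_inverse_pos[OF w])
  note D1 = gterm_sum_derivs[OF A w, of "\<lambda>_. 1" "2 * w" "w * of_real (quad_form A v)" "A *v v" r]
  note D2 = gterm_sum_derivs[OF posdef_inv[OF A] w', of "\<lambda>y. ev y r" 1 0 v 0]
  define f where "f = (\<lambda>s. infsum (gterm A w (\<lambda>_. 1) (2 * w) (w * of_real (quad_form A v)) (A *v v) r s) UNIV)"
  define f' where "f' = (\<lambda>s. infsum (gterm' A w (\<lambda>_. 1) (2 * w) (w * of_real (quad_form A v)) (A *v v) r s) UNIV)"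
  define g where "g = (\<lambda>s. infsum (gterm (matrix_inv A) w' (\<lambda>y. ev y r) 1 0 v 0 s) UNIV)"
  define g' where "g' = (\<lambda>s. infsum (gterm' (matrix_inv A) w' (\<lambda>y. ev y r) 1 0 v 0 s) UNIV)"
  have f: "(f has_field_derivative f' s) (at s)" for s
    unfolding f_def f'_def by (rule D1) auto
  have g: "(g has_field_derivative g' s) (at s)" for s
    unfolding g_def g'_def by (rule D2) auto
  have "f = (\<lambda>s. poisson_factor A w * g s)"
  proof (rule line_identity)
    have "g holomorphic_on UNIV" using g by (auto simp: holomorphic_on_open)
    then show "(\<lambda>s. poisson_factor A w * g s) holomorphic_on UNIV" by (intro holomorphic_intros)
    show "f holomorphic_on UNIV" using f by (auto simp: holomorphic_on_open)
    fix t :: real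
    have "g (of_real t) = dual_sum_fn A w (r + t *\<^sub>R v)"
      unfolding g_def dual_sum_fn_def w'_def[symmetric]
      by (rule infsum_cong) (simp add: gterm_def ev_add e_add, simp add: ev_def)
    then show "f (of_real t) = poisson_factor A w * g (of_real t)"
      unfolding f_def gauss_sum_fn_line[OF posdef_sym[OF A], symmetric]
      by (simp add: poisson_summation[OF A w])
  qed
  then have fg': "f' = (\<lambda>s. poisson_factor A w * g' s)"
    using f g by (metis (no_types, lifting) DERIV_cmult DERIV_unique ext)
  have "(f' has_field_derivative ?L) (at 0)"
  proof -
    have "(f' has_field_derivative infsum (gterm'' A w (\<lambda>_. 1) (2 * w) (w * of_real (quad_form A v)) (A *v v) r 0) UNIV) (at 0)"
      unfolding f'_def by (rule D1) auto
    also have "infsum (gterm'' A w (\<lambda>_. 1) (2 * w) (w * of_real (quad_form A v)) (A *v v) r 0) UNIV = ?L"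
    proof (rule infsum_cong)
      fix x
      have "(of_int_vec x + r) \<bullet> (A *v v) = (A *v (of_int_vec x + r)) \<bullet> v"
        using inner_matrix_sym[OF posdef_sym[OF A], of "of_int_vec x + r" v] by (simp add: inner_commute)
      then show "gterm'' A w (\<lambda>_. 1) (2 * w) (w * of_real (quad_form A v)) (A *v v) r 0 x =
          (4 * of_real pi * \<i> * w * of_real (quad_form A v)
            + (4 * of_real pi * \<i> * w)\<^sup>2 * of_real (((A *v (of_int_vec x + r)) \<bullet> v)\<^sup>2))
            * e (of_real (quad_form A (of_int_vec x + r)) * w)"
        by (simp add: gterm''_def gterm_def power_mult_distrib mult_ac)
    qed
    finally show ?thesis .
  qed
  moreover have "(f' has_field_derivative poisson_factor A w * ?R) (at 0)"
  proof -
    have "(g' has_field_derivative infsum (gterm'' (matrix_inv A) w' (\<lambda>y. ev y r) 1 0 v 0 0) UNIV) (at 0)"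
      unfolding g'_def by (rule D2) auto
    also have "infsum (gterm'' (matrix_inv A) w' (\<lambda>y. ev y r) 1 0 v 0 0) UNIV = ?R"
      by (intro infsum_cong) (simp add: gterm''_def gterm_def power_mult_distrib w'_def mult_ac)
    finally show ?thesis unfolding fg' by (rule DERIV_cmult)
  qed
  ultimately show ?thesis by (rule DERIV_unique)
qed

section \<open>Poisson summation with quadratic and harmonic coefficients\<close>

lemma quad_form_add_matrix: "quad_form (A + B) x = quad_form A x + quad_form B x"
  by (simp add: quad_form_def matrix_vector_mult_add_rdistrib inner_add_right)

lemma quad_form_scaleR_matrix: "quad_form (c *\<^sub>R A) x = c * quad_form A x"
  by (simp add: quad_form_def scaleR_matrix_vector_assoc[symmetric])

lemma matrix_add_rdistrib': "(B + C) ** A = B ** A + C ** (A :: real ^ 'n ^ 'n)"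
  by (simp add: matrix_matrix_mult_def vec_eq_iff distrib_right sum.distrib)

lemma trace_scaleR: "trace (c *\<^sub>R A) = c * trace (A :: real ^ 'n ^ 'n)"
  by (simp add: trace_def sum_distrib_left)

definition rank_one :: "real ^ 'n \<Rightarrow> real ^ 'n ^ 'n" where
  "rank_one v = (\<chi> i j. v $ i * v $ j)"

lemma rank_one_mult: "rank_one v *v x = (v \<bullet> x) *\<^sub>R v"
  by (simp add: rank_one_def matrix_vector_mult_def vec_eq_iff inner_vec_def sum_distrib_left sum_distrib_right mult_ac)

lemma quad_form_rank_one: "quad_form (rank_one v) x = (x \<bullet> v)\<^sup>2"
  by (simp add: quad_form_def rank_one_mult inner_commute power2_eq_square)

lemma trace_rank_one: "trace (rank_one v ** A) = quad_form A v"
proof -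
  have "trace (rank_one v ** A) = (\<Sum>i\<in>UNIV. \<Sum>k\<in>UNIV. v $ i * v $ k * A $ k $ i)"
    by (simp add: trace_def matrix_matrix_mult_def rank_one_def)
  also have "\<dots> = (\<Sum>k\<in>UNIV. \<Sum>i\<in>UNIV. v $ i * v $ k * A $ k $ i)" by (rule sum.swap)
  also have "\<dots> = quad_form A v"
    by (simp add: quad_form_def inner_vec_def matrix_vector_mult_def sum_distrib_left mult_ac)
  finally show ?thesis .
qed

text \<open>Polarisation: e_i e_j^T + e_j e_i^T is the rank-one matrix of e_i + e_j minus those of
  e_i and e_j. The double sum meets each such matrix twice, whence the coefficient 1/2.\<close>

lemma symmetric_span_rank_one:
  assumes K: "transpose K = (K :: real ^ 'n ^ 'n)"
  shows "K \<in> span (range rank_one)"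
proof -
  let ?P = "\<lambda>i j. rank_one (axis i 1 + axis j 1) - rank_one (axis i 1) - rank_one (axis j 1) :: real ^ 'n ^ 'n"
  have P: "?P i j $ a $ b = axis i 1 $ a * axis j 1 $ b + axis i 1 $ b * axis j 1 $ a" for i j a b
    by (simp add: rank_one_def algebra_simps)
  have delta: "(\<Sum>i\<in>UNIV. \<Sum>j\<in>UNIV. c i j * (axis i 1 $ a * axis j 1 $ b)) = c a b"
    for c :: "'n \<Rightarrow> 'n \<Rightarrow> real" and a b
  proof -
    have "(\<Sum>j\<in>UNIV. c i j * (axis i 1 $ a * axis j 1 $ b)) = c i b * axis i 1 $ a" for i
    proof -
      have "(\<Sum>j\<in>UNIV. c i j * (axis i 1 $ a * axis j 1 $ b)) = (\<Sum>j\<in>UNIV. if b = j then c i j * axis i 1 $ a else 0)"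
        by (intro sum.cong) (auto simp: axis_def)
      then show ?thesis by simp
    qed
    then have "(\<Sum>i\<in>UNIV. \<Sum>j\<in>UNIV. c i j * (axis i 1 $ a * axis j 1 $ b)) = (\<Sum>i\<in>UNIV. c i b * axis i 1 $ a)"
      by simp
    also have "\<dots> = (\<Sum>i\<in>UNIV. if a = i then c i b else 0)"
      by (intro sum.cong) (auto simp: axis_def)
    finally show ?thesis by simp
  qed
  have sym: "K $ a $ b = K $ b $ a" for a b
    using arg_cong[OF K, of "\<lambda>M. M $ b $ a"] by (simp add: transpose_def)
  have "K = (\<Sum>i\<in>UNIV. \<Sum>j\<in>UNIV. (K $ i $ j / 2) *\<^sub>R ?P i j)"
  proof (intro vec_eq_iff[THEN iffD2] allI)
    fix a b
    have "(\<Sum>i\<in>UNIV. \<Sum>j\<in>UNIV. (K $ i $ j / 2) *\<^sub>R ?P i j) $ a $ b = 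
        (\<Sum>i\<in>UNIV. \<Sum>j\<in>UNIV. K $ i $ j / 2 * (?P i j $ a $ b))"
      by (simp only: sum_component vector_scaleR_component real_scaleR_def)
    also have "\<dots> = (\<Sum>i\<in>UNIV. \<Sum>j\<in>UNIV. K $ i $ j / 2 * (axis i 1 $ a * axis j 1 $ b)) +
         (\<Sum>i\<in>UNIV. \<Sum>j\<in>UNIV. K $ i $ j / 2 * (axis i 1 $ b * axis j 1 $ a))"
      unfolding P by (simp only: distrib_left sum.distrib)
    also have "\<dots> = K $ a $ b"
      unfolding delta using sym[of b a] by simp
    finally show "K $ a $ b = (\<Sum>i\<in>UNIV. \<Sum>j\<in>UNIV. (K $ i $ j / 2) *\<^sub>R ?P i j) $ a $ b" by simp
  qed
  also have "\<dots> \<in> span (range rank_one)"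
    by (intro span_sum span_scale span_diff span_base rangeI)
  finally show ?thesis .
qed

lemma theta_infsum_add:
  assumes "poly_growth f" "poly_growth g" "quad_growth q" "Im w > 0"
  shows "(\<Sum>\<^sub>\<infinity>x. (f x + g x) * e (of_real (q x) * w)) = 
     (\<Sum>\<^sub>\<infinity>x. f x * e (of_real (q x) * w)) + (\<Sum>\<^sub>\<infinity>x. g x * e (of_real (q x) * w))"
  unfolding distrib_right
  by (intro infsum_add theta_summable) (use assms in \<open>auto simp: upper_half_plane_def\<close>)

lemma poly_growth_add:
  assumes "poly_growth f" "poly_growth g"
  shows "poly_growth (\<lambda>x. f x + g x)"
proof -
  from assms obtain C k C' k' where 1: "\<And>x. norm (f x) \<le> C * (1 + inorm x) ^ k"
    and 2: "\<And>x. norm (g x) \<le> C' * (1 + inorm x) ^ k'"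
    unfolding poly_growth_def by blast
  show ?thesis
  proof (rule poly_growthI)
    fix x
    have "norm (f x + g x) \<le> C * (1 + inorm x) ^ k + C' * (1 + inorm x) ^ k'"
      by (intro norm_triangle_mono 1 2)
    also have "\<dots> \<le> \<bar>C\<bar> * (1 + inorm x) ^ (k + k') + \<bar>C'\<bar> * (1 + inorm x) ^ (k + k')"
      by (intro add_mono mult_mono power_increasing) auto
    finally show "norm (f x + g x) \<le> (\<bar>C\<bar> + \<bar>C'\<bar>) * (1 + inorm x) ^ (k + k')"
      by (simp add: algebra_simps)
  qed
qed

lemma poly_growth_quad_form_linear: "poly_growth (\<lambda>x. of_real (quad_form K (A *v (of_int_vec x + r))))"
proof -
  have "quad_form K (A *v x) = quad_form (transpose A ** K ** A) x" for x
    unfolding quad_form_def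
    by (metis dot_lmul_matrix matrix_vector_mul_assoc transpose_matrix_vector transpose_transpose inner_commute)
  then show ?thesis by (simp add: poly_growth_quad_form)
qed

text \<open>Both sides are linear in K. For K = v v^T the identity is
  \<open>poisson_second_derivative\<close> in the direction v, and these K span the symmetric
  matrices.\<close>

lemma poisson_symmetric:
  assumes A: "posdef A" and w: "Im w > 0" and K: "transpose K = K"
  shows "(\<Sum>\<^sub>\<infinity>x. (4 * of_real pi * \<i> * w * of_real (trace (K ** A))
            + (4 * of_real pi * \<i> * w)\<^sup>2 * of_real (quad_form K (A *v (of_int_vec x + r))))
            * e (of_real (quad_form A (of_int_vec x + r)) * w)) =
         poisson_factor A w * (\<Sum>\<^sub>\<infinity>y. (2 * of_real pi * \<i>)\<^sup>2 * of_real (quad_form K (of_int_vec y)) *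
            (ev y r * e (of_real (quad_form (matrix_inv A) (of_int_vec y)) * (- 1 / (4 * w)))))"
    (is "?L K = poisson_factor A w * ?R K")
proof -
  let ?Z = "{K. ?L K = poisson_factor A w * ?R K}"
  have w': "Im (- 1 / (4 * w)) > 0" by (rule Im_neg_inverse_pos[OF w])
  note pg = poly_growth_add poly_growth_mult poly_growth_const poly_growth_quad_form_linear poly_growth_ev
    quad_growth_posdef[OF A] quad_growth_posdef0[OF posdef_inv[OF A]] poly_growth_quad_form[of _ 0, simplified]
  define cL where "cL = (\<lambda>K x. 4 * of_real pi * \<i> * w * of_real (trace (K ** A))
            + (4 * of_real pi * \<i> * w)\<^sup>2 * of_real (quad_form K (A *v (of_int_vec x + r))))"
  define cR where "cR = (\<lambda>K y. (2 * of_real pi * \<i>)\<^sup>2 * of_real (quad_form K (of_int_vec y)) * ev y r)"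
  have L: "?L K = (\<Sum>\<^sub>\<infinity>x. cL K x * e (of_real (quad_form A (of_int_vec x + r)) * w))" for K
    by (simp only: cL_def)
  have R: "?R K = (\<Sum>\<^sub>\<infinity>y. cR K y * e (of_real (quad_form (matrix_inv A) (of_int_vec y)) * (- 1 / (4 * w))))" for K
    by (simp only: cR_def mult.assoc)
  have pL: "poly_growth (cL K)" and pR: "poly_growth (cR K)" for K
    unfolding cL_def cR_def by (intro pg)+
  have cL_add: "cL (K1 + K2) = (\<lambda>x. cL K1 x + cL K2 x)" for K1 K2
    by (rule ext) (simp add: cL_def matrix_add_rdistrib' trace_add quad_form_add_matrix distrib_left)
  have cR_add: "cR (K1 + K2) = (\<lambda>x. cR K1 x + cR K2 x)" for K1 K2
    by (rule ext) (simp add: cR_def quad_form_add_matrix distrib_left distrib_right)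
  have cL_scale: "cL (c *\<^sub>R K) = (\<lambda>x. of_real c * cL K x)" for c K
    by (rule ext) (simp add: cL_def scalar_matrix_assoc[symmetric] trace_scaleR quad_form_scaleR_matrix distrib_left)
  have cR_scale: "cR (c *\<^sub>R K) = (\<lambda>x. of_real c * cR K x)" for c K
    by (rule ext) (simp add: cR_def quad_form_scaleR_matrix)
  have L_add: "?L (K1 + K2) = ?L K1 + ?L K2" for K1 K2
    unfolding L cL_add by (rule theta_infsum_add[OF pL pL quad_growth_posdef[OF A] w])
  have R_add: "?R (K1 + K2) = ?R K1 + ?R K2" for K1 K2
    unfolding R cR_add by (rule theta_infsum_add[OF pR pR quad_growth_posdef0[OF posdef_inv[OF A]] w'])
  have L_scale: "?L (c *\<^sub>R K1) = of_real c * ?L K1" for c K1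
    unfolding L cL_scale by (subst infsum_cmult_right'[symmetric]) (simp only: mult.assoc)
  have R_scale: "?R (c *\<^sub>R K1) = of_real c * ?R K1" for c K1
    unfolding R cR_scale by (subst infsum_cmult_right'[symmetric]) (simp only: mult.assoc)
  have "subspace ?Z"
    unfolding subspace_def
  proof (intro conjI ballI allI)
    show "0 \<in> ?Z" using L_scale[of 0 0] R_scale[of 0 0] by simp
  next
    fix K1 K2 assume "K1 \<in> ?Z" "K2 \<in> ?Z"
    then show "K1 + K2 \<in> ?Z" by (simp only: mem_Collect_eq L_add R_add distrib_left)
  next
    fix c K1 assume "K1 \<in> ?Z"
    then have 1: "?L K1 = poisson_factor A w * ?R K1" by (simp only: mem_Collect_eq)
    have "?L (c *\<^sub>R K1) = of_real c * (poisson_factor A w * ?R K1)" unfolding L_scale 1 by (rule refl)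
    also have "\<dots> = poisson_factor A w * ?R (c *\<^sub>R K1)" unfolding R_scale by (rule mult.left_commute)
    finally show "c *\<^sub>R K1 \<in> ?Z" by (simp only: mem_Collect_eq)
  qed
  moreover have "range rank_one \<subseteq> ?Z"
    using poisson_second_derivative[OF A w, of _ r]
    by (auto simp only: trace_rank_one quad_form_rank_one)
  ultimately have "span (range rank_one) \<subseteq> ?Z" by (rule span_minimal[rotated])
  then show ?thesis using symmetric_span_rank_one[OF K] by blast
qed

text \<open>Take K = A^(-1) h A^(-1) in \<open>poisson_symmetric\<close>: then K[A x] = h[x], and
  the trace of K A is that of h A^(-1), which vanishes. The quotient of the constants (2 pi i)^2 and
  (4 pi i w)^2 is 1 / (4 w^2), the source of the additional weight 2.\<close>

lemma poisson_harmonic: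
  assumes A: "posdef A" and w: "Im w > 0" and h: "transpose h = h" "trace (h ** matrix_inv A) = 0"
  shows "(\<Sum>\<^sub>\<infinity>x. of_real (quad_form h (of_int_vec x + r)) * e (of_real (quad_form A (of_int_vec x + r)) * w)) =
         poisson_factor A w / (4 * w\<^sup>2) * (\<Sum>\<^sub>\<infinity>y. of_real (quad_form h (matrix_inv A *v of_int_vec y)) *
            (ev y r * e (of_real (quad_form (matrix_inv A) (of_int_vec y)) * (- 1 / (4 * w)))))"
    (is "?L = _ * ?R")
proof -
  note inv = matrix_inv_mult[OF posdef_invertible[OF A]]
  have sym: "transpose (matrix_inv A) = matrix_inv A"
    by (rule matrix_inv_sym[OF posdef_invertible[OF A] posdef_sym[OF A]])
  define K where "K = matrix_inv A ** h ** matrix_inv A"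
  have K: "transpose K = K"
    by (simp add: K_def matrix_transpose_mul sym h(1) matrix_mul_assoc)
  have KA: "K ** A = matrix_inv A ** h" by (simp add: K_def matrix_mul_assoc[symmetric] inv)
  have tr: "trace (K ** A) = 0"
    unfolding KA using h(2) trace_mul_sym by metis
  have qK: "quad_form K y = quad_form h (matrix_inv A *v y)" for y
  proof -
    have "quad_form K y = y \<bullet> (matrix_inv A *v (h *v (matrix_inv A *v y)))"
      by (simp add: quad_form_def K_def matrix_vector_mul_assoc matrix_mul_assoc)
    also have "\<dots> = quad_form h (matrix_inv A *v y)"
      unfolding quad_form_def by (subst inner_matrix_sym[OF sym]) (rule inner_commute)
    finally show ?thesis .
  qed
  have "(4 * of_real pi * \<i> * w)\<^sup>2 * ?L = poisson_factor A w * ((2 * of_real pi * \<i>)\<^sup>2 * ?R)"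
    using poisson_symmetric[OF A w K, of r]
    by (simp only: tr qK inv of_real_0 mult_zero_right add_0_left mult.assoc infsum_cmult_right')
  moreover have "l = a / (4 * w\<^sup>2) * r"
    if "(4 * of_real pi * \<i> * w)\<^sup>2 * l = a * ((2 * of_real pi * \<i>)\<^sup>2 * r)" for l a r
  proof -
    have "w \<noteq> 0" using w by auto
    then show ?thesis using that by (simp add: power_mult_distrib field_simps)
  qed
  ultimately show ?thesis by blast
qed

text \<open>Applying to Poisson summation the Laplacian in \<open>r\<close> belonging to \<open>A\<close> gives a differential equation
  for the factor, so that no Gaussian integral has to be computed.\<close>

lemma poisson_laplace:
  assumes A: "posdef (A :: real ^ 'n ^ 'n)" and w: "Im w > 0"
  shows "of_nat CARD('n) * gauss_sum_fn A w r + 2 * w * deriv (\<lambda>w. gauss_sum_fn A w r) w =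
     2 * w * (poisson_factor A w * deriv (\<lambda>w. dual_sum_fn A w r) w)"
proof -
  note inv = matrix_inv_mult[OF posdef_invertible[OF A]]
  let ?E = "\<lambda>x. e (of_real (quad_form A (of_int_vec x + r)) * w)"
  let ?E' = "\<lambda>y. e (of_real (quad_form (matrix_inv A) (of_int_vec y)) * (- 1 / (4 * w)))"
  have w0: "w \<noteq> 0" using w by auto
  have H: "w \<in> upper_half_plane" "- 1 / (4 * w) \<in> upper_half_plane"
    using w Im_neg_inverse_pos[OF w] by (auto simp: upper_half_plane_def)
  define S where "S = (\<Sum>\<^sub>\<infinity>x. of_real (quad_form A (of_int_vec x + r)) * ?E x)"
  define S' where "S' = (\<Sum>\<^sub>\<infinity>y. of_real (quad_form (matrix_inv A) (of_int_vec y)) * (ev y r * ?E' y))"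
  have "theta_series (\<lambda>x. 1 * of_real (quad_form A (of_int_vec x + r))) (\<lambda>x. quad_form A (of_int_vec x + r)) w = S"
    by (simp add: S_def theta_series_def)
  with theta_deriv(2)[OF poly_growth_const[of 1] quad_growth_posdef[OF A, of r] H(1)]
  have "((\<lambda>w. gauss_sum_fn A w r) has_field_derivative 2 * of_real pi * \<i> * S) (at w)"
    unfolding gauss_sum_fn_theta by simp
  then have d: "deriv (\<lambda>w. gauss_sum_fn A w r) w = 2 * of_real pi * \<i> * S" by (rule DERIV_imp_deriv)
  have "((\<lambda>w. theta_series (\<lambda>y. ev y r) (\<lambda>y. quad_form (matrix_inv A) (of_int_vec y)) (- 1 / (4 * w)))
     has_field_derivative (2 * of_real pi * \<i> * S') * (1 / (4 * w\<^sup>2))) (at w)"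
  proof (rule DERIV_chain2[where g = "\<lambda>w. - 1 / (4 * w)"])
    show "((\<lambda>w. - 1 / (4 * w)) has_field_derivative 1 / (4 * w\<^sup>2)) (at w)"
      using w0 by (auto intro!: derivative_eq_intros simp: power2_eq_square)
    have "theta_series (\<lambda>y. ev y r * of_real (quad_form (matrix_inv A) (of_int_vec y)))
       (\<lambda>y. quad_form (matrix_inv A) (of_int_vec y)) (- 1 / (4 * w)) = S'"
      unfolding S'_def theta_series_def by (intro infsum_cong) (simp only: mult_ac)
    with theta_deriv(2)[OF poly_growth_ev quad_growth_posdef0[OF posdef_inv[OF A]] H(2), of r]
    show "(theta_series (\<lambda>y. ev y r) (\<lambda>y. quad_form (matrix_inv A) (of_int_vec y)) has_field_derivative 
        2 * of_real pi * \<i> * S') (at (- 1 / (4 * w)))" by simp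
  qed
  then have d': "deriv (\<lambda>w. dual_sum_fn A w r) w = 2 * of_real pi * \<i> * S' * (1 / (4 * w\<^sup>2))"
    unfolding dual_sum_fn_theta by (rule DERIV_imp_deriv)
  have sym: "transpose (matrix_inv A) = matrix_inv A"
    by (rule matrix_inv_sym[OF posdef_invertible[OF A] posdef_sym[OF A]])
  \<comment> \<open>The Laplacian is the case K = A^(-1) of \<open>poisson_symmetric\<close>: the
    trace becomes n, and K[A x] = A[x] is what a derivative in w brings down.\<close>
  have tr: "trace (matrix_inv A ** A) = CARD('n)"
    by (simp add: inv trace_I)
  have "(\<Sum>\<^sub>\<infinity>x. (4 * of_real pi * \<i> * w * of_nat CARD('n) + (4 * of_real pi * \<i> * w)\<^sup>2 * of_real (quad_form A (of_int_vec x + r))) * ?E x)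
     = poisson_factor A w * ((2 * of_real pi * \<i>)\<^sup>2 * S')"
    using poisson_symmetric[OF A w sym, of r]
    unfolding tr quad_form_inv[OF A] of_real_of_nat_eq
    by (simp only: mult.assoc infsum_cmult_right' S'_def)
  also have "(\<Sum>\<^sub>\<infinity>x. (4 * of_real pi * \<i> * w * of_nat CARD('n) + (4 * of_real pi * \<i> * w)\<^sup>2 * of_real (quad_form A (of_int_vec x + r))) * ?E x)
    = (\<Sum>\<^sub>\<infinity>x. 4 * of_real pi * \<i> * w * of_nat CARD('n) * ?E x) + (\<Sum>\<^sub>\<infinity>x. (4 * of_real pi * \<i> * w)\<^sup>2 * of_real (quad_form A (of_int_vec x + r)) * ?E x)"
    by (rule theta_infsum_add) (intro poly_growth_mult poly_growth_const poly_growth_quad_form quad_growth_posdef A w)+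
  also have "\<dots> = 4 * of_real pi * \<i> * w * of_nat CARD('n) * gauss_sum_fn A w r + (4 * of_real pi * \<i> * w)\<^sup>2 * S"
    by (simp only: mult.assoc infsum_cmult_right' S_def gauss_sum_fn_def)
  finally have "(4 * of_real pi * \<i> * w) * (of_nat CARD('n) * gauss_sum_fn A w r + 4 * of_real pi * \<i> * w * S)
     = (4 * of_real pi * \<i> * w) * (poisson_factor A w * (of_real pi * \<i> * S' / w))"
    using w0 by (simp add: power2_eq_square field_simps)
  then have "of_nat CARD('n) * gauss_sum_fn A w r + 4 * of_real pi * \<i> * w * S
     = poisson_factor A w * (of_real pi * \<i> * S' / w)"
    by (subst (asm) mult_left_cancel) (use w0 in auto)
  then show ?thesis unfolding d d' using w0 by (simp add: power2_eq_square field_simps)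
qed

text \<open>As a function of r its zeroth Fourier coefficient is 1. The point r found here makes it
  possible to write the Poisson factor as a quotient.\<close>

lemma dual_sum_fn_nonvanishing:
  assumes A: "posdef A" and w: "Im w > 0"
  obtains r where "dual_sum_fn A w r \<noteq> 0"
proof (rule ccontr)
  assume "\<not> thesis"
  then have 0: "dual_sum_fn A w r = 0" for r using that by blast
  define c where "c = (\<lambda>y. e (of_real (quad_form (matrix_inv A) (of_int_vec y)) * (- 1 / (4 * w))))"
  have c: "(\<lambda>y. norm (c y)) summable_on UNIV"
    using theta_abs_summable[OF poly_growth_const[of 1] quad_growth_posdef0[OF posdef_inv[OF A]], of "- 1 / (4 * w)"]
      Im_neg_inverse_pos[OF w] by (simp add: c_def upper_half_plane_def)
  have "torus_mean (\<lambda>r. dual_sum_fn A w r * ev 0 r) = c (- 0)"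
    using torus_mean_trig_series(2)[OF c, of 0] by (simp add: dual_sum_fn_def c_def)
  then show False by (simp add: 0 torus_mean_const c_def)
qed

lemma gauss_sum_fn_holomorphic:
  assumes A: "posdef A" shows "(\<lambda>w. gauss_sum_fn A w r) holomorphic_on upper_half_plane"
  unfolding gauss_sum_fn_theta
  by (rule theta_deriv(1)[OF poly_growth_const quad_growth_posdef[OF A]])

lemma dual_sum_fn_holomorphic:
  assumes A: "posdef A" shows "(\<lambda>w. dual_sum_fn A w r) holomorphic_on upper_half_plane"
  unfolding dual_sum_fn_theta
  by (rule holomorphic_on_compose_gen[OF _ theta_deriv(1)[OF poly_growth_ev quad_growth_posdef0[OF posdef_inv[OF A]]],
        unfolded o_def])
    (use Im_neg_inverse_pos in \<open>auto intro!: holomorphic_intros simp: upper_half_plane_def\<close>)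

text \<open>For a suitable r the factor is f / g near w, and \<open>poisson_laplace\<close> says
  precisely that (f / g)^2 w^n has derivative 0. The constant is nonzero because at w = i and r = 0
  the Gaussian sum has positive terms.\<close>

theorem poisson_factor_square:
  assumes A: "posdef (A :: real ^ 'n ^ 'n)"
  obtains \<kappa> where "\<kappa> \<noteq> 0" "\<And>w. Im w > 0 \<Longrightarrow> (poisson_factor A w)\<^sup>2 * w ^ CARD('n) = \<kappa>"
proof -
  define P where "P = (\<lambda>w. (poisson_factor A w)\<^sup>2 * w ^ CARD('n))"
  have P0: "(P has_field_derivative 0) (at w)" if w: "Im w > 0" for w
  proof -
    obtain r where r: "dual_sum_fn A w r \<noteq> 0" by (rule dual_sum_fn_nonvanishing[OF A w])
    define f where "f = (\<lambda>w. gauss_sum_fn A w r)"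
    define g where "g = (\<lambda>w. dual_sum_fn A w r)"
    have f_hol: "f holomorphic_on upper_half_plane"
      unfolding f_def by (rule gauss_sum_fn_holomorphic[OF A])
    have g_hol: "g holomorphic_on upper_half_plane"
      unfolding g_def by (rule dual_sum_fn_holomorphic[OF A])
    have wH: "w \<in> upper_half_plane" using w by (simp add: upper_half_plane_def)
    note f' = holomorphic_derivI[OF f_hol open_upper_half_plane wH]
    note g' = holomorphic_derivI[OF g_hol open_upper_half_plane wH]
    have w0: "w \<noteq> 0" using w by auto
    have g0: "g w \<noteq> 0" using r by (simp add: g_def)
    obtain m where m: "CARD('n) = Suc m" using zero_less_card_finite[where 'a='n] gr0_conv_Suc by blast
    have fg: "f w = poisson_factor A w * g w" if "Im w > 0" for w
      unfolding f_def g_def by (rule poisson_summation[OF A that])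
    have ode: "(1 + of_nat m) * f w + 2 * w * deriv f w = 2 * w * (poisson_factor A w * deriv g w)"
      using poisson_laplace[OF A w, of r] by (simp add: f_def g_def m)
    have pw: "((\<lambda>w :: complex. w ^ Suc m) has_field_derivative (1 + of_nat m) * w ^ m) (at w)"
      using DERIV_power[OF DERIV_ident, of "Suc m" w UNIV] by simp
    have dv: "((\<lambda>w. (f w)\<^sup>2 * w ^ CARD('n) / (g w)\<^sup>2) has_field_derivative 0) (at w)"
    proof -
      have "((\<lambda>w. (f w)\<^sup>2 * w ^ CARD('n) / (g w)\<^sup>2) has_field_derivative
         ((2 * f w * deriv f w * w ^ Suc m + (f w)\<^sup>2 * ((1 + of_nat m) * w ^ m)) * (g w)\<^sup>2 
           - (f w)\<^sup>2 * w ^ Suc m * (2 * g w * deriv g w)) / ((g w)\<^sup>2 * (g w)\<^sup>2)) (at w)"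
        unfolding m
        by (rule DERIV_cong[OF DERIV_divide[OF DERIV_mult[OF DERIV_power[OF f', of 2] pw] DERIV_power[OF g', of 2]]])
           (use g0 in \<open>simp_all add: power2_eq_square algebra_simps\<close>)
      moreover have "(2 * f w * deriv f w * w ^ Suc m + (f w)\<^sup>2 * ((1 + of_nat m) * w ^ m)) * (g w)\<^sup>2 
           - (f w)\<^sup>2 * w ^ Suc m * (2 * g w * deriv g w)
          = f w * w ^ m * g w * ((((1 + of_nat m) * f w + 2 * w * deriv f w) * g w) - 2 * w * f w * deriv g w)"
        by (simp add: power2_eq_square algebra_simps)
      moreover have "((1 + of_nat m) * f w + 2 * w * deriv f w) * g w = 2 * w * f w * deriv g w"
        unfolding ode by (simp add: fg[OF w] mult_ac)
      ultimately show ?thesis by simp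
    qed
    \<comment> \<open>The Poisson factor is accessible to differentiation only through the quotient
      f / g, which equals it on the neighbourhood where g does not vanish.\<close>
    have ev: "eventually (\<lambda>w. (f w)\<^sup>2 * w ^ CARD('n) / (g w)\<^sup>2 = P w) (nhds w)"
    proof -
      have "open (upper_half_plane \<inter> g -` (- {0}))"
        by (intro continuous_open_preimage holomorphic_on_imp_continuous_on g_hol open_upper_half_plane) auto
      then have "eventually (\<lambda>w. w \<in> upper_half_plane \<inter> g -` (- {0})) (nhds w)"
        by (rule eventually_nhds_in_open) (use wH g0 in auto)
      then show ?thesis
      proof eventually_elim
        case (elim v)
        then have v: "Im v > 0" by (simp add: upper_half_plane_def)
        show ?case using elim by (simp add: P_def fg[OF v] power_mult_distrib)
      qed
    qed
    show ?thesis using dv unfolding DERIV_cong_ev[OF refl ev refl] .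
  qed
  have "\<exists>\<kappa>. \<forall>w\<in>upper_half_plane. P w = \<kappa>"
  proof (rule has_field_derivative_zero_constant[of upper_half_plane P])
    show "convex upper_half_plane"
      unfolding upper_half_plane_def by (rule convex_halfspace_Im_gt)
    show "(P has_field_derivative 0) (at w within upper_half_plane)" if "w \<in> upper_half_plane" for w
      using P0[of w] that by (auto simp: upper_half_plane_def intro: has_field_derivative_at_within)
  qed
  then obtain \<kappa> where \<kappa>: "\<And>w. w \<in> upper_half_plane \<Longrightarrow> P w = \<kappa>" by blast
  have "\<kappa> \<noteq> 0"
  proof
    assume "\<kappa> = 0"
    then have "poisson_factor A \<i> = 0" using \<kappa>[of \<i>] by (simp add: P_def upper_half_plane_def)
    then have 0: "gauss_sum_fn A \<i> 0 = 0" using poisson_summation[OF A, of \<i> 0] by simp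
    have "((\<lambda>x. 1 * e (of_real (quad_form A (of_int_vec x + 0)) * \<i>)) has_sum gauss_sum_fn A \<i> 0) UNIV"
      unfolding gauss_sum_fn_def
      using has_sum_infsum[OF theta_summable[OF poly_growth_const[of 1] quad_growth_posdef[OF A, of 0], of \<i>]]
      by (simp add: upper_half_plane_def)
    then have "((\<lambda>x. Re (1 * e (of_real (quad_form A (of_int_vec x + 0)) * \<i>))) has_sum Re (gauss_sum_fn A \<i> 0)) UNIV"
      by (rule has_sum_Re)
    moreover have "Re (1 * e (of_real (quad_form A (of_int_vec x + 0)) * \<i>)) = exp (- (2 * pi * quad_form A (of_int_vec x)))" for x
      by (simp add: e_def Re_exp)
    ultimately have hs: "((\<lambda>x. exp (- (2 * pi * quad_form A (of_int_vec x)))) has_sum 0) UNIV"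
      using 0 by simp
    have "exp (- (2 * pi * quad_form A (of_int_vec (0 :: int ^ 'n)))) \<le> (0::real)"
      using has_sum_mono2[OF has_sum_finite[of "{0 :: int ^ 'n}"] hs] by simp
    then show False by simp
  qed
  then show ?thesis using that \<kappa> by (simp add: P_def upper_half_plane_def)
qed

subsection \<open>Residue systems\<close>

definition er :: "int \<Rightarrow> int \<Rightarrow> complex" where
  "er k d = e (of_int k / of_int d)"

lemma er_add: "er (k + l) d = er k d * er l d"
  by (simp add: er_def add_divide_distrib e_add)

lemma er_0 [simp]: "er 0 d = 1"
  by (simp add: er_def)

lemma er_dvd: "d dvd k \<Longrightarrow> er k d = 1"
  by (cases "d = 0") (auto simp: er_def elim!: dvdE)

lemma er_cong: assumes "d dvd k - l" shows "er k d = er l d"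
  using er_add[of "k - l" l d] er_dvd[OF assms] by simp

lemma er_mult_cancel: "m \<noteq> 0 \<Longrightarrow> er (m * k) (m * d) = er k d"
  by (simp add: er_def)

lemma er_minus: "er (- k) d = cnj (er k d)"
proof -
  have "of_int k / of_int d = (of_real (of_int k / of_int d) :: complex)" by simp
  then show ?thesis unfolding er_def by (simp only: cnj_e_of_real of_int_minus minus_divide_left[symmetric])
qed

lemma norm_er [simp]: "norm (er k d) = 1"
proof -
  have "of_int k / of_int d = (of_real (of_int k / of_int d) :: complex)" by simp
  then show ?thesis unfolding er_def by (simp only: norm_e_of_real)
qed

lemma er_eq_1_iff: "d \<noteq> 0 \<Longrightarrow> er k d = 1 \<longleftrightarrow> d dvd k"
proof -
  assume d: "d \<noteq> 0"
  have "of_int k / of_int d = (of_real (of_int k / of_int d) :: complex)" by simp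
  then have "er k d = 1 \<longleftrightarrow> (of_int k / of_int d :: real) \<in> \<int>"
    unfolding er_def by (simp only: e_eq_1_iff_Ints)
  also have "\<dots> \<longleftrightarrow> d dvd k"
  proof
    assume "(of_int k / of_int d :: real) \<in> \<int>"
    then obtain j where "of_int k / of_int d = (of_int j :: real)" by (auto elim!: Ints_cases)
    then have "real_of_int k = of_int (j * d)" using d by (simp add: field_simps)
    then show "d dvd k" by (simp only: of_int_eq_iff dvd_triv_right)
  qed (use d in \<open>auto elim!: dvdE\<close>)
  finally show ?thesis .
qed

definition idot :: "int ^ 'n \<Rightarrow> int ^ 'n \<Rightarrow> int" where
  "idot x y = (\<Sum>i\<in>UNIV. x $ i * y $ i)"

lemma idot_add_left: "idot (x + y) z = idot x z + idot y z"
  by (simp add: idot_def sum.distrib algebra_simps)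
lemma idot_add_right: "idot x (y + z) = idot x y + idot x z"
  by (simp add: idot_def sum.distrib algebra_simps)
lemma idot_scale_left: "idot (k *s x) y = k * idot x y"
  by (simp add: idot_def sum_distrib_left mult_ac)
lemma idot_scale_right: "idot x (k *s y) = k * idot x y"
  by (simp add: idot_def sum_distrib_left mult_ac)
lemma idot_commute: "idot x y = idot y x"
  by (simp add: idot_def mult.commute)
lemma idot_axis: "idot (axis i k) y = k * y $ i"
proof -
  have "idot (axis i k) y = (\<Sum>j\<in>UNIV. if i = j then k * y $ j else 0)"
    unfolding idot_def by (intro sum.cong) (auto simp: axis_def)
  then show ?thesis by simp
qed

lemma idot_sym:
  assumes "transpose S = S" shows "idot x (S *v y) = idot y (S *v x)"
proof -
  have S: "S $ i $ j = S $ j $ i" for i j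
    using arg_cong[OF assms, of "\<lambda>M. M $ j $ i"] by (simp add: transpose_def)
  have "idot x (S *v y) = (\<Sum>i\<in>UNIV. \<Sum>j\<in>UNIV. x $ i * S $ i $ j * y $ j)"
    by (simp add: idot_def matrix_vector_mult_def sum_distrib_left mult_ac)
  also have "\<dots> = (\<Sum>j\<in>UNIV. \<Sum>i\<in>UNIV. x $ i * S $ i $ j * y $ j)" by (rule sum.swap)
  also have "\<dots> = (\<Sum>j\<in>UNIV. \<Sum>i\<in>UNIV. y $ j * (S $ j $ i * x $ i))"
    by (intro sum.cong refl) (subst S, simp)
  also have "\<dots> = idot y (S *v x)"
    by (simp add: idot_def matrix_vector_mult_def sum_distrib_left)
  finally show ?thesis .
qed

definition vresidues :: "int \<Rightarrow> (int ^ 'n) set" where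
  "vresidues d = {x. \<forall>i. 0 \<le> x $ i \<and> x $ i < d}"

definition vdvd :: "int \<Rightarrow> int ^ 'n \<Rightarrow> bool" where
  "vdvd d x \<longleftrightarrow> (\<forall>i. d dvd x $ i)"

definition vmod :: "int ^ 'n \<Rightarrow> int \<Rightarrow> int ^ 'n" where
  "vmod x d = (\<chi> i. x $ i mod d)"

lemma vmod_in_residues: "d > 0 \<Longrightarrow> vmod x d \<in> vresidues d"
  by (simp add: vmod_def vresidues_def)

lemma vdvd_vmod: "vdvd d (vmod x d - x)"
  by (simp add: vmod_def vdvd_def mod_eq_dvd_iff[symmetric])

lemma vdvd_vmod': "vdvd d (x - vmod x d)"
  by (simp add: vmod_def vdvd_def mod_eq_dvd_iff[symmetric])

lemma vmod_eq_iff: "vmod x d = vmod y d \<longleftrightarrow> vdvd d (x - y)"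
  by (simp add: vmod_def vdvd_def vec_eq_iff mod_eq_dvd_iff)

lemma residues_eq: "x \<in> vresidues d \<Longrightarrow> y \<in> vresidues d \<Longrightarrow> vdvd d (x - y) \<Longrightarrow> x = y"
  unfolding vresidues_def vdvd_def vec_eq_iff
  by (metis (mono_tags, lifting) mem_Collect_eq mod_eq_dvd_iff mod_pos_pos_trivial vector_minus_component)

lemma vdvdE: assumes "vdvd d x" obtains y where "x = d *s y"
proof -
  have "x = d *s (\<chi> i. x $ i div d)"
    using assms by (simp add: vdvd_def vec_eq_iff)
  then show ?thesis by (rule that)
qed

lemma vdvd_scale [simp]: "vdvd d (d *s y)"
  by (simp add: vdvd_def)

lemma vdvd_dvd_trans: "c dvd d \<Longrightarrow> vdvd d x \<Longrightarrow> vdvd c x"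
  unfolding vdvd_def using dvd_trans by blast

lemma vdvd_diff: "vdvd d x \<Longrightarrow> vdvd d y \<Longrightarrow> vdvd d (x - y)"
  by (simp add: vdvd_def)

lemma vdvd_coprime_scale: "coprime k d \<Longrightarrow> vdvd d (k *s x) \<Longrightarrow> vdvd d x"
  by (auto simp: vdvd_def coprime_dvd_mult_right_iff coprime_commute)

lemma vdvd_idot: "vdvd d y \<Longrightarrow> d dvd idot x y"
  unfolding vdvd_def idot_def by (intro dvd_sum dvd_mult) auto

lemma residues_PiE: "bij_betw vec_nth (vresidues d :: (int ^ 'n) set) (PiE UNIV (\<lambda>_. {0..<d}))"
proof (rule bij_betwI[of _ _ _ vec_lambda])
qed (auto simp: vresidues_def)

lemma finite_residues [simp]: "finite (vresidues d :: (int ^ 'n) set)"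
proof -
  have "finite (PiE (UNIV :: 'n set) (\<lambda>_. {0..<d}))" by (intro finite_PiE) auto
  then show ?thesis using bij_betw_finite[OF residues_PiE] by blast
qed

lemma card_residues: "card (vresidues d :: (int ^ 'n) set) = nat d ^ CARD('n)"
proof -
  have "card (vresidues d :: (int ^ 'n) set) = card (PiE (UNIV :: 'n set) (\<lambda>_. {0..<d}))"
    by (rule bij_betw_same_card[OF residues_PiE])
  then show ?thesis by (simp add: card_PiE)
qed

lemma zero_in_residues: "d > 0 \<Longrightarrow> 0 \<in> vresidues d"
  by (simp add: vresidues_def)

lemma residues_1: "vresidues 1 = {0}"
proof -
  have "0 \<le> x \<and> x < 1 \<longleftrightarrow> x = 0" for x :: int by auto
  then show ?thesis by (simp add: vresidues_def vec_eq_iff set_eq_iff)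
qed

lemma sum_endo:
  assumes "finite A" "\<phi> ` A \<subseteq> A" "inj_on \<phi> A"
  shows "(\<Sum>x\<in>A. F (\<phi> x)) = (\<Sum>x\<in>A. F x)"
  using sum.reindex[OF assms(3), of F] endo_inj_surj[OF assms] by (simp add: o_def)

lemma sum_residues_inj:
  fixes \<phi> :: "int ^ 'n \<Rightarrow> int ^ 'n"
  assumes d: "d > 0" and F: "\<And>x y. vdvd d (x - y) \<Longrightarrow> F x = F y"
    and \<phi>: "\<And>x y. x \<in> vresidues d \<Longrightarrow> y \<in> vresidues d \<Longrightarrow> vdvd d (\<phi> x - \<phi> y) \<Longrightarrow> x = y"
  shows "(\<Sum>x\<in>vresidues d. F (\<phi> x)) = (\<Sum>x\<in>vresidues d. F x)"
proof -
  have "(\<Sum>x\<in>vresidues d. F (\<phi> x)) = (\<Sum>x\<in>vresidues d. F (vmod (\<phi> x) d))"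
    by (intro sum.cong refl F vdvd_vmod')
  also have "\<dots> = (\<Sum>x\<in>vresidues d. F x)"
    by (rule sum_endo[where \<phi> = "\<lambda>x. vmod (\<phi> x) d"]) (use d in \<open>auto intro!: vmod_in_residues inj_onI \<phi> simp: vmod_eq_iff\<close>)
  finally show ?thesis .
qed

lemma sum_residues_shift:
  assumes d: "d > 0" and F: "\<And>x y. vdvd d (x - y) \<Longrightarrow> F x = F y"
  shows "(\<Sum>x\<in>vresidues d. F (x + t)) = (\<Sum>x\<in>vresidues d. F x)"
  by (rule sum_residues_inj[where \<phi> = "\<lambda>x. x + t", OF d F]) (auto intro: residues_eq)

lemma residues_prod_bij:
  assumes "d > 0" "k > 0"
  shows "bij_betw (\<lambda>(s, t). s + d *s t) (vresidues d \<times> vresidues k) (vresidues (d * k) :: (int ^ 'n) set)"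
proof (rule bij_betwI[of _ _ _ "\<lambda>x. (vmod x d, \<chi> i. x $ i div d)"])
  show "(\<lambda>(s, t). s + d *s t) \<in> vresidues d \<times> vresidues k \<rightarrow> (vresidues (d * k) :: (int ^ 'n) set)"
  proof safe
    fix s t :: "int ^ 'n" assume st: "s \<in> vresidues d" "t \<in> vresidues k"
    have "0 \<le> s $ i + d * t $ i \<and> s $ i + d * t $ i < d * k" for i
    proof
      have *: "0 \<le> s $ i" "s $ i < d" "0 \<le> t $ i" "t $ i < k" using st by (auto simp: vresidues_def)
      then show "0 \<le> s $ i + d * t $ i" using assms by simp
      have "s $ i + d * t $ i < d + d * t $ i" using * by simp
      also have "\<dots> = d * (t $ i + 1)" by (simp add: algebra_simps)
      also have "\<dots> \<le> d * k" using * assms by (intro mult_left_mono) auto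
      finally show "s $ i + d * t $ i < d * k" .
    qed
    then show "s + d *s t \<in> vresidues (d * k)" by (simp add: vresidues_def)
  qed
  show "(\<lambda>x. (vmod x d, \<chi> i. x $ i div d)) \<in> (vresidues (d * k) :: (int ^ 'n) set) \<rightarrow> vresidues d \<times> vresidues k"
  proof safe
    fix x :: "int ^ 'n" assume x: "x \<in> vresidues (d * k)"
    show "vmod x d \<in> vresidues d" using assms by (intro vmod_in_residues)
    have "0 \<le> x $ i div d \<and> x $ i div d < k" for i
    proof
      have *: "0 \<le> x $ i" "x $ i < d * k" using x by (auto simp: vresidues_def)
      then show "0 \<le> x $ i div d" using assms by (simp add: pos_imp_zdiv_nonneg_iff)
      show "x $ i div d < k"
      proof (rule ccontr)
        assume "\<not> x $ i div d < k"
        then have "d * k \<le> d * (x $ i div d)" using assms by (intro mult_left_mono) auto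
        also have "\<dots> \<le> x $ i"
          using mult_div_mod_eq[of d "x $ i"] pos_mod_sign[of d "x $ i"] assms by linarith
        finally show False using * by simp
      qed
    qed
    then show "(\<chi> i. x $ i div d) \<in> vresidues k" by (simp add: vresidues_def)
  qed
next
  fix p :: "(int ^ 'n) \<times> (int ^ 'n)" assume p: "p \<in> vresidues d \<times> vresidues k"
  have "(fst p $ i + d * snd p $ i) div d = snd p $ i" "(fst p $ i + d * snd p $ i) mod d = fst p $ i" for i
    using p assms by (auto simp: vresidues_def div_add1_eq[of _ "d * _" d])
  then show "(vmod ((\<lambda>(s, t). s + d *s t) p) d, \<chi> i. ((\<lambda>(s, t). s + d *s t) p) $ i div d) = p"
    by (simp add: case_prod_unfold prod_eq_iff vec_eq_iff vmod_def)
qed (auto simp: vec_eq_iff vmod_def)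

lemma sum_residues_prod:
  assumes "d > 0" "k > 0"
  shows "(\<Sum>x\<in>vresidues (d * k). F x) = (\<Sum>s\<in>vresidues d. \<Sum>t\<in>vresidues k. F (s + d *s t))"
  using sum.reindex_bij_betw[OF residues_prod_bij[OF assms], of F]
  by (simp add: sum.cartesian_product case_prod_unfold)

text \<open>By coprimality (s, t) -> k s + d t is injective modulo d k, and then counting residues
  makes it bijective.\<close>

lemma sum_residues_crt:
  fixes F :: "int ^ 'n \<Rightarrow> complex"
  assumes d: "d > 0" "k > 0" "coprime d k" and F: "\<And>x y. vdvd (d * k) (x - y) \<Longrightarrow> F x = F y"
  shows "(\<Sum>x\<in>vresidues (d * k). F x) = (\<Sum>s\<in>vresidues d. \<Sum>t\<in>vresidues k. F (k *s s + d *s t))"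
proof -
  let ?\<phi> = "\<lambda>(s :: int ^ 'n, t). vmod (k *s s + d *s t) (d * k)"
  have inj: "inj_on ?\<phi> (vresidues d \<times> vresidues k)"
  proof (rule inj_onI)
    fix p p' assume pp: "p \<in> vresidues d \<times> vresidues k" "p' \<in> vresidues d \<times> vresidues k" "?\<phi> p = ?\<phi> p'"
    obtain s t s' t' where p: "p = (s, t)" "p' = (s', t')" by (cases p, cases p')
    have st: "s \<in> vresidues d" "t \<in> vresidues k" "s' \<in> vresidues d" "t' \<in> vresidues k"
      and eq: "vmod (k *s s + d *s t) (d * k) = vmod (k *s s' + d *s t') (d * k)"
      using pp by (simp_all add: p)
    have *: "vdvd (d * k) (k *s (s - s') + d *s (t - t'))"
      using eq unfolding vmod_eq_iff by (simp add: vdvd_def algebra_simps)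
    have "vdvd d ((k *s (s - s') + d *s (t - t')) - d *s (t - t'))"
      by (intro vdvd_diff vdvd_scale vdvd_dvd_trans[OF _ *]) auto
    then have "vdvd d (k *s (s - s'))" by simp
    then have "vdvd d (s - s')" by (rule vdvd_coprime_scale[rotated]) (use d in \<open>simp add: coprime_commute\<close>)
    moreover have "vdvd k ((k *s (s - s') + d *s (t - t')) - k *s (s - s'))"
      by (intro vdvd_diff vdvd_scale vdvd_dvd_trans[OF _ *]) auto
    then have "vdvd k (d *s (t - t'))" by simp
    then have "vdvd k (t - t')" by (rule vdvd_coprime_scale[rotated]) (use d in simp)
    ultimately show "p = p'" using st residues_eq unfolding p by blast
  qed
  have "?\<phi> ` (vresidues d \<times> vresidues k) \<subseteq> vresidues (d * k)"
    using d by (auto intro!: vmod_in_residues)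
  moreover have "card (?\<phi> ` (vresidues d \<times> vresidues k)) = card (vresidues (d * k) :: (int ^ 'n) set)"
    using d by (simp add: card_image[OF inj] card_residues card_cartesian_product nat_mult_distrib power_mult_distrib)
  ultimately have im: "?\<phi> ` (vresidues d \<times> vresidues k) = vresidues (d * k)"
    by (intro card_subset_eq) auto
  have "(\<Sum>x\<in>vresidues (d * k). F x) = (\<Sum>p\<in>vresidues d \<times> vresidues k. F (?\<phi> p))"
    unfolding im[symmetric] by (simp add: sum.reindex[OF inj])
  also have "\<dots> = (\<Sum>p\<in>vresidues d \<times> vresidues k. F (case p of (s, t) \<Rightarrow> k *s s + d *s t))"
    by (intro sum.cong refl F) (auto intro: vdvd_vmod)
  finally show ?thesis by (simp add: sum.cartesian_product case_prod_unfold)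
qed

lemma sum_er_idot:
  fixes y :: "int ^ 'n"
  assumes d: "d > 0"
  shows "(\<Sum>t\<in>vresidues d. er (idot t y) d) = (if vdvd d y then of_int d ^ CARD('n) else 0)"
proof (cases "vdvd d y")
  case True
  then have "er (idot t y) d = 1" for t by (intro er_dvd vdvd_idot)
  then show ?thesis using True d by (simp add: card_residues)
next
  case False
  then obtain i where i: "\<not> d dvd y $ i" by (auto simp: vdvd_def)
  let ?S = "\<Sum>t\<in>vresidues d. er (idot t y) d"
  \<comment> \<open>Moving t by the i-th unit vector permutes the classes and multiplies the sum by
    a root of unity different from 1.\<close>
  have "(\<Sum>t\<in>vresidues d. er (idot (t + axis i 1) y) d) = ?S"
  proof (rule sum_residues_shift[OF d])
    fix x z :: "int ^ 'n" assume "vdvd d (x - z)"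
    then have "d dvd idot y (x - z)" by (rule vdvd_idot)
    then have "d dvd idot x y - idot z y"
      using idot_add_left[of "x - z" z y] by (simp add: idot_commute[of y])
    then show "er (idot x y) d = er (idot z y) d" by (rule er_cong)
  qed
  then have "er (y $ i) d * ?S = ?S"
    by (simp add: idot_add_left idot_axis er_add sum_distrib_left mult.commute)
  moreover have "er (y $ i) d \<noteq> 1" using er_eq_1_iff[of d] d i by simp
  ultimately show ?thesis using False by simp
qed

subsection \<open>Quadratic Gauss sums\<close>

text \<open>For q(x) = A[x] the matrix S is the polar matrix 2A. Integrality holds for q and for 2A
  while A may have half-integral entries, so q is tied to S by the polar identity and not by a
  formula with a division.\<close>

definition int_quad :: "(int ^ 'n \<Rightarrow> int) \<Rightarrow> int ^ 'n ^ 'n \<Rightarrow> bool" where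
  "int_quad q S \<longleftrightarrow> transpose S = S \<and> (\<forall>x y. q (x + y) = q x + idot x (S *v y) + q y) \<and>
     (\<forall>k x. q (k *s x) = k\<^sup>2 * q x)"

text \<open>Injectivity of S modulo d; for d > 0 this means that det S is prime to d.\<close>

definition nondeg :: "int ^ 'n ^ 'n \<Rightarrow> int \<Rightarrow> bool" where
  "nondeg S d \<longleftrightarrow> (\<forall>x. vdvd d (S *v x) \<longrightarrow> vdvd d x)"

definition gauss :: "(int ^ 'n \<Rightarrow> int) \<Rightarrow> int \<Rightarrow> int \<Rightarrow> int ^ 'n \<Rightarrow> complex" where
  "gauss q a c y = (\<Sum>r\<in>vresidues c. er (a * q r + idot r y) c)"

lemma matrix_vector_scale_int: "S *v (k *s x) = k *s (S *v (x :: int ^ 'n))"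
  by (simp add: matrix_vector_mult_def vec_eq_iff sum_distrib_left mult_ac)

lemma int_quad_add: "int_quad q S \<Longrightarrow> q (x + y) = q x + idot x (S *v y) + q y"
  and int_quad_scale: "int_quad q S \<Longrightarrow> q (k *s x) = k\<^sup>2 * q x"
  and int_quad_sym: "int_quad q S \<Longrightarrow> transpose S = S"
  by (auto simp: int_quad_def)

lemma int_quad_0: "int_quad q S \<Longrightarrow> q 0 = 0"
  using int_quad_scale[of q S 0 0] by simp

lemma int_quad_add_scale:
  assumes "int_quad q S" shows "q (x + k *s y) = q x + k * idot x (S *v y) + k\<^sup>2 * q y"
  using int_quad_add[OF assms, of x "k *s y"] int_quad_scale[OF assms]
  by (simp add: matrix_vector_scale_int idot_scale_right)

lemma int_quad_cong:
  assumes "int_quad q S" "vdvd d (x - y)" shows "d dvd q x - q y"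
proof -
  obtain z where z: "x - y = d *s z" using assms(2) by (rule vdvdE)
  then have "x = y + d *s z" by (simp add: algebra_simps)
  then have "q x - q y = d * (idot y (S *v z) + d * q z)"
    by (simp add: int_quad_add_scale[OF assms(1)] power2_eq_square algebra_simps)
  then show ?thesis by simp
qed

lemma gauss_term_cong:
  assumes "int_quad q S" "vdvd c (x - x')"
  shows "er (a * q x + idot x y) c = er (a * q x' + idot x' y) c"
proof (rule er_cong)
  have "c dvd a * (q x - q x') + idot y (x - x')"
    by (intro dvd_add dvd_mult int_quad_cong[OF assms] vdvd_idot assms)
  moreover have "idot x y = idot y (x - x') + idot x' y"
    using idot_add_left[of "x - x'" x' y] by (simp add: idot_commute[of y])
  ultimately show "c dvd a * q x + idot x y - (a * q x' + idot x' y)"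
    by (simp add: algebra_simps)
qed

lemma gauss_shift:
  assumes "int_quad q S" "c > 0"
  shows "(\<Sum>r\<in>vresidues c. er (a * q (r + t) + idot (r + t) y) c) = gauss q a c y"
  unfolding gauss_def by (rule sum_residues_shift[OF assms(2) gauss_term_cong[OF assms(1)]])

lemma norm_gauss_le: "c > 0 \<Longrightarrow> norm (gauss (q :: int ^ 'n \<Rightarrow> int) a c y) \<le> of_int c ^ CARD('n)"
  unfolding gauss_def
  by (rule order_trans[OF norm_sum]) (simp add: card_residues)

text \<open>Shifting by \<open>(c / N) S' w\<close> multiplies the sum by \<open>e(y \<sqdot> S' w / N)\<close>, so it vanishes unless \<open>y\<close>
  lies in the image of \<open>S\<close>.\<close>

lemma gauss_eq_0:
  assumes q: "int_quad q S" and c: "c > 0" "N dvd c"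
    and S': "transpose S' = S'" "S ** S' = mat N" "\<And>w. N dvd q (S' *v w)"
    and nz: "gauss q a c y \<noteq> 0"
  shows "\<exists>x. y = S *v x"
proof -
  obtain m where m: "c = N * m" using c(2) by (rule dvdE)
  have N0: "N \<noteq> 0" "m \<noteq> 0" using c(1) m by auto
  have SS: "S *v (S' *v w) = N *s w" for w
  proof -
    have "S *v (S' *v w) = mat N *v w" by (simp add: matrix_vector_mul_assoc S'(2))
    also have "mat N *v w = N *s w"
      by (simp add: mat_def matrix_vector_mult_def vec_eq_iff if_distrib[of "\<lambda>x. x * _"] cong: if_cong)
    finally show ?thesis .
  qed
  have "N dvd idot (S' *v w) y" for w
  proof -
    obtain k where k: "q (S' *v w) = N * k" using S'(3) by (rule dvdE)
    let ?t = "m *s (S' *v w)"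
    have *: "er (a * q (r + ?t) + idot (r + ?t) y) c = er (idot (S' *v w) y) N * er (a * q r + idot r y) c" for r
    proof -
      have "a * q (r + ?t) + idot (r + ?t) y = (a * q r + idot r y) + m * idot (S' *v w) y + c * (a * (idot r w + m * k))"
        by (simp add: int_quad_add_scale[OF q] SS idot_scale_right idot_add_left idot_scale_left k m power2_eq_square algebra_simps)
      moreover have "er (c * (a * (idot r w + m * k))) c = 1" by (rule er_dvd) simp
      moreover have "er (m * idot (S' *v w) y) c = er (idot (S' *v w) y) N"
        using er_mult_cancel[OF N0(2), of "idot (S' *v w) y" N] by (simp add: m mult.commute)
      ultimately show ?thesis by (simp add: er_add mult_ac)
    qed
    have "er (idot (S' *v w) y) N * gauss q a c y = gauss q a c y"
      using gauss_shift[OF q c(1), of a ?t y] by (simp add: * gauss_def sum_distrib_left)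
    then have "er (idot (S' *v w) y) N = 1" using nz by simp
    then show ?thesis using er_eq_1_iff[OF N0(1)] by simp
  qed
  then have "N dvd idot w (S' *v y)" for w
    by (metis idot_commute idot_sym[OF S'(1)])
  from this[of "axis i 1" for i] have "vdvd N (S' *v y)" by (simp add: vdvd_def idot_axis)
  then obtain x where x: "S' *v y = N *s x" by (rule vdvdE)
  have "N *s y = N *s (S *v x)" using SS[of y] by (simp add: x matrix_vector_scale_int)
  then have "y = S *v x" using N0 by (simp add: vec_eq_iff)
  then show ?thesis ..
qed

text \<open>Completing the square modulo c: as d inverts a, the shift of r by d x turns the linear
  term with S x into the constant d q(x).\<close>

lemma gauss_image:
  assumes q: "int_quad q S" and c: "c > 0" and ad: "c dvd a * d - 1"
  shows "gauss q a c (S *v x) * er (d * q x) c = gauss q a c 0"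
proof -
  obtain k where "a * d - 1 = c * k" using ad by (rule dvdE)
  then have k: "a * d = 1 + c * k" by simp
  have "er (a * q (r + d *s x) + idot (r + d *s x) 0) c = er (a * q r + idot r (S *v x)) c * er (d * q x) c" for r
  proof -
    have "a * q (r + d *s x) + idot (r + d *s x) 0 = a * q r + (a * d) * idot r (S *v x) + (a * d) * d * q x"
      by (simp add: int_quad_add_scale[OF q] idot_def power2_eq_square algebra_simps)
    also have "\<dots> = (a * q r + idot r (S *v x)) + d * q x + c * (k * (idot r (S *v x) + d * q x))"
      unfolding k by (simp add: algebra_simps)
    finally show ?thesis by (simp add: er_add er_dvd)
  qed
  then show ?thesis
    using gauss_shift[OF q c, of a "d *s x" 0] by (simp add: gauss_def sum_distrib_right)
qed

section \<open>Gauss sums without linear term\<close>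

lemma gauss_0_def: "gauss q b d 0 = (\<Sum>r\<in>vresidues d. er (b * q r) d)"
  by (simp add: gauss_def idot_def)

lemma er_quad_cong: "int_quad q S \<Longrightarrow> vdvd d (x - y) \<Longrightarrow> er (b * q x) d = er (b * q y) d"
  by (rule er_cong) (metis int_quad_cong dvd_mult right_diff_distrib)

lemma gauss_uminus: "gauss q (- b) d 0 = cnj (gauss q b d 0)"
  by (simp add: gauss_0_def er_minus)

lemma gauss_square_unit:
  assumes q: "int_quad q S" and d: "d > 0" "coprime t d"
  shows "gauss q (b * t\<^sup>2) d 0 = gauss q b d 0"
proof -
  have "(\<Sum>r\<in>vresidues d. er (b * q (t *s r)) d) = (\<Sum>r\<in>vresidues d. er (b * q r) d)"
  proof (rule sum_residues_inj[where \<phi> = "\<lambda>r. t *s r", OF d(1) er_quad_cong[OF q]])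
    fix x y :: "int ^ 'a" assume xy: "x \<in> vresidues d" "y \<in> vresidues d" "vdvd d (t *s x - t *s y)"
    then have "vdvd d (t *s (x - y))" by (simp add: vdvd_def right_diff_distrib)
    then have "vdvd d (x - y)" by (rule vdvd_coprime_scale[OF d(2)])
    then show "x = y" by (rule residues_eq[OF xy(1,2)])
  qed
  then show ?thesis by (simp add: gauss_0_def int_quad_scale[OF q] mult_ac)
qed

lemma gauss_cong:
  assumes "d dvd b - b'" shows "gauss q b d 0 = gauss q b' d 0"
  unfolding gauss_0_def
proof (intro sum.cong refl er_cong)
  fix r show "d dvd b * q r - b' * q r"
    using assms by (simp add: left_diff_distrib[symmetric])
qed

text \<open>Put r = t + s in the double sum. For fixed t the terms in s form a character sum, which
  vanishes unless d divides b S t, that is, unless t = 0.\<close>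

lemma gauss_norm:
  assumes q: "int_quad (q :: int ^ 'n \<Rightarrow> int) S" and d: "d > 0" "coprime b d" and S: "nondeg S d"
  shows "gauss q b d 0 * cnj (gauss q b d 0) = of_int d ^ CARD('n)"
proof -
  have "gauss q b d 0 * cnj (gauss q b d 0) = (\<Sum>s\<in>vresidues d. (\<Sum>r\<in>vresidues d. er (b * q r) d) * er (- (b * q s)) d)"
    by (simp add: gauss_0_def sum_distrib_left er_minus)
  also have "\<dots> = (\<Sum>s\<in>vresidues d. \<Sum>t\<in>vresidues d. er (b * q t) d * er (idot s (b *s (S *v t))) d)"
  proof (intro sum.cong refl)
    fix s :: "int ^ 'n"
    have "(\<Sum>r\<in>vresidues d. er (b * q r) d) = (\<Sum>t\<in>vresidues d. er (b * q (t + s)) d)"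
      by (rule sum_residues_shift[OF d(1) er_quad_cong[OF q], symmetric])
    also have "\<dots> * er (- (b * q s)) d = (\<Sum>t\<in>vresidues d. er (b * q (t + s)) d * er (- (b * q s)) d)"
      by (rule sum_distrib_right)
    also have "\<dots> = (\<Sum>t\<in>vresidues d. er (b * q t) d * er (idot s (b *s (S *v t))) d)"
      by (intro sum.cong refl)
        (simp add: er_add[symmetric] int_quad_add[OF q] idot_scale_right idot_sym[OF int_quad_sym[OF q], of _ s] algebra_simps)
    finally show "(\<Sum>r\<in>vresidues d. er (b * q r) d) * er (- (b * q s)) d =
       (\<Sum>t\<in>vresidues d. er (b * q t) d * er (idot s (b *s (S *v t))) d)" .
  qed
  also have "\<dots> = (\<Sum>t\<in>vresidues d. er (b * q t) d * (\<Sum>s\<in>vresidues d. er (idot s (b *s (S *v t))) d))"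
    by (subst sum.swap) (simp add: sum_distrib_left)
  also have "\<dots> = (\<Sum>t\<in>(vresidues d :: (int ^ 'n) set). if t = 0 then of_int d ^ CARD('n) else 0)"
  proof (intro sum.cong refl)
    fix t :: "int ^ 'n" assume t: "t \<in> vresidues d"
    have "vdvd d (b *s (S *v t)) \<longleftrightarrow> t = 0"
    proof
      assume "vdvd d (b *s (S *v t))"
      then have "vdvd d (S *v t)" by (rule vdvd_coprime_scale[OF d(2)])
      then have "vdvd d (t - 0)" using S by (simp add: nondeg_def)
      then show "t = 0" by (rule residues_eq[OF t zero_in_residues[OF d(1)]])
    qed (simp add: vdvd_def)
    then show "er (b * q t) d * (\<Sum>s\<in>vresidues d. er (idot s (b *s (S *v t))) d) =
        (if t = 0 then of_int d ^ CARD('n) else 0)"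
      unfolding sum_er_idot[OF d(1)] by (simp add: int_quad_0[OF q])
  qed
  also have "\<dots> = of_int d ^ CARD('n)"
    using zero_in_residues[OF d(1), where 'a = 'n] by (subst sum.delta) simp_all
  finally show ?thesis .
qed

text \<open>The rotation of the pairs \<open>(r, s)\<close> by \<open>(\<alpha>, \<beta>)\<close> turns \<open>q r + q s\<close> into its negative.\<close>

lemma gauss_square_real:
  assumes q: "int_quad q S" and d: "d > 0" and ab: "d dvd \<alpha>\<^sup>2 + \<beta>\<^sup>2 + 1"
  shows "(gauss q (- b) d 0)\<^sup>2 = (gauss q b d 0)\<^sup>2"
proof -
  let ?X = "vresidues d \<times> vresidues d"
  have sq: "(gauss q b d 0)\<^sup>2 = (\<Sum>p\<in>?X. er (b * (q (fst p) + q (snd p))) d)" for b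
    by (simp add: gauss_0_def power2_eq_square sum_product sum.cartesian_product case_prod_unfold er_add distrib_left)
  define \<psi> where "\<psi> = (\<lambda>p :: (int ^ 'a) \<times> (int ^ 'a). (\<alpha> *s fst p + \<beta> *s snd p, (- \<beta>) *s fst p + \<alpha> *s snd p))"
  define \<phi> where "\<phi> = (\<lambda>p. (vmod (fst (\<psi> p)) d, vmod (snd (\<psi> p)) d))"
  have "(\<Sum>p\<in>?X. er (b * (q (fst p) + q (snd p))) d) = (\<Sum>p\<in>?X. er (b * (q (fst (\<phi> p)) + q (snd (\<phi> p)))) d)"
  proof (rule sum_endo[symmetric, where \<phi> = \<phi>])
    \<comment> \<open>The determinant \<open>\<alpha>\<^sup>2 + \<beta>\<^sup>2\<close> of the
      rotation is -1 modulo d, hence a unit.\<close>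
    show "inj_on \<phi> ?X"
    proof (rule inj_onI)
      fix p p' assume p: "p \<in> ?X" "p' \<in> ?X" "\<phi> p = \<phi> p'"
      define x y where "x = fst p - fst p'" and "y = snd p - snd p'"
      have "vdvd d (\<alpha> *s x + \<beta> *s y)" "vdvd d ((- \<beta>) *s x + \<alpha> *s y)"
        using p(3) by (simp_all add: \<phi>_def \<psi>_def vmod_eq_iff x_def y_def vdvd_def algebra_simps)
      then have 1: "d dvd \<alpha> * x $ i + \<beta> * y $ i" "d dvd - \<beta> * x $ i + \<alpha> * y $ i" for i
        by (auto simp: vdvd_def)
      have "d dvd x $ i \<and> d dvd y $ i" for i
      proof -
        have "d dvd \<alpha> * (\<alpha> * x $ i + \<beta> * y $ i) - \<beta> * (- \<beta> * x $ i + \<alpha> * y $ i)" by (intro dvd_diff dvd_mult 1)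
        then have 2: "d dvd (\<alpha>\<^sup>2 + \<beta>\<^sup>2) * x $ i" by (simp add: power2_eq_square algebra_simps)
        have "d dvd (\<alpha>\<^sup>2 + \<beta>\<^sup>2 + 1) * x $ i - (\<alpha>\<^sup>2 + \<beta>\<^sup>2) * x $ i" by (intro dvd_diff 2 dvd_mult2 ab)
        moreover have "d dvd \<beta> * (\<alpha> * x $ i + \<beta> * y $ i) + \<alpha> * (- \<beta> * x $ i + \<alpha> * y $ i)" by (intro dvd_add dvd_mult 1)
        then have 3: "d dvd (\<alpha>\<^sup>2 + \<beta>\<^sup>2) * y $ i" by (simp add: power2_eq_square algebra_simps)
        have "d dvd (\<alpha>\<^sup>2 + \<beta>\<^sup>2 + 1) * y $ i - (\<alpha>\<^sup>2 + \<beta>\<^sup>2) * y $ i" by (intro dvd_diff 3 dvd_mult2 ab)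
        ultimately show ?thesis by (simp add: algebra_simps)
      qed
      then have "vdvd d (fst p - fst p')" "vdvd d (snd p - snd p')" by (auto simp: vdvd_def x_def y_def)
      then show "p = p'" using p residues_eq by (metis mem_Times_iff prod_eq_iff)
    qed
  qed (use d in \<open>auto simp: \<phi>_def vmod_in_residues\<close>)
  also have "\<dots> = (\<Sum>p\<in>?X. er (b * (q (fst (\<psi> p)) + q (snd (\<psi> p)))) d)"
    unfolding distrib_left er_add \<phi>_def fst_conv snd_conv
    by (intro sum.cong refl arg_cong2[where f = "(*)"] er_quad_cong[OF q] vdvd_vmod)
  also have "\<dots> = (\<Sum>p\<in>?X. er ((- b) * (q (fst p) + q (snd p))) d)"
  proof (intro sum.cong refl er_cong)
    fix p
    have "q (fst (\<psi> p)) + q (snd (\<psi> p)) = (\<alpha>\<^sup>2 + \<beta>\<^sup>2) * (q (fst p) + q (snd p))"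
      unfolding \<psi>_def fst_conv snd_conv
      by (simp add: int_quad_add[OF q] int_quad_scale[OF q] matrix_vector_scale_int idot_scale_left idot_scale_right
            idot_sym[OF int_quad_sym[OF q], of "snd p" "fst p"] algebra_simps)
    then have "b * (q (fst (\<psi> p)) + q (snd (\<psi> p))) - (- b) * (q (fst p) + q (snd p)) = (\<alpha>\<^sup>2 + \<beta>\<^sup>2 + 1) * (b * (q (fst p) + q (snd p)))"
      by (simp add: algebra_simps)
    then show "d dvd b * (q (fst (\<psi> p)) + q (snd (\<psi> p))) - (- b) * (q (fst p) + q (snd p))"
      using ab by simp
  qed
  finally show ?thesis unfolding sq by simp
qed

section \<open>Squares of Gauss sums modulo an odd prime\<close>

lemma sum_er_multiples:
  assumes "p > 0"
  shows "(\<Sum>b<p. er (int b * k) (int p)) = (if int p dvd k then of_nat p else 0)"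
proof -
  define z where "z = er k (int p)"
  have z: "er (int b * k) (int p) = z ^ b" for b
    by (induction b) (simp_all add: z_def er_add distrib_right)
  show ?thesis
  proof (cases "int p dvd k")
    case True
    then have "z = 1" by (simp add: z_def er_dvd)
    then show ?thesis using True by (simp add: z)
  next
    case False
    then have z1: "z \<noteq> 1" using assms er_eq_1_iff[of "int p" k] by (simp add: z_def)
    have "z ^ p = 1" using z[of p] by (simp add: er_dvd)
    then show ?thesis using False z1 by (simp add: z sum_gp_strict)
  qed
qed

text \<open>Summed over all b modulo p, the exponential sums give p times the number of zeros of Q
  modulo p in X, an integer. The class b = 0 contributes the cardinality of X, and each of the p - 1
  others contributes H.\<close>

lemma constant_exponential_sum:
  assumes p: "prime p" and X: "finite X"
    and const: "\<And>b. coprime b (int p) \<Longrightarrow> (\<Sum>x\<in>X. er (b * Q x) (int p)) = H"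
  shows "\<exists>k::int. (of_nat p - 1) * H = of_int k"
proof -
  have p0: "p > 0" "p > 1" using p prime_gt_0_nat prime_gt_1_nat by auto
  have "(\<Sum>b<p. \<Sum>x\<in>X. er (int b * Q x) (int p)) = (\<Sum>x\<in>X. if int p dvd Q x then of_nat p else 0)"
    by (subst sum.swap) (simp add: sum_er_multiples[OF p0(1)])
  also have "\<dots> = of_int (\<Sum>x\<in>X. if int p dvd Q x then int p else 0)"
    by (simp add: if_distrib[of of_int] cong: if_cong)
  finally have "(\<Sum>b<p. \<Sum>x\<in>X. er (int b * Q x) (int p)) = of_int (\<Sum>x\<in>X. if int p dvd Q x then int p else 0)" .
  moreover have "{..<p} = insert 0 {1..<p}" using p0 by auto
  then have "(\<Sum>b<p. \<Sum>x\<in>X. er (int b * Q x) (int p)) = of_nat (card X) + (\<Sum>b\<in>{1..<p}. \<Sum>x\<in>X. er (int b * Q x) (int p))"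
    by simp
  moreover have "(\<Sum>b\<in>{1..<p}. \<Sum>x\<in>X. er (int b * Q x) (int p)) = (\<Sum>b\<in>{1..<p}. H)"
  proof (intro sum.cong refl const)
    fix b assume "b \<in> {1..<p}"
    then have "\<not> p dvd b" by (auto dest: dvd_imp_le)
    then have "coprime p b" using p by (simp add: prime_imp_coprime)
    then show "coprime (int b) (int p)" by (simp add: coprime_commute)
  qed
  moreover have "(\<Sum>b\<in>{1..<p}. H) = (of_nat p - 1) * H" using p0 by (simp add: of_nat_diff)
  ultimately have "(of_nat p - 1) * H = of_int (\<Sum>x\<in>X. if int p dvd Q x then int p else 0) - of_nat (card X)"
    by (simp only: add_diff_cancel_left' eq_diff_eq add.commute)
  also have "\<dots> = of_int ((\<Sum>x\<in>X. if int p dvd Q x then int p else 0) - int (card X))"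
    by (simp only: of_int_diff of_int_of_nat_eq)
  finally show ?thesis by blast
qed

lemma coprime_prime_not_dvd:
  assumes "prime (p :: nat)" "coprime b (int p)" shows "\<not> int p dvd b"
proof
  assume "int p dvd b"
  then have "is_unit (int p)" using assms(2) coprime_common_divisor[of b "int p" "int p"] by simp
  then show False using prime_gt_1_nat[OF assms(1)] by simp
qed

text \<open>Otherwise k^2 = (p - 1)^2 p^n, where p occurs to an even power on the left and to the
  odd power n on the right.\<close>

lemma odd_prime_power_not_square:
  assumes p: "prime p" and n: "odd n" and k: "(of_nat p - 1) * H = (of_int k :: complex)"
  shows "H\<^sup>2 \<noteq> of_nat p ^ n"
proof
  assume H: "H\<^sup>2 = of_nat p ^ n"
  have p1: "p > 1" using p prime_gt_1_nat by auto
  have "(of_int (k\<^sup>2) :: complex) = ((of_nat p - 1) * H)\<^sup>2" by (simp add: k)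
  also have "\<dots> = of_int ((int p - 1)\<^sup>2 * int p ^ n)" by (simp add: power_mult_distrib H)
  finally have eq: "k\<^sup>2 = (int p - 1)\<^sup>2 * int p ^ n" by (simp only: of_int_eq_iff)
  have pe: "prime_elem (int p)" using p by (simp add: prime_imp_prime_elem)
  have k0: "k \<noteq> 0" using eq p1 by auto
  have "\<not> int p dvd int p - 1" using p1 zdvd_imp_le[of "int p" "int p - 1"] by auto
  then have m0: "multiplicity (int p) (int p - 1) = 0" by (rule not_dvd_imp_multiplicity_0)
  have "2 * multiplicity (int p) k = multiplicity (int p) (k\<^sup>2)"
    using pe k0 by (simp add: prime_elem_multiplicity_power_distrib)
  also have "\<dots> = multiplicity (int p) ((int p - 1)\<^sup>2) + multiplicity (int p) (int p ^ n)"
    unfolding eq using pe p1 by (subst prime_elem_multiplicity_mult_distrib) auto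
  also have "\<dots> = n"
    using pe p1 m0 by (simp add: prime_elem_multiplicity_power_distrib)
  finally show False using n by presburger
qed

text \<open>Pigeonhole: for 0 <= x, y <= (p - 1) / 2 the residues of x^2 and of -1 - y^2 are (p + 1)
  / 2 each, so the two sets meet.\<close>

lemma minus_one_two_squares:
  assumes p: "prime (p :: nat)" "odd p"
  shows "\<exists>\<alpha> \<beta>. int p dvd \<alpha>\<^sup>2 + \<beta>\<^sup>2 + 1"
proof -
  define m where "m = (int p - 1) div 2"
  have m: "int p = 2 * m + 1" using p(2) by (auto simp: m_def elim!: oddE)
  have m0: "m \<ge> 0" using m by simp
  have p0: "int p > 0" using m m0 by simp
  have inj: "x = y" if "x \<in> {0..m}" "y \<in> {0..m}" "int p dvd x\<^sup>2 - y\<^sup>2" for x y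
  proof -
    have "int p dvd (x - y) * (x + y)" using that(3) by (simp add: power2_eq_square algebra_simps)
    then have "int p dvd x - y \<or> int p dvd x + y"
      using p(1) by (simp add: prime_dvd_mult_iff)
    then show ?thesis
    proof
      assume "int p dvd x - y"
      then show ?thesis using that m dvd_imp_le_int[of "x - y" "int p"] by (cases "x = y") auto
    next
      assume "int p dvd x + y"
      then show ?thesis using that m dvd_imp_le_int[of "x + y" "int p"] by (cases "x + y = 0") auto
    qed
  qed
  define A B where "A = (\<lambda>x. x\<^sup>2 mod int p) ` {0..m}" and "B = (\<lambda>x. (- 1 - x\<^sup>2) mod int p) ` {0..m}"
  have "inj_on (\<lambda>x. x\<^sup>2 mod int p) {0..m}"
    by (intro inj_onI inj) (auto simp: mod_eq_dvd_iff)
  then have cA: "card A = nat (m + 1)" unfolding A_def by (subst card_image) auto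
  have "inj_on (\<lambda>x. (- 1 - x\<^sup>2) mod int p) {0..m}"
  proof (intro inj_onI inj)
    fix x y assume "(- 1 - x\<^sup>2) mod int p = (- 1 - y\<^sup>2) mod int p"
    then have "int p dvd (- 1 - x\<^sup>2) - (- 1 - y\<^sup>2)" by (simp only: mod_eq_dvd_iff)
    then show "int p dvd x\<^sup>2 - y\<^sup>2" using dvd_minus_iff[of "int p" "x\<^sup>2 - y\<^sup>2"] by (simp add: algebra_simps)
  qed auto
  then have cB: "card B = nat (m + 1)" unfolding B_def by (subst card_image) auto
  have sub: "A \<union> B \<subseteq> {0..<int p}" using p0 by (auto simp: A_def B_def)
  have "A \<inter> B \<noteq> {}"
  proof
    assume "A \<inter> B = {}"
    then have "card (A \<union> B) = card A + card B" by (intro card_Un_disjoint) (auto simp: A_def B_def)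
    moreover have "card (A \<union> B) \<le> card {0..<int p}" by (intro card_mono sub) auto
    ultimately show False using cA cB m m0 by simp
  qed
  then obtain x y where "x\<^sup>2 mod int p = (- 1 - y\<^sup>2) mod int p" by (auto simp: A_def B_def)
  then have "int p dvd x\<^sup>2 - (- 1 - y\<^sup>2)" by (simp only: mod_eq_dvd_iff)
  then have "int p dvd x\<^sup>2 + y\<^sup>2 + 1" by (simp add: algebra_simps)
  then show ?thesis by blast
qed

lemma minus_one_square:
  assumes p: "prime (p :: nat)" "p mod 4 = 1"
  shows "\<exists>i. int p dvd i\<^sup>2 + 1"
proof -
  have p2: "p > 2" using p prime_gt_1_nat[of p] by (cases "p = 2") auto
  have "even ((p - 1) div 2)" using p(2) by presburger
  then have "[Legendre (- 1) (int p) = 1] (mod int p)"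
    using euler_criterion[of p "- 1"] p(1) p2 by simp
  moreover have "\<not> [- 1 = 1] (mod int p)" "\<not> [0 = 1] (mod int p)"
    using p2 zdvd_imp_le[of "int p" 2] zdvd_imp_le[of "int p" 1] by (auto simp: cong_iff_dvd_diff)
  ultimately have "QuadRes (int p) (- 1)" by (auto simp: Legendre_def split: if_splits)
  then obtain i where "[i\<^sup>2 = - 1] (mod int p)" by (auto simp: QuadRes_def)
  then show ?thesis by (intro exI[of _ i]) (simp add: cong_iff_dvd_diff)
qed

text \<open>By Euler's criterion -1 is a nonresidue for such p: if neither b nor -b were a square,
  their odd powers of exponent (p - 1) / 2 would both be -1 and yet opposite, so p would divide
  2.\<close>

lemma square_or_minus_square:
  assumes p: "prime (p :: nat)" "p mod 4 = 3" and b: "coprime b (int p)"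
  shows "\<exists>t. int p dvd b - t\<^sup>2 \<or> int p dvd b + t\<^sup>2"
proof (rule ccontr)
  assume *: "\<not> ?thesis"
  have p2: "p > 2" using p prime_gt_1_nat[of p] by (cases "p = 2") auto
  have o: "odd ((p - 1) div 2)" using p(2) by presburger
  have nb: "\<not> int p dvd b" by (rule coprime_prime_not_dvd[OF p(1) b])
  have "\<not> QuadRes (int p) b" "\<not> QuadRes (int p) (- b)"
  proof -
    show "\<not> QuadRes (int p) b"
      using * by (auto simp: QuadRes_def cong_iff_dvd_diff dvd_diff_commute)
    show "\<not> QuadRes (int p) (- b)"
      using * by (auto simp: QuadRes_def cong_iff_dvd_diff add.commute)
  qed
  then have "Legendre b (int p) = - 1" "Legendre (- b) (int p) = - 1"
    using nb by (auto simp: Legendre_def cong_0_iff)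
  then have 1: "[- 1 = b ^ ((p - 1) div 2)] (mod int p)" "[- 1 = (- b) ^ ((p - 1) div 2)] (mod int p)"
    using euler_criterion[of p b] euler_criterion[of p "- b"] p(1) p2 by auto
  have "(- b) ^ ((p - 1) div 2) = - (b ^ ((p - 1) div 2))" using o by (simp add: power_minus_odd)
  then have "[- 1 + - 1 = b ^ ((p - 1) div 2) + - (b ^ ((p - 1) div 2))] (mod int p)"
    using 1 cong_add by metis
  then have "int p dvd 2" by (simp add: cong_iff_dvd_diff)
  then show False using p2 zdvd_imp_le[of "int p" 2] by simp
qed

lemma nondeg_dvd:
  assumes "nondeg S d" "c dvd d" "d > 0"
  shows "nondeg S c"
  unfolding nondeg_def
proof (intro allI impI)
  fix x assume x: "vdvd c (S *v x)"
  obtain m where m: "d = c * m" using assms(2) by (rule dvdE)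
  obtain y where y: "S *v x = c *s y" using x by (rule vdvdE)
  have "S *v (m *s x) = d *s y" by (simp add: matrix_vector_scale_int y m vec_eq_iff)
  then have "vdvd d (S *v (m *s x))" by simp
  then have "vdvd (c * m) (m *s x)" using assms(1) by (simp add: nondeg_def m)
  then show "vdvd c x" using assms(3) by (auto simp: vdvd_def m mult.commute[of c])
qed

text \<open>The nontrivial character modulo 4 on odd integers. On even ones the value -1 is a
  placeholder that keeps \<open>chi4_square\<close> valid everywhere.\<close>

definition chi4 :: "int \<Rightarrow> complex" where
  "chi4 d = (if d mod 4 = 1 then 1 else - 1)"

lemma chi4_square [simp]: "(chi4 d)\<^sup>2 = 1"
  by (simp add: chi4_def)

lemma chi4_mult: "odd a \<Longrightarrow> odd b \<Longrightarrow> chi4 (a * b) = chi4 a * chi4 b"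
proof -
  assume "odd a" "odd b"
  then have "a mod 4 = 1 \<or> a mod 4 = 3" "b mod 4 = 1 \<or> b mod 4 = 3" by presburger+
  then show ?thesis by (auto simp: chi4_def mod_mult_eq[of a 4 b, symmetric])
qed

lemma gauss_prime_cnj_cases:
  assumes q: "int_quad q S" and p: "prime p" "p mod 4 = 3"
  shows "cnj (gauss q 1 (int p) 0) = gauss q 1 (int p) 0 \<or> cnj (gauss q 1 (int p) 0) = - gauss q 1 (int p) 0"
proof -
  have p0: "int p > 0" "odd p" using p prime_gt_0_nat by (auto, presburger)
  obtain \<alpha> \<beta> where "int p dvd \<alpha>\<^sup>2 + \<beta>\<^sup>2 + 1" using minus_one_two_squares[OF p(1) p0(2)] by blast
  from gauss_square_real[OF q p0(1) this, of 1]
  have "(cnj (gauss q 1 (int p) 0))\<^sup>2 = (gauss q 1 (int p) 0)\<^sup>2"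
    by (simp only: gauss_uminus)
  then show ?thesis by (simp only: power2_eq_iff)
qed

lemma gauss_of_square:
  assumes "int_quad q S" "p > 0" "coprime t p" "p dvd b - t\<^sup>2"
  shows "gauss q b p 0 = gauss q 1 p 0"
  using gauss_cong[OF assms(4), of q] gauss_square_unit[OF assms(1-3), of 1] by simp

lemma gauss_of_minus_square:
  assumes "int_quad q S" "p > 0" "coprime t p" "p dvd b + t\<^sup>2"
  shows "gauss q b p 0 = cnj (gauss q 1 p 0)"
proof -
  have "p dvd b - (- 1) * t\<^sup>2" using assms(4) by simp
  from gauss_cong[OF this, of q] show ?thesis
    using gauss_square_unit[OF assms(1-3), of "- 1"] gauss_uminus[of q 1 p] by simp
qed

text \<open>Modulo p the unit b is a square or minus a square, and which alternative holds depends
  on b alone. It is therefore shared by all forms of any rank, and \<open>gauss_prime_3\<close>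
  applies it to two forms at once.\<close>

lemma gauss_prime_reduce:
  assumes q: "int_quad q S" and p: "prime p" "p mod 4 = 3" and b: "coprime b (int p)"
  shows "gauss q b (int p) 0 = gauss q 1 (int p) 0 \<and> (\<forall>q' S'. int_quad q' S' \<longrightarrow> gauss q' b (int p) 0 = gauss q' 1 (int p) (0 :: int ^ 'k)) \<or>
     gauss q b (int p) 0 = cnj (gauss q 1 (int p) 0) \<and> (\<forall>q' S'. int_quad q' S' \<longrightarrow> gauss q' b (int p) 0 = cnj (gauss q' 1 (int p) (0 :: int ^ 'k)))"
proof -
  have p0: "int p > 0" using p prime_gt_0_nat by auto
  obtain t where t: "int p dvd b - t\<^sup>2 \<or> int p dvd b + t\<^sup>2" using square_or_minus_square[OF p b] by blast
  have "\<not> int p dvd t"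
  proof
    assume "int p dvd t"
    then have "int p dvd t\<^sup>2" by (simp add: power2_eq_square)
    then have "int p dvd (b - t\<^sup>2) + t\<^sup>2 \<or> int p dvd (b + t\<^sup>2) - t\<^sup>2"
      using t dvd_add dvd_diff by blast
    then show False using coprime_prime_not_dvd[OF p(1) b] by simp
  qed
  then have "coprime (int p) t" using p(1) by (intro prime_imp_coprime) auto
  then have ct: "coprime t (int p)" by (simp add: coprime_commute)
  from t show ?thesis
  proof
    assume *: "int p dvd b - t\<^sup>2"
    show ?thesis
      by (intro disjI1 conjI allI impI) (auto intro: gauss_of_square[OF _ p0 ct *] q)
  next
    assume *: "int p dvd b + t\<^sup>2"
    show ?thesis
      by (intro disjI2 conjI allI impI) (auto intro: gauss_of_minus_square[OF _ p0 ct *] q)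
  qed
qed

text \<open>Otherwise \<open>p - 1\<close> times the Gauss sum would be an integer, although its square is an odd power of \<open>p\<close>.\<close>

lemma gauss_prime_3_odd:
  assumes q: "int_quad (q :: int ^ 'n \<Rightarrow> int) S" and p: "prime p" "p mod 4 = 3" and S: "nondeg S (int p)"
    and n: "odd CARD('n)"
  shows "cnj (gauss q 1 (int p) 0) = - gauss q 1 (int p) 0"
proof (rule ccontr)
  define g where "g = gauss q 1 (int p) 0"
  have p0: "int p > 0" using p prime_gt_0_nat by auto
  assume "\<not> ?thesis"
  then have g: "cnj g = g" using gauss_prime_cnj_cases[OF q p] by (auto simp: g_def)
  have "\<exists>k::int. (of_nat p - 1) * g = of_int k"
  proof (rule constant_exponential_sum[OF p(1) finite_residues])
    fix b assume "coprime b (int p)"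
    from gauss_prime_reduce[OF q p this] g show "(\<Sum>x\<in>vresidues (int p). er (b * q x) (int p)) = g"
      by (auto simp: g_def gauss_0_def)
  qed
  then obtain k :: int where k: "(of_nat p - 1) * g = of_int k" ..
  have "g\<^sup>2 = g * cnj g" by (simp add: g power2_eq_square)
  also have "\<dots> = of_nat p ^ CARD('n)"
    using gauss_norm[OF q p0, of 1] S by (simp add: g_def)
  finally show False using odd_prime_power_not_square[OF p(1) n k] by simp
qed

text \<open>Even rank is reduced to odd rank by adjoining the form x^2 in one variable, whose Gauss
  sum is purely imaginary. Were g imaginary too, g times this sum would be unchanged under
  conjugation, hence independent of b, and its square would be p^(n + 1), an odd power.\<close>

lemma gauss_prime_3:
  assumes q: "int_quad (q :: int ^ 'n \<Rightarrow> int) S" and p: "prime p" "p mod 4 = 3" and S: "nondeg S (int p)"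
  shows "cnj (gauss q 1 (int p) 0) = (- 1) ^ CARD('n) * gauss q 1 (int p) 0"
proof (cases "odd CARD('n)")
  case True
  then show ?thesis using gauss_prime_3_odd[OF q p S] by simp
next
  case even: False
  define q1 :: "int ^ 1 \<Rightarrow> int" where "q1 = (\<lambda>x. (x $ 1)\<^sup>2)"
  have q1: "int_quad q1 (mat 2)"
    unfolding int_quad_def transpose_mat
    by (simp add: q1_def idot_def matrix_vector_mult_def mat_def power2_eq_square algebra_simps)
  have p0: "int p > 0" using p prime_gt_0_nat by auto
  have "coprime 2 (int p)" using p(2) by (subst coprime_left_2_iff_odd) presburger
  then have S1: "nondeg (mat 2 :: int ^ 1 ^ 1) (int p)"
    by (auto simp: nondeg_def vdvd_def matrix_vector_mult_def mat_def coprime_dvd_mult_right_iff coprime_commute)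
  define g g1 where "g = gauss q 1 (int p) 0" and "g1 = gauss q1 1 (int p) 0"
  have g1: "cnj g1 = - g1"
    unfolding g1_def by (rule gauss_prime_3_odd[OF q1 p S1]) simp
  have "cnj g = g"
  proof (rule ccontr)
    assume "cnj g \<noteq> g"
    then have g: "cnj g = - g" using gauss_prime_cnj_cases[OF q p] by (auto simp: g_def)
    have "\<exists>k::int. (of_nat p - 1) * (g * g1) = of_int k"
    proof (rule constant_exponential_sum[OF p(1), where X = "vresidues (int p) \<times> vresidues (int p)"])
      fix b assume b: "coprime b (int p)"
      have "(\<Sum>x\<in>vresidues (int p) \<times> vresidues (int p). er (b * (q (fst x) + q1 (snd x))) (int p))
        = gauss q b (int p) 0 * gauss q1 b (int p) 0"
        by (simp add: gauss_0_def sum_product sum.cartesian_product case_prod_unfold er_add distrib_left)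
      also have "\<dots> = g * g1"
        using gauss_prime_reduce[OF q p b] q1 g g1 by (auto simp: g_def g1_def)
      finally show "(\<Sum>x\<in>vresidues (int p) \<times> vresidues (int p). er (b * (q (fst x) + q1 (snd x))) (int p)) = g * g1" .
    qed auto
    then obtain k :: int where k: "(of_nat p - 1) * (g * g1) = of_int k" ..
    have "(g * g1)\<^sup>2 = (g * cnj g) * (g1 * cnj g1)" by (simp add: g g1 power2_eq_square)
    also have "\<dots> = of_nat p ^ (CARD('n) + 1)"
      using gauss_norm[OF q p0, of 1] gauss_norm[OF q1 p0, of 1] S S1 by (simp add: g_def g1_def)
    finally show False using odd_prime_power_not_square[OF p(1) _ k, of "CARD('n) + 1"] even by simp
  qed
  then show ?thesis using even by (simp add: g_def)
qed

text \<open>The square is the squared absolute value p^n up to the sign that conjugation produces.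
  If p is 1 modulo 4, then -1 is a square and the sum is real; otherwise
  \<open>gauss_prime_3\<close> gives the sign (-1)^n.\<close>

lemma gauss_prime:
  assumes q: "int_quad (q :: int ^ 'n \<Rightarrow> int) S" and p: "prime p" "odd p" and S: "nondeg S (int p)"
    and b: "coprime b (int p)"
  shows "(gauss q b (int p) 0)\<^sup>2 = (chi4 (int p) * of_nat p) ^ CARD('n)"
proof -
  have p0: "int p > 0" using p prime_gt_0_nat by auto
  note N = gauss_norm[OF q p0 b S]
  have "p mod 4 = 1 \<or> p mod 4 = 3" using p(2) by presburger
  then show ?thesis
  proof
    assume 1: "p mod 4 = 1"
    then obtain i where i: "int p dvd i\<^sup>2 + 1" using minus_one_square[OF p(1)] by blast
    have "\<not> int p dvd i"
    proof
      assume "int p dvd i"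
      then have "int p dvd (i\<^sup>2 + 1) - i\<^sup>2" using i by (intro dvd_diff) (auto simp: power2_eq_square)
      then show False using prime_gt_1_nat[OF p(1)] by simp
    qed
    then have "coprime (int p) i" using p(1) by (intro prime_imp_coprime) auto
    then have ci: "coprime i (int p)" by (simp add: coprime_commute)
    have "gauss q (- b) (int p) 0 = gauss q (b * i\<^sup>2) (int p) 0"
    proof (rule gauss_cong)
      have "int p dvd (- b) * (i\<^sup>2 + 1)" using i by (rule dvd_mult)
      then show "int p dvd - b - b * i\<^sup>2" by (simp add: algebra_simps)
    qed
    also have "\<dots> = gauss q b (int p) 0" by (rule gauss_square_unit[OF q p0 ci])
    finally have "cnj (gauss q b (int p) 0) = gauss q b (int p) 0" by (simp add: gauss_uminus)
    moreover have "int p mod 4 = 1" using 1 by presburger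
    ultimately show ?thesis using N by (simp add: power2_eq_square chi4_def)
  next
    assume 3: "p mod 4 = 3"
    have "cnj (gauss q b (int p) 0) = (- 1) ^ CARD('n) * gauss q b (int p) 0"
      using gauss_prime_reduce[OF q p(1) 3 b, where ?'k = 'n] gauss_prime_3[OF q p(1) 3 S] by (cases "even CARD('n)") auto
    then have "gauss q b (int p) 0 = (- 1) ^ CARD('n) * cnj (gauss q b (int p) 0)"
      by (cases "even CARD('n)") auto
    then have "(gauss q b (int p) 0)\<^sup>2 = (- 1) ^ CARD('n) * (gauss q b (int p) 0 * cnj (gauss q b (int p) 0))"
      unfolding power2_eq_square by (metis mult.left_commute)
    moreover have "chi4 (int p) = - 1" using 3 by (simp add: chi4_def) presburger
    ultimately show ?thesis unfolding N by (simp add: power_mult_distrib[symmetric])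
  qed
qed

text \<open>Write r = s + p m t. The sum over t is a character sum modulo p that kills every s not
  divisible by p and gives p^n for the others; for s = p x the factor p^2 cancels against the
  modulus.\<close>

lemma gauss_prime_power_reduce:
  assumes q: "int_quad (q :: int ^ 'n \<Rightarrow> int) S" and p: "p > 0" "m > 0" and S: "nondeg S p" and b: "coprime b p"
  shows "gauss q b (p * m * p) 0 = of_int p ^ CARD('n) * gauss q b m 0"
proof -
  let ?k = "p * m"
  have k: "?k > 0" using p by simp
  have "gauss q b (?k * p) 0 = (\<Sum>s\<in>vresidues ?k. \<Sum>t\<in>vresidues p. er (b * q (s + ?k *s t)) (?k * p))"
    unfolding gauss_0_def by (rule sum_residues_prod[OF k p(1)])
  also have "\<dots> = (\<Sum>s\<in>vresidues ?k. er (b * q s) (?k * p) * (\<Sum>t\<in>vresidues p. er (idot t (b *s (S *v s))) p))"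
  proof (intro sum.cong refl)
    fix s :: "int ^ 'n"
    have "er (b * q (s + ?k *s t)) (?k * p) = er (b * q s) (?k * p) * er (idot t (b *s (S *v s))) p" for t
    proof -
      have "b * q (s + ?k *s t) = b * q s + ?k * idot t (b *s (S *v s)) + (?k * p) * (b * m * q t)"
        by (simp add: int_quad_add_scale[OF q] idot_sym[OF int_quad_sym[OF q], of s t] idot_scale_right power2_eq_square algebra_simps)
      moreover have "er (?k * idot t (b *s (S *v s))) (?k * p) = er (idot t (b *s (S *v s))) p"
        using p by (intro er_mult_cancel) simp
      moreover have "er ((?k * p) * (b * m * q t)) (?k * p) = 1" by (rule er_dvd) simp
      ultimately show ?thesis by (simp add: er_add)
    qed
    then show "(\<Sum>t\<in>vresidues p. er (b * q (s + ?k *s t)) (?k * p)) = er (b * q s) (?k * p) * (\<Sum>t\<in>vresidues p. er (idot t (b *s (S *v s))) p)"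
      by (simp add: sum_distrib_left)
  qed
  also have "\<dots> = (\<Sum>s\<in>vresidues ?k. if vdvd p s then er (b * q s) (?k * p) * of_int p ^ CARD('n) else 0)"
  proof (intro sum.cong refl)
    fix s :: "int ^ 'n"
    have "vdvd p (b *s (S *v s)) \<longleftrightarrow> vdvd p s"
    proof
      assume "vdvd p (b *s (S *v s))"
      then have "vdvd p (S *v s)" by (rule vdvd_coprime_scale[OF b])
      then show "vdvd p s" using S by (simp add: nondeg_def)
    next
      assume "vdvd p s"
      then obtain x where "s = p *s x" by (rule vdvdE)
      then show "vdvd p (b *s (S *v s))" by (simp add: matrix_vector_scale_int vdvd_def)
    qed
    then show "er (b * q s) (?k * p) * (\<Sum>t\<in>vresidues p. er (idot t (b *s (S *v s))) p) =
        (if vdvd p s then er (b * q s) (?k * p) * of_int p ^ CARD('n) else 0)"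
      unfolding sum_er_idot[OF p(1)] by simp
  qed
  also have "\<dots> = (\<Sum>s\<in>{s\<in>vresidues ?k. vdvd p s}. er (b * q s) (?k * p) * of_int p ^ CARD('n))"
    by (simp add: sum.inter_filter)
  also have "\<dots> = (\<Sum>x\<in>vresidues m. er (b * q (p *s x)) (?k * p) * of_int p ^ CARD('n))"
  proof (rule sum.reindex_bij_betw[symmetric])
    show "bij_betw (\<lambda>x :: int ^ 'n. p *s x) (vresidues m) {s \<in> vresidues ?k. vdvd p s}"
    proof (rule bij_betwI[of _ _ _ "\<lambda>s. \<chi> i. s $ i div p"])
      show "(\<lambda>x :: int ^ 'n. p *s x) \<in> vresidues m \<rightarrow> {s \<in> vresidues ?k. vdvd p s}"
        using p by (auto simp: vresidues_def)
      show "(\<lambda>s :: int ^ 'n. \<chi> i. s $ i div p) \<in> {s \<in> vresidues ?k. vdvd p s} \<rightarrow> vresidues m"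
      proof safe
        fix s :: "int ^ 'n" assume s: "s \<in> vresidues ?k" "vdvd p s"
        then obtain x where x: "s = p *s x" by (elim vdvdE)
        then show "(\<chi> i. s $ i div p) \<in> vresidues m"
          using s(1) p by (simp add: vresidues_def zero_le_mult_iff)
      qed
    qed (use p in \<open>auto simp: vec_eq_iff vdvd_def\<close>)
  qed
  also have "\<dots> = (\<Sum>x\<in>vresidues m. er (b * q x) m * of_int p ^ CARD('n))"
  proof (intro sum.cong refl)
    fix x
    have "er (b * q (p *s x)) (?k * p) = er ((p * p) * (b * q x)) ((p * p) * m)"
      by (simp add: int_quad_scale[OF q] power2_eq_square mult_ac)
    also have "\<dots> = er (b * q x) m" using p by (intro er_mult_cancel) simp
    finally show "er (b * q (p *s x)) (?k * p) * of_int p ^ CARD('n) = er (b * q x) m * of_int p ^ CARD('n)" by simp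
  qed
  finally show ?thesis by (simp add: gauss_0_def sum_distrib_left mult.commute)
qed

text \<open>With r = k s + p t the cross term of the quadratic form is divisible by the modulus p k,
  so the exponential factors.\<close>

lemma gauss_coprime_product:
  assumes q: "int_quad (q :: int ^ 'n \<Rightarrow> int) S" and pk: "p > 0" "k > 0" "coprime p k"
  shows "gauss q b (p * k) 0 = gauss q (b * k) p 0 * gauss q (b * p) k 0"
proof -
  have "gauss q b (p * k) 0 = (\<Sum>s\<in>vresidues p. \<Sum>t\<in>vresidues k. er (b * q (k *s s + p *s t)) (p * k))"
    unfolding gauss_0_def by (rule sum_residues_crt[OF pk er_quad_cong[OF q]])
  also have "\<dots> = (\<Sum>s\<in>vresidues p. \<Sum>t\<in>vresidues k. er (b * k * q s) p * er (b * p * q t) k)"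
  proof (intro sum.cong refl)
    fix s t :: "int ^ 'n"
    have "b * q (k *s s + p *s t) = k * (b * k * q s) + p * (b * p * q t) + (p * k) * (b * idot s (S *v t))"
      by (simp add: int_quad_add_scale[OF q] int_quad_scale[OF q] idot_scale_left power2_eq_square algebra_simps)
    moreover have "er (k * (b * k * q s)) (p * k) = er (b * k * q s) p"
      using er_mult_cancel[of k "b * k * q s" p] pk by (simp add: mult.commute)
    moreover have "er (p * (b * p * q t)) (p * k) = er (b * p * q t) k"
      using pk by (intro er_mult_cancel) simp
    moreover have "er ((p * k) * (b * idot s (S *v t))) (p * k) = 1" by (rule er_dvd) simp
    ultimately show "er (b * q (k *s s + p *s t)) (p * k) = er (b * k * q s) p * er (b * p * q t) k"
      by (simp add: er_add)
  qed
  finally show ?thesis by (simp add: gauss_0_def sum_product)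
qed

text \<open>For a prime divisor p of d, remove the factor p^2 if p divides d / p, and split off p by
  coprimality otherwise. The right-hand side follows suit, as \<open>chi4\<close> is multiplicative
  on odd numbers and 1 on their squares.\<close>

theorem gauss_square:
  assumes q: "int_quad (q :: int ^ 'n \<Rightarrow> int) S"
  shows "odd d \<Longrightarrow> nondeg S (int d) \<Longrightarrow> coprime b (int d) \<Longrightarrow>
    (gauss q b (int d) 0)\<^sup>2 = (chi4 (int d) * of_nat d) ^ CARD('n)"
proof (induction d arbitrary: b rule: less_induct)
  case (less d)
  have d0: "d > 0" using less.prems(1) by (cases d) auto
  show ?case
  proof (cases "d = 1")
    case True
    then show ?thesis by (simp add: gauss_0_def residues_1 int_quad_0[OF q] chi4_def)
  next
    case False
    then obtain p where p: "prime p" "p dvd d" using prime_factor_nat by blast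
    then obtain k where k: "d = p * k" by (auto elim!: dvdE)
    have p0: "p > 1" "k > 0" "odd p" "odd k" using p k d0 less.prems(1) prime_gt_1_nat by auto
    have cb: "coprime b (int p)" "coprime b (int k)" using less.prems(3) by (auto simp: k)
    have Sp: "nondeg S (int p)" "nondeg S (int k)"
      using d0 by (auto intro!: nondeg_dvd[OF less.prems(2)] simp: k)
    show ?thesis
    proof (cases "p dvd k")
      case True
      then obtain m where m: "k = p * m" by (rule dvdE)
      have m0: "m > 0" "odd m" using p0 m by auto
      have "nondeg S (int m)" using p0 by (intro nondeg_dvd[OF Sp(2)]) (auto simp: m)
      moreover have "coprime b (int m)" using cb by (simp add: m)
      moreover have "1 * m < (p * p) * m"
        using p0 m0 less_1_mult[of p p] by (intro mult_strict_right_mono) auto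
      then have "m < d" by (simp add: k m mult.assoc)
      ultimately have IH: "(gauss q b (int m) 0)\<^sup>2 = (chi4 (int m) * of_nat m) ^ CARD('n)"
        using m0 by (intro less.IH) auto
      have "gauss q b (int d) 0 = of_nat p ^ CARD('n) * gauss q b (int m) 0"
        using gauss_prime_power_reduce[OF q, of "int p" "int m" b] p0 m0 Sp cb by (simp add: k m mult_ac)
      then have "(gauss q b (int d) 0)\<^sup>2 = (of_nat p ^ CARD('n))\<^sup>2 * (chi4 (int m) * of_nat m) ^ CARD('n)"
        by (simp add: power_mult_distrib IH)
      also have "\<dots> = ((of_nat p)\<^sup>2 * (chi4 (int m) * of_nat m)) ^ CARD('n)"
        by (simp add: power_mult_distrib flip: power_mult) (simp add: mult.commute)
      finally have pow: "(gauss q b (int d) 0)\<^sup>2 = ((of_nat p)\<^sup>2 * (chi4 (int m) * of_nat m)) ^ CARD('n)" .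
      have "chi4 (int d) = chi4 (int p) * (chi4 (int p) * chi4 (int m))"
        using p0 m0 by (simp add: k m chi4_mult)
      then have "chi4 (int d) = (chi4 (int p))\<^sup>2 * chi4 (int m)" by (simp add: power2_eq_square del: chi4_square)
      then have "chi4 (int d) = chi4 (int m)" by simp
      then have "(of_nat p)\<^sup>2 * (chi4 (int m) * of_nat m) = chi4 (int d) * of_nat d"
        by (simp add: k m power2_eq_square mult_ac)
      with pow show ?thesis by simp
    next
      case False
      then have cpk: "coprime (int p) (int k)" using p(1) by (simp add: prime_imp_coprime)
      have c1: "coprime (b * int k) (int p)" "coprime (b * int p) (int k)"
        using cb cpk by (auto simp: coprime_commute)
      have "k < d" using p0 by (simp add: k)
      then have IH: "(gauss q (b * int p) (int k) 0)\<^sup>2 = (chi4 (int k) * of_nat k) ^ CARD('n)"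
        using p0 Sp c1 by (intro less.IH) auto
      have "gauss q b (int d) 0 = gauss q (b * int k) (int p) 0 * gauss q (b * int p) (int k) 0"
        using gauss_coprime_product[OF q, of "int p" "int k" b] p0 cpk by (simp add: k)
      then have "(gauss q b (int d) 0)\<^sup>2 = (chi4 (int p) * of_nat p) ^ CARD('n) * (chi4 (int k) * of_nat k) ^ CARD('n)"
        by (simp add: power_mult_distrib IH gauss_prime[OF q p(1) p0(3) Sp(1) c1(1)])
      also have "\<dots> = (chi4 (int p) * of_nat p * (chi4 (int k) * of_nat k)) ^ CARD('n)"
        by (simp add: power_mult_distrib)
      also have "chi4 (int p) * of_nat p * (chi4 (int k) * of_nat k) = chi4 (int d) * of_nat d"
        using p0 by (simp add: k chi4_mult)
      finally show ?thesis .
    qed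
  qed
qed

lemma nondeg_coprime:
  assumes "S' ** S = mat N" "coprime N d"
  shows "nondeg S d"
  unfolding nondeg_def
proof (intro allI impI)
  fix x assume "vdvd d (S *v x)"
  then obtain y where "S *v x = d *s y" by (rule vdvdE)
  then have "d *s (S' *v y) = mat N *v x"
    by (metis matrix_vector_scale_int matrix_vector_mul_assoc assms(1))
  also have "mat N *v x = N *s x"
    by (simp add: mat_def matrix_vector_mult_def vec_eq_iff if_distrib[of "\<lambda>x. x * _"] cong: if_cong)
  finally have "vdvd d (N *s x)" by (metis vdvd_scale)
  then show "vdvd d x" by (rule vdvd_coprime_scale[OF assms(2)])
qed

text \<open>An odd level would give a rational Gauss sum modulo 2 whose square is an odd power of 2.\<close>

lemma odd_rank_even_level:
  assumes q: "int_quad (q :: int ^ 'n \<Rightarrow> int) S" and S: "S' ** S = mat N" and n: "odd CARD('n)"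
  shows "even N"
proof (rule ccontr)
  assume "odd N"
  then have "coprime N 2" by simp
  then have nd: "nondeg S 2" by (rule nondeg_coprime[OF S])
  define g where "g = gauss q 1 2 0"
  \<comment> \<open>For p = 2 the factor p - 1 is 1, kept in the shape that
    \<open>odd_prime_power_not_square\<close> expects. The roots of unity are 1 and -1, so g is an
    integer.\<close>
  have "\<exists>k::int. (of_nat 2 - 1) * g = of_int k"
  proof -
    have "er k 2 = of_int (if even k then 1 else - 1)" for k
    proof (cases "even k")
      case False
      then obtain m where "k = 2 * m + 1" by (elim oddE)
      then have "er k 2 = er 1 2" by (intro er_cong) simp
      also have "er 1 2 = - 1" using exp_pi_i' by (simp add: er_def e_def mult.commute)
      finally show ?thesis using False by simp
    qed (simp add: er_dvd)
    then have "g = of_int (\<Sum>r\<in>vresidues 2. if even (q r) then 1 else - 1)"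
      by (simp add: g_def gauss_0_def)
    then show ?thesis by (intro exI[of _ "\<Sum>r\<in>vresidues 2. if even (q r) then 1 else - 1"]) simp
  qed
  then obtain k :: int where k: "(of_nat 2 - 1) * g = of_int k" ..
  then have "cnj g = g" by simp
  then have "g\<^sup>2 = g * cnj g" by (simp add: power2_eq_square)
  also have "\<dots> = of_nat 2 ^ CARD('n)"
    using gauss_norm[OF q, of 2 1] nd by (simp add: g_def)
  finally show False using odd_prime_power_not_square[OF two_is_prime_nat n k] by simp
qed

subsection \<open>Wronskian determinants\<close>

definition wronskian :: "nat \<Rightarrow> (nat \<Rightarrow> complex \<Rightarrow> complex) \<Rightarrow> complex \<Rightarrow> complex" where
  "wronskian m f z = Determinant.det (Matrix.mat m m (\<lambda>(k, j). (D ^^ k) (f j) z))"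

lemma D_holomorphic: "open S \<Longrightarrow> f holomorphic_on S \<Longrightarrow> D f holomorphic_on S"
  unfolding D_def by (intro holomorphic_intros holomorphic_deriv) auto

lemma D_funpow_holomorphic: "open S \<Longrightarrow> f holomorphic_on S \<Longrightarrow> (D ^^ k) f holomorphic_on S"
  by (induction k) (auto intro: D_holomorphic)

lemma DERIV_D:
  assumes "open S" "f holomorphic_on S" "z \<in> S"
  shows "(f has_field_derivative 2 * of_real pi * \<i> * D f z) (at z)"
  using holomorphic_derivI[OF assms(2,1,3)] by (simp add: D_def)

lemma D_eqI: "(f has_field_derivative 2 * of_real pi * \<i> * d) (at z) \<Longrightarrow> D f z = d"
  by (simp add: D_def DERIV_imp_deriv)

lemma D_zero [simp]: "D (\<lambda>z. 0) = (\<lambda>z. 0)"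
  by (simp add: D_def fun_eq_iff)

lemma det_mat_holomorphic:
  assumes "\<And>i j. i < n \<Longrightarrow> j < n \<Longrightarrow> (\<lambda>z. a z i j) holomorphic_on S"
  shows "(\<lambda>z. Determinant.det (Matrix.mat n n (\<lambda>(i, j). a z i j))) holomorphic_on S"
proof -
  have eq: "Determinant.det (Matrix.mat n n (\<lambda>(i, j). a z i j)) =
      (\<Sum>p\<in>{p. p permutes {0..<n}}. signof p * (\<Prod>i=0..<n. a z i (p i)))" for z
    unfolding Determinant.det_def
    by (auto intro!: sum.cong prod.cong simp: permutes_in_image)
  show ?thesis
    unfolding eq
    by (intro holomorphic_intros assms) (auto simp: permutes_in_image)
qed

lemma det_mat_bounded:
  assumes "\<And>i j. i < n \<Longrightarrow> j < n \<Longrightarrow> \<exists>K. \<forall>z\<in>S. norm (a z i j) \<le> K"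
  shows "\<exists>K. \<forall>z\<in>S. norm (Determinant.det (Matrix.mat n n (\<lambda>(i, j). a z i j)) :: complex) \<le> K"
proof -
  have eq: "Determinant.det (Matrix.mat n n (\<lambda>(i, j). a z i j)) =
      (\<Sum>p\<in>{p. p permutes {0..<n}}. signof p * (\<Prod>i=0..<n. a z i (p i)))" for z
    unfolding Determinant.det_def
    by (auto intro!: sum.cong prod.cong simp: permutes_in_image)
  from assms obtain K where K: "\<And>i j z. i < n \<Longrightarrow> j < n \<Longrightarrow> z \<in> S \<Longrightarrow> norm (a z i j) \<le> K i j" by metis
  have "norm (Determinant.det (Matrix.mat n n (\<lambda>(i, j). a z i j))) \<le> (\<Sum>p\<in>{p. p permutes {0..<n}}. \<Prod>i=0..<n. K i (p i))"
    if "z \<in> S" for z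
    unfolding eq
  proof (rule sum_norm_le)
    fix p assume p: "p \<in> {p. p permutes {0..<n}}"
    have "norm (signof p * (\<Prod>i=0..<n. a z i (p i))) = (\<Prod>i=0..<n. norm (a z i (p i)))"
      by (simp add: norm_mult prod_norm sign_def)
    also have "\<dots> \<le> (\<Prod>i=0..<n. K i (p i))"
      using p that by (intro prod_mono conjI K) (auto simp: permutes_in_image)
    finally show "norm (signof p * (\<Prod>i=0..<n. a z i (p i))) \<le> (\<Prod>i=0..<n. K i (p i))" .
  qed
  then show ?thesis by blast
qed

lemma wronskian_holomorphic:
  assumes "open S" "\<And>j. j < m \<Longrightarrow> f j holomorphic_on S"
  shows "wronskian m f holomorphic_on S"
  unfolding wronskian_def using det_mat_holomorphic[of m "\<lambda>z k j. (D ^^ k) (f j) z"] assms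
  by (simp add: D_funpow_holomorphic)

text \<open>Row operations: differentiating \<open>f (\<phi> z) = g z * F z\<close>, where \<open>\<phi>' = 1 / l\<^sup>2\<close>, expresses the
  \<open>k\<close>-th derivative of \<open>f\<close> at \<open>\<phi> z\<close> through the derivatives of \<open>F\<close> of order at most \<open>k\<close>.\<close>

primrec transfer_coeff :: "(complex \<Rightarrow> complex) \<Rightarrow> (complex \<Rightarrow> complex) \<Rightarrow> nat \<Rightarrow> nat \<Rightarrow> complex \<Rightarrow> complex" where
  "transfer_coeff g l 0 = (\<lambda>i. if i = 0 then g else (\<lambda>z. 0))"
| "transfer_coeff g l (Suc k) = (\<lambda>i z. (l z)\<^sup>2 *
     (D (transfer_coeff g l k i) z + (if i = 0 then 0 else transfer_coeff g l k (i - 1) z)))"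

lemma transfer_coeff_0: "k < i \<Longrightarrow> transfer_coeff g l k i = (\<lambda>z. 0)"
  by (induction k arbitrary: i) auto

lemma transfer_coeff_diag: "transfer_coeff g l k k z = (l z) ^ (2 * k) * g z"
  by (induction k) (simp_all add: transfer_coeff_0 power2_eq_square mult_ac)

lemma transfer_coeff_holomorphic:
  assumes "open S" "g holomorphic_on S" "l holomorphic_on S"
  shows "transfer_coeff g l k i holomorphic_on S"
proof (induction k arbitrary: i)
  case (Suc k)
  show ?case
    by (cases "i = 0") (auto intro!: holomorphic_intros assms D_holomorphic Suc.IH)
qed (use assms in auto)

lemma transfer_derivatives:
  assumes S: "open S" and hol: "f holomorphic_on S" "F holomorphic_on S" "g holomorphic_on S" "l holomorphic_on S"
    and \<phi>: "\<And>z. z \<in> S \<Longrightarrow> \<phi> z \<in> S" "\<And>z. z \<in> S \<Longrightarrow> (\<phi> has_field_derivative 1 / (l z)\<^sup>2) (at z)"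
    and l: "\<And>z. z \<in> S \<Longrightarrow> l z \<noteq> 0"
    and eq: "\<And>z. z \<in> S \<Longrightarrow> f (\<phi> z) = g z * F z"
    and z: "z \<in> S"
  shows "(D ^^ k) f (\<phi> z) = (\<Sum>i\<le>k. transfer_coeff g l k i z * (D ^^ i) F z)"
  using z
proof (induction k arbitrary: z)
  case 0
  then show ?case by (simp add: eq)
next
  case (Suc k)
  let ?c = "transfer_coeff g l k"
  have D1: "D (\<lambda>z. (D ^^ k) f (\<phi> z)) z = D ((D ^^ k) f) (\<phi> z) / (l z)\<^sup>2"
    by (rule D_eqI, rule DERIV_cong[OF DERIV_chain2[OF DERIV_D[OF S D_funpow_holomorphic[OF S hol(1)] \<phi>(1)[OF Suc.prems]] \<phi>(2)[OF Suc.prems]]]) simp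
  have "D (\<lambda>z. \<Sum>i\<le>k. ?c i z * (D ^^ i) F z) z =
     (\<Sum>i\<le>k. D (?c i) z * (D ^^ i) F z + ?c i z * (D ^^ Suc i) F z)"
  proof (rule D_eqI, rule DERIV_cong[OF DERIV_sum])
    fix i assume "i \<in> {..k}"
    show "((\<lambda>z. ?c i z * (D ^^ i) F z) has_field_derivative 2 * of_real pi * \<i> * D (?c i) z * (D ^^ i) F z
        + 2 * of_real pi * \<i> * D ((D ^^ i) F) z * ?c i z) (at z)"
      by (intro DERIV_mult DERIV_D[OF S] transfer_coeff_holomorphic[OF S hol(3,4)] D_funpow_holomorphic[OF S hol(2)] Suc.prems)
  qed (simp add: sum_distrib_left distrib_left mult_ac)
  also have "\<dots> = (\<Sum>i\<le>Suc k. D (?c i) z * (D ^^ i) F z) + (\<Sum>i\<le>Suc k. (if i = 0 then 0 else ?c (i - 1) z) * (D ^^ i) F z)"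
  proof -
    have "(\<Sum>i\<le>Suc k. D (?c i) z * (D ^^ i) F z) = (\<Sum>i\<le>k. D (?c i) z * (D ^^ i) F z)"
      by (simp add: transfer_coeff_0)
    moreover have "(\<Sum>i\<le>Suc k. (if i = 0 then 0 else ?c (i - 1) z) * (D ^^ i) F z) = (\<Sum>i\<le>k. ?c i z * (D ^^ Suc i) F z)"
      unfolding sum.atMost_Suc_shift by simp
    ultimately show ?thesis by (simp only: sum.distrib)
  qed
  also have "D (\<lambda>z. \<Sum>i\<le>k. ?c i z * (D ^^ i) F z) z = D (\<lambda>z. (D ^^ k) f (\<phi> z)) z"
    by (rule D_cong_open[OF S _ Suc.prems]) (simp add: Suc.IH)
  finally have "(D ^^ Suc k) f (\<phi> z) = (l z)\<^sup>2 * ((\<Sum>i\<le>Suc k. D (?c i) z * (D ^^ i) F z) + (\<Sum>i\<le>Suc k. (if i = 0 then 0 else ?c (i - 1) z) * (D ^^ i) F z))"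
    using l[OF Suc.prems] by (simp add: D1 field_simps)
  also have "\<dots> = (\<Sum>i\<le>Suc k. transfer_coeff g l (Suc k) i z * (D ^^ i) F z)"
    by (simp only: sum.distrib[symmetric] sum_distrib_left transfer_coeff.simps distrib_right mult.assoc distrib_left)
  finally show ?case .
qed

text \<open>By \<open>transfer_derivatives\<close> the matrix at \<phi> z is a lower triangular
  matrix times the matrix of the F j at z. Its diagonal entries l^(2 k) g multiply to l^(m (m - 1))
  g^m.\<close>

lemma wronskian_transfer:
  assumes S: "open S" and hol: "\<And>j. j < m \<Longrightarrow> f j holomorphic_on S" "\<And>j. j < m \<Longrightarrow> F j holomorphic_on S" "g holomorphic_on S" "l holomorphic_on S"
    and \<phi>: "\<And>z. z \<in> S \<Longrightarrow> \<phi> z \<in> S" "\<And>z. z \<in> S \<Longrightarrow> (\<phi> has_field_derivative 1 / (l z)\<^sup>2) (at z)"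
    and l: "\<And>z. z \<in> S \<Longrightarrow> l z \<noteq> 0"
    and eq: "\<And>j z. j < m \<Longrightarrow> z \<in> S \<Longrightarrow> f j (\<phi> z) = g z * F j z"
    and z: "z \<in> S"
  shows "wronskian m f (\<phi> z) = (l z) ^ (m * (m - 1)) * g z ^ m * wronskian m F z"
proof -
  let ?C = "Matrix.mat m m (\<lambda>(k, i). transfer_coeff g l k i z)"
  let ?M = "Matrix.mat m m (\<lambda>(k, j). (D ^^ k) (F j) z)"
  have "Matrix.mat m m (\<lambda>(k, j). (D ^^ k) (f j) (\<phi> z)) = ?C * ?M"
  proof (rule eq_matI)
    fix k j assume "k < dim_row (?C * ?M)" "j < dim_col (?C * ?M)"
    then have kj: "k < m" "j < m" by auto
    have "(D ^^ k) (f j) (\<phi> z) = (\<Sum>i\<le>k. transfer_coeff g l k i z * (D ^^ i) (F j) z)"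
      using kj by (intro transfer_derivatives[OF S _ _ hol(3,4) \<phi> l eq z] hol) auto
    also have "\<dots> = (\<Sum>i<m. transfer_coeff g l k i z * (D ^^ i) (F j) z)"
      using kj by (intro sum.mono_neutral_left) (auto simp: transfer_coeff_0)
    finally show "Matrix.mat m m (\<lambda>(k, j). (D ^^ k) (f j) (\<phi> z)) $$ (k, j) = (?C * ?M) $$ (k, j)"
      using kj by (simp add: Matrix.scalar_prod_def atLeast0LessThan)
  qed auto
  then have "wronskian m f (\<phi> z) = Determinant.det ?C * wronskian m F z"
    unfolding wronskian_def by (simp add: Determinant.det_mult[of _ m])
  also have "Determinant.det ?C = prod_list (diag_mat ?C)"
    by (rule det_lower_triangular[of m]) (auto simp: transfer_coeff_0)
  also have "\<dots> = (\<Prod>k<m. (l z) ^ (2 * k) * g z)"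
    by (simp add: prod_list_diag_prod transfer_coeff_diag atLeast0LessThan)
  also have "\<dots> = (l z) ^ (m * (m - 1)) * g z ^ m"
  proof -
    have "(\<Sum>k<m. 2 * k) = m * (m - 1)"
    proof (induction m)
      case (Suc m)
      then show ?case by (cases m) auto
    qed auto
    then show ?thesis by (simp add: prod.distrib power_sum[symmetric])
  qed
  finally show ?thesis .
qed

lemma wronskian_dependent_imp_0:
  assumes S: "open S" and hol: "\<And>j. j < m \<Longrightarrow> f j holomorphic_on S"
    and c: "\<And>z k. z \<in> S \<Longrightarrow> k < m \<Longrightarrow> (\<Sum>j<m. c j * (D ^^ k) (f j) z) = 0" "i < m" "c i \<noteq> 0" and z: "z \<in> S"
  shows "wronskian m f z = 0"
proof -
  let ?M = "Matrix.mat m m (\<lambda>(k, j). (D ^^ k) (f j) z)"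
  have "\<exists>v\<in>carrier_vec m. v \<noteq> 0\<^sub>v m \<and> ?M *\<^sub>v v = 0\<^sub>v m"
  proof (intro bexI[of _ "Matrix.vec m c"] conjI)
    show "Matrix.vec m c \<noteq> 0\<^sub>v m"
      using c(2,3) by (metis index_vec index_zero_vec(1))
    show "?M *\<^sub>v Matrix.vec m c = 0\<^sub>v m"
    proof (rule eq_vecI)
      fix k assume "k < dim_vec (0\<^sub>v m :: complex Matrix.vec)"
      then have k: "k < m" by simp
      then show "Matrix.vec_index (?M *\<^sub>v Matrix.vec m c) k = Matrix.vec_index (0\<^sub>v m) k"
        using c(1)[OF z k] by (simp add: Matrix.scalar_prod_def atLeast0LessThan mult.commute)
    qed auto
  qed auto
  then show ?thesis
    unfolding wronskian_def by (subst det_0_iff_vec_prod_zero[of _ m]) auto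
qed

text \<open>The last-row cofactors solve the linear system given by the first rows; where the smaller
  Wronskian does not vanish, differentiating that system shows that their ratios are constant.\<close>

lemma wronskian_0_imp_dependent:
  assumes S: "open S" "connected S" "S \<noteq> {}" and hol: "\<And>j. j < m \<Longrightarrow> f j holomorphic_on S"
    and W: "\<And>z. z \<in> S \<Longrightarrow> wronskian m f z = 0"
  shows "\<exists>c. (\<exists>j<m. c j \<noteq> 0) \<and> (\<forall>z\<in>S. (\<Sum>j<m. c j * f j z) = 0)"
  using hol W
proof (induction m)
  case 0
  then show ?case using S(3) by (auto simp: wronskian_def)
next
  case (Suc m)
  show ?case
  proof (cases "\<forall>z\<in>S. wronskian m f z = 0")
    case True
    then obtain c where c: "\<exists>j<m. c j \<noteq> 0" "\<forall>z\<in>S. (\<Sum>j<m. c j * f j z) = 0"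
      using Suc by (metis less_SucI)
    then show ?thesis
      by (intro exI[of _ "\<lambda>j. if j < m then c j else 0"]) auto
  next
    case False
    then obtain z0 where z0: "z0 \<in> S" "wronskian m f z0 \<noteq> 0" by blast
    have "wronskian m f holomorphic_on S" using Suc.prems by (intro wronskian_holomorphic S) auto
    then have "open (S \<inter> wronskian m f -` (- {0}))"
      by (intro continuous_open_preimage holomorphic_on_imp_continuous_on S) auto
    then obtain r where r: "r > 0" "ball z0 r \<subseteq> S \<inter> wronskian m f -` (- {0})"
      by (rule openE[where x = z0]) (use z0 in auto)
    define B where "B = ball z0 r"
    have B: "open B" "convex B" "z0 \<in> B" "B \<subseteq> S" "\<And>z. z \<in> B \<Longrightarrow> wronskian m f z \<noteq> 0"
      using r by (auto simp: B_def)
    \<comment> \<open>The Wronskian matrix of order m + 1 with its last row replaced by k-th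
      derivatives. The cofactors along this row do not see k, so each k gives one equation for the
      same cofactors.\<close>
    define A where "A = (\<lambda>k z. Matrix.mat (Suc m) (Suc m) (\<lambda>(i, j). (D ^^ (if i = m then k else i)) (f j) z))"
    define C where "C = (\<lambda>j z. cofactor (A m z) m j)"
    have holS: "(D ^^ k) (f j) holomorphic_on S" if "j < Suc m" for k j
      using Suc.prems(1)[OF that] by (rule D_funpow_holomorphic[OF S(1)])
    have A_carrier: "A k z \<in> carrier_mat (Suc m) (Suc m)" for k z by (simp add: A_def)
    have del: "mat_delete (A k z) m j = Matrix.mat m m (\<lambda>(i, j'). (D ^^ i) (f (if j' < j then j' else Suc j')) z)" for k z j
      by (rule eq_matI) (auto simp: mat_delete_def A_def)
    have C_eq: "cofactor (A k z) m j = C j z" for k z j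
      by (simp add: C_def cofactor_def del)
    have C_hol: "C j holomorphic_on S" if "j < Suc m" for j
      unfolding C_def cofactor_def del
      by (intro holomorphic_intros det_mat_holomorphic holS) auto
    have C_m: "C m z = wronskian m f z" for z
      unfolding C_def cofactor_def del wronskian_def
      by (auto intro!: arg_cong[of _ _ Determinant.det] cong_mat)
    have sys: "(\<Sum>j<Suc m. (D ^^ k) (f j) z * C j z) = 0" if k: "k < Suc m" and z: "z \<in> S" for k z
    proof -
      have "Determinant.det (A k z) = (\<Sum>j<Suc m. A k z $$ (m, j) * cofactor (A k z) m j)"
        by (rule laplace_expansion_row[OF A_carrier]) simp
      also have "\<dots> = (\<Sum>j<Suc m. (D ^^ k) (f j) z * C j z)"
        by (intro sum.cong refl) (simp add: C_eq, simp add: A_def)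
      finally have "(\<Sum>j<Suc m. (D ^^ k) (f j) z * C j z) = Determinant.det (A k z)" ..
      also have "Determinant.det (A k z) = 0"
      proof (cases "k = m")
        case True
        have "Determinant.det (A m z) = wronskian (Suc m) f z"
          unfolding A_def wronskian_def by (auto intro!: arg_cong[of _ _ Determinant.det] cong_mat)
        then show ?thesis using Suc.prems(2)[OF z] True by simp
      next
        case False
        show ?thesis
          by (rule Determinant.det_identical_rows[OF A_carrier, of k m]) (use k False in \<open>auto simp: A_def intro!: eq_vecI\<close>)
      qed
      finally show ?thesis .
    qed
    \<comment> \<open>Normalised by the last cofactor, which is the smaller Wronskian and has no
      zero on \<open>B\<close>. Thus x_m = 1, and its derivative drops out below.\<close>
    define x where "x = (\<lambda>j z. C j z / C m z)"
    have Cm0: "C m z \<noteq> 0" if "z \<in> B" for z using B(5)[OF that] by (simp add: C_m)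
    have x_hol: "x j holomorphic_on B" if "j < Suc m" for j
      unfolding x_def using that B(4) Cm0
      by (intro holomorphic_on_divide holomorphic_on_subset[OF C_hol]) auto
    have sysx: "(\<Sum>j<Suc m. (D ^^ k) (f j) z * x j z) = 0" if "k < Suc m" "z \<in> B" for k z
    proof -
      have "(\<Sum>j<Suc m. (D ^^ k) (f j) z * x j z) = (\<Sum>j<Suc m. (D ^^ k) (f j) z * C j z) / C m z"
        by (simp only: x_def times_divide_eq_right sum_divide_distrib)
      then show ?thesis using sys[OF that(1)] that(2) B(4) by auto
    qed
    have Dx: "D (x j) z = 0" if j: "j < m" and z: "z \<in> B" for j z
    proof -
      \<comment> \<open>Differentiate equation k and subtract equation k + 1, which is available
        since k < m. What remains is a homogeneous system for the derivatives of the x_j whose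
        determinant is the nonvanishing smaller Wronskian.\<close>
      have sysD: "(\<Sum>j<m. (D ^^ k) (f j) z * D (x j) z) = 0" if k: "k < m" for k
      proof -
        have "D (\<lambda>z. \<Sum>j<Suc m. (D ^^ k) (f j) z * x j z) z = 
            (\<Sum>j<Suc m. (D ^^ Suc k) (f j) z * x j z + (D ^^ k) (f j) z * D (x j) z)"
        proof (rule D_eqI, rule DERIV_cong[OF DERIV_sum])
          fix j assume "j \<in> {..<Suc m}"
          then have j: "j < Suc m" by simp
          show "((\<lambda>z. (D ^^ k) (f j) z * x j z) has_field_derivative 2 * of_real pi * \<i> * D ((D ^^ k) (f j)) z * x j z
              + 2 * of_real pi * \<i> * D (x j) z * (D ^^ k) (f j) z) (at z)"
            by (intro DERIV_mult DERIV_D[OF B(1) _ z] holomorphic_on_subset[OF holS[OF j] B(4)] x_hol[OF j])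
        qed (simp add: sum_distrib_left distrib_left mult_ac)
        moreover have "D (\<lambda>z. \<Sum>j<Suc m. (D ^^ k) (f j) z * x j z) z = D (\<lambda>z. 0) z"
          by (rule D_cong_open[OF B(1) _ z]) (use sysx[of k] k in auto)
        moreover have "(\<Sum>j<Suc m. (D ^^ Suc k) (f j) z * x j z) = 0"
          using sysx[of "Suc k", OF _ z] k by simp
        moreover have "D (x m) z = 0"
        proof -
          have "D (x m) z = D (\<lambda>z. 1) z"
            by (rule D_cong_open[OF B(1) _ z]) (simp add: x_def Cm0)
          then show ?thesis by (simp add: D_def)
        qed
        ultimately show ?thesis by (simp add: sum.distrib)
      qed
      show ?thesis
      proof (rule ccontr)
        assume "D (x j) z \<noteq> 0"
        have "wronskian m f z = 0"
        proof -
          let ?M = "Matrix.mat m m (\<lambda>(k, j). (D ^^ k) (f j) z)" and ?v = "Matrix.vec m (\<lambda>j. D (x j) z)"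
          have "?v \<noteq> 0\<^sub>v m" using \<open>D (x j) z \<noteq> 0\<close> j by (metis index_vec index_zero_vec(1))
          moreover have "?M *\<^sub>v ?v = 0\<^sub>v m"
            by (rule eq_vecI) (use sysD in \<open>auto simp: Matrix.scalar_prod_def atLeast0LessThan\<close>)
          ultimately show ?thesis
            unfolding wronskian_def by (subst det_0_iff_vec_prod_zero[of _ m]) (auto intro!: exI[of _ ?v])
        qed
        then show False using B(5)[OF z] by simp
      qed
    qed
    have x_const: "x j z = x j z0" if j: "j < Suc m" and z: "z \<in> B" for j z
    proof (cases "j = m")
      case True
      then show ?thesis using Cm0 z B(3) by (simp add: x_def)
    next
      case False
      then have jm: "j < m" using j by simp
      have "\<exists>c. \<forall>z\<in>B. x j z = c"
      proof (rule has_field_derivative_zero_constant[OF B(2)])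
        fix w assume w: "w \<in> B"
        show "(x j has_field_derivative 0) (at w within B)"
          using DERIV_D[OF B(1) x_hol[OF j] w] Dx[OF jm w] by (simp add: has_field_derivative_at_within)
      qed
      then show ?thesis using z B(3) by auto
    qed
    show ?thesis
    proof (intro exI[of _ "\<lambda>j. x j z0"] conjI ballI)
      show "\<exists>j<Suc m. x j z0 \<noteq> 0"
        using Cm0[OF B(3)] by (intro exI[of _ m]) (simp add: x_def)
      fix z assume z: "z \<in> S"
      show "(\<Sum>j<Suc m. x j z0 * f j z) = 0"
      proof (rule analytic_continuation_open[OF B(1) S(1) _ S(2) B(4), where z = z])
        fix w assume w: "w \<in> B"
        have "(\<Sum>j<Suc m. x j z0 * f j w) = (\<Sum>j<Suc m. (D ^^ 0) (f j) w * x j w)"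
          using x_const[OF _ w] by (intro sum.cong) (auto simp: mult.commute)
        also have "\<dots> = 0" by (rule sysx[OF _ w]) simp
        finally show "(\<Sum>j<Suc m. x j z0 * f j w) = 0" .
      qed (use B(3) z Suc.prems(1) in \<open>auto intro!: holomorphic_intros\<close>)
    qed
  qed
qed

subsection \<open>Orthonormal bases of harmonic forms\<close>

lemma symmetric_nth: "transpose h = h \<Longrightarrow> h $ i $ j = h $ j $ i"
  by (metis transpose_def vec_lambda_beta)

lemma trace_mult_inner:
  assumes "transpose (k :: real ^ 'n ^ 'n) = k" shows "trace (h ** k) = h \<bullet> k"
  using symmetric_nth[OF assms]
  by (simp add: trace_def matrix_matrix_mult_def inner_vec_def)

lemma trace_inner: "trace (h :: real ^ 'n ^ 'n) = mat 1 \<bullet> h"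
  using trace_mult_inner[of "mat 1" h] by (simp add: inner_commute)

lemma subspace_symmetric: "subspace {h :: real ^ 'n ^ 'n. transpose h = h}"
  by (auto simp: subspace_def transpose_def vec_eq_iff)

lemma subspace_harmonic: "subspace (harmonic_forms :: (real ^ 'n ^ 'n) set)"
  unfolding harmonic_forms_def
  by (auto simp: subspace_def transpose_def vec_eq_iff trace_def sum.distrib sum_distrib_left[symmetric])

text \<open>A basis of matrices indexed by subsets with one or two elements, so that the order of
  row and column index disappears. Distinct ones have disjoint supports and are therefore
  orthogonal.\<close>

lemma dim_symmetric:
  "dim {h :: real ^ 'n ^ 'n. transpose h = h} = CARD('n) + CARD('n) * (CARD('n) - 1) div 2"
proof -
  define U where "U = (\<lambda>p. (\<chi> a b. if {a, b} = p then 1 else 0) :: real ^ 'n ^ 'n)"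
  define P where "P = {p :: 'n set. card p = 1} \<union> {p. card p = 2}"
  have rep: "\<exists>a b. p = {a, b}" if "p \<in> P" for p
    using that by (auto simp: P_def card_1_singleton_iff card_2_iff)
  have inP: "{a, b} \<in> P" for a b by (cases "a = b") (auto simp: P_def)
  have inj: "inj_on U P"
  proof (rule inj_onI)
    fix p p' assume p: "p \<in> P" "p' \<in> P" "U p = U p'"
    obtain a b where ab: "p = {a, b}" using rep[OF p(1)] by blast
    have "U p $ a $ b = 1" by (simp add: U_def ab)
    then have "U p' $ a $ b = 1" by (simp only: p(3))
    then show "p = p'" using ab by (simp add: U_def split: if_splits)
  qed
  have orth: "pairwise orthogonal (U ` P)"
  proof (rule pairwise_imageI)
    fix p p' :: "'n set" assume "p \<noteq> p'"
    then have z: "U p $ a $ b * U p' $ a $ b = 0" for a b by (auto simp: U_def)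
    show "orthogonal (U p) (U p')"
      by (simp only: orthogonal_def inner_vec_def inner_real_def z sum.neutral_const)
  qed
  have "0 \<notin> U ` P"
  proof
    assume "0 \<in> U ` P"
    then obtain p where p: "p \<in> P" "U p = 0" by auto
    obtain a b where ab: "p = {a, b}" using rep[OF p(1)] by blast
    have "U p $ a $ b = 1" using ab by (simp add: U_def)
    then show False using p by simp
  qed
  then have ind: "independent (U ` P)" by (rule pairwise_orthogonal_independent[OF orth])
  have sub: "U ` P \<subseteq> {h. transpose h = h}"
    by (auto simp: U_def transpose_def vec_eq_iff insert_commute)
  have "{h. transpose h = h} \<subseteq> span (U ` P)"
  proof safe
    fix h :: "real ^ 'n ^ 'n" assume h: "transpose h = h"
    \<comment> \<open>In the double sum below each off-diagonal pair {a, b} occurs twice, each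
      diagonal one once.\<close>
    define c where "c = (\<lambda>a b. h $ a $ b * (if a = b then 1 else 1 / 2))"
    have "h = (\<Sum>a\<in>UNIV. \<Sum>b\<in>UNIV. c a b *\<^sub>R U {a, b})"
    proof (intro vec_eq_iff[THEN iffD2] allI)
      fix x y
      have "(\<Sum>a\<in>UNIV. \<Sum>b\<in>UNIV. c a b *\<^sub>R U {a, b}) $ x $ y = (\<Sum>a\<in>UNIV. \<Sum>b\<in>UNIV. c a b * (U {a, b} $ x $ y))"
        by (simp only: sum_component vector_scaleR_component real_scaleR_def)
      also have "\<dots> = (\<Sum>a\<in>UNIV. \<Sum>b\<in>UNIV. (if x = a then if y = b then h $ a $ b / 2 else 0 else 0) 
           + (if y = a then if x = b then h $ a $ b / 2 else 0 else 0))"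
        by (intro sum.cong refl) (auto simp: c_def U_def doubleton_eq_iff)
      also have "\<dots> = (\<Sum>a\<in>UNIV. if x = a then h $ a $ y / 2 else 0) + (\<Sum>a\<in>UNIV. if y = a then h $ a $ x / 2 else 0)"
      proof -
        have "(\<Sum>b\<in>UNIV. if P then if z = b then g b else 0 else 0) = (if P then g z else 0)" for P z and g :: "'n \<Rightarrow> real"
          by (cases P) auto
        then show ?thesis by (simp only: sum.distrib)
      qed
      also have "\<dots> = h $ x $ y" using symmetric_nth[OF h, of x y] by simp
      finally show "h $ x $ y = (\<Sum>a\<in>UNIV. \<Sum>b\<in>UNIV. c a b *\<^sub>R U {a, b}) $ x $ y" by simp
    qed
    also have "\<dots> \<in> span (U ` P)"
      by (intro span_sum span_scale span_base imageI inP)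
    finally show "h \<in> span (U ` P)" .
  qed
  then have "dim {h :: real ^ 'n ^ 'n. transpose h = h} = card (U ` P)"
    using basis_card_eq_dim[OF sub _ ind] by simp
  also have "\<dots> = card P" by (rule card_image[OF inj])
  also have "\<dots> = card {p :: 'n set. card p = 1} + card {p :: 'n set. card p = 2}"
    unfolding P_def by (rule card_Un_disjoint) auto
  also have "\<dots> = (CARD('n) choose 1) + (CARD('n) choose 2)"
    using n_subsets[of "UNIV :: 'n set" 1] n_subsets[of "UNIV :: 'n set" 2] by simp
  finally show ?thesis by (simp add: choose_two)
qed

text \<open>The trace is the inner product with the identity matrix, so the harmonic forms are the
  orthogonal complement of that matrix among the symmetric ones, and the dimension drops by
  1.\<close>

lemma dim_harmonic: "dim (harmonic_forms :: (real ^ 'n ^ 'n) set) = harmonic_dim TYPE('n)"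
proof -
  let ?S = "{h :: real ^ 'n ^ 'n. transpose h = h}" and ?I = "mat 1 :: real ^ 'n ^ 'n"
  have I: "?I \<in> ?S" by (simp add: transpose_mat)
  have I0: "?I \<noteq> 0"
  proof
    assume "?I = 0"
    then have "?I $ i $ i = 0" for i by simp
    then show False by (simp add: mat_def)
  qed
  have "span {?I} \<subseteq> ?S" using I by (intro span_minimal subspace_symmetric) auto
  then have "dim {y \<in> ?S. \<forall>x\<in>span {?I}. orthogonal x y} + dim (span {?I}) = dim ?S"
    by (intro dim_subspace_orthogonal_to_vectors subspace_span subspace_symmetric)
  moreover have "{y \<in> ?S. \<forall>x\<in>span {?I}. orthogonal x y} = harmonic_forms"
    by (auto simp: harmonic_forms_def trace_inner orthogonal_def span_singleton intro: span_base)
  moreover have "dim (span {?I}) = 1"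
    using I0 by (simp add: dim_eq_card_independent)
  ultimately have "dim (harmonic_forms :: (real ^ 'n ^ 'n) set) + 1 = CARD('n) + CARD('n) * (CARD('n) - 1) div 2"
    using dim_symmetric[where 'n='n] by simp
  moreover obtain m where m: "CARD('n) = Suc m" using zero_less_card_finite[where 'a='n] gr0_conv_Suc by blast
  moreover have "Suc m * m div 2 = harmonic_dim TYPE('n) - m" "m \<le> harmonic_dim TYPE('n)"
  proof -
    have "(Suc m)\<^sup>2 + Suc m - 2 = Suc m * m + 2 * m" by (simp add: power2_eq_square)
    then have "harmonic_dim TYPE('n) = Suc m * m div 2 + m" by (simp add: harmonic_dim_def m)
    then show "Suc m * m div 2 = harmonic_dim TYPE('n) - m" "m \<le> harmonic_dim TYPE('n)" by auto
  qed
  ultimately show ?thesis by simp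
qed

lemma orthonormal_basis_harmonic:
  assumes "orthonormal_basis (hs :: nat \<Rightarrow> real ^ 'n ^ 'n)" "i < harmonic_dim TYPE('n)"
  shows "hs i \<in> harmonic_forms"
proof -
  have "hs i \<in> span (hs ` {..<harmonic_dim TYPE('n)})" using assms(2) by (intro span_base) auto
  then show ?thesis using assms(1) by (simp add: orthonormal_basis_def)
qed

lemma exists_orthonormal_basis: "\<exists>hs :: nat \<Rightarrow> real ^ 'n ^ 'n. orthonormal_basis hs"
proof -
  let ?m = "harmonic_dim TYPE('n)"
  obtain B :: "(real ^ 'n ^ 'n) set" where B: "B \<subseteq> harmonic_forms" "pairwise orthogonal B" "\<And>x. x \<in> B \<Longrightarrow> norm x = 1"
    "independent B" "card B = dim (harmonic_forms :: (real ^ 'n ^ 'n) set)" "span B = harmonic_forms"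
    by (rule orthonormal_basis_subspace[OF subspace_harmonic]) blast
  have "finite B" using B(4) independent_bound by blast
  then obtain b where b: "bij_betw b {..<?m} B"
    using B(5) by (metis dim_harmonic ex_bij_betw_nat_finite lessThan_atLeast0)
  \<comment> \<open>The prescribed scalar product 2 tr(h h') is twice the Euclidean one, so
    Euclidean unit vectors shrink by this factor.\<close>
  define c where "c = 1 / sqrt 2"
  have c: "c * c = 1 / 2" "c \<noteq> 0" by (auto simp: c_def)
  define hs where "hs = (\<lambda>i. c *\<^sub>R b i)"
  have bB: "b i \<in> B" if "i < ?m" for i using b that by (auto simp: bij_betw_def)
  have sym: "transpose (hs i) = hs i" if "i < ?m" for i
    using bB[OF that] B(1) subspace_scale[OF subspace_symmetric, of "b i" c] by (auto simp: hs_def harmonic_forms_def)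
  have "2 * trace (hs i ** hs j) = (if i = j then 1 else 0)" if ij: "i < ?m" "j < ?m" for i j
  proof -
    have "2 * trace (hs i ** hs j) = 2 * (hs i \<bullet> hs j)"
      by (simp add: trace_mult_inner[OF sym[OF ij(2)]])
    also have "\<dots> = 2 * (c * c) * (b i \<bullet> b j)" by (simp add: hs_def)
    also have "\<dots> = b i \<bullet> b j" using c by simp
    also have "\<dots> = (if i = j then 1 else 0)"
    proof (cases "i = j")
      case True
      then show ?thesis using B(3)[OF bB[OF ij(1)]] by (simp add: dot_square_norm)
    next
      case False
      then have "b i \<noteq> b j" using b ij by (auto simp: bij_betw_def inj_on_def)
      then show ?thesis using False B(2) bB ij by (auto simp: pairwise_def orthogonal_def)
    qed
    finally show ?thesis .
  qed
  moreover have "span (hs ` {..<?m}) = harmonic_forms"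
  proof -
    have "hs ` {..<?m} = (\<lambda>x. c *\<^sub>R x) ` B" using b by (auto simp: hs_def bij_betw_def image_image[symmetric])
    then show ?thesis using span_image_scale[OF \<open>finite B\<close>, of "\<lambda>_. c"] c B(6) by simp
  qed
  ultimately show ?thesis unfolding orthonormal_basis_def by blast
qed

lemma orthonormal_basis_expansion:
  assumes hs: "orthonormal_basis (hs :: nat \<Rightarrow> real ^ 'n ^ 'n)" and h: "h \<in> harmonic_forms"
  shows "h = (\<Sum>i<harmonic_dim TYPE('n). (2 * trace (hs i ** h)) *\<^sub>R hs i)"
proof -
  let ?m = "harmonic_dim TYPE('n)"
  define d where "d = h - (\<Sum>i<?m. (2 * trace (hs i ** h)) *\<^sub>R hs i)"
  have sym: "transpose (hs i) = hs i" if "i < ?m" for i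
    using orthonormal_basis_harmonic[OF hs that] by (simp add: harmonic_forms_def)
  have hsym: "transpose h = h" using h by (simp add: harmonic_forms_def)
  have dH: "d \<in> harmonic_forms"
    unfolding d_def
    by (intro subspace_diff subspace_sum subspace_scale subspace_harmonic h orthonormal_basis_harmonic[OF hs]) auto
  have "orthogonal d (hs j)" if j: "j < ?m" for j
  proof -
    have "d \<bullet> hs j = h \<bullet> hs j - (\<Sum>i<?m. (hs i \<bullet> h) * (2 * (hs i \<bullet> hs j)))"
      by (simp add: d_def inner_diff_left inner_sum_left trace_mult_inner[OF hsym] mult_ac)
    also have "(\<Sum>i<?m. (hs i \<bullet> h) * (2 * (hs i \<bullet> hs j))) = (\<Sum>i<?m. if j = i then hs i \<bullet> h else 0)"
      using hs j by (intro sum.cong refl) (auto simp: orthonormal_basis_def trace_mult_inner[OF sym[OF j], symmetric])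
    also have "\<dots> = hs j \<bullet> h" using j by simp
    finally show ?thesis by (simp add: orthogonal_def inner_commute)
  qed
  then have "orthogonal d d"
    using orthogonal_to_span[of d "hs ` {..<?m}" d] dH hs by (auto simp: orthonormal_basis_def)
  then have "d = 0" by (simp add: orthogonal_def)
  then show ?thesis by (simp add: d_def)
qed

text \<open>Expanding hs' in hs, orthonormality of hs' reads R^T R = 1 for the matrix R of
  coefficients.\<close>

lemma orthonormal_basis_change_det:
  assumes hs: "orthonormal_basis (hs :: nat \<Rightarrow> real ^ 'n ^ 'n)" and hs': "orthonormal_basis hs'"
  defines "m \<equiv> harmonic_dim TYPE('n)"
  shows "(Determinant.det (Matrix.mat m m (\<lambda>(i, j). complex_of_real (2 * trace (hs i ** hs' j)))))\<^sup>2 = 1"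
proof -
  define R where "R = (\<lambda>i j. 2 * trace (hs i ** hs' j))"
  let ?M = "Matrix.mat m m (\<lambda>(i, j). complex_of_real (R i j))"
  have sym: "transpose (hs' j) = hs' j" "transpose (hs j) = hs j" if "j < m" for j
    using orthonormal_basis_harmonic[OF hs'] orthonormal_basis_harmonic[OF hs] that by (simp_all add: harmonic_forms_def m_def)
  have RR: "(\<Sum>i<m. R i j * R i k) = (if j = k then 1 else 0)" if jk: "j < m" "k < m" for j k
  proof -
    have rep: "hs' j = (\<Sum>i<m. R i j *\<^sub>R hs i)"
      using orthonormal_basis_expansion[OF hs orthonormal_basis_harmonic[OF hs']] jk by (simp add: m_def R_def)
    have "hs' j \<bullet> hs' k = (\<Sum>i<m. R i j * (hs i \<bullet> hs' k))"
      unfolding arg_cong[OF rep, of "\<lambda>x. x \<bullet> hs' k"] by (simp add: inner_sum_left)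
    moreover have "R i k = 2 * (hs i \<bullet> hs' k)" for i
      by (simp add: R_def trace_mult_inner[OF sym(1)[OF jk(2)]])
    ultimately have "(\<Sum>i<m. R i j * R i k) = 2 * trace (hs' j ** hs' k)"
      by (simp add: trace_mult_inner[OF sym(1)[OF jk(2)]] sum_distrib_left mult_ac)
    then show ?thesis using hs' jk by (simp add: orthonormal_basis_def m_def)
  qed
  have "transpose_mat ?M * ?M = 1\<^sub>m m"
  proof (rule eq_matI)
    fix j k assume "j < dim_row (1\<^sub>m m :: complex Matrix.mat)" "k < dim_col (1\<^sub>m m :: complex Matrix.mat)"
    then have jk: "j < m" "k < m" by auto
    have "(transpose_mat ?M * ?M) $$ (j, k) = of_real (\<Sum>i<m. R i j * R i k)"
      using jk by (simp add: Matrix.scalar_prod_def atLeast0LessThan)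
    then show "(transpose_mat ?M * ?M) $$ (j, k) = 1\<^sub>m m $$ (j, k)" using jk by (simp add: RR)
  qed auto
  then have "Determinant.det (transpose_mat ?M) * Determinant.det ?M = 1"
    by (metis Determinant.det_mult Determinant.det_one mat_carrier transpose_carrier_mat)
  then show ?thesis
    by (simp add: Determinant.det_transpose[of _ m] power2_eq_square R_def)
qed

text \<open>Conjugation by an orthogonal matrix respects products and traces. Rotating a lattice
  amounts to conjugating the basis of forms, so this gives the invariance.\<close>

lemma orthonormal_basis_conjugate:
  assumes hs: "orthonormal_basis (hs :: nat \<Rightarrow> real ^ 'n ^ 'n)" and \<gamma>: "orthogonal_matrix \<gamma>"
  shows "orthonormal_basis (\<lambda>i. transpose \<gamma> ** hs i ** \<gamma>)"
proof -
  have g: "\<gamma> ** transpose \<gamma> = mat 1" "transpose \<gamma> ** \<gamma> = mat 1" using \<gamma> by (auto simp: orthogonal_matrix_def)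
  define \<Phi> where "\<Phi> = (\<lambda>h. transpose \<gamma> ** h ** \<gamma>)"
  define \<Psi> where "\<Psi> = (\<lambda>h. \<gamma> ** h ** transpose \<gamma>)"
  have lin: "linear \<Phi>" 
    unfolding \<Phi>_def
    by (rule linearI) (simp_all add: matrix_add_ldistrib matrix_scalar_ac scalar_matrix_assoc[symmetric],
       simp add: matrix_matrix_mult_def vec_eq_iff distrib_right sum.distrib)
  have mult: "\<Phi> h ** \<Phi> k = \<Phi> (h ** k)" for h k
  proof -
    have "\<Phi> h ** \<Phi> k = transpose \<gamma> ** h ** (\<gamma> ** transpose \<gamma>) ** k ** \<gamma>"
      by (simp only: \<Phi>_def matrix_mul_assoc)
    then show ?thesis by (simp add: g \<Phi>_def matrix_mul_assoc)
  qed
  have tr: "trace (\<Phi> h) = trace h" for h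
  proof -
    have "trace (\<Phi> h) = trace (\<gamma> ** (transpose \<gamma> ** h))" unfolding \<Phi>_def by (rule trace_mul_sym)
    then show ?thesis by (simp add: matrix_mul_assoc g)
  qed
  have tr': "trace (\<Psi> h) = trace h" for h
  proof -
    have "trace (\<Psi> h) = trace (transpose \<gamma> ** (\<gamma> ** h))" unfolding \<Psi>_def by (rule trace_mul_sym)
    then show ?thesis by (simp add: matrix_mul_assoc g)
  qed
  have "\<Phi> ` harmonic_forms = harmonic_forms"
  proof safe
    fix h :: "real ^ 'n ^ 'n" assume "h \<in> harmonic_forms"
    then show "\<Phi> h \<in> harmonic_forms"
      by (simp add: harmonic_forms_def tr) (simp add: \<Phi>_def matrix_transpose_mul matrix_mul_assoc)
  next
    fix h :: "real ^ 'n ^ 'n" assume "h \<in> harmonic_forms"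
    then have "\<Psi> h \<in> harmonic_forms"
      by (simp add: harmonic_forms_def tr') (simp add: \<Psi>_def matrix_transpose_mul matrix_mul_assoc)
    moreover have "\<Phi> (\<Psi> h) = (transpose \<gamma> ** \<gamma>) ** h ** (transpose \<gamma> ** \<gamma>)"
      by (simp only: \<Phi>_def \<Psi>_def matrix_mul_assoc)
    then have "h = \<Phi> (\<Psi> h)" by (simp add: g)
    ultimately show "h \<in> \<Phi> ` harmonic_forms" by blast
  qed
  then have "span (\<Phi> ` (hs ` {..<harmonic_dim TYPE('n)})) = harmonic_forms"
    using hs by (simp add: linear_span_image[OF lin] orthonormal_basis_def)
  moreover have "\<Phi> ` (hs ` {..<harmonic_dim TYPE('n)}) = (\<lambda>i. \<Phi> (hs i)) ` {..<harmonic_dim TYPE('n)}"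
    by (rule image_image)
  ultimately have "orthonormal_basis (\<lambda>i. \<Phi> (hs i))"
    using hs unfolding orthonormal_basis_def mult tr by auto
  then show ?thesis by (simp only: \<Phi>_def)
qed

subsection \<open>Theta series of a lattice\<close>

definition pull_form :: "real ^ 'n ^ 'n \<Rightarrow> real ^ 'n ^ 'n \<Rightarrow> real ^ 'n ^ 'n" where
  "pull_form Q h = transpose Q ** h ** Q"

lemma quad_form_pull: "quad_form (pull_form Q h) x = quad_form h (Q *v x)"
proof -
  have "quad_form (pull_form Q h) x = x \<bullet> (transpose Q *v (h *v (Q *v x)))"
    by (simp add: quad_form_def pull_form_def matrix_vector_mul_assoc matrix_mul_assoc)
  also have "\<dots> = quad_form h (Q *v x)"
    by (metis quad_form_def dot_lmul_matrix transpose_matrix_vector transpose_transpose)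
  finally show ?thesis .
qed

lemma pull_form_add: "pull_form Q (h + k) = pull_form Q h + pull_form Q k"
  by (simp add: pull_form_def matrix_add_ldistrib matrix_add_rdistrib')

lemma pull_form_scaleR: "pull_form Q (c *\<^sub>R h) = c *\<^sub>R pull_form Q h"
  by (simp add: pull_form_def matrix_scalar_ac scalar_matrix_assoc)

lemma pull_form_sym: "transpose h = h \<Longrightarrow> transpose (pull_form Q h) = pull_form Q h"
  by (simp add: pull_form_def matrix_transpose_mul matrix_mul_assoc)

lemma quad_form_gram:
  fixes Q :: "real ^ 'n ^ 'n"
  shows "quad_form (transpose Q ** Q) x = (norm (Q *v x))\<^sup>2"
  using quad_form_pull[of Q "mat 1" x]
  by (simp add: pull_form_def quad_form_def dot_square_norm)

lemma posdef_gram: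
  assumes Q: "invertible (Q :: real ^ 'n ^ 'n)"
  shows "posdef (transpose Q ** Q)"
proof -
  obtain K where K: "K > 0" "\<And>x. norm (matrix_inv Q *v x) \<le> K * norm x" by (rule matrix_bound) blast
  have "1 / K\<^sup>2 * (norm x)\<^sup>2 \<le> quad_form (transpose Q ** Q) x" for x
  proof -
    have "norm x \<le> K * norm (Q *v x)"
      using K(2)[of "Q *v x"] by (simp add: matrix_inv_mult[OF Q])
    then have "(norm x)\<^sup>2 \<le> (K * norm (Q *v x))\<^sup>2" by (rule power_mono) auto
    then show ?thesis using K(1) by (simp add: quad_form_gram field_simps)
  qed
  moreover have "1 / K\<^sup>2 > 0" using K by simp
  ultimately show ?thesis
    unfolding posdef_def matrix_transpose_mul transpose_transpose by blast
qed

lemma matrix_inv_eqI: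
  assumes "A ** B = mat 1" "B ** A = mat (1 :: real)"
  shows "matrix_inv (A :: real ^ 'n ^ 'n) = B"
proof -
  have "invertible A" using assms by (auto simp: invertible_def)
  then show ?thesis
    by (metis assms(1) matrix_inv_mult(2) matrix_mul_assoc matrix_mul_lid matrix_mul_rid)
qed

lemma gram_inv:
  assumes Q: "invertible (Q :: real ^ 'n ^ 'n)"
  shows "matrix_inv (transpose Q ** Q) = matrix_inv Q ** transpose (matrix_inv Q)"
proof (rule matrix_inv_eqI)
  note inv = matrix_inv_mult[OF Q]
  have T: "transpose Q ** transpose (matrix_inv Q) = mat 1" "transpose (matrix_inv Q) ** transpose Q = mat 1"
    by (simp_all add: matrix_transpose_mul[symmetric] inv transpose_mat)
  have "transpose Q ** Q ** (matrix_inv Q ** transpose (matrix_inv Q)) = transpose Q ** (Q ** matrix_inv Q) ** transpose (matrix_inv Q)"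
    by (simp only: matrix_mul_assoc)
  then show "transpose Q ** Q ** (matrix_inv Q ** transpose (matrix_inv Q)) = mat 1" by (simp add: inv T)
  have "matrix_inv Q ** transpose (matrix_inv Q) ** (transpose Q ** Q) = matrix_inv Q ** (transpose (matrix_inv Q) ** transpose Q) ** Q"
    by (simp only: matrix_mul_assoc)
  then show "matrix_inv Q ** transpose (matrix_inv Q) ** (transpose Q ** Q) = mat 1" by (simp add: inv T)
qed

text \<open>By cyclicity of the trace, in lattice coordinates trace 0 is the condition defining
  \<open>disc_tangent\<close> and also the trace hypothesis of
  \<open>poisson_harmonic\<close>.\<close>

lemma trace_pull_form:
  assumes Q: "invertible (Q :: real ^ 'n ^ 'n)"
  shows "trace (pull_form Q h ** matrix_inv (transpose Q ** Q)) = trace h"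
proof -
  note inv = matrix_inv_mult[OF Q]
  have T: "transpose (matrix_inv Q) ** transpose Q = mat 1"
    by (simp add: matrix_transpose_mul[symmetric] inv transpose_mat)
  have "pull_form Q h ** matrix_inv (transpose Q ** Q) = transpose Q ** h ** (Q ** matrix_inv Q) ** transpose (matrix_inv Q)"
    unfolding gram_inv[OF Q] pull_form_def by (simp only: matrix_mul_assoc)
  then have "trace (pull_form Q h ** matrix_inv (transpose Q ** Q)) = trace (transpose Q ** (h ** transpose (matrix_inv Q)))"
    by (simp add: inv matrix_mul_assoc)
  also have "\<dots> = trace (h ** transpose (matrix_inv Q) ** transpose Q)" by (rule trace_mul_sym)
  also have "\<dots> = trace h" by (simp add: matrix_mul_assoc[symmetric] T)
  finally show ?thesis .
qed

lemma inj_lattice_param: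
  assumes "invertible (Q :: real ^ 'n ^ 'n)" shows "inj (\<lambda>x. Q *v of_int_vec x)"
proof (rule injI)
  fix x y assume "Q *v of_int_vec x = Q *v of_int_vec y"
  then have "matrix_inv Q *v (Q *v of_int_vec x) = matrix_inv Q *v (Q *v of_int_vec y)" by simp
  then show "x = y" by (simp add: matrix_inv_mult[OF assms] inj_eq[OF inj_of_int_vec])
qed

lemma Theta_series:
  assumes "invertible Q"
  shows "Theta h (lattice_of Q) = theta_series (\<lambda>x. of_real (quad_form (pull_form Q h) (of_int_vec x)))
     (\<lambda>x. quad_form (transpose Q ** Q) (of_int_vec x))"
  unfolding Theta_def lattice_of_def theta_series_def
  by (rule ext, subst infsum_reindex[OF inj_lattice_param[OF assms]])
     (simp add: o_def quad_form_pull quad_form_gram e_def mult.assoc)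

context
  fixes Q :: "real ^ 'n ^ 'n"
  assumes Q: "invertible Q"
begin

abbreviation (input) "Gram \<equiv> transpose Q ** Q"

lemma quad_growth_Gram: "quad_growth (\<lambda>x. quad_form Gram (of_int_vec x))"
  by (rule quad_growth_posdef0[OF posdef_gram[OF Q]])

lemma Theta_holomorphic: "Theta h (lattice_of Q) holomorphic_on upper_half_plane"
  unfolding Theta_series[OF Q] by (rule theta_deriv(1)[OF poly_growth_quad_form0 quad_growth_Gram])

lemma D_Theta:
  "z \<in> upper_half_plane \<Longrightarrow> (D ^^ k) (Theta h (lattice_of Q)) z =
     theta_series (\<lambda>x. of_real (quad_form (pull_form Q h) (of_int_vec x)) * of_real (quad_form Gram (of_int_vec x)) ^ k)
       (\<lambda>x. quad_form Gram (of_int_vec x)) z"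
  unfolding Theta_series[OF Q] by (rule D_theta_series[OF poly_growth_quad_form0 quad_growth_Gram])

lemma D_Theta_add:
  assumes z: "z \<in> upper_half_plane"
  shows "(D ^^ k) (Theta (h + h') (lattice_of Q)) z = (D ^^ k) (Theta h (lattice_of Q)) z + (D ^^ k) (Theta h' (lattice_of Q)) z"
proof -
  have "Im z > 0" using z by (simp add: upper_half_plane_def)
  then show ?thesis
    unfolding D_Theta[OF z] theta_series_def
    by (subst theta_infsum_add[symmetric])
      (auto intro!: poly_growth_mult poly_growth_power poly_growth_quad_form0 quad_growth_Gram
        simp: pull_form_add quad_form_add_matrix distrib_right)
qed

lemma D_Theta_scaleR:
  assumes z: "z \<in> upper_half_plane"
  shows "(D ^^ k) (Theta (c *\<^sub>R h) (lattice_of Q)) z = of_real c * (D ^^ k) (Theta h (lattice_of Q)) z"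
  unfolding D_Theta[OF z] theta_series_def
  by (subst infsum_cmult_right'[symmetric]) (simp add: pull_form_scaleR quad_form_scaleR_matrix mult.assoc)

lemma D_Theta_sum:
  assumes z: "z \<in> upper_half_plane" and "finite I"
  shows "(D ^^ k) (Theta (\<Sum>i\<in>I. c i *\<^sub>R h i) (lattice_of Q)) z = (\<Sum>i\<in>I. of_real (c i) * (D ^^ k) (Theta (h i) (lattice_of Q)) z)"
  using assms(2)
proof induction
  case empty
  show ?case using D_Theta_scaleR[OF z, of k 0 0] by simp
next
  case (insert i I)
  then show ?case by (simp add: D_Theta_add[OF z] D_Theta_scaleR[OF z])
qed

lemma detDTheta_wronskian:
  "detDTheta hs (lattice_of Q) = wronskian (harmonic_dim TYPE('n)) (\<lambda>j. Theta (hs j) (lattice_of Q))"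
  by (simp add: fun_eq_iff detDTheta_def wronskian_def)

lemma detDTheta_change_basis:
  assumes hs: "orthonormal_basis (hs :: nat \<Rightarrow> real ^ 'n ^ 'n)" "orthonormal_basis hs'" and z: "z \<in> upper_half_plane"
  shows "(detDTheta hs' (lattice_of Q) z)\<^sup>2 = (detDTheta hs (lattice_of Q) z)\<^sup>2"
proof -
  define m where "m = harmonic_dim TYPE('n)"
  define R where "R = (\<lambda>i j. 2 * trace (hs i ** hs' j))"
  let ?R = "Matrix.mat m m (\<lambda>(i, j). complex_of_real (R i j))"
  let ?M = "\<lambda>hs. Matrix.mat m m (\<lambda>(k, j). (D ^^ k) (Theta (hs j) (lattice_of Q)) z)"
  have "?M hs' = ?M hs * ?R"
  proof (rule eq_matI)
    fix k j assume "k < dim_row (?M hs * ?R)" "j < dim_col (?M hs * ?R)"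
    then have kj: "k < m" "j < m" by auto
    have "hs' j = (\<Sum>i<m. R i j *\<^sub>R hs i)"
      using orthonormal_basis_expansion[OF hs(1) orthonormal_basis_harmonic[OF hs(2)]] kj by (simp add: m_def R_def)
    then have "(D ^^ k) (Theta (hs' j) (lattice_of Q)) z = (\<Sum>i<m. of_real (R i j) * (D ^^ k) (Theta (hs i) (lattice_of Q)) z)"
      by (simp only: D_Theta_sum[OF z] finite_lessThan)
    then show "?M hs' $$ (k, j) = (?M hs * ?R) $$ (k, j)"
      using kj by (simp add: Matrix.scalar_prod_def atLeast0LessThan mult.commute)
  qed auto
  then have "detDTheta hs' (lattice_of Q) z = detDTheta hs (lattice_of Q) z * Determinant.det ?R"
    unfolding detDTheta_def m_def[symmetric] by (simp add: Determinant.det_mult[of _ m])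
  then show ?thesis
    using orthonormal_basis_change_det[OF hs] by (simp add: power_mult_distrib R_def m_def)
qed

lemma det2DTheta_basis:
  assumes hs: "orthonormal_basis (hs :: nat \<Rightarrow> real ^ 'n ^ 'n)" and z: "z \<in> upper_half_plane"
  shows "det2DTheta (lattice_of Q) z = (detDTheta hs (lattice_of Q) z)\<^sup>2"
  unfolding det2DTheta_def by (rule detDTheta_change_basis[OF hs someI[of orthonormal_basis, OF hs] z])

lemma Theta_cnj: "cnj (Theta h (lattice_of Q) (- cnj z)) = Theta h (lattice_of Q) z"
  unfolding Theta_series[OF Q] theta_series_def infsum_cnj[symmetric]
  by (simp add: cnj_e)

lemma det2DTheta_zero_iff:
  "(\<forall>z\<in>upper_half_plane. det2DTheta (lattice_of Q) z = 0) \<longleftrightarrow>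
     (\<exists>h\<in>harmonic_forms. h \<noteq> 0 \<and> (\<forall>z\<in>upper_half_plane. Theta h (lattice_of Q) z = 0))"
proof -
  obtain hs :: "nat \<Rightarrow> real ^ 'n ^ 'n" where hs: "orthonormal_basis hs" using exists_orthonormal_basis by blast
  define m where "m = harmonic_dim TYPE('n)"
  define f where "f = (\<lambda>j. Theta (hs j) (lattice_of Q))"
  have f_hol: "f j holomorphic_on upper_half_plane" for j
    unfolding f_def by (rule Theta_holomorphic)
  have hsH: "hs j \<in> harmonic_forms" if "j < m" for j
    using orthonormal_basis_harmonic[OF hs] that by (simp add: m_def)
  have zero_iff: "(\<forall>z\<in>upper_half_plane. det2DTheta (lattice_of Q) z = 0) \<longleftrightarrow> (\<forall>z\<in>upper_half_plane. wronskian m f z = 0)"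
    by (auto simp: det2DTheta_basis[OF hs] detDTheta_wronskian m_def f_def)
  show ?thesis
    unfolding zero_iff
  proof
    assume W: "\<forall>z\<in>upper_half_plane. wronskian m f z = 0"
    have conn: "connected upper_half_plane" "upper_half_plane \<noteq> {}"
      using convex_connected[OF convex_halfspace_Im_gt[of 0]] by (auto simp: upper_half_plane_def intro!: exI[of _ \<i>])
    have "\<exists>c. (\<exists>j<m. c j \<noteq> 0) \<and> (\<forall>z\<in>upper_half_plane. (\<Sum>j<m. c j * f j z) = 0)"
      by (rule wronskian_0_imp_dependent[OF open_upper_half_plane conn]) (use f_hol W in auto)
    then obtain c where cc: "(\<exists>j<m. c j \<noteq> 0) \<and> (\<forall>z\<in>upper_half_plane. (\<Sum>j<m. c j * f j z) = 0)" ..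
    then obtain i where "i < m" "c i \<noteq> 0" by blast
    note c = this conjunct2[OF cc, rule_format]
    \<comment> \<open>The Wronskian criterion yields complex coefficients. Conjugating the relation
      at the reflected point -conj z shows that the conjugate coefficients satisfy it too, so real
      and imaginary parts are separate real relations, and one of them is nontrivial at i.\<close>
    have c': "(\<Sum>j<m. cnj (c j) * f j z) = 0" if z: "z \<in> upper_half_plane" for z
    proof -
      have "- cnj z \<in> upper_half_plane" using z by (simp add: upper_half_plane_def)
      then have "cnj (\<Sum>j<m. c j * f j (- cnj z)) = 0" using c(3) by simp
      then show ?thesis by (simp add: f_def Theta_cnj)
    qed
    have rel: "(\<Sum>j<m. of_real (Re (c j)) * f j z) = 0" "(\<Sum>j<m. of_real (Im (c j)) * f j z) = 0"
      if z: "z \<in> upper_half_plane" for z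
    proof -
      have "2 * (\<Sum>j<m. of_real (Re (c j)) * f j z) = (\<Sum>j<m. c j * f j z) + (\<Sum>j<m. cnj (c j) * f j z)"
        unfolding sum.distrib[symmetric] sum_distrib_left distrib_right[symmetric] complex_add_cnj
        by (simp add: mult.assoc)
      then show "(\<Sum>j<m. of_real (Re (c j)) * f j z) = 0" using c(3)[OF z] c'[OF z] by simp
      have "2 * \<i> * (\<Sum>j<m. of_real (Im (c j)) * f j z) = (\<Sum>j<m. c j * f j z) - (\<Sum>j<m. cnj (c j) * f j z)"
        unfolding sum_subtractf[symmetric] sum_distrib_left left_diff_distrib[symmetric] complex_diff_cnj
        by (simp add: mult_ac)
      then show "(\<Sum>j<m. of_real (Im (c j)) * f j z) = 0" using c(3)[OF z] c'[OF z] by simp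
    qed
    have "\<exists>r :: nat \<Rightarrow> real. r i \<noteq> 0 \<and> (\<forall>z\<in>upper_half_plane. (\<Sum>j<m. of_real (r j) * f j z) = 0)"
    proof (cases "Re (c i) = 0")
      case False
      then show ?thesis using rel(1) by (intro exI[of _ "\<lambda>j. Re (c j)"]) auto
    next
      case True
      then have "Im (c i) \<noteq> 0" using c(2) by (simp add: complex_eq_iff)
      then show ?thesis using rel(2) by (intro exI[of _ "\<lambda>j. Im (c j)"]) auto
    qed
    then obtain r :: "nat \<Rightarrow> real" where r: "r i \<noteq> 0" "\<And>z. z \<in> upper_half_plane \<Longrightarrow> (\<Sum>j<m. of_real (r j) * f j z) = 0"
      by blast
    define h where "h = (\<Sum>j<m. r j *\<^sub>R hs j)"
    have "h \<in> harmonic_forms"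
      unfolding h_def by (intro subspace_sum subspace_scale subspace_harmonic hsH) auto
    moreover have "h \<noteq> 0"
    proof
      assume "h = 0"
      have sym: "transpose (hs i) = hs i" using hsH[OF c(1)] by (simp add: harmonic_forms_def)
      have "h \<bullet> hs i = (\<Sum>j<m. r j * (hs j \<bullet> hs i))" by (simp add: h_def inner_sum_left)
      also have "\<dots> = (\<Sum>j<m. if i = j then r j / 2 else 0)"
      proof (intro sum.cong refl)
        fix j assume "j \<in> {..<m}"
        then have "2 * (hs j \<bullet> hs i) = (if j = i then 1 else 0)"
          using hs c(1) by (simp add: orthonormal_basis_def m_def trace_mult_inner[OF sym, symmetric])
        then show "r j * (hs j \<bullet> hs i) = (if i = j then r j / 2 else 0)" by (auto split: if_splits)
      qed
      also have "\<dots> = r i / 2" using c(1) by simp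
      finally show False using r(1) \<open>h = 0\<close> by simp
    qed
    moreover have "Theta h (lattice_of Q) z = 0" if "z \<in> upper_half_plane" for z
      using D_Theta_sum[OF that, of "{..<m}" 0 r hs] r(2)[OF that] by (simp add: h_def f_def)
    ultimately show "\<exists>h\<in>harmonic_forms. h \<noteq> 0 \<and> (\<forall>z\<in>upper_half_plane. Theta h (lattice_of Q) z = 0)" by blast
  next
    assume "\<exists>h\<in>harmonic_forms. h \<noteq> 0 \<and> (\<forall>z\<in>upper_half_plane. Theta h (lattice_of Q) z = 0)"
    then obtain h where h: "h \<in> harmonic_forms" "h \<noteq> 0" "\<And>z. z \<in> upper_half_plane \<Longrightarrow> Theta h (lattice_of Q) z = 0" by blast
    define r where "r = (\<lambda>i. 2 * trace (hs i ** h))"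
    have hr: "h = (\<Sum>i<m. r i *\<^sub>R hs i)"
      using orthonormal_basis_expansion[OF hs h(1)] by (simp add: r_def m_def)
    have "\<exists>i<m. r i \<noteq> 0"
    proof (rule ccontr)
      assume "\<not> ?thesis"
      then have "h = 0" by (subst hr) simp
      then show False using h(2) by simp
    qed
    then obtain i where i: "i < m" "r i \<noteq> 0" by blast
    show "\<forall>z\<in>upper_half_plane. wronskian m f z = 0"
    proof
      fix z assume z: "z \<in> upper_half_plane"
      show "wronskian m f z = 0"
      proof (rule wronskian_dependent_imp_0[OF open_upper_half_plane f_hol _ i(1) _ z, of "\<lambda>i. of_real (r i)"])
        fix z k assume z: "z \<in> upper_half_plane"
        have "(D ^^ k) (\<lambda>z. 0) = (\<lambda>z. 0)" by (induction k) auto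
        then have "(D ^^ k) (Theta h (lattice_of Q)) z = 0"
          using D_funpow_cong_open[OF open_upper_half_plane, of "Theta h (lattice_of Q)" "\<lambda>z. 0" z k] h(3) z by simp
        then show "(\<Sum>j<m. of_real (r j) * (D ^^ k) (f j) z) = 0"
          using D_Theta_sum[OF z, of "{..<m}" k r hs] by (simp add: hr[symmetric] f_def)
      qed (use i(2) in simp)
    qed
  qed
qed

end

lemma Theta_orthogonal:
  assumes \<gamma>: "orthogonal_matrix \<gamma>"
  shows "Theta h ((\<lambda>x. \<gamma> *v x) ` \<Lambda>) z = Theta (pull_form \<gamma> h) \<Lambda> z"
proof -
  have g: "transpose \<gamma> ** \<gamma> = mat 1" using \<gamma> by (simp add: orthogonal_matrix_def)
  have "inj_on (\<lambda>x. \<gamma> *v x) \<Lambda>"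
    by (rule inj_on_inverseI[of _ "\<lambda>x. transpose \<gamma> *v x"]) (simp add: matrix_vector_mul_assoc g)
  moreover have "(norm (\<gamma> *v x))\<^sup>2 = (norm x)\<^sup>2" for x
    using quad_form_gram[of \<gamma> x] by (simp add: g quad_form_def dot_square_norm)
  ultimately show ?thesis
    unfolding Theta_def by (subst infsum_reindex) (auto simp: o_def quad_form_pull)
qed

lemma det2DTheta_lattice_invariant:
  assumes z: "z \<in> upper_half_plane"
  shows "lattice_invariant (\<lambda>\<Lambda> :: (real ^ 'n) set. det2DTheta \<Lambda> z)"
  unfolding lattice_invariant_def
proof (intro allI impI)
  fix \<Lambda> :: "(real ^ 'n) set" and \<gamma> :: "real ^ 'n ^ 'n"
  assume "is_lattice \<Lambda>" and \<gamma>: "orthogonal_matrix \<gamma>"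
  then obtain Q where Q: "invertible Q" "\<Lambda> = lattice_of Q" by (auto simp: is_lattice_def)
  obtain hs :: "nat \<Rightarrow> real ^ 'n ^ 'n" where hs: "orthonormal_basis hs" using exists_orthonormal_basis by blast
  have image: "(\<lambda>x. \<gamma> *v x) ` \<Lambda> = lattice_of (\<gamma> ** Q)"
    by (auto simp: Q(2) lattice_of_def image_image matrix_vector_mul_assoc)
  have inv: "invertible (\<gamma> ** Q)"
    using \<gamma> Q(1) by (intro invertible_mult) (auto simp: orthogonal_matrix_def invertible_def)
  have "det2DTheta ((\<lambda>x. \<gamma> *v x) ` \<Lambda>) z = (detDTheta hs ((\<lambda>x. \<gamma> *v x) ` \<Lambda>) z)\<^sup>2"
    unfolding image by (rule det2DTheta_basis[OF inv hs z])
  also have "detDTheta hs ((\<lambda>x. \<gamma> *v x) ` \<Lambda>) z = detDTheta (\<lambda>i. pull_form \<gamma> (hs i)) \<Lambda> z"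
    unfolding detDTheta_def by (simp add: Theta_orthogonal[OF \<gamma>, abs_def])
  also have "(detDTheta (\<lambda>i. pull_form \<gamma> (hs i)) \<Lambda> z)\<^sup>2 = det2DTheta \<Lambda> z"
    unfolding Q(2) pull_form_def
    by (rule det2DTheta_basis[OF Q(1) orthonormal_basis_conjugate[OF hs \<gamma>] z, symmetric])
  finally show "det2DTheta ((\<lambda>x. \<gamma> *v x) ` \<Lambda>) z = det2DTheta \<Lambda> z" .
qed

subsection \<open>The differential of the theta map\<close>

text \<open>The real parameter t is made complex, so that termwise differentiation of a sum of
  holomorphic functions applies; the derivative is then restricted to the real line.\<close>

lemma theta_map_deriv_eq:
  fixes A B :: "real ^ 'n ^ 'n"
  assumes A: "posdef A" and z: "z \<in> upper_half_plane"
  shows "theta_map_deriv A B z =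
    theta_series (\<lambda>x. of_real (quad_form B (of_int_vec x))) (\<lambda>x. quad_form A (of_int_vec x)) z"
proof -
  have y: "Im z > 0" using z by (simp add: upper_half_plane_def)
  then have z0: "z \<noteq> 0" by auto
  obtain c where c: "c > 0" "\<And>x. c * (norm x)\<^sup>2 \<le> quad_form A x"
    using A unfolding posdef_def by blast
  obtain K where K: "K > 0" "\<And>x. \<bar>quad_form B x\<bar> \<le> K * (norm x)\<^sup>2" by (rule quad_form_upper) blast
  \<comment> \<open>For |t| < \<epsilon> the perturbation t B consumes at most half of the decay c
    Im z |x|^2.\<close>
  define \<epsilon> where "\<epsilon> = c * Im z / (2 * norm z * K)"
  have \<epsilon>: "\<epsilon> > 0" using c K y z0 by (simp add: \<epsilon>_def)
  define f where "f = (\<lambda>(x :: int ^ 'n) t. e (of_real (quad_form A (of_int_vec x)) * z + t * (of_real (quad_form B (of_int_vec x)) * z)))"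
  define M where "M = (\<lambda>x :: int ^ 'n. (1 + inorm x) ^ 0 * exp (- (pi * c * Im z) * (inorm x)\<^sup>2))"
  have M: "M summable_on UNIV" unfolding M_def by (rule gauss_summable) (use c y in simp)
  have bound: "norm (f x t) \<le> M x" if t: "t \<in> ball 0 \<epsilon>" for x t
  proof -
    let ?a = "quad_form A (of_int_vec x)" and ?b = "quad_form B (of_int_vec x)"
    have "\<bar>Im (t * (of_real ?b * z))\<bar> \<le> norm t * (\<bar>?b\<bar> * norm z)"
      by (rule order_trans[OF abs_Im_le_cmod]) (simp add: norm_mult)
    also have "\<dots> \<le> \<epsilon> * ((K * (inorm x)\<^sup>2) * norm z)"
      using t K(2)[of "of_int_vec x"] \<epsilon> by (intro mult_mono) (auto simp: inorm_def)
    also have "\<dots> = c * Im z / 2 * (inorm x)\<^sup>2"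
      using K z0 by (simp add: \<epsilon>_def field_simps)
    finally have 1: "\<bar>Im (t * (of_real ?b * z))\<bar> \<le> c * Im z / 2 * (inorm x)\<^sup>2" .
    have 2: "c * (inorm x)\<^sup>2 * Im z \<le> ?a * Im z"
      using c(2)[of "of_int_vec x"] y by (intro mult_right_mono) (auto simp: inorm_def)
    have "c * Im z / 2 * (inorm x)\<^sup>2 \<le> ?a * Im z + Im (t * (of_real ?b * z))"
    proof -
      have "c * (inorm x)\<^sup>2 * Im z = 2 * (c * Im z / 2 * (inorm x)\<^sup>2)" by simp
      then show ?thesis
        using 1 2 unfolding abs_le_iff by linarith
    qed
    then have "2 * pi * (c * Im z / 2 * (inorm x)\<^sup>2) \<le> 2 * pi * (?a * Im z + Im (t * (of_real ?b * z)))"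
      by (intro mult_left_mono) auto
    then show ?thesis
      unfolding f_def M_def norm_e by (simp add: algebra_simps)
  qed
  have hol: "f x holomorphic_on ball 0 \<epsilon>" for x
    unfolding f_def by (intro holomorphic_intros)
  have bd: "\<exists>r>0. \<exists>M. M summable_on UNIV \<and> cball t r \<subseteq> ball 0 \<epsilon> \<and> (\<forall>x. \<forall>w\<in>cball t r. norm (f x w) \<le> M x)"
    if t: "t \<in> ball 0 \<epsilon>" for t
  proof -
    obtain r where "r > 0" "cball t r \<subseteq> ball 0 \<epsilon>"
      using open_contains_cball[THEN iffD1, OF open_ball, rule_format, OF t] by metis
    then show ?thesis using M bound by (intro exI[of _ r] conjI exI[of _ M]) auto
  qed
  have 0: "0 \<in> ball (0::complex) \<epsilon>" using \<epsilon> by simp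
  have d: "deriv (f x) 0 = (2 * of_real pi * \<i> * z) * (of_real (quad_form B (of_int_vec x)) * e (of_real (quad_form A (of_int_vec x)) * z))" for x
    unfolding f_def by (rule DERIV_imp_deriv) (auto intro!: derivative_eq_intros)
  have "((\<lambda>t. infsum (\<lambda>x. f x t) UNIV) has_field_derivative infsum (\<lambda>x. deriv (f x) 0) UNIV) (at 0)"
    by (rule termwise_holomorphic(2)[OF open_ball hol bd 0]) auto
  also have "infsum (\<lambda>x. deriv (f x) 0) UNIV = (2 * of_real pi * \<i> * z) *
      theta_series (\<lambda>x. of_real (quad_form B (of_int_vec x))) (\<lambda>x. quad_form A (of_int_vec x)) z"
    unfolding d theta_series_def by (rule infsum_cmult_right')
  finally have "((\<lambda>t. infsum (\<lambda>x. f x t) UNIV) has_field_derivative (2 * of_real pi * \<i> * z) *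
      theta_series (\<lambda>x. of_real (quad_form B (of_int_vec x))) (\<lambda>x. quad_form A (of_int_vec x)) z) (at (of_real 0))"
    by simp
  then have "((\<lambda>t. infsum (\<lambda>x. f x (of_real t)) UNIV) has_vector_derivative (2 * of_real pi * \<i> * z) *
      theta_series (\<lambda>x. of_real (quad_form B (of_int_vec x))) (\<lambda>x. quad_form A (of_int_vec x)) z) (at 0)"
    by (rule has_vector_derivative_real_field)
  moreover have "infsum (\<lambda>x. f x (of_real t)) UNIV = theta_map (A + t *\<^sub>R B) z" for t
    unfolding theta_map_def f_def e_def
    by (intro infsum_cong) (simp add: quad_form_add_matrix quad_form_scaleR_matrix algebra_simps)
  ultimately have "vector_derivative (\<lambda>t. theta_map (A + t *\<^sub>R B) z) (at 0) = (2 * of_real pi * \<i> * z) *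
      theta_series (\<lambda>x. of_real (quad_form B (of_int_vec x))) (\<lambda>x. quad_form A (of_int_vec x)) z"
    by (intro vector_derivative_at) simp
  then show ?thesis using z0 by (simp add: theta_map_deriv_def)
qed

text \<open>\<open>pull_form Q\<close> carries \<open>harmonic_forms\<close> onto
  \<open>disc_tangent\<close>, with inverse the pullback by the inverse of Q, and the differential
  in direction \<open>pull_form Q h\<close> is the theta series of h. This is linear in h, so
  failure of injectivity means a nonzero kernel.\<close>

lemma theta_degenerate_iff:
  fixes Q :: "real ^ 'n ^ 'n"
  assumes Q: "invertible Q"
  shows "theta_differential_degenerate (transpose Q ** Q) \<longleftrightarrow>
     (\<exists>h\<in>harmonic_forms. h \<noteq> 0 \<and> (\<forall>z\<in>upper_half_plane. Theta h (lattice_of Q) z = 0))"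
proof -
  let ?A = "transpose Q ** Q"
  note A = posdef_gram[OF Q]
  note inv = matrix_inv_mult[OF Q]
  let ?f = "\<lambda>B. restrict (theta_map_deriv ?A B) upper_half_plane"
  have T: "transpose Q ** transpose (matrix_inv Q) = mat 1" "transpose (matrix_inv Q) ** transpose Q = mat 1"
    by (simp_all add: matrix_transpose_mul[symmetric] inv transpose_mat)
  have push: "pull_form Q (pull_form (matrix_inv Q) B) = B" for B
  proof -
    have "pull_form Q (pull_form (matrix_inv Q) B) = (transpose Q ** transpose (matrix_inv Q)) ** B ** (matrix_inv Q ** Q)"
      by (simp only: pull_form_def matrix_mul_assoc)
    then show ?thesis by (simp add: T inv)
  qed
  have pull: "pull_form (matrix_inv Q) (pull_form Q h) = h" for h
  proof -
    have "pull_form (matrix_inv Q) (pull_form Q h) = (transpose (matrix_inv Q) ** transpose Q) ** h ** (Q ** matrix_inv Q)"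
      by (simp only: pull_form_def matrix_mul_assoc)
    then show ?thesis by (simp add: T inv)
  qed
  have Theta: "theta_map_deriv ?A (pull_form Q h) z = Theta h (lattice_of Q) z" if "z \<in> upper_half_plane" for h z
    unfolding theta_map_deriv_eq[OF A that] Theta_series[OF Q] ..
  show ?thesis
    unfolding theta_differential_degenerate_def
  proof
    assume "\<not> inj_on ?f (disc_tangent ?A)"
    then obtain B C where BC: "B \<in> disc_tangent ?A" "C \<in> disc_tangent ?A" "?f B = ?f C" "B \<noteq> C"
      by (auto simp: inj_on_def)
    define hB hC where "hB = pull_form (matrix_inv Q) B" and "hC = pull_form (matrix_inv Q) C"
    have harm: "pull_form (matrix_inv Q) B \<in> harmonic_forms" if "B \<in> disc_tangent ?A" for B
      using that trace_pull_form[OF Q, of "pull_form (matrix_inv Q) B"]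
      by (simp add: disc_tangent_def harmonic_forms_def push pull_form_sym)
    have "hB - hC \<in> harmonic_forms"
      unfolding hB_def hC_def by (intro subspace_diff subspace_harmonic harm BC)
    moreover have "hB - hC \<noteq> 0" using BC(4) push[of B] push[of C] by (auto simp: hB_def hC_def)
    moreover have "Theta (hB - hC) (lattice_of Q) z = 0" if z: "z \<in> upper_half_plane" for z
    proof -
      have "Theta hB (lattice_of Q) z = Theta hC (lattice_of Q) z"
        using Theta[OF z, of hB] Theta[OF z, of hC] fun_cong[OF BC(3), of z] z by (simp add: hB_def hC_def push)
      moreover have "Theta (hB + (- 1) *\<^sub>R hC) (lattice_of Q) z = Theta hB (lattice_of Q) z + of_real (- 1) * Theta hC (lattice_of Q) z"
        using D_Theta_add[OF Q z, of 0 hB "(- 1) *\<^sub>R hC"] D_Theta_scaleR[OF Q z, of 0 "- 1" hC] by simp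
      ultimately show ?thesis by simp
    qed
    ultimately show "\<exists>h\<in>harmonic_forms. h \<noteq> 0 \<and> (\<forall>z\<in>upper_half_plane. Theta h (lattice_of Q) z = 0)" by blast
  next
    assume "\<exists>h\<in>harmonic_forms. h \<noteq> 0 \<and> (\<forall>z\<in>upper_half_plane. Theta h (lattice_of Q) z = 0)"
    then obtain h where h: "h \<in> harmonic_forms" "h \<noteq> 0" "\<And>z. z \<in> upper_half_plane \<Longrightarrow> Theta h (lattice_of Q) z = 0" by blast
    have p0: "pull_form Q 0 = 0" using pull_form_scaleR[of Q 0 0] by simp
    have mem: "pull_form Q h \<in> disc_tangent ?A" "pull_form Q 0 \<in> disc_tangent ?A"
      using h(1) subspace_0[OF subspace_harmonic] trace_pull_form[OF Q]
      by (auto simp: disc_tangent_def harmonic_forms_def pull_form_sym)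
    have "Theta 0 (lattice_of Q) z = 0" if z: "z \<in> upper_half_plane" for z
      using D_Theta_scaleR[OF Q z, of 0 0 0] by simp
    then have "?f (pull_form Q h) = ?f (pull_form Q 0)"
      using h(3) by (intro ext) (simp add: restrict_def Theta)
    moreover have "pull_form Q h \<noteq> pull_form Q 0" using h(2) pull by metis
    ultimately show "\<not> inj_on ?f (disc_tangent ?A)" using mem by (auto simp: inj_on_def)
  qed
qed

subsection \<open>Integral lattices and the level\<close>

definition real_mat :: "int ^ 'n ^ 'm \<Rightarrow> real ^ 'n ^ 'm" where
  "real_mat M = (\<chi> i j. of_int (M $ i $ j))"

lemma real_mat_vec: "of_int_vec (M *v x) = real_mat M *v of_int_vec x"
  by (simp add: vec_eq_iff matrix_vector_mult_def real_mat_def)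

lemma real_mat_mult: "real_mat (M ** M') = real_mat M ** real_mat M'"
  by (simp add: vec_eq_iff matrix_matrix_mult_def real_mat_def)

lemma real_mat_mat: "real_mat (mat k) = of_int k *\<^sub>R mat 1"
  by (simp add: vec_eq_iff mat_def real_mat_def)

lemma real_mat_transpose: "real_mat (transpose M) = transpose (real_mat M)"
  by (simp add: vec_eq_iff transpose_def real_mat_def)

lemma real_mat_inject: "real_mat M = real_mat M' \<Longrightarrow> M = M'"
  by (simp add: vec_eq_iff real_mat_def)

lemma real_mat_surj:
  assumes "\<And>i j. R $ i $ j \<in> \<int>" obtains M where "R = real_mat M"
proof -
  have "R = real_mat (\<chi> i j. \<lfloor>R $ i $ j\<rfloor>)"
    using assms by (simp add: vec_eq_iff real_mat_def)
  then show ?thesis by (rule that)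
qed

lemma idot_inner: "of_int (idot x y) = of_int_vec x \<bullet> of_int_vec y"
  by (simp add: idot_def inner_vec_def)

lemma det_Ints: "(\<And>i j. M $ i $ j \<in> \<int>) \<Longrightarrow> Determinants.det (M :: real ^ 'n ^ 'n) \<in> \<int>"
  unfolding Determinants.det_def by (intro Ints_sum Ints_mult Ints_prod) auto

text \<open>Cramer's rule. It bounds the denominators of the inverse and thus shows that the minimum
  in \<open>level\<close> is taken over a nonempty set.\<close>

lemma det_mult_inv_Ints:
  assumes M: "\<And>i j. M $ i $ j \<in> \<int>" and inv: "invertible (M :: real ^ 'n ^ 'n)"
  shows "Determinants.det M * matrix_inv M $ k $ j \<in> \<int>"
proof -
  have d: "Determinants.det M \<noteq> 0" using inv by (simp add: invertible_det_nz)
  let ?x = "matrix_inv M *v axis j 1"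
  have "M *v ?x = axis j 1" by (rule matrix_inv_mult(3)[OF inv])
  then have "?x = (\<chi> k. Determinants.det (\<chi> i l. if l = k then axis j 1 $ i else M $ i $ l) / Determinants.det M)"
    using cramer[OF d] by blast
  then have "?x $ k = Determinants.det (\<chi> i l. if l = k then axis j 1 $ i else M $ i $ l) / Determinants.det M"
    by (metis (no_types, lifting) vec_lambda_beta)
  moreover have "?x $ k = matrix_inv M $ k $ j"
    by (simp add: matrix_vector_mul_component inner_axis)
  ultimately have "Determinants.det M * matrix_inv M $ k $ j = Determinants.det (\<chi> i l. if l = k then axis j 1 $ i else M $ i $ l)"
    using d by simp
  also have "\<dots> \<in> \<int>" by (rule det_Ints) (use M in \<open>auto simp: axis_def\<close>)
  finally show ?thesis .
qed

text \<open>Off-diagonal entries enter twice and diagonal ones are even; the coordinates of w are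
  switched on one by one.\<close>

lemma even_idot:
  assumes S: "transpose S = S" "\<And>i. even (S $ i $ i)"
  shows "even (idot w (S *v w))"
proof -
  define w' where "w' = (\<lambda>I. (\<chi> i. if i \<in> I then w $ i else 0))"
  have "even (idot (w' I) (S *v w' I))" if "finite I" for I
    using that
  proof induction
    case empty
    have "w' {} = 0" by (simp add: w'_def vec_eq_iff)
    then show ?case by (simp add: idot_def)
  next
    case (insert i I)
    have eq: "w' (insert i I) = w' I + w $ i *s axis i 1"
      using insert.hyps by (auto simp: w'_def vec_eq_iff axis_def)
    have "idot (w' (insert i I)) (S *v w' (insert i I)) =
        idot (w' I) (S *v w' I) + 2 * (w $ i * idot (w' I) (S *v axis i 1)) + (w $ i)\<^sup>2 * idot (axis i 1) (S *v axis i 1)"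
      unfolding eq
      using idot_sym[OF S(1), of "axis i 1" "w' I"]
      by (simp add: matrix_vector_right_distrib matrix_vector_scale_int idot_add_left idot_add_right
          idot_scale_left idot_scale_right power2_eq_square algebra_simps)
    moreover have "idot (axis i 1) (S *v axis i 1) = S $ i $ i"
    proof -
      have "(S *v axis i 1) $ i = (\<Sum>j\<in>UNIV. if i = j then S $ i $ j else 0)"
        unfolding matrix_vector_mult_def vec_lambda_beta by (intro sum.cong) (auto simp: axis_def)
      then show ?thesis by (simp add: idot_axis)
    qed
    ultimately show ?case using insert.IH S(2) by simp
  qed
  from this[of UNIV] show ?thesis by (simp add: w'_def)
qed

text \<open>Here q is the norm form, S = 2A is integral by polarisation, and S' = N (2A)^(-1). The
  last divisibility is where the even diagonal in the level counts: 2 q(S' w) is N times the value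
  of S' at w, and that value is even.\<close>

theorem integral_lattice_data:
  fixes Q :: "real ^ 'n ^ 'n"
  assumes Q: "invertible Q" and int: "integral_lattice (lattice_of Q)"
    and N: "N = level (transpose Q ** Q)"
  obtains q S S' where "int_quad q S"
    "\<And>x. of_int (q x) = quad_form (transpose Q ** Q) (of_int_vec x)"
    "real_mat S = 2 *\<^sub>R (transpose Q ** Q)"
    "transpose S' = S'" "S ** S' = mat (int N)" "S' ** S = mat (int N)" "\<And>w. int N dvd q (S' *v w)" "N > 0"
proof -
  define A where "A = transpose Q ** Q"
  have sA: "transpose A = A" by (simp add: A_def matrix_transpose_mul)
  have iA: "invertible A" unfolding A_def by (rule posdef_invertible[OF posdef_gram[OF Q]])
  have qZ: "quad_form A (of_int_vec x) \<in> \<int>" for x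
    using int unfolding integral_lattice_def lattice_of_def by (auto simp: A_def quad_form_gram)
  define q where "q = (\<lambda>x. \<lfloor>quad_form A (of_int_vec x)\<rfloor>)"
  have q: "of_int (q x) = quad_form A (of_int_vec x)" for x
    using qZ[of x] by (simp add: q_def)
  have "(2 *\<^sub>R A) $ i $ j \<in> \<int>" for i j
  proof -
    have ax: "of_int_vec (axis i 1) = (axis i 1 :: real ^ 'n)" for i by (simp add: vec_eq_iff axis_def)
    have "quad_form A (of_int_vec (axis i 1 + axis j 1)) = quad_form A (of_int_vec (axis i 1)) + 2 * (axis i 1 \<bullet> (A *v axis j 1)) + quad_form A (of_int_vec (axis j 1))"
      using quad_form_add[OF sA, of "axis i 1" "axis j 1"] by (simp add: of_int_vec_add ax)
    moreover have "axis i 1 \<bullet> (A *v axis j 1) = A $ i $ j"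
      by (simp add: inner_axis' matrix_vector_mul_component inner_axis)
    ultimately have "(2 *\<^sub>R A) $ i $ j = quad_form A (of_int_vec (axis i 1 + axis j 1)) - quad_form A (of_int_vec (axis i 1)) - quad_form A (of_int_vec (axis j 1))"
      by simp
    also have "\<dots> \<in> \<int>" by (intro Ints_diff qZ)
    finally show ?thesis .
  qed
  then obtain S where S: "2 *\<^sub>R A = real_mat S" using real_mat_surj by metis
  have sS: "transpose S = S"
    by (rule real_mat_inject) (simp add: real_mat_transpose S[symmetric], simp add: sA transpose_def vec_eq_iff symmetric_nth[OF sA])
  have iq: "int_quad q S"
    unfolding int_quad_def
  proof (intro conjI allI sS)
    fix x y
    have "2 * (of_int_vec x \<bullet> (A *v of_int_vec y)) = of_int_vec x \<bullet> ((2 *\<^sub>R A) *v of_int_vec y)"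
      by (simp add: scaleR_matrix_vector_assoc[symmetric])
    also have "\<dots> = of_int (idot x (S *v y))" by (simp add: idot_inner S real_mat_vec)
    finally have "real_of_int (q (x + y)) = of_int (q x + idot x (S *v y) + q y)"
      by (simp add: q of_int_vec_add quad_form_add[OF sA])
    then show "q (x + y) = q x + idot x (S *v y) + q y" by (simp only: of_int_eq_iff)
  next
    fix k x
    have "of_int_vec (k *s x) = of_int k *\<^sub>R (of_int_vec x :: real ^ 'n)" by (simp add: vec_eq_iff)
    then have "real_of_int (q (k *s x)) = of_int (k\<^sup>2 * q x)"
      by (simp add: q quad_form_scale)
    then show "q (k *s x) = k\<^sup>2 * q x" by (simp only: of_int_eq_iff)
  qed
  let ?P = "\<lambda>N. N > 0 \<and> even_integral_matrix (real N *\<^sub>R matrix_inv (2 *\<^sub>R A))"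
  have i2A: "invertible (2 *\<^sub>R A)"
    by (rule invertible_def[THEN iffD2], rule exI[of _ "(1 / 2) *\<^sub>R matrix_inv A"])
      (simp add: matrix_scalar_ac scalar_matrix_assoc[symmetric] matrix_inv_mult[OF iA])
  have "\<exists>N. ?P N"
  proof -
    have Z: "(2 *\<^sub>R A) $ i $ j \<in> \<int>" for i j by (simp add: S real_mat_def)
    obtain \<delta> where \<delta>: "Determinants.det (2 *\<^sub>R A) = of_int \<delta>" using det_Ints[OF Z] by (auto elim: Ints_cases)
    have \<delta>0: "\<delta> \<noteq> 0" using i2A \<delta> by (simp add: invertible_det_nz)
    \<comment> \<open>The determinant clears the denominators, and the additional factor 2 makes the
      diagonal even.\<close>
    have entry: "\<exists>k::int. (real (nat (2 * \<bar>\<delta>\<bar>)) *\<^sub>R matrix_inv (2 *\<^sub>R A)) $ i $ j = 2 * of_int k" for i j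
    proof -
      obtain k where k: "of_int \<delta> * matrix_inv (2 *\<^sub>R A) $ i $ j = of_int k"
        using det_mult_inv_Ints[OF Z i2A, of i j] \<delta> by (auto elim: Ints_cases)
      have "(real (nat (2 * \<bar>\<delta>\<bar>)) *\<^sub>R matrix_inv (2 *\<^sub>R A)) $ i $ j = 2 * (of_int (sgn \<delta>) * (of_int \<delta> * matrix_inv (2 *\<^sub>R A) $ i $ j))"
      proof -
        have "real (nat (2 * \<bar>\<delta>\<bar>)) = 2 * (of_int (sgn \<delta>) * of_int \<delta>)"
          using \<delta>0 by (cases "\<delta> > 0") auto
        then show ?thesis by simp
      qed
      then show ?thesis unfolding k by (intro exI[of _ "sgn \<delta> * k"]) simp
    qed
    have "(real (nat (2 * \<bar>\<delta>\<bar>)) *\<^sub>R matrix_inv (2 *\<^sub>R A)) $ i $ j \<in> \<int>" for i j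
    proof -
      obtain k :: int where "(real (nat (2 * \<bar>\<delta>\<bar>)) *\<^sub>R matrix_inv (2 *\<^sub>R A)) $ i $ j = 2 * of_int k"
        using entry by blast
      also have "\<dots> \<in> \<int>" by simp
      finally show ?thesis .
    qed
    then have "?P (nat (2 * \<bar>\<delta>\<bar>))"
      unfolding even_integral_matrix_def using entry \<delta>0 by auto
    then show ?thesis by blast
  qed
  then have "?P (LEAST N. ?P N)" by (rule LeastI_ex)
  then have PN: "N > 0" "even_integral_matrix (real N *\<^sub>R matrix_inv (2 *\<^sub>R A))"
    by (simp_all add: N level_def A_def)
  obtain S' where S': "real N *\<^sub>R matrix_inv (2 *\<^sub>R A) = real_mat S'"
    using PN(2) real_mat_surj unfolding even_integral_matrix_def by metis
  have SS': "S ** S' = mat (int N)" "S' ** S = mat (int N)"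
  proof -
    have "real_mat (S ** S') = real_mat (mat (int N))"
      unfolding real_mat_mult S[symmetric] S'[symmetric] matrix_scalar_ac real_mat_mat
      unfolding scalar_matrix_assoc[of "real N", symmetric] matrix_inv_mult(1)[OF i2A] by simp
    then show "S ** S' = mat (int N)" by (rule real_mat_inject)
    have "real_mat (S' ** S) = real_mat (mat (int N))"
      unfolding real_mat_mult S[symmetric] S'[symmetric] real_mat_mat
      unfolding scalar_matrix_assoc[of "real N", symmetric] matrix_inv_mult(2)[OF i2A] by simp
    then show "S' ** S = mat (int N)" by (rule real_mat_inject)
  qed
  have s2A: "transpose (2 *\<^sub>R A) = 2 *\<^sub>R A" by (simp add: S real_mat_transpose[symmetric] sS)
  have sS': "transpose S' = S'"
  proof (rule real_mat_inject)
    have "transpose (real N *\<^sub>R matrix_inv (2 *\<^sub>R A)) = real N *\<^sub>R transpose (matrix_inv (2 *\<^sub>R A))"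
      by (simp add: transpose_def vec_eq_iff)
    then show "real_mat (transpose S') = real_mat S'"
      by (simp add: real_mat_transpose S'[symmetric] matrix_inv_sym[OF i2A s2A])
  qed
  have "even (S' $ i $ i)" for i
  proof -
    obtain k :: int where "real_of_int (S' $ i $ i) = 2 * of_int k"
      using PN(2) unfolding even_integral_matrix_def S' by (auto simp: real_mat_def)
    then have "real_of_int (S' $ i $ i) = of_int (2 * k)" by simp
    then show ?thesis by (simp only: of_int_eq_iff) simp
  qed
  then have ev: "even (idot w (S' *v w))" for w by (rule even_idot[OF sS'])
  have "int N dvd q (S' *v w)" for w
  proof -
    obtain k where k: "idot w (S' *v w) = 2 * k" using ev by (auto elim: evenE)
    have q2: "2 * q x = idot x (S *v x)" for x
    proof -
      have "q (x + x) = 4 * q x" using int_quad_scale[OF iq, of 2 x] by (simp add: vector_add_ldistrib scalar_vector_matrix_assoc vec_eq_iff)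
        (metis mult_2 numeral_One one_add_one vector_sadd_rdistrib vector_smult_lid)
      then show ?thesis using int_quad_add[OF iq, of x x] by simp
    qed
    have "S *v (S' *v w) = int N *s w"
      by (simp add: matrix_vector_mul_assoc SS', simp add: mat_def matrix_vector_mult_def vec_eq_iff if_distrib[of "\<lambda>x. x * _"] cong: if_cong)
    then have "2 * q (S' *v w) = int N * (2 * k)"
      unfolding q2 by (simp add: idot_scale_right idot_commute[of _ w] k)
    then have "q (S' *v w) = int N * k" by simp
    then show ?thesis by simp
  qed
  then show ?thesis
    using that[OF iq _ _ sS' SS' _ PN(1)] q S by (simp add: A_def)
qed

subsection \<open>Transformation under the modular group\<close>

text \<open>Locally the factor is a quotient of holomorphic functions, by Poisson summation at a
  shift r where the dual sum does not vanish. \<open>wronskian_transfer\<close> differentiates this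
  factor, so holomorphy is required there.\<close>

lemma poisson_factor_holomorphic:
  assumes A: "posdef A" shows "poisson_factor A holomorphic_on upper_half_plane"
proof (rule holomorphic_on_open[OF open_upper_half_plane, THEN iffD2], safe)
  fix w assume wH: "w \<in> upper_half_plane"
  then have w: "Im w > 0" by (simp add: upper_half_plane_def)
  obtain r where r: "dual_sum_fn A w r \<noteq> 0" by (rule dual_sum_fn_nonvanishing[OF A w])
  define f where "f = (\<lambda>w. gauss_sum_fn A w r)"
  define g where "g = (\<lambda>w. dual_sum_fn A w r)"
  have f_hol: "f holomorphic_on upper_half_plane"
    unfolding f_def by (rule gauss_sum_fn_holomorphic[OF A])
  have g_hol: "g holomorphic_on upper_half_plane"
    unfolding g_def by (rule dual_sum_fn_holomorphic[OF A])
  define U where "U = upper_half_plane \<inter> g -` (- {0})"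
  have "open U" unfolding U_def
    by (rule continuous_open_preimage[OF holomorphic_on_imp_continuous_on[OF g_hol] open_upper_half_plane]) (simp add: open_Compl)
  moreover have "w \<in> U" using wH r by (simp add: U_def g_def)
  ultimately have U: "open U" "w \<in> U" .
  have "(\<lambda>v. f v / g v) holomorphic_on U"
    by (intro holomorphic_on_divide holomorphic_on_subset[OF f_hol] holomorphic_on_subset[OF g_hol]) (auto simp: U_def)
  then have "poisson_factor A holomorphic_on U"
  proof (rule holomorphic_transform)
    fix v assume v: "v \<in> U"
    then have "Im v > 0" by (simp add: U_def upper_half_plane_def)
    then have "f v = poisson_factor A v * g v" unfolding f_def g_def by (rule poisson_summation[OF A])
    then show "f v / g v = poisson_factor A v" using v by (simp add: U_def)
  qed
  then show "\<exists>f'. (poisson_factor A has_field_derivative f') (at w)"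
    using U by (auto simp: holomorphic_on_open)
qed

lemma posdef_scaleR:
  assumes "posdef A" "c > 0" shows "posdef (c *\<^sub>R A)"
proof -
  obtain c' where c': "c' > 0" "\<And>x. c' * (norm x)\<^sup>2 \<le> quad_form A x"
    using assms(1) unfolding posdef_def by blast
  have "(c * c') * (norm x)\<^sup>2 \<le> quad_form (c *\<^sub>R A) x" for x
    using mult_left_mono[OF c'(2), of c x] assms(2) by (simp add: quad_form_scaleR_matrix mult.assoc)
  moreover have "transpose (c *\<^sub>R A) = c *\<^sub>R A"
    using posdef_sym[OF assms(1)] by (simp add: transpose_def vec_eq_iff)
  ultimately show ?thesis
    unfolding posdef_def using mult_pos_pos[OF assms(2) c'(1)] by blast
qed

lemma infsum_finite_swap:
  fixes f :: "'a \<Rightarrow> 'b \<Rightarrow> complex"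
  assumes "finite I" "\<And>i. i \<in> I \<Longrightarrow> f i summable_on X"
  shows "(\<Sum>i\<in>I. \<Sum>\<^sub>\<infinity>x\<in>X. f i x) = (\<Sum>\<^sub>\<infinity>x\<in>X. \<Sum>i\<in>I. f i x)"
    and "(\<lambda>x. \<Sum>i\<in>I. f i x) summable_on X"
proof -
  have "((\<lambda>x. \<Sum>i\<in>I. f i x) has_sum (\<Sum>i\<in>I. \<Sum>\<^sub>\<infinity>x\<in>X. f i x)) X"
    using assms
  proof (induction I rule: finite_induct)
    case (insert i I)
    then show ?case by (simp add: has_sum_add has_sum_infsum)
  qed simp
  then show "(\<Sum>i\<in>I. \<Sum>\<^sub>\<infinity>x\<in>X. f i x) = (\<Sum>\<^sub>\<infinity>x\<in>X. \<Sum>i\<in>I. f i x)" "(\<lambda>x. \<Sum>i\<in>I. f i x) summable_on X"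
    by (auto simp: infsumI summable_on_def)
qed

lemma infsum_residue_classes:
  fixes g :: "int ^ 'n \<Rightarrow> complex"
  assumes c: "c > 0" and g: "g summable_on UNIV"
  shows "infsum g UNIV = (\<Sum>r\<in>vresidues c. \<Sum>\<^sub>\<infinity>x. g (r + c *s x))"
proof -
  let ?\<phi> = "\<lambda>(r :: int ^ 'n, x :: int ^ 'n). r + c *s x"
  have bij: "bij_betw ?\<phi> (vresidues c \<times> UNIV) UNIV"
  proof (rule bij_betwI[of _ _ _ "\<lambda>x. (vmod x c, \<chi> i. x $ i div c)"])
    show "(\<lambda>x. (vmod x c, \<chi> i. x $ i div c)) \<in> UNIV \<rightarrow> vresidues c \<times> UNIV"
      using c by (auto intro: vmod_in_residues)
    fix p :: "(int ^ 'n) \<times> (int ^ 'n)" assume "p \<in> vresidues c \<times> UNIV"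
    then have "(fst p $ i + c * snd p $ i) div c = snd p $ i" "(fst p $ i + c * snd p $ i) mod c = fst p $ i" for i
      using c by (auto simp: vresidues_def div_add1_eq[of _ "c * _" c])
    then show "(\<lambda>x. (vmod x c, \<chi> i. x $ i div c)) (?\<phi> p) = p"
      by (simp add: case_prod_unfold prod_eq_iff vec_eq_iff vmod_def)
  qed (auto simp: vec_eq_iff vmod_def)
  have S: "(\<lambda>p. g (?\<phi> p)) summable_on (vresidues c \<times> UNIV)"
    using summable_on_reindex_bij_betw[OF bij, of g] g by simp
  have "infsum g UNIV = (\<Sum>\<^sub>\<infinity>p\<in>vresidues c \<times> UNIV. g (?\<phi> p))"
    by (rule infsum_reindex_bij_betw[OF bij, symmetric])
  also have "\<dots> = (\<Sum>\<^sub>\<infinity>r\<in>vresidues c. \<Sum>\<^sub>\<infinity>x. g (?\<phi> (r, x)))"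
    using infsum_Sigma_banach[OF S] by simp
  finally show ?thesis by simp
qed

lemma moebius_upper:
  fixes a b c d :: int
  assumes det: "a * d - b * c = 1" and z: "z \<in> upper_half_plane"
  shows "of_int c * z + of_int d \<noteq> (0 :: complex)"
    and "(of_int a * z + of_int b) / (of_int c * z + of_int d) \<in> upper_half_plane"
    and "((\<lambda>z. (of_int a * z + of_int b) / (of_int c * z + of_int d)) has_field_derivative
       1 / (of_int c * z + of_int d)\<^sup>2) (at z)"
proof -
  have y: "Im z > 0" using z by (simp add: upper_half_plane_def)
  show l: "of_int c * z + of_int d \<noteq> (0 :: complex)"
  proof
    assume 0: "of_int c * z + of_int d = (0 :: complex)"
    have "of_int c * Im z = 0" using arg_cong[OF 0, of Im] by simp
    then have "c = 0" using y by simp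
    then have "d = 0" using 0 by simp
    then show False using det \<open>c = 0\<close> by simp
  qed
  have det': "of_int a * of_int d - of_int b * of_int c = (1 :: real)" "of_int a * of_int d - of_int b * of_int c = (1 :: complex)"
    using det by (metis of_int_1 of_int_diff of_int_mult)+
  have "Im ((of_int a * z + of_int b) / (of_int c * z + of_int d)) = ((of_int a * of_int d - of_int b * of_int c) * Im z) / (norm (of_int c * z + of_int d))\<^sup>2"
    by (simp add: Im_divide cmod_power2) (simp add: algebra_simps)
  also have "\<dots> = Im z / (norm (of_int c * z + of_int d))\<^sup>2" by (simp add: det')
  also have "\<dots> > 0" using y l by simp
  finally show "(of_int a * z + of_int b) / (of_int c * z + of_int d) \<in> upper_half_plane"
    by (simp add: upper_half_plane_def)
  have "((\<lambda>z. (of_int a * z + of_int b) / (of_int c * z + of_int d)) has_field_derivative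
      (of_int a * (of_int c * z + of_int d) - (of_int a * z + of_int b) * of_int c) / ((of_int c * z + of_int d) * (of_int c * z + of_int d))) (at z)"
    using l by (auto intro!: derivative_eq_intros)
  also have "of_int a * (of_int c * z + of_int d) - (of_int a * z + of_int b) * of_int c = of_int a * of_int d - of_int b * (of_int c :: complex)"
    by (simp add: algebra_simps)
  finally show "((\<lambda>z. (of_int a * z + of_int b) / (of_int c * z + of_int d)) has_field_derivative
       1 / (of_int c * z + of_int d)\<^sup>2) (at z)"
    by (simp add: det' power2_eq_square)
qed

text \<open>The image point is a/c - 1 / (c (c z + d)), and with w = -c / (c z + d) the second
  summand is w / c^2. The rational part a/c gives the Gauss sum, and rescaling by c leaves the
  argument w. Poisson summation sends w to z/4 + d / (4 c), whose constant part is the phase in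
  \<open>gauss_coeff\<close>.\<close>

lemma moebius_poisson_arg:
  fixes a b c d :: int
  assumes det: "a * d - b * c = 1" and c: "c > 0" and z: "z \<in> upper_half_plane"
  defines "l \<equiv> of_int c * z + of_int d"
  shows "Im (- of_int c / l) > 0"
    and "(of_int a * z + of_int b) / l = of_int a / of_int c + (- of_int c / l) / (of_int c)\<^sup>2"
    and "- 1 / (4 * (- of_int c / l)) = z / 4 + of_int d / (4 * of_int c)"
proof -
  have l0: "l \<noteq> 0" unfolding l_def by (rule moebius_upper(1)[OF det z])
  have c0: "of_int c \<noteq> (0::complex)" using c by simp
  have "Im l = of_int c * Im z" by (simp add: l_def)
  then have "Im l > 0" using c z by (simp add: upper_half_plane_def)
  moreover have "Im (- of_int c / l) = of_int c * Im l / (norm l)\<^sup>2"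
    by (simp add: Im_divide cmod_power2)
  ultimately show "Im (- of_int c / l) > 0" using c l0 by simp
  have det': "of_int a * of_int d - of_int b * of_int c = (1 :: complex)"
    using det by (metis of_int_1 of_int_diff of_int_mult)
  have "(of_int a * z + of_int b) * of_int c = of_int a * l - 1"
    using det' by (simp add: l_def algebra_simps)
  then show "(of_int a * z + of_int b) / l = of_int a / of_int c + (- of_int c / l) / (of_int c)\<^sup>2"
    using l0 c0 by (simp add: divide_simps power2_eq_square)
  show "- 1 / (4 * (- of_int c / l)) = z / 4 + of_int d / (4 * of_int c)"
    using l0 c0 by (simp add: field_simps) (simp add: l_def algebra_simps)
qed

definition gauss_coeff :: "(int ^ 'n \<Rightarrow> int) \<Rightarrow> real ^ 'n ^ 'n \<Rightarrow> int \<Rightarrow> int \<Rightarrow> int \<Rightarrow> int ^ 'n \<Rightarrow> complex" where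
  "gauss_coeff q A a c d y = gauss q a c y * e (of_real (quad_form (matrix_inv A) (of_int_vec y)) * (of_int d / (4 * of_int c)))"

lemma norm_gauss_coeff_le:
  assumes "c > 0" shows "norm (gauss_coeff (q :: int ^ 'n \<Rightarrow> int) A a c d y) \<le> of_int c ^ CARD('n)"
proof -
  have "of_real (quad_form (matrix_inv A) (of_int_vec y)) * (of_int d / (4 * of_int c)) =
      (of_real (quad_form (matrix_inv A) (of_int_vec y) * (of_int d / (4 * of_int c))) :: complex)" by simp
  then have "norm (e (of_real (quad_form (matrix_inv A) (of_int_vec y)) * (of_int d / (4 * of_int c)))) = 1"
    by (simp only: norm_e_of_real)
  then show ?thesis using norm_gauss_le[OF assms, of q a y] by (simp add: gauss_coeff_def norm_mult)
qed

lemma poly_growth_gauss_coeff: "c > 0 \<Longrightarrow> poly_growth (gauss_coeff q A a c d)"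
  by (rule poly_growthI[of _ "of_int c ^ CARD('a)" 0]) (simp add: norm_gauss_coeff_le)

text \<open>Splitting into residue classes modulo \<open>c\<close> and applying Poisson summation to each class;
  \<open>p\<close> is either constant or a harmonic form, for which \<open>t\<close> is \<open>0\<close> or \<open>2\<close>.\<close>

lemma theta_moebius:
  fixes A :: "real ^ 'n ^ 'n" and p p' :: "real ^ 'n \<Rightarrow> real" and a b c d :: int
  assumes A: "posdef A" and iq: "int_quad q S" and q: "\<And>x. of_int (q x) = quad_form A (of_int_vec x)"
    and det: "a * d - b * c = 1" and c: "c > 0" and z: "z \<in> upper_half_plane"
    and p: "\<And>s x. p (s *\<^sub>R x) = s ^ t * p x" "\<And>r. poly_growth (\<lambda>x. of_real (p (of_int_vec x + r)))"
    and p': "poly_growth (\<lambda>y. of_real (p' (of_int_vec y)))"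
    and poisson: "\<And>w r. Im w > 0 \<Longrightarrow> (\<Sum>\<^sub>\<infinity>x. of_real (p (of_int_vec x + r)) * e (of_real (quad_form A (of_int_vec x + r)) * w)) =
       poisson_factor A w / w ^ t * (\<Sum>\<^sub>\<infinity>y. of_real (p' (of_int_vec y)) *
          (ev y r * e (of_real (quad_form (matrix_inv A) (of_int_vec y)) * (- 1 / (4 * w)))))"
  defines "l \<equiv> of_int c * z + of_int d"
  shows "theta_series (\<lambda>x. of_real (p (of_int_vec x))) (\<lambda>x. quad_form A (of_int_vec x)) ((of_int a * z + of_int b) / l) =
    (- l) ^ t * poisson_factor A (- of_int c / l) *
      theta_series (\<lambda>y. of_real (p' (of_int_vec y)) * gauss_coeff q A a c d y) (\<lambda>y. quad_form ((1 / 4) *\<^sub>R matrix_inv A) (of_int_vec y)) z"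
proof -
  define w where "w = - of_int c / l"
  define c' where "c' = real_of_int c"
  have c'0: "c' > 0" using c by (simp add: c'_def)
  have l0: "l \<noteq> 0" unfolding l_def by (rule moebius_upper(1)[OF det z])
  note arg = moebius_poisson_arg[OF det c z, folded l_def, folded w_def]
  let ?z' = "(of_int a * z + of_int b) / l"
  have z': "?z' \<in> upper_half_plane" unfolding l_def by (rule moebius_upper(2)[OF det z])
  have w0: "w \<noteq> 0" using arg(1) by auto
  let ?g = "\<lambda>x. of_real (p (of_int_vec x)) * e (of_real (quad_form A (of_int_vec x)) * ?z')"
  let ?E = "\<lambda>y. e (of_real (quad_form (matrix_inv A) (of_int_vec y)) * (- 1 / (4 * w)))"
  have gs: "?g summable_on UNIV"
    by (rule theta_summable[OF _ quad_growth_posdef0[OF A] z']) (use p(2)[of 0] in simp)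
  \<comment> \<open>On a class modulo c the phase e(a q / c) is constant, since q is integral. After
    division by c the rest is a Gaussian in x + r / c at w, to which Poisson summation
    applies.\<close>
  have term_eq: "?g (r + c *s x) = (er (a * q r) c * of_real (c' ^ t)) *
      (of_real (p (of_int_vec x + (1 / c') *\<^sub>R of_int_vec r)) * e (of_real (quad_form A (of_int_vec x + (1 / c') *\<^sub>R of_int_vec r)) * w))" for r x
  proof -
    let ?v = "of_int_vec x + (1 / c') *\<^sub>R of_int_vec r"
    have v: "of_int_vec (r + c *s x) = c' *\<^sub>R ?v"
      using c'0 by (simp add: vec_eq_iff c'_def algebra_simps)
    have 1: "p (of_int_vec (r + c *s x)) = c' ^ t * p ?v" by (simp only: v p)
    have 2: "quad_form A (of_int_vec (r + c *s x)) = c'\<^sup>2 * quad_form A ?v" by (simp only: v quad_form_scale)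
    have "e (of_real (quad_form A (of_int_vec (r + c *s x))) * ?z') =
       e (of_real (quad_form A (of_int_vec (r + c *s x))) * (of_int a / of_int c)) *
       e (of_real (quad_form A (of_int_vec (r + c *s x))) * (w / (of_int c)\<^sup>2))"
      unfolding arg(2) by (simp only: distrib_left e_add)
    also have "of_real (quad_form A (of_int_vec (r + c *s x))) * (w / (of_int c)\<^sup>2) = of_real (quad_form A ?v) * w"
      unfolding 2 using c by (simp add: c'_def)
    also have "e (of_real (quad_form A (of_int_vec (r + c *s x))) * (of_int a / of_int c)) = er (a * q (r + c *s x)) c"
      unfolding q[symmetric] er_def by (simp add: mult.commute)
    also have "er (a * q (r + c *s x)) c = er (a * q r) c"
      by (rule er_quad_cong[OF iq]) simp
    finally show ?thesis unfolding 1 by (simp add: mult_ac)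
  qed
  have pe: "poly_growth (\<lambda>y. er (a * q r) c * er (idot r y) c)" for r
    by (rule poly_growthI[of _ 1 0]) (simp add: norm_mult)
  have sum_y: "(\<lambda>y. of_real (p' (of_int_vec y)) * (er (a * q r) c * er (idot r y) c) * ?E y) summable_on UNIV" for r
    by (rule theta_summable[OF _ quad_growth_posdef0[OF posdef_inv[OF A]]])
      (auto intro!: poly_growth_mult p' pe simp: upper_half_plane_def Im_neg_inverse_pos[OF arg(1), simplified])
  have ev_r: "ev y ((1 / c') *\<^sub>R of_int_vec r) = er (idot r y) c" for y r :: "int ^ 'n"
  proof -
    have "of_int_vec y \<bullet> ((1 / c') *\<^sub>R of_int_vec r) = of_int (idot r y) / c'"
      by (simp add: idot_inner inner_commute)
    then show ?thesis unfolding ev_def er_def by (simp only: c'_def of_real_divide of_real_of_int_eq)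
  qed
  have "theta_series (\<lambda>x. of_real (p (of_int_vec x))) (\<lambda>x. quad_form A (of_int_vec x)) ?z' = 
      (\<Sum>r\<in>vresidues c. \<Sum>\<^sub>\<infinity>x. ?g (r + c *s x))"
    unfolding theta_series_def by (rule infsum_residue_classes[OF c gs])
  also have "\<dots> = (\<Sum>r\<in>vresidues c. (er (a * q r) c * of_real (c' ^ t)) * (poisson_factor A w / w ^ t * 
      (\<Sum>\<^sub>\<infinity>y. of_real (p' (of_int_vec y)) * (ev y ((1 / c') *\<^sub>R of_int_vec r) * ?E y))))"
    unfolding term_eq infsum_cmult_right' poisson[OF arg(1)] ..
  also have "\<dots> = of_real (c' ^ t) * poisson_factor A w / w ^ t * (\<Sum>r\<in>vresidues c. er (a * q r) c * 
      (\<Sum>\<^sub>\<infinity>y. of_real (p' (of_int_vec y)) * (ev y ((1 / c') *\<^sub>R of_int_vec r) * ?E y)))"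
    unfolding sum_distrib_left by (intro sum.cong refl) simp
  also have "(\<Sum>r\<in>vresidues c. er (a * q r) c * (\<Sum>\<^sub>\<infinity>y. of_real (p' (of_int_vec y)) * (ev y ((1 / c') *\<^sub>R of_int_vec r) * ?E y))) =
      (\<Sum>r\<in>vresidues c. \<Sum>\<^sub>\<infinity>y. of_real (p' (of_int_vec y)) * (er (a * q r) c * er (idot r y) c) * ?E y)"
    unfolding ev_r infsum_cmult_right'[symmetric] by (intro sum.cong infsum_cong refl) (simp only: mult_ac)
  also have "\<dots> = (\<Sum>\<^sub>\<infinity>y. \<Sum>r\<in>vresidues c. of_real (p' (of_int_vec y)) * (er (a * q r) c * er (idot r y) c) * ?E y)"
    by (rule infsum_finite_swap(1)[OF finite_residues sum_y])
  also have "\<dots> = theta_series (\<lambda>y. of_real (p' (of_int_vec y)) * gauss_coeff q A a c d y) (\<lambda>y. quad_form ((1 / 4) *\<^sub>R matrix_inv A) (of_int_vec y)) z"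
    unfolding theta_series_def
  proof (intro infsum_cong)
    fix y :: "int ^ 'n"
    have "?E y = e (of_real (quad_form (matrix_inv A) (of_int_vec y)) * (of_int d / (4 * of_int c))) *
        e (of_real (quad_form ((1 / 4) *\<^sub>R matrix_inv A) (of_int_vec y)) * z)"
      unfolding arg(3) e_add[symmetric] by (simp add: quad_form_scaleR_matrix algebra_simps)
    then show "(\<Sum>r\<in>vresidues c. of_real (p' (of_int_vec y)) * (er (a * q r) c * er (idot r y) c) * ?E y) =
       of_real (p' (of_int_vec y)) * gauss_coeff q A a c d y * e (of_real (quad_form ((1 / 4) *\<^sub>R matrix_inv A) (of_int_vec y)) * z)"
      by (simp add: gauss_coeff_def gauss_def er_add sum_distrib_left sum_distrib_right mult_ac)
  qed
  also have "of_real (c' ^ t) * poisson_factor A w / w ^ t = (- l) ^ t * poisson_factor A w"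
  proof -
    have "of_real c' / w = - l" using c l0 by (simp add: w_def c'_def)
    then have "of_real (c' ^ t) / w ^ t = (- l) ^ t" by (metis of_real_power power_divide)
    then show ?thesis by (simp only: times_divide_eq_left[symmetric])
  qed
  finally show ?thesis by (simp only: w_def)
qed

subsection \<open>Modularity\<close>

lemma wronskian_theta_bounded:
  assumes "\<And>j. j < m \<Longrightarrow> poly_growth (\<phi> j)" "quad_growth q"
  shows "\<exists>K. \<forall>z. Im z \<ge> 1 \<longrightarrow> norm (wronskian m (\<lambda>j. theta_series (\<phi> j) q) z) \<le> K"
proof -
  have "\<exists>K. \<forall>z\<in>{z. Im z \<ge> 1}. norm (Determinant.det (Matrix.mat m m (\<lambda>(k, j). (D ^^ k) (theta_series (\<phi> j) q) z))) \<le> K"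
  proof (rule det_mat_bounded)
    fix k j assume "j < m"
    then have \<phi>: "poly_growth (\<lambda>x. \<phi> j x * of_real (q x) ^ k)"
      by (intro poly_growth_mult poly_growth_power poly_growth_quad assms)
    obtain K where "norm (theta_series (\<lambda>x. \<phi> j x * of_real (q x) ^ k) q z) \<le> K" if "Im z \<ge> 1" for z
      using theta_bounded[OF \<phi> assms(2), of 1] by auto
    then show "\<exists>K. \<forall>z\<in>{z. Im z \<ge> 1}. norm ((D ^^ k) (theta_series (\<phi> j) q) z) \<le> K"
      using D_theta_series[OF assms(1)[OF \<open>j < m\<close>] assms(2)]
      by (intro exI[of _ K]) (auto simp: upper_half_plane_def)
  qed
  then show ?thesis by (simp add: wronskian_def)
qed

lemma harmonic_dim_double: "2 * harmonic_dim TYPE('n::finite) = (CARD('n) - 1) * (CARD('n) + 2)"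
proof -
  obtain j where j: "CARD('n) = Suc j" using zero_less_card_finite[where 'a = 'n] by (auto simp: gr0_conv_Suc)
  have "(CARD('n))\<^sup>2 + CARD('n) - 2 = j * (j + 3)" by (simp add: j power2_eq_square algebra_simps)
  then have "2 * harmonic_dim TYPE('n) = 2 * (j * (j + 3) div 2)" by (simp only: harmonic_dim_def)
  also have "\<dots> = j * (j + 3)" by (rule dvd_mult_div_cancel) auto
  finally show ?thesis by (simp add: j algebra_simps)
qed

text \<open>With n = j + 1 one has 2 m = j (j + 3), and both sides become (j + 3) (j + 1) m.\<close>

lemma weight_eq:
  assumes "k = (CARD('n::finite) + 2)\<^sup>2 * CARD('n) * (CARD('n) - 1) div 2" and "m = harmonic_dim TYPE('n)"
  shows "k = 2 * (m * (m - 1)) + 4 * m + CARD('n) * m"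
proof -
  obtain j where j: "CARD('n) = Suc j" using zero_less_card_finite[where 'a = 'n] by (auto simp: gr0_conv_Suc)
  have m2: "2 * m = j * (j + 3)" using harmonic_dim_double[where 'n = 'n] by (simp add: assms(2) j algebra_simps)
  have "(CARD('n) + 2)\<^sup>2 * CARD('n) * (CARD('n) - 1) = (j + 3) * (j + 1) * (j * (j + 3))"
    by (simp add: j power2_eq_square algebra_simps)
  also have "\<dots> = 2 * ((j + 3) * (j + 1) * m)" by (simp only: m2[symmetric] mult_ac)
  finally have k: "k = (j + 3) * (j + 1) * m" by (simp add: assms(1))
  show ?thesis
  proof (cases m)
    case 0 then show ?thesis by (simp add: k)
  next
    case (Suc i)
    have "k = m * (2 * m + j + 3)" unfolding k m2 by (simp add: algebra_simps)
    also have "\<dots> = 2 * (m * (m - 1)) + 4 * m + CARD('n) * m" by (simp add: j Suc algebra_simps)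
    finally show ?thesis .
  qed
qed

lemma weight_even_rank:
  assumes "k = (CARD('n::finite) + 2)\<^sup>2 * CARD('n) * (CARD('n) - 1) div 2" and "even CARD('n)"
  shows "even k"
proof -
  obtain i where i: "CARD('n) = 2 * i" using assms(2) by (rule evenE)
  have "(CARD('n) + 2)\<^sup>2 * CARD('n) * (CARD('n) - 1) = 2 * (2 * (2 * (i + 1)\<^sup>2 * i * (CARD('n) - 1)))"
    by (simp add: i power2_eq_square algebra_simps)
  then have "k = 2 * (2 * (i + 1)\<^sup>2 * i * (CARD('n) - 1))" unfolding assms(1) by (simp only: nonzero_mult_div_cancel_left)
  then show ?thesis by simp
qed

lemma weight_character_odd:
  assumes "odd d" shows "weight_character k d = chi4 d ^ k"
proof (cases "even k")
  case True
  then obtain i where "k = 2 * i" by (rule evenE)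
  then show ?thesis by (simp add: weight_character_def power_mult)
next
  case False
  then obtain i where "k = 2 * i + 1" by (rule oddE)
  moreover have "d mod 4 = 1 \<or> d mod 4 = 3" using assms by presburger
  ultimately show ?thesis by (auto simp: weight_character_def power_mult chi4_def power_add)
qed

lemma chi4_minus: "odd d \<Longrightarrow> chi4 (- d) = - chi4 d"
proof -
  assume "odd d"
  then have "d mod 4 = 1 \<and> (- d) mod 4 = 3 \<or> d mod 4 = 3 \<and> (- d) mod 4 = 1" by presburger
  then show ?thesis unfolding chi4_def by (elim disjE conjE; simp only:; simp)
qed

lemma poisson_factor_square_eq:
  assumes "posdef (A :: real ^ 'n ^ 'n)" "Im w > 0"
  shows "(poisson_factor A w)\<^sup>2 * w ^ CARD('n) = (poisson_factor A \<i>)\<^sup>2 * \<i> ^ CARD('n)"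
proof -
  obtain \<kappa> where \<kappa>: "\<And>w. Im w > 0 \<Longrightarrow> (poisson_factor A w)\<^sup>2 * w ^ CARD('n) = \<kappa>"
    by (rule poisson_factor_square[OF assms(1)]) blast
  show ?thesis using \<kappa>[OF assms(2)] \<kappa>[of \<i>] by simp
qed

section \<open>The determinant of a fixed integral lattice under the modular group\<close>

locale integral_gram =
  fixes Q :: "real ^ 'n ^ 'n" and q :: "int ^ 'n \<Rightarrow> int" and S S' :: "int ^ 'n ^ 'n" and N :: int
    and hs :: "nat \<Rightarrow> real ^ 'n ^ 'n"
  assumes Q: "invertible Q" and iq: "int_quad q S"
    and q: "\<And>x. of_int (q x) = quad_form (transpose Q ** Q) (of_int_vec x)"
    and S: "real_mat S = 2 *\<^sub>R (transpose Q ** Q)"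
    and S': "transpose S' = S'" "S ** S' = mat N" "S' ** S = mat N" "\<And>w. N dvd q (S' *v w)"
    and N: "N > 0"
    and hs: "orthonormal_basis hs"
begin

definition "A = transpose Q ** Q"
definition "A' = (1 / 4) *\<^sub>R matrix_inv A"
definition "m = harmonic_dim TYPE('n)"
definition "\<kappa> = (poisson_factor A \<i>)\<^sup>2 * \<i> ^ CARD('n)"
definition "\<Lambda> = lattice_of Q"
text \<open>The factor 1/4 is the one in \<open>poisson_harmonic\<close>, whereas the quarter in
  \<open>A'\<close> comes from the argument -1 / (4 w).\<close>

definition "dual_form h = (1 / 4) *\<^sub>R pull_form (matrix_inv A) (pull_form Q h)"
definition "dual_Theta a c d h = theta_series (\<lambda>y. of_real (quad_form (dual_form h) (of_int_vec y)) * gauss_coeff q A a c d y)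
    (\<lambda>y. quad_form A' (of_int_vec y))"
definition "theta = theta_series (\<lambda>_. 1) (\<lambda>x. quad_form A (of_int_vec x))"
definition "dual_theta a c d = theta_series (gauss_coeff q A a c d) (\<lambda>y. quad_form A' (of_int_vec y))"
definition "W = wronskian m (\<lambda>j. Theta (hs j) \<Lambda>)"
definition "dual_W a c d = wronskian m (\<lambda>j. dual_Theta a c d (hs j))"

lemma posdef_A: "posdef A" unfolding A_def by (rule posdef_gram[OF Q])

lemma posdef_A': "posdef A'" unfolding A'_def by (intro posdef_scaleR posdef_inv posdef_A) simp

lemma q_A: "of_int (q x) = quad_form A (of_int_vec x)" by (simp add: q A_def)

lemma quad_growth_A: "quad_growth (\<lambda>x. quad_form A (of_int_vec x))"
  by (rule quad_growth_posdef0[OF posdef_A])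

lemma quad_growth_A': "quad_growth (\<lambda>x. quad_form A' (of_int_vec x))"
  by (rule quad_growth_posdef0[OF posdef_A'])

lemma Theta_eq: "Theta h \<Lambda> = theta_series (\<lambda>x. of_real (quad_form (pull_form Q h) (of_int_vec x))) (\<lambda>x. quad_form A (of_int_vec x))"
  unfolding \<Lambda>_def A_def by (rule Theta_series[OF Q])

lemma Theta_hol: "Theta h \<Lambda> holomorphic_on upper_half_plane"
  unfolding \<Lambda>_def by (rule Theta_holomorphic[OF Q])

lemma dual_Theta_hol: "c > 0 \<Longrightarrow> dual_Theta a c d h holomorphic_on upper_half_plane"
  unfolding dual_Theta_def by (intro theta_deriv(1) poly_growth_mult poly_growth_quad_form0 poly_growth_gauss_coeff quad_growth_A')

lemma theta_modular:
  assumes det: "a * d - b * c = 1" and c: "c > 0" and z: "z \<in> upper_half_plane"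
  shows "theta ((of_int a * z + of_int b) / (of_int c * z + of_int d)) =
     poisson_factor A (- of_int c / (of_int c * z + of_int d)) * dual_theta a c d z"
proof -
  have "theta_series (\<lambda>x. of_real ((\<lambda>_. 1) (of_int_vec x :: real ^ 'n))) (\<lambda>x. quad_form A (of_int_vec x)) ((of_int a * z + of_int b) / (of_int c * z + of_int d)) =
    (- (of_int c * z + of_int d)) ^ 0 * poisson_factor A (- of_int c / (of_int c * z + of_int d)) *
      theta_series (\<lambda>y. of_real ((\<lambda>_. 1) (of_int_vec y :: real ^ 'n)) * gauss_coeff q A a c d y) (\<lambda>y. quad_form ((1 / 4) *\<^sub>R matrix_inv A) (of_int_vec y)) z"
  proof (rule theta_moebius[OF posdef_A iq q_A det c z])
    fix w and r :: "real ^ 'n" assume w: "Im w > 0"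
    show "(\<Sum>\<^sub>\<infinity>x. of_real 1 * e (of_real (quad_form A (of_int_vec x + r)) * w)) =
       poisson_factor A w / w ^ 0 * (\<Sum>\<^sub>\<infinity>y. of_real 1 *
          (ev y r * e (of_real (quad_form (matrix_inv A) (of_int_vec y)) * (- 1 / (4 * w)))))"
      using poisson_summation[OF posdef_A w, of r] by (simp add: gauss_sum_fn_def dual_sum_fn_def)
  qed (auto intro: poly_growth_const)
  then show ?thesis by (simp add: theta_def dual_theta_def A'_def)
qed

lemma quad_form_dual: "quad_form (dual_form h) y = quad_form (pull_form Q h) (matrix_inv A *v y) / 4"
  unfolding dual_form_def quad_form_scaleR_matrix quad_form_pull[of "matrix_inv A"] by simp

lemma Theta_modular:
  assumes h: "h \<in> harmonic_forms" and det: "a * d - b * c = 1" and c: "c > 0" and z: "z \<in> upper_half_plane"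
  shows "Theta h \<Lambda> ((of_int a * z + of_int b) / (of_int c * z + of_int d)) =
     (of_int c * z + of_int d)\<^sup>2 * poisson_factor A (- of_int c / (of_int c * z + of_int d)) * dual_Theta a c d h z"
proof -
  let ?B = "pull_form Q h"
  have B: "transpose ?B = ?B" "trace (?B ** matrix_inv A) = 0"
    using h trace_pull_form[OF Q, of h] by (simp_all add: harmonic_forms_def pull_form_sym A_def)
  have "theta_series (\<lambda>x. of_real (quad_form ?B (of_int_vec x))) (\<lambda>x. quad_form A (of_int_vec x)) ((of_int a * z + of_int b) / (of_int c * z + of_int d)) =
    (- (of_int c * z + of_int d)) ^ 2 * poisson_factor A (- of_int c / (of_int c * z + of_int d)) *
      theta_series (\<lambda>y. of_real (quad_form (dual_form h) (of_int_vec y)) * gauss_coeff q A a c d y) (\<lambda>y. quad_form ((1 / 4) *\<^sub>R matrix_inv A) (of_int_vec y)) z"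
  proof (rule theta_moebius[OF posdef_A iq q_A det c z])
    fix w and r :: "real ^ 'n" assume w: "Im w > 0"
    have "poisson_factor A w / (4 * w\<^sup>2) * (\<Sum>\<^sub>\<infinity>y. of_real (quad_form ?B (matrix_inv A *v of_int_vec y)) *
            (ev y r * e (of_real (quad_form (matrix_inv A) (of_int_vec y)) * (- 1 / (4 * w))))) =
       poisson_factor A w / w\<^sup>2 * (1 / 4 * (\<Sum>\<^sub>\<infinity>y. of_real (quad_form ?B (matrix_inv A *v of_int_vec y)) *
            (ev y r * e (of_real (quad_form (matrix_inv A) (of_int_vec y)) * (- 1 / (4 * w))))))"
      by simp
    also have "\<dots> = poisson_factor A w / w\<^sup>2 * (\<Sum>\<^sub>\<infinity>y. of_real (quad_form (dual_form h) (of_int_vec y)) *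
            (ev y r * e (of_real (quad_form (matrix_inv A) (of_int_vec y)) * (- 1 / (4 * w)))))"
      unfolding infsum_cmult_right'[symmetric] quad_form_dual by (simp add: mult_ac)
    finally show "(\<Sum>\<^sub>\<infinity>x. of_real (quad_form ?B (of_int_vec x + r)) * e (of_real (quad_form A (of_int_vec x + r)) * w)) =
       poisson_factor A w / w\<^sup>2 * (\<Sum>\<^sub>\<infinity>y. of_real (quad_form (dual_form h) (of_int_vec y)) *
            (ev y r * e (of_real (quad_form (matrix_inv A) (of_int_vec y)) * (- 1 / (4 * w)))))"
      unfolding poisson_harmonic[OF posdef_A w B, of r] .
  qed (auto intro: quad_form_scale poly_growth_quad_form poly_growth_quad_form0)
  then show ?thesis unfolding power2_minus Theta_eq dual_Theta_def A'_def .
qed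

lemma harmonic_hs: "j < m \<Longrightarrow> hs j \<in> harmonic_forms"
  using orthonormal_basis_harmonic[OF hs] by (simp add: m_def)

lemma W_modular:
  assumes det: "a * d - b * c = 1" and c: "c > 0" and z: "z \<in> upper_half_plane"
  defines "l \<equiv> of_int c * z + of_int d"
  shows "W ((of_int a * z + of_int b) / l) = l ^ (m * (m - 1)) * (l\<^sup>2 * poisson_factor A (- of_int c / l)) ^ m * dual_W a c d z"
  unfolding W_def dual_W_def l_def
proof (rule wronskian_transfer[OF open_upper_half_plane])
  have "(\<lambda>z. poisson_factor A (- of_int c / (of_int c * z + of_int d))) holomorphic_on upper_half_plane"
  proof (rule holomorphic_on_compose_gen[unfolded o_def, OF _ poisson_factor_holomorphic[OF posdef_A]])
    show "(\<lambda>z. - of_int c / (of_int c * z + of_int d)) holomorphic_on upper_half_plane"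
      using moebius_upper(1)[OF det] by (intro holomorphic_intros) auto
    show "(\<lambda>z. - of_int c / (of_int c * z + of_int d)) ` upper_half_plane \<subseteq> upper_half_plane"
      using moebius_poisson_arg(1)[OF det c] by (auto simp: upper_half_plane_def)
  qed
  then show "(\<lambda>z. (of_int c * z + of_int d)\<^sup>2 * poisson_factor A (- of_int c / (of_int c * z + of_int d))) holomorphic_on upper_half_plane"
    by (intro holomorphic_intros)
  show "(\<lambda>z. of_int c * z + of_int d) holomorphic_on upper_half_plane" by (intro holomorphic_intros)
  show "Theta (hs j) \<Lambda> ((of_int a * z + of_int b) / (of_int c * z + of_int d)) =
      (of_int c * z + of_int d)\<^sup>2 * poisson_factor A (- of_int c / (of_int c * z + of_int d)) * dual_Theta a c d (hs j) z"
    if "j < m" "z \<in> upper_half_plane" for j z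
    by (rule Theta_modular[OF harmonic_hs[OF that(1)] det c that(2)])
qed (rule Theta_hol dual_Theta_hol[OF c] moebius_upper[OF det] z; assumption)+

lemma kappa: "Im w > 0 \<Longrightarrow> (poisson_factor A w)\<^sup>2 * w ^ CARD('n) = \<kappa>"
  unfolding \<kappa>_def by (rule poisson_factor_square_eq[OF posdef_A])

abbreviation "P \<equiv> det2DTheta \<Lambda>"

lemma P_eq: "z \<in> upper_half_plane \<Longrightarrow> P z = (W z)\<^sup>2"
  unfolding \<Lambda>_def det2DTheta_basis[OF Q hs] W_def m_def detDTheta_wronskian[OF Q] ..

context
  fixes k assumes k: "k = (CARD('n) + 2)\<^sup>2 * CARD('n) * (CARD('n) - 1) div 2"
begin

text \<open>Squaring replaces the Poisson factor by \<kappa> times a power of (c z + d) / (-c), so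
  only integral powers of c z + d remain; they add up to k and cancel against the slash
  factor.\<close>

lemma slash_pos:
  assumes det: "a * d - b * c = 1" and c: "c > 0" and z: "z \<in> upper_half_plane"
  shows "slash k P (a, b, c, d) z = (\<kappa> / (- of_int c) ^ CARD('n)) ^ m * (dual_W a c d z)\<^sup>2"
proof -
  define l where "l = of_int c * z + of_int d"
  define p where "p = poisson_factor A (- of_int c / l)"
  have l0: "l \<noteq> 0" unfolding l_def by (rule moebius_upper(1)[OF det z])
  have "p\<^sup>2 * (- of_int c / l) ^ CARD('n) = \<kappa>"
    unfolding p_def by (rule kappa) (use moebius_poisson_arg(1)[OF det c z] in \<open>simp add: l_def\<close>)
  then have p: "p\<^sup>2 = \<kappa> / (- of_int c) ^ CARD('n) * l ^ CARD('n)"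
    using l0 c unfolding power_divide by (simp add: divide_simps)
  have "P ((of_int a * z + of_int b) / l) = (W ((of_int a * z + of_int b) / l))\<^sup>2"
    by (rule P_eq) (use moebius_upper(2)[OF det z] in \<open>simp add: l_def\<close>)
  also have "\<dots> = (l ^ (m * (m - 1)) * (l\<^sup>2 * p) ^ m * dual_W a c d z)\<^sup>2"
    unfolding W_modular[OF det c z, folded l_def, folded p_def] ..
  also have "\<dots> = l ^ (2 * (m * (m - 1)) + 4 * m) * (p\<^sup>2) ^ m * (dual_W a c d z)\<^sup>2"
    by (simp add: power_mult_distrib power_add mult_ac flip: power_mult)
  also have "(p\<^sup>2) ^ m = (\<kappa> / (- of_int c) ^ CARD('n)) ^ m * l ^ (CARD('n) * m)"
    unfolding p power_mult_distrib power_mult ..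
  also have "l ^ (2 * (m * (m - 1)) + 4 * m) * ((\<kappa> / (- of_int c) ^ CARD('n)) ^ m * l ^ (CARD('n) * m)) * (dual_W a c d z)\<^sup>2 =
      l ^ k * ((\<kappa> / (- of_int c) ^ CARD('n)) ^ m * (dual_W a c d z)\<^sup>2)"
    unfolding weight_eq[OF k m_def] by (simp add: power_add mult_ac)
  finally show ?thesis using l0 by (simp add: slash_def l_def)
qed

end

lemma of_int_vec_S: "of_int_vec (S *v x) = 2 *\<^sub>R (A *v of_int_vec x)"
  unfolding real_mat_vec S A_def by (simp add: scaleR_matrix_vector_assoc[symmetric])

lemma inv_A_S: "matrix_inv A *v of_int_vec (S *v x) = 2 *\<^sub>R of_int_vec x"
  unfolding of_int_vec_S matrix_vector_mult_scaleR matrix_inv_mult(4)[OF posdef_invertible[OF posdef_A]] ..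

lemma quad_form_inv_S: "quad_form (matrix_inv A) (of_int_vec (S *v x)) = 4 * quad_form A (of_int_vec x)"
  unfolding of_int_vec_S quad_form_scale quad_form_inv[OF posdef_A] by simp

lemma inj_S: "inj ((*v) S)"
proof (rule injI)
  fix x y assume "S *v x = S *v y"
  then have "S' *v (S *v x) = S' *v (S *v y)" by simp
  then have "mat N *v x = mat N *v y" by (simp only: matrix_vector_mul_assoc S')
  moreover have "mat N *v x = N *s x" for x :: "int ^ 'n"
    by (simp add: mat_def matrix_vector_mult_def vec_eq_iff if_distrib[of "\<lambda>x. x * _"] cong: if_cong)
  ultimately show "x = y" using N by (simp add: vec_eq_iff)
qed

text \<open>If \<open>N\<close> divides \<open>c\<close>, the Gauss sums live on \<open>S *v UNIV\<close>, where the dual series becomes the original one.\<close>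

lemma theta_series_level:
  assumes det: "a * d - b * c = 1" and c: "c > 0" "N dvd c"
  shows "theta_series (\<lambda>y. \<phi> y * gauss_coeff q A a c d y) (\<lambda>y. quad_form A' (of_int_vec y)) z =
     gauss q a c 0 * theta_series (\<lambda>x. \<phi> (S *v x)) (\<lambda>x. quad_form A (of_int_vec x)) z"
proof -
  have "c dvd a * d - 1"
  proof
    show "a * d - 1 = c * b" using det by (simp add: algebra_simps)
  qed
  note image = gauss_image[OF iq c(1) this]
  have coeff: "gauss_coeff q A a c d (S *v x) = gauss q a c 0" for x
  proof -
    have "of_real (quad_form (matrix_inv A) (of_int_vec (S *v x))) * (of_int d / (4 * of_int c)) =
       (of_int (d * q x) / of_int c :: complex)"
      unfolding quad_form_inv_S q_A[symmetric] by simp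
    then show ?thesis unfolding gauss_coeff_def image[of x, symmetric] er_def by simp
  qed
  have "theta_series (\<lambda>y. \<phi> y * gauss_coeff q A a c d y) (\<lambda>y. quad_form A' (of_int_vec y)) z =
     (\<Sum>\<^sub>\<infinity>y\<in>range ((*v) S). \<phi> y * gauss_coeff q A a c d y * e (of_real (quad_form A' (of_int_vec y)) * z))"
    unfolding theta_series_def
  proof (rule infsum_cong_neutral)
    fix y assume "y \<in> UNIV - range ((*v) S)"
    then have "gauss q a c y = 0" using gauss_eq_0[OF iq c S'(1,2,4), of a y] by auto
    then show "\<phi> y * gauss_coeff q A a c d y * e (of_real (quad_form A' (of_int_vec y)) * z) = 0"
      by (simp add: gauss_coeff_def)
  qed auto
  also have "\<dots> = (\<Sum>\<^sub>\<infinity>x. gauss q a c 0 * (\<phi> (S *v x) * e (of_real (quad_form A (of_int_vec x)) * z)))"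
    unfolding infsum_reindex[OF inj_S] o_def coeff
    by (simp add: A'_def quad_form_scaleR_matrix quad_form_inv_S mult_ac)
  finally show ?thesis by (simp only: infsum_cmult_right' theta_series_def)
qed

lemma dual_theta_level:
  assumes "a * d - b * c = 1" "c > 0" "N dvd c"
  shows "dual_theta a c d z = gauss q a c 0 * theta z"
  using theta_series_level[OF assms, of "\<lambda>_. 1" z] by (simp add: dual_theta_def theta_def)

lemma dual_Theta_level:
  assumes "a * d - b * c = 1" "c > 0" "N dvd c"
  shows "dual_Theta a c d h z = gauss q a c 0 * Theta h \<Lambda> z"
  unfolding dual_Theta_def theta_series_level[OF assms] Theta_eq
  by (simp add: quad_form_dual inv_A_S quad_form_scale)

lemma dual_W_level:
  assumes det: "a * d - b * c = 1" and c: "c > 0" "N dvd c" and z: "z \<in> upper_half_plane"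
  shows "dual_W a c d z = gauss q a c 0 ^ m * W z"
proof -
  \<comment> \<open>The row-operation lemma with the identity map and a constant factor: it takes
    the constant out of all m columns.\<close>
  have "wronskian m (\<lambda>j. dual_Theta a c d (hs j)) z = (\<lambda>_. 1) z ^ (m * (m - 1)) * (\<lambda>_. gauss q a c 0) z ^ m * wronskian m (\<lambda>j. Theta (hs j) \<Lambda>) z"
  proof (rule wronskian_transfer[OF open_upper_half_plane, where \<phi> = "\<lambda>z. z"])
    show "dual_Theta a c d (hs j) holomorphic_on upper_half_plane" for j by (rule dual_Theta_hol[OF c(1)])
  qed (auto intro: Theta_hol z simp: dual_Theta_level[OF det c])
  then show ?thesis by (simp add: dual_W_def W_def)
qed

lemma dual_theta_tendsto:
  assumes "c > 0"
  shows "((\<lambda>t. dual_theta a c d (of_real t * \<i>)) \<longlongrightarrow> gauss q a c 0) at_top"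
proof -
  obtain \<epsilon> where \<epsilon>: "\<epsilon> > 0" "\<And>x. \<epsilon> * (norm x)\<^sup>2 \<le> quad_form A' x"
    using posdef_A' unfolding posdef_def by blast
  have "\<epsilon> \<le> quad_form A' (of_int_vec x)" if "x \<noteq> 0" for x :: "int ^ 'n"
  proof -
    have "1 \<le> (norm (of_int_vec x :: real ^ 'n))\<^sup>2" using inorm_ge_1[OF that] by (simp add: inorm_def)
    then have "\<epsilon> * 1 \<le> \<epsilon> * (norm (of_int_vec x :: real ^ 'n))\<^sup>2" using \<epsilon>(1) by (intro mult_left_mono) auto
    then show ?thesis using \<epsilon>(2)[of "of_int_vec x"] by simp
  qed
  then have "((\<lambda>t. dual_theta a c d (of_real t * \<i>)) \<longlongrightarrow> gauss_coeff q A a c d 0) at_top"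
    unfolding dual_theta_def by (intro theta_tendsto[OF poly_growth_gauss_coeff[OF assms] quad_growth_A' _ \<epsilon>(1)]) auto
  then show ?thesis by (simp add: gauss_coeff_def)
qed

text \<open>Comparing the behaviour of \<open>theta\<close> at the cusp \<open>b / d\<close> computed directly and by way of the inversion
  \<open>z \<mapsto> -1 / z\<close> replaces the Gauss sum modulo \<open>c\<close> by one modulo \<open>d\<close>.\<close>

lemma multiplier:
  assumes det: "a * d - b * c = 1" and c: "c > 0" "N dvd c" and d: "d > 0"
  shows "\<kappa> * (gauss q a c 0)\<^sup>2 / (- of_int c) ^ CARD('n) = (gauss q b d 0)\<^sup>2 / of_int d ^ CARD('n)"
proof -
  let ?n = "CARD('n)"
  obtain \<kappa>' where \<kappa>': "\<kappa>' \<noteq> 0" "\<And>w. Im w > 0 \<Longrightarrow> (poisson_factor A w)\<^sup>2 * w ^ ?n = \<kappa>'"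
    by (rule poisson_factor_square[OF posdef_A]) (rule that)
  have \<kappa>0: "\<kappa> \<noteq> 0" using \<kappa>'(1) \<kappa>'(2)[of \<i>] by (simp add: \<kappa>_def)
  have *: "(dual_theta b d (- c) z)\<^sup>2 * (- of_int c / of_int d) ^ ?n = \<kappa> * (gauss q a c 0)\<^sup>2 * (dual_theta 0 1 0 z)\<^sup>2"
    if z: "z \<in> upper_half_plane" for z
  proof -
    have z0: "z \<noteq> 0" using z by (auto simp: upper_half_plane_def)
    define l where "l = of_int d * z - of_int c"
    have det': "b * (- c) - (- a) * d = 1" using det by (simp add: algebra_simps)
    have det0: "0 * 0 - (- 1) * 1 = (1 :: int)" by simp
    have l0: "l \<noteq> 0" using moebius_upper(1)[OF det' z] by (simp add: l_def)
    have iz: "- 1 / z \<in> upper_half_plane" using moebius_upper(2)[OF det0 z] by simp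
    have l': "of_int c * (- 1 / z) + of_int d = l / z" using z0 by (simp add: l_def field_simps)
    have arg: "(of_int a * (- 1 / z) + of_int b) / (l / z) = (of_int b * z + of_int (- a)) / l"
      using z0 l0 by (simp add: field_simps)
    \<comment> \<open>The Poisson arguments: \<open>w1\<close> for the direct route to b / d,
      \<open>w2\<close> and \<open>w3\<close> for the route through the inversion. Since w2 w3 / w1
      = -c / d, the variable z cancels, and one of the three constants \<kappa> survives.\<close>
    define w1 w2 w3 where "w1 = - of_int d / l" and "w2 = - of_int c / (l / z)" and "w3 = - 1 / z"
    have w: "Im w1 > 0" "Im w2 > 0" "Im w3 > 0"
      using moebius_poisson_arg(1)[OF det' d z] moebius_poisson_arg(1)[OF det c(1) iz] moebius_poisson_arg(1)[OF det0 _ z]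
      unfolding l' by (simp_all add: w1_def w2_def w3_def l_def)
    have 1: "theta ((of_int b * z + of_int (- a)) / l) = poisson_factor A w1 * dual_theta b d (- c) z"
      using theta_modular[OF det' d z] by (simp add: w1_def l_def)
    have 2: "theta ((of_int b * z + of_int (- a)) / l) = poisson_factor A w2 * (gauss q a c 0 * theta w3)"
      using theta_modular[OF det c(1) iz] unfolding l' arg dual_theta_level[OF det c] by (simp only: w2_def w3_def)
    have 3: "theta w3 = poisson_factor A w3 * dual_theta 0 1 0 z"
      using theta_modular[OF det0 _ z] by (simp add: w3_def)
    have w0: "w1 \<noteq> 0" "w2 \<noteq> 0" "w3 \<noteq> 0" using w by auto
    have pw: "(poisson_factor A w)\<^sup>2 = \<kappa> / w ^ ?n" if "Im w > 0" for w
      using kappa[OF that] that by (auto simp: divide_simps)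
    have "(poisson_factor A w1 * dual_theta b d (- c) z)\<^sup>2 = (poisson_factor A w2 * (gauss q a c 0 * (poisson_factor A w3 * dual_theta 0 1 0 z)))\<^sup>2"
      using 1 2 3 by simp
    then have "\<kappa> / w1 ^ ?n * (dual_theta b d (- c) z)\<^sup>2 = \<kappa> / w2 ^ ?n * ((gauss q a c 0)\<^sup>2 * (\<kappa> / w3 ^ ?n * (dual_theta 0 1 0 z)\<^sup>2))"
      unfolding power_mult_distrib pw[OF w(1)] pw[OF w(2)] pw[OF w(3)] .
    then have "(dual_theta b d (- c) z)\<^sup>2 * (w2 * w3 / w1) ^ ?n = \<kappa> * (gauss q a c 0)\<^sup>2 * (dual_theta 0 1 0 z)\<^sup>2"
      using w0 \<kappa>0 by (simp add: power_divide power_mult_distrib divide_simps mult_ac)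
    moreover have "w2 * w3 / w1 = - of_int c / of_int d"
      using l0 z0 d by (simp add: w1_def w2_def w3_def divide_simps)
    ultimately show ?thesis by simp
  qed
  \<comment> \<open>As z goes to infinity along the imaginary axis the dual series tend to their
    constant terms, which are Gauss sums; the one modulo 1 is 1.\<close>
  have lim1: "((\<lambda>t. (dual_theta b d (- c) (of_real t * \<i>))\<^sup>2 * (- of_int c / of_int d) ^ ?n) \<longlongrightarrow>
      (gauss q b d 0)\<^sup>2 * (- of_int c / of_int d) ^ ?n) at_top"
    by (intro tendsto_intros dual_theta_tendsto d)
  have "((\<lambda>t. \<kappa> * (gauss q a c 0)\<^sup>2 * (dual_theta 0 1 0 (of_real t * \<i>))\<^sup>2) \<longlongrightarrow>
      \<kappa> * (gauss q a c 0)\<^sup>2 * (gauss q 0 1 0)\<^sup>2) at_top"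
    by (intro tendsto_intros dual_theta_tendsto) simp
  then have "((\<lambda>t. (dual_theta b d (- c) (of_real t * \<i>))\<^sup>2 * (- of_int c / of_int d) ^ ?n) \<longlongrightarrow>
      \<kappa> * (gauss q a c 0)\<^sup>2 * (gauss q 0 1 0)\<^sup>2) at_top"
  proof (rule Lim_transform_eventually)
    show "\<forall>\<^sub>F t in at_top. \<kappa> * (gauss q a c 0)\<^sup>2 * (dual_theta 0 1 0 (of_real t * \<i>))\<^sup>2 =
        (dual_theta b d (- c) (of_real t * \<i>))\<^sup>2 * (- of_int c / of_int d) ^ ?n"
      using eventually_gt_at_top[of "0::real"] by eventually_elim (rule *[symmetric], simp add: upper_half_plane_def)
  qed
  from tendsto_unique[OF _ lim1 this]
  have "(gauss q b d 0)\<^sup>2 * (- of_int c / of_int d) ^ ?n = \<kappa> * (gauss q a c 0)\<^sup>2"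
    by (simp add: gauss_0_def residues_1 int_quad_0[OF iq])
  then show ?thesis using c d unfolding power_divide by (simp add: divide_simps mult_ac)
qed

text \<open>From a d - b c = 1 both b and c are prime to d, hence so is N. Thus S is nondegenerate
  modulo d, and \<open>gauss_square\<close> evaluates the Gauss sum on the side of d.\<close>

lemma multiplier_odd:
  assumes det: "a * d - b * c = 1" and c: "c > 0" "N dvd c" and d: "d > 0" "odd d"
  shows "\<kappa> * (gauss q a c 0)\<^sup>2 / (- of_int c) ^ CARD('n) = chi4 d ^ CARD('n)"
proof -
  have unit: "is_unit t" if "t dvd d" "t dvd b * c" for t
    using dvd_diff[OF dvd_mult[OF that(1)] that(2), of a] by (simp add: det)
  have cop: "coprime c d"
    by (rule coprimeI) (rule unit, assumption, rule dvd_mult)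
  have cop': "coprime b d"
    by (rule coprimeI) (rule unit, assumption, rule dvd_mult2)
  have "nondeg S d"
    by (rule nondeg_coprime[OF S'(3) coprime_divisors[OF c(2) dvd_refl cop]])
  then have "(gauss q b d 0)\<^sup>2 = (chi4 d * of_int d) ^ CARD('n)"
    using gauss_square[OF iq, of "nat d" b] d cop' by (simp add: even_nat_iff)
  then show ?thesis unfolding multiplier[OF det c d(1)] using d by (simp add: power_mult_distrib)
qed

lemma Theta_periodic: "Theta h \<Lambda> (z + of_int j) = Theta h \<Lambda> z"
proof -
  have "e (of_real (quad_form A (of_int_vec x)) * (z + of_int j)) = e (of_real (quad_form A (of_int_vec x)) * z)" for x :: "int ^ 'n"
    unfolding distrib_left q_A[symmetric] by (rule e_add_Ints) simp
  then show ?thesis by (simp add: Theta_eq theta_series_def)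
qed

lemma P_periodic:
  assumes z: "z \<in> upper_half_plane" shows "P (z + of_int j) = P z"
proof -
  have H: "z + of_int j \<in> upper_half_plane" if "z \<in> upper_half_plane" for z
    using that by (simp add: upper_half_plane_def)
  have "W ((\<lambda>z. z + of_int j) z) = (\<lambda>_. 1) z ^ (m * (m - 1)) * (\<lambda>_. 1) z ^ m * W z"
    unfolding W_def
    by (rule wronskian_transfer[OF open_upper_half_plane])
      (auto intro!: Theta_hol z H derivative_eq_intros simp: Theta_periodic)
  then show ?thesis by (simp add: P_eq H z)
qed

lemma det_one_odd: "a * d - b * c = 1 \<Longrightarrow> odd c \<or> odd (d :: int)"
proof (rule ccontr)
  assume det: "a * d - b * c = 1" and "\<not> (odd c \<or> odd d)"
  then have "even c" "even d" by auto
  then have "even (a * d - b * c)" by simp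
  then show False unfolding det by simp
qed

lemma slash_shift: "slash k P (a, a * j + b, c, c * j + d) z = slash k P (a, b, c, d) (z + of_int j)"
  by (simp add: slash_def algebra_simps)

lemma slash_uminus: "slash k P (- a, - b, - c, - d) z = (- 1) ^ k * slash k P (a, b, c, d) z"
proof -
  have 1: "of_int (- a) * z + of_int (- b) = - (of_int a * z + of_int b)" for a b by simp
  have 2: "(- x :: complex) ^ k = (- 1) ^ k * x ^ k" for x by (rule power_minus)
  show ?thesis
    unfolding slash_def prod.case 1 2[of "of_int c * z + of_int d"] minus_divide_divide
    by (cases "even k") auto
qed

context
  fixes k assumes k: "k = (CARD('n) + 2)\<^sup>2 * CARD('n) * (CARD('n) - 1) div 2"
begin

lemma slash_level_pos:
  assumes det: "a * d - b * c = 1" and c: "c > 0" "N dvd c" and z: "z \<in> upper_half_plane" and d: "d > 0" "odd d"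
  shows "slash k P (a, b, c, d) z = chi4 d ^ k * P z"
proof -
  have "slash k P (a, b, c, d) z = (\<kappa> / (- of_int c) ^ CARD('n)) ^ m * (gauss q a c 0 ^ m * W z)\<^sup>2"
    unfolding slash_pos[OF k det c(1) z] dual_W_level[OF det c z] ..
  also have "(gauss q a c 0 ^ m * W z)\<^sup>2 = ((gauss q a c 0)\<^sup>2) ^ m * P z"
    by (simp add: P_eq[OF z] power_mult_distrib mult.commute flip: power_mult)
  also have "(\<kappa> / (- of_int c) ^ CARD('n)) ^ m * (((gauss q a c 0)\<^sup>2) ^ m * P z) =
      (\<kappa> * (gauss q a c 0)\<^sup>2 / (- of_int c) ^ CARD('n)) ^ m * P z"
    by (simp add: power_mult_distrib power_divide)
  also have "\<dots> = chi4 d ^ (CARD('n) * m) * P z"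
    unfolding multiplier_odd[OF det c d] power_mult ..
  \<comment> \<open>The weight and n m differ by an even number, and the square of
    \<open>chi4 d\<close> is 1.\<close>
  also have "chi4 d ^ (CARD('n) * m) = chi4 d ^ k"
  proof -
    have "k = 2 * (m * (m - 1) + 2 * m) + CARD('n) * m" unfolding weight_eq[OF k m_def] by simp
    then show ?thesis by (simp only: power_add power_mult[of _ 2] chi4_square power_one mult_1_left)
  qed
  finally show ?thesis .
qed

lemma odd_d_of_odd_rank:
  assumes "a * d - b * c = 1" "N dvd c" "odd CARD('n)" shows "odd d"
proof -
  have "even c" using odd_rank_even_level[OF iq S'(3) assms(3)] assms(2) dvd_trans by blast
  then show ?thesis using det_one_odd[OF assms(1)] by blast
qed

text \<open>A translation of z replaces d by c j + d. As P has period 1, d may in this way be made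
  positive and odd, the case settled by \<open>slash_level_pos\<close>.\<close>

lemma slash_level_gt:
  assumes det: "a * d - b * c = 1" and c: "c > 0" "N dvd c" and z: "z \<in> upper_half_plane"
  shows "slash k P (a, b, c, d) z = weight_character k d * P z"
proof -
  \<comment> \<open>For odd d a multiple of 4 preserves d modulo 4. For even d the entry c is odd,
    so an odd j makes c j + d odd; the rank is then even, hence also k, and the character is
    trivial. In both cases j exceeds |d|, which gives positivity.\<close>
  define j where "j = (if odd d then 4 * (\<bar>d\<bar> + 1) else 2 * \<bar>d\<bar> + 1)"
  have "odd c" if "even d" using det_one_odd[OF det] that by blast
  then have odd: "odd (c * j + d)" by (simp add: j_def)
  have "j > \<bar>d\<bar>" using abs_ge_zero[of d] unfolding j_def by presburger
  moreover have "1 * j \<le> c * j" using c(1) calculation by (intro mult_right_mono) auto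
  ultimately have pos: "c * j + d > 0" by linarith
  have det': "a * (c * j + d) - (a * j + b) * c = 1" using det by (simp add: algebra_simps)
  have zj: "z - of_int j \<in> upper_half_plane" using z by (simp add: upper_half_plane_def)
  have "slash k P (a, b, c, d) z = slash k P (a, a * j + b, c, c * j + d) (z - of_int j)"
    by (simp add: slash_shift)
  also have "\<dots> = chi4 (c * j + d) ^ k * P (z - of_int j)" by (rule slash_level_pos[OF det' c zj pos odd])
  also have "P (z - of_int j) = P z" using P_periodic[OF zj, of j] by simp
  also have "chi4 (c * j + d) ^ k = weight_character k d"
  proof (cases "even CARD('n)")
    case True
    then have "even k" by (rule weight_even_rank[OF k])
    then obtain i where "k = 2 * i" by (rule evenE)
    then show ?thesis by (simp add: weight_character_def power_mult)
  next
    case False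
    then have "odd d" by (rule odd_d_of_odd_rank[OF det c(2)])
    moreover have "(c * j + d) mod 4 = d mod 4"
    proof -
      have "c * j + d = d + c * (\<bar>d\<bar> + 1) * 4" using \<open>odd d\<close> by (simp add: j_def)
      then show ?thesis by (simp only: mod_mult_self1)
    qed
    ultimately show ?thesis by (simp add: weight_character_odd chi4_def)
  qed
  finally show ?thesis .
qed

lemma slash_level:
  assumes det: "a * d - b * c = 1" and c: "N dvd c" and z: "z \<in> upper_half_plane"
  shows "slash k P (a, b, c, d) z = weight_character k d * P z"
proof -
  consider "c > 0" | "c = 0" | "c < 0" by linarith
  then show ?thesis
  proof cases
    case 1 then show ?thesis by (rule slash_level_gt[OF det _ c z])
  next
    case 2
    then have "a = d" "d = 1 \<or> d = - 1" using det zmult_eq_1_iff by auto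
    then show ?thesis
      using P_periodic[OF z, of b] P_periodic[OF z, of "- b"] 2
      by (auto simp: slash_def weight_character_def)
  next
    case 3
    have det': "(- a) * (- d) - (- b) * (- c) = 1" using det by simp
    \<comment> \<open>An odd k occurs only in odd rank, where d is odd; then the sign (-1)^k is
      compensated by \<open>chi4 (- d) = - chi4 d\<close>.\<close>
    have wc: "(- 1) ^ k * weight_character k (- d) = weight_character k d"
    proof (cases "even k")
      case True then show ?thesis by (simp add: weight_character_def)
    next
      case False
      then have "odd CARD('n)" using weight_even_rank[OF k] by blast
      then have "odd d" by (rule odd_d_of_odd_rank[OF det c])
      then show ?thesis by (simp add: weight_character_odd chi4_minus False)
    qed
    have "slash k P (a, b, c, d) z = (- 1) ^ k * slash k P (- a, - b, - c, - d) z"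
      using slash_uminus[of k "- a" "- b" "- c" "- d" z] by simp
    also have "slash k P (- a, - b, - c, - d) z = weight_character k (- d) * P z"
      by (rule slash_level_gt[OF det' _ _ z]) (use 3 c in auto)
    finally show ?thesis by (simp only: mult.assoc[symmetric] wc)
  qed
qed

lemma dual_W_bounded:
  assumes "c > 0" shows "\<exists>K. \<forall>z. Im z \<ge> 1 \<longrightarrow> norm (dual_W a c d z) \<le> K"
  unfolding dual_W_def dual_Theta_def
  by (intro wronskian_theta_bounded poly_growth_mult poly_growth_quad_form0 poly_growth_gauss_coeff assms quad_growth_A')

lemma slash_bounded_pos:
  assumes det: "a * d - b * c = 1" and c: "c > 0"
  shows "\<exists>K. \<forall>z. Im z \<ge> 1 \<longrightarrow> norm (slash k P (a, b, c, d) z) \<le> K"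
proof -
  obtain K where K: "\<And>z. Im z \<ge> 1 \<Longrightarrow> norm (dual_W a c d z) \<le> K" using dual_W_bounded[OF c, of a d] by auto
  have "norm (slash k P (a, b, c, d) z) \<le> norm ((\<kappa> / (- of_int c) ^ CARD('n)) ^ m) * K\<^sup>2" if "Im z \<ge> 1" for z
  proof -
    have z: "z \<in> upper_half_plane" using that by (simp add: upper_half_plane_def)
    show ?thesis unfolding slash_pos[OF k det c z] norm_mult norm_power[of "dual_W a c d z"]
      by (intro mult_left_mono power_mono K that) auto
  qed
  then show ?thesis by blast
qed

lemma slash_bounded:
  assumes det: "a * d - b * c = 1"
  shows "\<exists>K. \<forall>z. Im z \<ge> 1 \<longrightarrow> norm (slash k P (a, b, c, d) z) \<le> K"
proof -
  consider "c > 0" | "c = 0" | "c < 0" by linarith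
  then show ?thesis
  proof cases
    case 1 then show ?thesis by (rule slash_bounded_pos[OF det])
  next
    case 2
    have "\<exists>K. \<forall>z. Im z \<ge> 1 \<longrightarrow> norm (W z) \<le> K"
      unfolding W_def Theta_eq by (intro wronskian_theta_bounded poly_growth_quad_form0 quad_growth_A)
    then obtain K where K: "\<And>z. Im z \<ge> 1 \<Longrightarrow> norm (W z) \<le> K" by auto
    have "norm (slash k P (a, b, c, d) z) \<le> norm (weight_character k d) * K\<^sup>2" if "Im z \<ge> 1" for z
    proof -
      have z: "z \<in> upper_half_plane" using that by (simp add: upper_half_plane_def)
      \<comment> \<open>With c = 0 the matrix lies in the level group itself, so boundedness reduces
        to that of the original Wronskian.\<close>
      have "N dvd c" using 2 by simp
      show ?thesis unfolding slash_level[OF det \<open>N dvd c\<close> z] P_eq[OF z] norm_mult norm_power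
        by (intro mult_left_mono power_mono K that) auto
    qed
    then show ?thesis by blast
  next
    case 3
    have det': "(- a) * (- d) - (- b) * (- c) = 1" using det by simp
    have "norm (slash k P (a, b, c, d) z) = norm (slash k P (- a, - b, - c, - d) z)" for z
      unfolding slash_uminus norm_mult norm_power by simp
    then show ?thesis using slash_bounded_pos[OF det'] 3 by simp
  qed
qed

lemma P_modular_form: "modular_form (nat N) (weight_character k) k P"
  unfolding modular_form_def
proof (intro conjI ballI)
  have "W holomorphic_on upper_half_plane"
    unfolding W_def by (intro wronskian_holomorphic open_upper_half_plane Theta_hol)
  then have "(\<lambda>z. (W z)\<^sup>2) holomorphic_on upper_half_plane" by (intro holomorphic_intros)
  then show "P holomorphic_on upper_half_plane" by (rule holomorphic_transform) (simp add: P_eq)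
next
  fix \<gamma> assume "\<gamma> \<in> Gamma0 (nat N)"
  then obtain a b c d where "\<gamma> = (a, b, c, d)" "a * d - b * c = 1" "N dvd c"
    using N by (auto simp: Gamma0_def SL2Z_def)
  then show "case \<gamma> of (a, b, c, d) \<Rightarrow> \<forall>z\<in>upper_half_plane. slash k P (a, b, c, d) z = weight_character k d * P z"
    by (simp add: slash_level)
next
  fix \<gamma> assume "\<gamma> \<in> SL2Z"
  then obtain a b c d where \<gamma>: "\<gamma> = (a, b, c, d)" "a * d - b * c = 1" by (auto simp: SL2Z_def)
  show "\<exists>C>0. \<exists>K. \<forall>z. C \<le> Im z \<longrightarrow> norm (slash k P \<gamma> z) \<le> K"
  proof -
    from slash_bounded[OF \<gamma>(2)] obtain K where "norm (slash k P \<gamma> z) \<le> K" if "Im z \<ge> 1" for z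
      unfolding \<gamma>(1) by auto
    then show ?thesis by (intro exI[of _ "1 :: real"] conjI exI[of _ K] allI impI) auto
  qed
qed

end

end

theorem proposition4p1:
  fixes Q :: "real ^ 'n::finite ^ 'n" and N k :: nat
  assumes Q: "invertible Q"
    and N: "N = level (transpose Q ** Q)"
    and k: "k = (CARD('n) + 2)\<^sup>2 * CARD('n) * (CARD('n) - 1) div 2"
  shows
    "(\<forall>hs. \<forall>z \<in> upper_half_plane. orthonormal_basis hs \<longrightarrow>
        det2DTheta (lattice_of Q) z = (detDTheta hs (lattice_of Q) z)\<^sup>2) \<and>
     (\<forall>z \<in> upper_half_plane.
        lattice_invariant (\<lambda>\<Lambda> :: (real ^ 'n) set. det2DTheta \<Lambda> z)) \<and>
     ((\<forall>z \<in> upper_half_plane. det2DTheta (lattice_of Q) z = 0) \<longleftrightarrow>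
        theta_differential_degenerate (transpose Q ** Q)) \<and>
     (integral_lattice (lattice_of Q) \<longrightarrow>
        modular_form N (weight_character k) k (det2DTheta (lattice_of Q)))"
proof (intro conjI impI allI ballI)
  fix hs z assume "z \<in> upper_half_plane" "orthonormal_basis (hs :: nat \<Rightarrow> real ^ 'n ^ 'n)"
  then show "det2DTheta (lattice_of Q) z = (detDTheta hs (lattice_of Q) z)\<^sup>2" by (intro det2DTheta_basis[OF Q])
next
  fix z assume "z \<in> upper_half_plane"
  then show "lattice_invariant (\<lambda>\<Lambda> :: (real ^ 'n) set. det2DTheta \<Lambda> z)" by (rule det2DTheta_lattice_invariant)
next
  show "(\<forall>z \<in> upper_half_plane. det2DTheta (lattice_of Q) z = 0) \<longleftrightarrow> theta_differential_degenerate (transpose Q ** Q)"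
    unfolding det2DTheta_zero_iff[OF Q] theta_degenerate_iff[OF Q] ..
next
  assume int: "integral_lattice (lattice_of Q)"
  obtain hs :: "nat \<Rightarrow> real ^ 'n ^ 'n" where hs: "orthonormal_basis hs" using exists_orthonormal_basis by blast
  show "modular_form N (weight_character k) k (det2DTheta (lattice_of Q))"
  proof (rule integral_lattice_data[OF Q int N])
    fix q S S'
    assume *: "int_quad q S" "\<And>x. of_int (q x) = quad_form (transpose Q ** Q) (of_int_vec x)"
      "real_mat S = 2 *\<^sub>R (transpose Q ** Q)" "transpose S' = S'" "S ** S' = mat (int N)" "S' ** S = mat (int N)"
      "\<And>w. int N dvd q (S' *v w)" "N > 0"
    interpret integral_gram Q q S S' "int N" hs
      by unfold_locales (rule Q hs *(1-7) | simp only: of_nat_0_less_iff, rule *(8))+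
    show ?thesis using P_modular_form[OF k] by (simp add: \<Lambda>_def)
  qed
qed

end
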